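(* Let $S$ be a (pure) simplicial poset of dimension $n-1$ which is a homology $(n-1)$-manifold, and let $\mathcal{I}$, $\widehat{\Pi}$ be the graded sheaf and graded cosheaf on $S$ determined by some homological $\Bbbk$-characteristic function on $S$. Then for each $k$ there is an isomorphism $$H^k(S;\mathcal{I})\cong H_{n-1-k}(S;\widehat{\Pi})$$ respecting the inner gradings.
   Context: Ground ring: $\Bbbk$ is a field or $\mathbb{Z}$; homology is with coefficients in $\Bbbk$ unless indicated otherwise. Simplicial posets: a finite poset $S$ is simplicial if it has a minimal element $\hat 0$ and for each $I\in S$ the order ideal $\{J\leqslant I\}$ is isomorphic to the boolean lattice $2^{[k]}$ for some $k\geqslant 0$; put $|I|=k$, $\dim I=k-1$. Elements of rank $1$ are vertices, $\mathrm{Vert}(S)$ is their set. $S$ is pure if all maximal elements have the same dimension, which is then $\dim S$. Write $I<_1J$ if $I<J$ and $|J|-|I|=1$. A sign convention is fixed: numbers $[J:I]=\pm1$ for $I<_1J$ such that $[J:J'][J':I]+[J:J''][J'':I]=0$ whenever $J'\ne J''$ are the two elements strictly between $I$ and $J$, $|J|-|I|=2$. The barycentric subdivision $S'$ is the simplicial complex of chains in $S\setminus\{\hat 0\}$; $|S|=|S'|$, regarded as a CW-complex with simplicial cells. For $J\in S$, $\mathrm{st}^\circ_S J=\{J'\in S: J'\geqslant J\}$; then $S\setminus\mathrm{st}^\circ_S J$ is a simplicial subposet for $J\ne\hat0$. Buchsbaum: a simplicial complex $K$ of dimension $n-1$ is Buchsbaum (over $\Bbbk$) if $\widetilde{H}_i(\mathrm{lk}_K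 I;\Bbbk)=0$ for all nonempty simplices $I\in K$ and all $i\neq n-1-|I|$, where $|I|$ is the number of vertices of $I$. A simplicial poset $S$ is Buchsbaum if $S'$ is. Sheaves: a sheaf on $S$ is a covariant functor $\mathcal{A}$ from $S$ (as a category, with a morphism $I\to J$ for $I\leqslant J$) to $\Bbbk$-modules. $H^*(S;\mathcal{A})$ is the cohomology of $C^i(S;\mathcal{A})=\bigoplus_{\dim I=i}\mathcal{A}(I)$, $i\geqslant -1$, with $d=\bigoplus_{I<_1I'}[I':I]\,\mathcal{A}(I\leqslant I')$. A cosheaf $\widehat{\mathcal{A}}$ is a contravariant functor; $H_*(S;\widehat{\mathcal{A}})$ is the homology of $C_i(S;\widehat{\mathcal{A}})=\bigoplus_{\dim I=i}\widehat{\mathcal{A}}(I)$ with $d=\bigoplus_{I'<_1I}[I:I']\,\widehat{\mathcal{A}}(I\geqslant I')$. A locally constant sheaf with value $W$ has value $0$ at $\hat 0$, values isomorphic to $W$ at all $I\neq\hat 0$, and all restriction maps $\mathcal{A}(I\leqslant J)$ with $I\ne\hat0$ isomorphisms; the constant sheaf $\Bbbk$ is the one with value $\Bbbk$ and identity restriction maps. Homology manifold: the local homology sheaf $\mathcal{U}_i$ on $S$ is given by $\mathcal{U}_i(\hat0)=0$, $\mathcal{U}_i(J)=H_i(S,S\setminus\mathrm{st}^\circ_S J;\Bbbk)$ for $J\neq\hat0$, with restriction maps induced by the inclusions $\mathrm{st}^\circ_S J_2\subset\mathrm{st}^\circ_S J_1$ for $J_1<J_2$. A Buchsbaum simplicial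 poset $S$ of dimension $n-1$ is called a homology manifold (orientable over $\Bbbk$) if $\mathcal{U}_{n-1}$ is isomorphic to the constant sheaf $\Bbbk$ (so orientability is part of the definition). Characteristic functions: let $V$ be a free $\Bbbk$-module of finite rank and $\mathcal{V}$ a locally constant sheaf on $S$ with value $V$. A homological $\Bbbk$-characteristic function is a collection $\{\omega_i\in\mathcal{V}(i): i\in\mathrm{Vert}(S)\}$ such that for each $I\ne\hat 0$ with vertices $i_1,\dots,i_k$ the vectors $\mathcal{V}(i_1\leqslant I)(\omega_{i_1}),\dots,\mathcal{V}(i_k\leqslant I)(\omega_{i_k})$ are linearly independent over $\Bbbk$ and span a direct summand of $\mathcal{V}(I)$; these images are again denoted $\omega_{i_1},\dots,\omega_{i_k}$. Let $\mathcal{L}$ be the locally constant sheaf of graded exterior algebras, $\mathcal{L}(\hat0)=0$, $\mathcal{L}(I)=\Lambda[\mathcal{V}(I)]$ for $I\neq\hat0$ (graded by exterior degree, the inner grading), with restriction maps induced from $\mathcal{V}$; let $\widehat{\mathcal{L}}$ be the corresponding cosheaf, $\widehat{\mathcal{L}}(I)=\mathcal{L}(I)$, $\widehat{\mathcal{L}}(J>I)=\mathcal{L}(I<J)^{-1}$ for $I\neq\hat 0$. The subsheaf $\mathcal{I}\subset\mathcal{L}$: $\mathcal{I}(I)$ is the ideal of $\mathcal{L}(I)$ generated by $\omega_{i_1},\dots,\omega_{i_k}$, where $i_1,\dots,i_k$ are the vertices of $I$ (and $\mathcal{I}(\hat0)=0$). The subcosheaf $\widehat{\Pi}\subset\widehat{\mathcal{L}}$: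 $\widehat{\Pi}(I)=\Pi_I$ is the principal ideal of $\mathcal{L}(I)$ generated by $\pi_I=\omega_{i_1}\wedge\dots\wedge\omega_{i_k}$ for $I\neq\hat0$, and $\widehat{\Pi}(\hat0)=0$. *)

theory Defs
  imports "HOL-Algebra.Module" "HOL-Algebra.QuotRing" "HOL-Algebra.IntRing"
begin

section \<open>Modules\<close>

definition ground_ring :: "'k ring \<Rightarrow> bool" where
  "ground_ring R \<longleftrightarrow> field R \<or> (cring R \<and> R \<simeq> \<Z>)"

definition mod_hom :: "'k ring \<Rightarrow> ('k,'a) module \<Rightarrow> ('k,'b) module \<Rightarrow> ('a \<Rightarrow> 'b) set" where
  "mod_hom R M N = {h. h \<in> carrier M \<rightarrow> carrier N
     \<and> (\<forall>x\<in>carrier M. \<forall>y\<in>carrier M. h (x \<oplus>\<^bsub>M\<^esub> y) = h x \<oplus>\<^bsub>N\<^esub> h y)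
     \<and> (\<forall>a\<in>carrier R. \<forall>x\<in>carrier M. h (a \<odot>\<^bsub>M\<^esub> x) = a \<odot>\<^bsub>N\<^esub> h x)}"

definition mod_iso :: "'k ring \<Rightarrow> ('k,'a) module \<Rightarrow> ('k,'b) module \<Rightarrow> ('a \<Rightarrow> 'b) set" where
  "mod_iso R M N = {h \<in> mod_hom R M N. bij_betw h (carrier M) (carrier N)}"

definition ring_as_module :: "'k ring \<Rightarrow> ('k,'k) module" where
  "ring_as_module R = \<lparr>carrier = carrier R, monoid.mult = monoid.mult R, one = one R,
     zero = zero R, add = add R, smult = monoid.mult R\<rparr>"

definition zero_module :: "('k,'a) module \<Rightarrow> ('k,'a) module" where
  "zero_module M = M\<lparr>carrier := {\<zero>\<^bsub>M\<^esub>}\<rparr>"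

text \<open>
  The quotient ring, together with the induced scalar multiplication.  When the
  multiplication of \<open>M\<close> carries no meaning (as for modules of chains), only the module
  structure of the result is used.
\<close>

definition quot_module :: "('k,'a) module \<Rightarrow> 'a set \<Rightarrow> ('k,'a set) module" where
  "quot_module M N = \<lparr>carrier = carrier (M Quot N), monoid.mult = monoid.mult (M Quot N),
     one = one (M Quot N), zero = zero (M Quot N), add = add (M Quot N),
     smult = (\<lambda>a X. \<Union>x\<in>X. N +>\<^bsub>M\<^esub> (a \<odot>\<^bsub>M\<^esub> x))\<rparr>"

text \<open>The map of quotients by \<open>N\<close> (in the target module \<open>M\<close>) induced by \<open>h\<close>.\<close>

definition quot_map :: "('k,'b) module \<Rightarrow> 'b set \<Rightarrow> ('a \<Rightarrow> 'b) \<Rightarrow> 'a set \<Rightarrow> 'b set" where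
  "quot_map M N h X = (\<Union>x\<in>X. N +>\<^bsub>M\<^esub> h x)"

text \<open>The direct sum of \<open>A I\<close> over a finite index set \<open>X\<close>.\<close>

definition direct_sum :: "'p set \<Rightarrow> ('p \<Rightarrow> ('k,'a) module) \<Rightarrow> ('k,'p \<Rightarrow> 'a) module" where
  "direct_sum X A = \<lparr>carrier = (\<Pi>\<^sub>E I\<in>X. carrier (A I)),
     monoid.mult = undefined, one = undefined,
     zero = (\<lambda>I\<in>X. \<zero>\<^bsub>A I\<^esub>),
     add = (\<lambda>f g. \<lambda>I\<in>X. f I \<oplus>\<^bsub>A I\<^esub> g I),
     smult = (\<lambda>a f. \<lambda>I\<in>X. a \<odot>\<^bsub>A I\<^esub> f I)\<rparr>"

definition lin_indep :: "'k ring \<Rightarrow> ('k,'a) module \<Rightarrow> 'i set \<Rightarrow> ('i \<Rightarrow> 'a) \<Rightarrow> bool" where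
  "lin_indep R M X x \<longleftrightarrow> (\<forall>a \<in> X \<rightarrow> carrier R.
     (\<Oplus>\<^bsub>M\<^esub>i\<in>X. a i \<odot>\<^bsub>M\<^esub> x i) = \<zero>\<^bsub>M\<^esub> \<longrightarrow> (\<forall>i\<in>X. a i = \<zero>\<^bsub>R\<^esub>))"

definition lin_span :: "'k ring \<Rightarrow> ('k,'a) module \<Rightarrow> 'i set \<Rightarrow> ('i \<Rightarrow> 'a) \<Rightarrow> 'a set" where
  "lin_span R M X x = {(\<Oplus>\<^bsub>M\<^esub>i\<in>X. a i \<odot>\<^bsub>M\<^esub> x i) | a. a \<in> X \<rightarrow> carrier R}"

definition direct_summand :: "'k ring \<Rightarrow> ('k,'a) module \<Rightarrow> 'a set \<Rightarrow> bool" where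
  "direct_summand R M N \<longleftrightarrow> submodule N R M \<and>
     (\<exists>N'. submodule N' R M \<and> N \<inter> N' = {\<zero>\<^bsub>M\<^esub>} \<and> N <+>\<^bsub>M\<^esub> N' = carrier M)"

definition free_of_finite_rank :: "'k ring \<Rightarrow> ('k,'a) module \<Rightarrow> bool" where
  "free_of_finite_rank R M \<longleftrightarrow> module R M \<and>
     (\<exists>(r::nat) b. b \<in> {..<r} \<rightarrow> carrier M \<and> lin_indep R M {..<r} b
        \<and> lin_span R M {..<r} b = carrier M)"


section \<open>Simplicial posets\<close>

definition boolean_ideal :: "'p::order set \<Rightarrow> 'p \<Rightarrow> nat \<Rightarrow> bool" where
  "boolean_ideal S I k \<longleftrightarrow> (\<exists>f. bij_betw f {J\<in>S. J \<le> I} (Pow {1..k})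
     \<and> (\<forall>J\<in>{J\<in>S. J \<le> I}. \<forall>J'\<in>{J\<in>S. J \<le> I}. J \<le> J' \<longleftrightarrow> f J \<subseteq> f J'))"

definition simplicial_poset :: "'p::order set \<Rightarrow> bool" where
  "simplicial_poset S \<longleftrightarrow> finite S \<and> (\<exists>z\<in>S. \<forall>I\<in>S. z \<le> I) \<and> (\<forall>I\<in>S. \<exists>k. boolean_ideal S I k)"

definition bot_of :: "'p::order set \<Rightarrow> 'p" where
  "bot_of S = (LEAST I. I \<in> S)"

definition rank :: "'p::order set \<Rightarrow> 'p \<Rightarrow> nat" where
  "rank S I = (THE k. boolean_ideal S I k)"

definition dim_of :: "'p::order set \<Rightarrow> 'p \<Rightarrow> int" where
  "dim_of S I = int (rank S I) - 1"

definition poset_dim :: "'p::order set \<Rightarrow> int" where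
  "poset_dim S = Max (dim_of S ` S)"

definition pure :: "'p::order set \<Rightarrow> bool" where
  "pure S \<longleftrightarrow> (\<forall>I\<in>S. (\<forall>J\<in>S. I \<le> J \<longrightarrow> J = I) \<longrightarrow> dim_of S I = poset_dim S)"

definition cells :: "'p::order set \<Rightarrow> int \<Rightarrow> 'p set" where
  "cells S i = {I\<in>S. dim_of S I = i}"

definition Vert :: "'p::order set \<Rightarrow> 'p set" where
  "Vert S = {i\<in>S. rank S i = 1}"

definition verts_below :: "'p::order set \<Rightarrow> 'p \<Rightarrow> 'p set" where
  "verts_below S I = {i\<in>Vert S. i \<le> I}"

definition covered_by :: "'p::order set \<Rightarrow> 'p \<Rightarrow> 'p \<Rightarrow> bool" where
  "covered_by S I J \<longleftrightarrow> I \<in> S \<and> J \<in> S \<and> I < J \<and> rank S J = rank S I + 1"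

text \<open>\<open>eps J I\<close> is the incidence number \<open>[J:I]\<close>.\<close>

definition sign_convention :: "'p::order set \<Rightarrow> ('p \<Rightarrow> 'p \<Rightarrow> int) \<Rightarrow> bool" where
  "sign_convention S eps \<longleftrightarrow>
     (\<forall>I J. covered_by S I J \<longrightarrow> eps J I \<in> {1, -1}) \<and>
     (\<forall>I\<in>S. \<forall>J\<in>S. I < J \<and> rank S J = rank S I + 2 \<longrightarrow>
        (\<forall>J'\<in>S. \<forall>J''\<in>S. I < J' \<and> J' < J \<and> I < J'' \<and> J'' < J \<and> J' \<noteq> J'' \<longrightarrow>
           eps J J' * eps J' I + eps J J'' * eps J'' I = 0))"

definition open_star :: "'p::order set \<Rightarrow> 'p \<Rightarrow> 'p set" where
  "open_star S J = {J'\<in>S. J \<le> J'}"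


section \<open>Sheaves, cosheaves and their (co)homology\<close>

text \<open>
  A system of coefficients: a module for each element and, for comparable \<open>I\<close> and \<open>J\<close>,
  a map \<open>mor A I J\<close> from \<open>val A I\<close> to \<open>val A J\<close>.  A sheaf uses the maps with \<open>I \<le> J\<close>,
  a cosheaf those with \<open>J \<le> I\<close>.
\<close>

record ('p, 'k, 'a) coeff_system =
  val :: "'p \<Rightarrow> ('k,'a) module"
  mor :: "'p \<Rightarrow> 'p \<Rightarrow> 'a \<Rightarrow> 'a"

definition is_sheaf :: "'k ring \<Rightarrow> 'p::order set \<Rightarrow> ('p,'k,'a) coeff_system \<Rightarrow> bool" where
  "is_sheaf R S A \<longleftrightarrow>
     (\<forall>I\<in>S. module R (val A I)) \<and>
     (\<forall>I\<in>S. \<forall>J\<in>S. I \<le> J \<longrightarrow> mor A I J \<in> mod_hom R (val A I) (val A J)) \<and>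
     (\<forall>I\<in>S. \<forall>x\<in>carrier (val A I). mor A I I x = x) \<and>
     (\<forall>I\<in>S. \<forall>J\<in>S. \<forall>K\<in>S. I \<le> J \<and> J \<le> K \<longrightarrow>
        (\<forall>x\<in>carrier (val A I). mor A J K (mor A I J x) = mor A I K x))"

definition sheaf_isomorphic ::
  "'k ring \<Rightarrow> 'p::order set \<Rightarrow> ('p,'k,'a) coeff_system \<Rightarrow> ('p,'k,'b) coeff_system \<Rightarrow> bool" where
  "sheaf_isomorphic R S A B \<longleftrightarrow> (\<exists>h.
     (\<forall>I\<in>S. h I \<in> mod_iso R (val A I) (val B I)) \<and>
     (\<forall>I\<in>S. \<forall>J\<in>S. I \<le> J \<longrightarrow>
        (\<forall>x\<in>carrier (val A I). h J (mor A I J x) = mor B I J (h I x))))"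

definition cochain_module :: "'p::order set \<Rightarrow> ('p,'k,'a) coeff_system \<Rightarrow> int \<Rightarrow> ('k,'p \<Rightarrow> 'a) module" where
  "cochain_module S A i = direct_sum (cells S i) (val A)"

definition cobd ::
  "'p::order set \<Rightarrow> ('p \<Rightarrow> 'p \<Rightarrow> int) \<Rightarrow> ('p,'k,'a) coeff_system \<Rightarrow> int \<Rightarrow> ('p \<Rightarrow> 'a) \<Rightarrow> 'p \<Rightarrow> 'a" where
  "cobd S eps A i c = (\<lambda>J\<in>cells S (i + 1).
     \<Oplus>\<^bsub>val A J\<^esub>I\<in>{I. covered_by S I J}. [eps J I] \<cdot>\<^bsub>val A J\<^esub> mor A I J (c I))"

definition cohomology ::
  "'p::order set \<Rightarrow> ('p \<Rightarrow> 'p \<Rightarrow> int) \<Rightarrow> ('p,'k,'a) coeff_system \<Rightarrow> int \<Rightarrow> ('k,('p \<Rightarrow> 'a) set) module" where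
  "cohomology S eps A i =
     quot_module
       ((cochain_module S A i)\<lparr>carrier :=
          {c\<in>carrier (cochain_module S A i). cobd S eps A i c = \<zero>\<^bsub>cochain_module S A (i + 1)\<^esub>}\<rparr>)
       (cobd S eps A (i - 1) ` carrier (cochain_module S A (i - 1)))"

definition chain_module :: "'p::order set \<Rightarrow> ('p,'k,'a) coeff_system \<Rightarrow> int \<Rightarrow> ('k,'p \<Rightarrow> 'a) module" where
  "chain_module S A i = direct_sum (cells S i) (val A)"

definition bd ::
  "'p::order set \<Rightarrow> ('p \<Rightarrow> 'p \<Rightarrow> int) \<Rightarrow> ('p,'k,'a) coeff_system \<Rightarrow> int \<Rightarrow> ('p \<Rightarrow> 'a) \<Rightarrow> 'p \<Rightarrow> 'a" where
  "bd S eps A i c = (\<lambda>J\<in>cells S (i - 1).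
     \<Oplus>\<^bsub>val A J\<^esub>I\<in>{I. covered_by S J I}. [eps I J] \<cdot>\<^bsub>val A J\<^esub> mor A I J (c I))"

definition homology ::
  "'p::order set \<Rightarrow> ('p \<Rightarrow> 'p \<Rightarrow> int) \<Rightarrow> ('p,'k,'a) coeff_system \<Rightarrow> int \<Rightarrow> ('k,('p \<Rightarrow> 'a) set) module" where
  "homology S eps A i =
     quot_module
       ((chain_module S A i)\<lparr>carrier :=
          {c\<in>carrier (chain_module S A i). bd S eps A i c = \<zero>\<^bsub>chain_module S A (i - 1)\<^esub>}\<rparr>)
       (bd S eps A (i + 1) ` carrier (chain_module S A (i + 1)))"

text \<open>
  The part of a (co)homology module \<open>H\<close> in dimension \<open>i\<close> represented by (co)cycles all of whose
  coefficients at \<open>I\<close> lie in \<open>D I\<close>; with \<open>D I\<close> a homogeneous component of the coefficient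
  module, this is the corresponding homogeneous component of \<open>H\<close>.
\<close>

definition represented_in ::
  "'p::order set \<Rightarrow> ('p \<Rightarrow> 'a set) \<Rightarrow> int \<Rightarrow> ('k,('p \<Rightarrow> 'a) set) module \<Rightarrow> ('p \<Rightarrow> 'a) set set" where
  "represented_in S D i H = {X\<in>carrier H. \<exists>c\<in>X. \<forall>I\<in>cells S i. c I \<in> D I}"

definition locally_constant_sheaf ::
  "'k ring \<Rightarrow> 'p::order set \<Rightarrow> ('k,'w) module \<Rightarrow> ('p,'k,'a) coeff_system \<Rightarrow> bool" where
  "locally_constant_sheaf R S W A \<longleftrightarrow> is_sheaf R S A \<and>
     carrier (val A (bot_of S)) = {\<zero>\<^bsub>val A (bot_of S)\<^esub>} \<and>
     (\<forall>I\<in>S. I \<noteq> bot_of S \<longrightarrow> mod_iso R W (val A I) \<noteq> {}) \<and>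
     (\<forall>I\<in>S. \<forall>J\<in>S. I \<noteq> bot_of S \<and> I \<le> J \<longrightarrow> mor A I J \<in> mod_iso R (val A I) (val A J))"

text \<open>
  The constant system with value the ground ring away from the least element and \<open>0\<close> there.
  It is used both as a sheaf and as a cosheaf; the case distinction in \<open>mor\<close> concerns only
  the cosheaf map into the zero module at the least element.
\<close>

definition constant_system :: "'k ring \<Rightarrow> 'p::order set \<Rightarrow> ('p,'k,'k) coeff_system" where
  "constant_system R S = \<lparr>
     val = (\<lambda>I. if I = bot_of S then zero_module (ring_as_module R) else ring_as_module R),
     mor = (\<lambda>I J x. if J = bot_of S then \<zero>\<^bsub>R\<^esub> else x)\<rparr>"


section \<open>Buchsbaum posets and homology manifolds\<close>

definition link :: "'v set set \<Rightarrow> 'v set \<Rightarrow> 'v set set" where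
  "link K I = {F\<in>K. F \<inter> I = {} \<and> F \<union> I \<in> K}"

text \<open>
  The face poset of a simplicial complex (including the empty face, and ordered by inclusion) is a
  simplicial poset; reduced simplicial homology is obtained from the ground ring placed
  at every face, including the empty one.
\<close>

definition reduced_homology ::
  "'k ring \<Rightarrow> 'v set set \<Rightarrow> ('v set \<Rightarrow> 'v set \<Rightarrow> int) \<Rightarrow> int \<Rightarrow> ('k,('v set \<Rightarrow> 'k) set) module" where
  "reduced_homology R K eps i =
     homology K eps \<lparr>val = (\<lambda>_. ring_as_module R), mor = (\<lambda>_ _ x. x)\<rparr> i"

text \<open>
  Up to isomorphism the homology of the link does not depend on the sign convention, and
  sign conventions exist, so the quantification over \<open>eps\<close> is only a way of not choosing one.
\<close>

definition buchsbaum_complex :: "'k ring \<Rightarrow> 'v set set \<Rightarrow> bool" where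
  "buchsbaum_complex R K \<longleftrightarrow> (\<forall>I\<in>K. I \<noteq> {} \<longrightarrow> (\<forall>i. i \<noteq> poset_dim K - int (card I) \<longrightarrow>
     (\<forall>eps. sign_convention (link K I) eps \<longrightarrow>
        carrier (reduced_homology R (link K I) eps i)
          = {\<zero>\<^bsub>reduced_homology R (link K I) eps i\<^esub>})))"

definition subdivision :: "'p::order set \<Rightarrow> 'p set set" where
  "subdivision S = {C. C \<subseteq> S - {bot_of S} \<and> Complete_Partial_Order.chain (\<le>) C}"

definition buchsbaum_poset :: "'k ring \<Rightarrow> 'p::order set \<Rightarrow> bool" where
  "buchsbaum_poset R S \<longleftrightarrow> buchsbaum_complex R (subdivision S)"

text \<open>
  Homology of the pair \<open>(S, T)\<close>, for a simplicial subposet \<open>T\<close>, by cellular chains of the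
  CW-complex with simplicial cells: chains with boundary in \<open>T\<close>, modulo boundaries
  and chains of \<open>T\<close>.
\<close>

definition rel_cycles ::
  "'k ring \<Rightarrow> 'p::order set \<Rightarrow> ('p \<Rightarrow> 'p \<Rightarrow> int) \<Rightarrow> 'p set \<Rightarrow> int \<Rightarrow> ('p \<Rightarrow> 'k) set" where
  "rel_cycles R S eps T i = {c\<in>carrier (chain_module S (constant_system R S) i).
     \<forall>J\<in>cells S (i - 1) - T. bd S eps (constant_system R S) i c J = \<zero>\<^bsub>R\<^esub>}"

definition rel_boundaries ::
  "'k ring \<Rightarrow> 'p::order set \<Rightarrow> ('p \<Rightarrow> 'p \<Rightarrow> int) \<Rightarrow> 'p set \<Rightarrow> int \<Rightarrow> ('p \<Rightarrow> 'k) set" where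
  "rel_boundaries R S eps T i =
     {bd S eps (constant_system R S) (i + 1) b \<oplus>\<^bsub>chain_module S (constant_system R S) i\<^esub> t | b t.
        b \<in> carrier (chain_module S (constant_system R S) (i + 1)) \<and>
        t \<in> carrier (chain_module S (constant_system R S) i) \<and>
        (\<forall>I\<in>cells S i - T. t I = \<zero>\<^bsub>R\<^esub>)}"

definition rel_homology ::
  "'k ring \<Rightarrow> 'p::order set \<Rightarrow> ('p \<Rightarrow> 'p \<Rightarrow> int) \<Rightarrow> 'p set \<Rightarrow> int \<Rightarrow> ('k,('p \<Rightarrow> 'k) set) module" where
  "rel_homology R S eps T i =
     quot_module
       ((chain_module S (constant_system R S) i)\<lparr>carrier := rel_cycles R S eps T i\<rparr>)
       (rel_boundaries R S eps T i)"

text \<open>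
  For \<open>J1 \<le> J2\<close> the inclusion of pairs from \<open>(S, S - open_star S J1)\<close> to
  \<open>(S, S - open_star S J2)\<close> is the identity on chains of \<open>S\<close>.
\<close>

definition local_homology_sheaf ::
  "'k ring \<Rightarrow> 'p::order set \<Rightarrow> ('p \<Rightarrow> 'p \<Rightarrow> int) \<Rightarrow> int \<Rightarrow> ('p,'k,('p \<Rightarrow> 'k) set) coeff_system" where
  "local_homology_sheaf R S eps i = \<lparr>
     val = (\<lambda>J. if J = bot_of S then zero_module (rel_homology R S eps (S - open_star S J) i)
                else rel_homology R S eps (S - open_star S J) i),
     mor = (\<lambda>J1 J2. quot_map (chain_module S (constant_system R S) i)
                      (rel_boundaries R S eps (S - open_star S J2) i) (\<lambda>c. c))\<rparr>"

definition homology_manifold ::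
  "'k ring \<Rightarrow> 'p::order set \<Rightarrow> ('p \<Rightarrow> 'p \<Rightarrow> int) \<Rightarrow> bool" where
  "homology_manifold R S eps \<longleftrightarrow> buchsbaum_poset R S \<and>
     sheaf_isomorphic R S (local_homology_sheaf R S eps (poset_dim S)) (constant_system R S)"


section \<open>Exterior algebras\<close>

text \<open>
  The free associative algebra on \<open>X\<close>: finitely supported functions on words over \<open>X\<close>,
  with concatenation product.
\<close>

definition free_algebra :: "'k ring \<Rightarrow> 'v set \<Rightarrow> ('k,'v list \<Rightarrow> 'k) module" where
  "free_algebra R X = \<lparr>
     carrier = {f. (\<forall>w. f w \<in> carrier R) \<and> finite {w. f w \<noteq> \<zero>\<^bsub>R\<^esub>}
                   \<and> {w. f w \<noteq> \<zero>\<^bsub>R\<^esub>} \<subseteq> lists X},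
     monoid.mult = (\<lambda>f g w. \<Oplus>\<^bsub>R\<^esub>j\<in>{..length w}. f (take j w) \<otimes>\<^bsub>R\<^esub> g (drop j w)),
     one = (\<lambda>w. if w = [] then \<one>\<^bsub>R\<^esub> else \<zero>\<^bsub>R\<^esub>),
     zero = (\<lambda>w. \<zero>\<^bsub>R\<^esub>),
     add = (\<lambda>f g w. f w \<oplus>\<^bsub>R\<^esub> g w),
     smult = (\<lambda>a f w. a \<otimes>\<^bsub>R\<^esub> f w)\<rparr>"

definition word :: "'k ring \<Rightarrow> 'v list \<Rightarrow> 'v list \<Rightarrow> 'k" where
  "word R w = (\<lambda>u. if u = w then \<one>\<^bsub>R\<^esub> else \<zero>\<^bsub>R\<^esub>)"

text \<open>
  The first two families of relations cut the free algebra on the elements of \<open>M\<close> down to the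
  tensor algebra of \<open>M\<close>, the third one cuts the tensor algebra down to the exterior algebra.
\<close>

definition exterior_relations :: "'k ring \<Rightarrow> ('k,'v) module \<Rightarrow> ('v list \<Rightarrow> 'k) set" where
  "exterior_relations R M = (let F = free_algebra R (carrier M) in
     {word R [x \<oplus>\<^bsub>M\<^esub> y] \<ominus>\<^bsub>F\<^esub> (word R [x] \<oplus>\<^bsub>F\<^esub> word R [y]) | x y. x \<in> carrier M \<and> y \<in> carrier M} \<union>
     {word R [a \<odot>\<^bsub>M\<^esub> x] \<ominus>\<^bsub>F\<^esub> (a \<odot>\<^bsub>F\<^esub> word R [x]) | a x. a \<in> carrier R \<and> x \<in> carrier M} \<union>
     {word R [x] \<otimes>\<^bsub>F\<^esub> word R [x] | x. x \<in> carrier M})"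

definition exterior_ideal :: "'k ring \<Rightarrow> ('k,'v) module \<Rightarrow> ('v list \<Rightarrow> 'k) set" where
  "exterior_ideal R M = Idl\<^bsub>free_algebra R (carrier M)\<^esub> (exterior_relations R M)"

definition exterior_algebra :: "'k ring \<Rightarrow> ('k,'v) module \<Rightarrow> ('k,('v list \<Rightarrow> 'k) set) module" where
  "exterior_algebra R M = quot_module (free_algebra R (carrier M)) (exterior_ideal R M)"

definition exterior_gen :: "'k ring \<Rightarrow> ('k,'v) module \<Rightarrow> 'v \<Rightarrow> ('v list \<Rightarrow> 'k) set" where
  "exterior_gen R M x = exterior_ideal R M +>\<^bsub>free_algebra R (carrier M)\<^esub> word R [x]"

definition exterior_degree :: "'k ring \<Rightarrow> ('k,'v) module \<Rightarrow> nat \<Rightarrow> ('v list \<Rightarrow> 'k) set set" where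
  "exterior_degree R M q = {X\<in>carrier (exterior_algebra R M).
     \<exists>f\<in>X. \<forall>w. f w \<noteq> \<zero>\<^bsub>R\<^esub> \<longrightarrow> length w = q}"

definition wedge :: "'k ring \<Rightarrow> ('k,'v) module \<Rightarrow> 'v list \<Rightarrow> ('v list \<Rightarrow> 'k) set" where
  "wedge R M xs = foldr (\<lambda>x y. exterior_gen R M x \<otimes>\<^bsub>exterior_algebra R M\<^esub> y) xs
     \<one>\<^bsub>exterior_algebra R M\<^esub>"

text \<open>The homomorphism of free algebras induced by a map \<open>h\<close> of generators.\<close>

definition push_words :: "'k ring \<Rightarrow> ('v \<Rightarrow> 'u) \<Rightarrow> ('v list \<Rightarrow> 'k) \<Rightarrow> 'u list \<Rightarrow> 'k" where
  "push_words R h f = (\<lambda>w. \<Oplus>\<^bsub>R\<^esub>u\<in>{u. f u \<noteq> \<zero>\<^bsub>R\<^esub> \<and> map h u = w}. f u)"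

definition exterior_map ::
  "'k ring \<Rightarrow> ('k,'u) module \<Rightarrow> ('v \<Rightarrow> 'u) \<Rightarrow> ('v list \<Rightarrow> 'k) set \<Rightarrow> ('u list \<Rightarrow> 'k) set" where
  "exterior_map R N h =
     quot_map (free_algebra R (carrier N)) (exterior_ideal R N) (push_words R h)"


section \<open>Characteristic functions and the associated sheaf and cosheaf\<close>

definition characteristic_function ::
  "'k ring \<Rightarrow> 'p::order set \<Rightarrow> ('p,'k,'v) coeff_system \<Rightarrow> ('p \<Rightarrow> 'v) \<Rightarrow> bool" where
  "characteristic_function R S VV om \<longleftrightarrow>
     (\<forall>i\<in>Vert S. om i \<in> carrier (val VV i)) \<and>
     (\<forall>I\<in>S. I \<noteq> bot_of S \<longrightarrow>
        lin_indep R (val VV I) (verts_below S I) (\<lambda>i. mor VV i I (om i)) \<and>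
        direct_summand R (val VV I)
          (lin_span R (val VV I) (verts_below S I) (\<lambda>i. mor VV i I (om i))))"

definition exterior_sheaf ::
  "'k ring \<Rightarrow> 'p::order set \<Rightarrow> ('p,'k,'v) coeff_system \<Rightarrow> ('p,'k,('v list \<Rightarrow> 'k) set) coeff_system" where
  "exterior_sheaf R S VV = \<lparr>
     val = (\<lambda>I. if I = bot_of S then zero_module (exterior_algebra R (val VV I))
                else exterior_algebra R (val VV I)),
     mor = (\<lambda>I J. exterior_map R (val VV J) (mor VV I J))\<rparr>"

definition exterior_cosheaf ::
  "'k ring \<Rightarrow> 'p::order set \<Rightarrow> ('p,'k,'v) coeff_system \<Rightarrow> ('p,'k,('v list \<Rightarrow> 'k) set) coeff_system" where
  "exterior_cosheaf R S VV = \<lparr>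
     val = val (exterior_sheaf R S VV),
     mor = (\<lambda>J I. if I = bot_of S then (\<lambda>_. \<zero>\<^bsub>val (exterior_sheaf R S VV) I\<^esub>)
                  else inv_into (carrier (val (exterior_sheaf R S VV) I))
                         (mor (exterior_sheaf R S VV) I J))\<rparr>"

definition ideal_sheaf ::
  "'k ring \<Rightarrow> 'p::order set \<Rightarrow> ('p,'k,'v) coeff_system \<Rightarrow> ('p \<Rightarrow> 'v)
     \<Rightarrow> ('p,'k,('v list \<Rightarrow> 'k) set) coeff_system" where
  "ideal_sheaf R S VV om = \<lparr>
     val = (\<lambda>I. if I = bot_of S then val (exterior_sheaf R S VV) I
        else (val (exterior_sheaf R S VV) I)\<lparr>carrier :=
          Idl\<^bsub>exterior_algebra R (val VV I)\<^esub>
            ((\<lambda>i. exterior_gen R (val VV I) (mor VV i I (om i))) ` verts_below S I)\<rparr>),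
     mor = mor (exterior_sheaf R S VV)\<rparr>"

text \<open>
  The order of the factors is arbitrary; it affects the product only up to sign and
  the ideal it generates not at all.
\<close>

definition pi_elem ::
  "'k ring \<Rightarrow> 'p::order set \<Rightarrow> ('p,'k,'v) coeff_system \<Rightarrow> ('p \<Rightarrow> 'v) \<Rightarrow> 'p \<Rightarrow> ('v list \<Rightarrow> 'k) set" where
  "pi_elem R S VV om I = wedge R (val VV I)
     (map (\<lambda>i. mor VV i I (om i)) (SOME vs. distinct vs \<and> set vs = verts_below S I))"

definition pi_cosheaf ::
  "'k ring \<Rightarrow> 'p::order set \<Rightarrow> ('p,'k,'v) coeff_system \<Rightarrow> ('p \<Rightarrow> 'v)
     \<Rightarrow> ('p,'k,('v list \<Rightarrow> 'k) set) coeff_system" where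
  "pi_cosheaf R S VV om = \<lparr>
     val = (\<lambda>I. if I = bot_of S then val (exterior_cosheaf R S VV) I
        else (val (exterior_cosheaf R S VV) I)\<lparr>carrier :=
          Idl\<^bsub>exterior_algebra R (val VV I)\<^esub> {pi_elem R S VV om I}\<rparr>),
     mor = mor (exterior_cosheaf R S VV)\<rparr>"

end

theory Submission
  imports Defs
begin

text \<open>
  Over the pairs \<open>I \<le> J\<close> with \<open>I \<noteq> bot_of S\<close> consider the double complex with the principal ideal
  generated by \<open>\<pi>_I\<close> in the exterior algebra at \<open>J\<close> as entry: boundary in \<open>I\<close>, coboundary in \<open>J\<close>.
  For fixed \<open>J\<close> it resolves the value of the ideal sheaf at \<open>J\<close>: functionals dual to the characteristic
  vectors give commuting idempotents, each of which yields a partial contraction. For fixed \<open>I\<close> it is the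
  cochain complex of the star of \<open>I\<close> with coefficients in \<open>\<Pi>_I\<close>; as \<open>S\<close> is Buchsbaum and orientable, it is
  acyclic except in top degree, where a fundamental class \<open>u\<close> identifies the cohomology with \<open>\<Pi>_I\<close>.
  Zigzags through the double complex compare the two sides. All maps preserve exterior degree, so the same
  argument in the subcomplex of a given degree shows that the isomorphism respects the gradings.
\<close>

text \<open>Three obstacles shape the argument. The Buchsbaum condition concerns links in the
  barycentric subdivision, while the double complex needs cellular chains of the stars of
  \<open>S\<close>; pairs of a cell and a flag above it carry exactness from one to the other. That
  exactness is homological with coefficients in the ground ring, whereas the complex for fixed
  \<open>I\<close> consists of cochains with values in an ideal, possibly over the integers; an
  explicit contracting matrix has a transpose that acts on cochains with any values. Finally, the
  complex for fixed \<open>J\<close> is exact because the principal ideal of a product of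
  characteristic vectors is the intersection of the ideals of its factors: it is the
  inclusion-exclusion complex of ideals cut out by commuting idempotents, and over the integers it
  is the direct summand condition that provides these idempotents. The isomorphism comes from a
  linear relation rather than a formula, since the lifts in a zigzag are not canonical. Homogeneous
  lifts are particular lifts, so one and the same isomorphism respects every inner degree.\<close>

abbreviation (input) module_add ("_ \<oplus>\<^sub>_ _" [65, 1000, 66] 65) where "x \<oplus>\<^sub>M y \<equiv> x \<oplus>\<^bsub>M\<^esub> y"
abbreviation (input) module_diff ("_ \<ominus>\<^sub>_ _" [65, 1000, 66] 65) where "x \<ominus>\<^sub>M y \<equiv> x \<ominus>\<^bsub>M\<^esub> y"
abbreviation (input) module_uminus ("\<ominus>\<^sub>_ _" [1000, 81] 80) where "\<ominus>\<^sub>M x \<equiv> \<ominus>\<^bsub>M\<^esub> x"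
abbreviation (input) module_zero ("\<zero>\<^sub>_" [1000] 1000) where "\<zero>\<^sub>M \<equiv> \<zero>\<^bsub>M\<^esub>"
abbreviation (input) module_one ("\<one>\<^sub>_" [1000] 1000) where "\<one>\<^sub>M \<equiv> \<one>\<^bsub>M\<^esub>"
abbreviation (input) module_mult ("_ \<otimes>\<^sub>_ _" [70, 1000, 71] 70) where "x \<otimes>\<^sub>M y \<equiv> x \<otimes>\<^bsub>M\<^esub> y"
abbreviation (input) module_smult ("_ \<odot>\<^sub>_ _" [70, 1000, 71] 70) where "a \<odot>\<^sub>M x \<equiv> a \<odot>\<^bsub>M\<^esub> x"
abbreviation (input) module_coset ("_ +>\<^sub>_ _" [60, 1000, 61] 60) where "N +>\<^sub>M x \<equiv> N +>\<^bsub>M\<^esub> x"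

section \<open>Finite sums in commutative monoids and the exchange of double sums\<close>

context abelian_monoid
begin

lemma finsum_single:
  assumes "finite A" "a : A" "f a : carrier G" "!!x. x : A ==> x ~= a ==> f x = \<zero>"
  shows "finsum G f A = f a"
proof -
  have "finsum G f (insert a (A - {a})) = f a \<oplus> finsum G f (A - {a})" using assms by (intro finsum_insert) auto
  moreover have "finsum G f (A - {a}) = \<zero>" using assms by (intro add.finprod_one_eqI) auto
  ultimately show ?thesis using assms by (simp add: insert_absorb)
qed

lemma finsum_two:
  assumes "finite A" "a : A" "b : A" "a ~= b" "f a : carrier G" "f b : carrier G"
    "!!x. x : A ==> x ~= a ==> x ~= b ==> f x = \<zero>"
  shows "finsum G f A = f a \<oplus> f b"
proof -
  have "finsum G f (insert a (A - {a})) = f a \<oplus> finsum G f (A - {a})"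
  proof (intro finsum_insert)
    have "f x : carrier G" if "x : A - {a}" for x using that assms(6,7) by (cases "x = b") auto
    then show "f : A - {a} \<rightarrow> carrier G" by auto
  qed (use assms in auto)
  moreover have "finsum G f (A - {a}) = f b" using assms by (intro finsum_single) auto
  ultimately show ?thesis using assms by (simp add: insert_absorb)
qed

lemma finsum_zeroI: "(!!x. x : A ==> f x = \<zero>) ==> finsum G f A = \<zero>" by (rule add.finprod_one_eqI)

lemma finsum_restrict:
  assumes "finite A" "B \<subseteq> A" "!!x. x : A - B ==> f x = \<zero>" "!!x. x : B ==> f x : carrier G"
  shows "finsum G f A = finsum G f B"
proof (rule add.finprod_mono_neutral_cong_right)
  have "f x : carrier G" if "x : A" for x using that assms(3,4) by (cases "x : B") auto
  then show "f : A \<rightarrow> carrier G" by auto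
qed (use assms in auto)

lemma finsum_swap:
  assumes "finite A" "finite B" "!!a b. a : A ==> b : B ==> f a b : carrier G"
  shows "(\<Oplus>a\<in>A. \<Oplus>b\<in>B. f a b) = (\<Oplus>b\<in>B. \<Oplus>a\<in>A. f a b)" using assms(1,3)
proof (induct A)
  case empty
  have "(\<Oplus>b\<in>B. \<zero>) = \<zero>" by (rule finsum_zeroI) simp
  then show ?case by simp
next
  case (insert a A)
  have "(\<Oplus>b\<in>B. \<Oplus>a\<in>insert a A. f a b) = (\<Oplus>b\<in>B. f a b \<oplus> (\<Oplus>a\<in>A. f a b))"
    using insert by (intro finsum_cong') (auto intro!: finsum_closed finsum_insert)
  also have "\<dots> = (\<Oplus>b\<in>B. f a b) \<oplus> (\<Oplus>b\<in>B. \<Oplus>a\<in>A. f a b)"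
    using insert by (intro finsum_addf) (auto intro!: finsum_closed)
  finally show ?case using insert by (subst finsum_insert) (auto intro!: finsum_closed)
qed

text \<open>The summand is extended by zero to a rectangle, where the two sums may be
  exchanged.\<close>

lemma finsum_swap_dep:
  assumes "finite A" "finite B" "!!a. a : A ==> N a \<subseteq> B"
    "!!a b. a : A ==> b : N a ==> f a b : carrier G"
  shows "(\<Oplus>a\<in>A. \<Oplus>b\<in>N a. f a b) = (\<Oplus>b\<in>B. \<Oplus>a\<in>{a : A. b : N a}. f a b)"
proof -
  let ?g = "%a b. if b : N a then f a b else \<zero>"
  have "(\<Oplus>a\<in>A. \<Oplus>b\<in>N a. f a b) = (\<Oplus>a\<in>A. \<Oplus>b\<in>B. ?g a b)"
  proof (rule finsum_cong'[OF refl])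
    show "(%a. \<Oplus>b\<in>B. ?g a b) : A \<rightarrow> carrier G" using assms by (auto intro!: finsum_closed)
    show "(\<Oplus>b\<in>N a. f a b) = (\<Oplus>b\<in>B. ?g a b)" if "a : A" for a
      using that assms by (intro add.finprod_mono_neutral_cong_left) (auto simp: Pi_def)
  qed
  also have "\<dots> = (\<Oplus>b\<in>B. \<Oplus>a\<in>A. ?g a b)" using assms by (intro finsum_swap) auto
  also have "\<dots> = (\<Oplus>b\<in>B. \<Oplus>a\<in>{a : A. b : N a}. f a b)"
  proof (rule finsum_cong'[OF refl])
    show "(%b. \<Oplus>a\<in>{a : A. b : N a}. f a b) : B \<rightarrow> carrier G"
      using assms by (auto intro!: finsum_closed)
    show "(\<Oplus>a\<in>A. ?g a b) = (\<Oplus>a\<in>{a : A. b : N a}. f a b)" if "b : B" for b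
      using that assms by (intro add.finprod_mono_neutral_cong_right) (auto simp: Pi_def)
  qed
  finally show ?thesis .
qed

text \<open>An incidence relation is listed once by the cells above and once by the cells below.
  \<open>N\<close> and \<open>M\<close> are these two listings of the same relation; nearly all
  commutation relations between boundary and coboundary operators come down to this
  exchange.\<close>

lemma finsum_swap_rel:
  assumes "finite A" "finite B" "!!a. a : A ==> finite (N a)" "!!b. b : B ==> finite (M b)"
    "!!a b. a : A & b : N a \<longleftrightarrow> b : B & a : M b"
    "!!a b. a : A ==> b : N a ==> f a b : carrier G"
  shows "(\<Oplus>a\<in>A. \<Oplus>b\<in>N a. f a b) = (\<Oplus>b\<in>B. \<Oplus>a\<in>M b. f a b)"
proof -
  have "(\<Oplus>a\<in>A. \<Oplus>b\<in>N a. f a b) = (\<Oplus>b\<in>B. \<Oplus>a\<in>{a : A. b : N a}. f a b)"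
    using assms by (intro finsum_swap_dep) auto
  also have "\<dots> = (\<Oplus>b\<in>B. \<Oplus>a\<in>M b. f a b)"
  proof (rule finsum_cong'[OF refl])
    fix b assume b: "b : B"
    have "{a : A. b : N a} = M b" using assms(5) b by blast
    then show "(\<Oplus>a\<in>{a : A. b : N a}. f a b) = (\<Oplus>a\<in>M b. f a b)" by simp
  next
    show "(%b. \<Oplus>a\<in>M b. f a b) : B \<rightarrow> carrier G" using assms(5,6) by (auto intro!: finsum_closed)
  qed
  finally show ?thesis .
qed

end

section \<open>Linear algebra over a commutative ring: homomorphisms, direct sums, quotients\<close>

section \<open>Module homomorphisms and submodules\<close>

lemma mod_homI:
  assumes "!!x. x : carrier M ==> h x : carrier N"
    "!!x y. x : carrier M ==> y : carrier M ==> h (x \<oplus>\<^sub>M y) = h x \<oplus>\<^sub>N h y"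
    "!!a x. a : carrier R ==> x : carrier M ==> h (a \<odot>\<^sub>M x) = a \<odot>\<^sub>N h x"
  shows "h : mod_hom R M N" using assms unfolding mod_hom_def by auto

lemma
  assumes "h : mod_hom R M N"
  shows mod_hom_closed: "x : carrier M ==> h x : carrier N"
    and mod_hom_add: "x : carrier M ==> y : carrier M ==> h (x \<oplus>\<^sub>M y) = h x \<oplus>\<^sub>N h y"
    and mod_hom_smult: "a : carrier R ==> x : carrier M ==> h (a \<odot>\<^sub>M x) = a \<odot>\<^sub>N h x"
  using assms unfolding mod_hom_def by auto

text \<open>\<open>mod_hom\<close> speaks of sums and scalar multiples only; zero and negatives are
  preserved because they are the multiples by the scalars zero and minus one.\<close>

lemma mod_hom_zero:
  assumes "module R M" "module R N" "h : mod_hom R M N"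
  shows "h \<zero>\<^sub>M = \<zero>\<^sub>N"
proof -
  interpret M: module R M by fact
  interpret N: module R N by fact
  have "h (\<zero>\<^sub>R \<odot>\<^sub>M \<zero>\<^sub>M) = \<zero>\<^sub>R \<odot>\<^sub>N h \<zero>\<^sub>M"
    using assms by (intro mod_hom_smult) auto
  then show ?thesis using mod_hom_closed[OF assms(3)] by simp
qed

lemma mod_hom_uminus:
  assumes "module R M" "module R N" "h : mod_hom R M N" "x : carrier M"
  shows "h (\<ominus>\<^sub>M x) = \<ominus>\<^sub>N h x"
proof -
  interpret M: module R M by fact
  interpret N: module R N by fact
  have "h ((\<ominus>\<^sub>R \<one>\<^sub>R) \<odot>\<^sub>M x) = (\<ominus>\<^sub>R \<one>\<^sub>R) \<odot>\<^sub>N h x"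
    using assms by (intro mod_hom_smult) auto
  then show ?thesis using mod_hom_closed[OF assms(3,4)] assms by (simp add: M.smult_l_minus N.smult_l_minus)
qed

lemma mod_hom_minus:
  assumes "module R M" "module R N" "h : mod_hom R M N" "x : carrier M" "y : carrier M"
  shows "h (x \<ominus>\<^sub>M y) = h x \<ominus>\<^sub>N h y"
proof -
  interpret M: module R M by fact
  interpret N: module R N by fact
  show ?thesis using assms by (simp add: a_minus_def mod_hom_add[OF assms(3)] mod_hom_uminus[OF assms(1-3)])
qed

lemma mod_hom_finsum:
  assumes "module R M" "module R N" "h : mod_hom R M N" "!!x. x : A ==> f x : carrier M"
  shows "h (\<Oplus>\<^bsub>M\<^esub>x\<in>A. f x) = (\<Oplus>\<^bsub>N\<^esub>x\<in>A. h (f x))"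
proof -
  interpret M: module R M by fact
  interpret N: module R N by fact
  show ?thesis using assms(4)
  proof (induct A rule: infinite_finite_induct)
    case (insert x F)
    then show ?case by (simp add: mod_hom_add[OF assms(3)] mod_hom_closed[OF assms(3)] Pi_def M.finsum_closed)
  qed (simp_all add: mod_hom_zero[OF assms(1-3)])
qed

lemma mod_hom_comp:
  "g : mod_hom R N P ==> h : mod_hom R M N ==> (%x. g (h x)) : mod_hom R M P" unfolding mod_hom_def by (auto simp: Pi_def)

lemma mod_hom_scale:
  assumes "module R M" "a : carrier R"
  shows "(%x. a \<odot>\<^sub>M x) : mod_hom R M M"
proof -
  interpret module R M by fact
  show ?thesis using assms(2) by (intro mod_homI) (auto simp: smult_r_distr smult_assoc1[symmetric] R.m_comm)
qed

lemma mod_iso_hom: "h : mod_iso R M N ==> h : mod_hom R M N"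
  and mod_iso_bij: "h : mod_iso R M N ==> bij_betw h (carrier M) (carrier N)" unfolding mod_iso_def by auto

lemma mod_isoI:
  "h : mod_hom R M N ==> bij_betw h (carrier M) (carrier N) ==> h : mod_iso R M N" unfolding mod_iso_def by auto

lemma mod_iso_inv:
  assumes "module R M" "h : mod_iso R M N"
  shows "inv_into (carrier M) h : mod_iso R N M"
proof -
  interpret M: module R M by fact
  have b: "bij_betw h (carrier M) (carrier N)" and hom: "h : mod_hom R M N" using assms(2) by (auto simp: mod_iso_def)
  let ?g = "inv_into (carrier M) h"
  have b': "bij_betw ?g (carrier N) (carrier M)" using b by (rule bij_betw_inv_into)
  have g: "?g y : carrier M" "h (?g y) = y" if "y : carrier N" for y
    using that b b' by (auto simp: bij_betw_apply bij_betw_inv_into_right)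
  have gh: "?g (h x) = x" if "x : carrier M" for x using that b by (simp add: bij_betw_inv_into_left)
  have "?g : mod_hom R N M"
  proof (rule mod_homI)
    fix x y assume xy: "x : carrier N" "y : carrier N"
    have "?g (h (?g x \<oplus>\<^sub>M ?g y)) = ?g x \<oplus>\<^sub>M ?g y" using xy g by (intro gh) auto
    then show "?g (x \<oplus>\<^sub>N y) = ?g x \<oplus>\<^sub>M ?g y" using xy g by (simp add: mod_hom_add[OF hom])
  next
    fix a x assume ax: "a : carrier R" "x : carrier N"
    have "?g (h (a \<odot>\<^sub>M ?g x)) = a \<odot>\<^sub>M ?g x" using ax g by (intro gh) auto
    then show "?g (a \<odot>\<^sub>N x) = a \<odot>\<^sub>M ?g x" using ax g by (simp add: mod_hom_smult[OF hom])
  qed (use g in auto)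
  then show ?thesis using b' by (simp add: mod_isoI)
qed

context module
begin

lemma submodule_carrier: "submodule N R M ==> x : N ==> x : carrier M" using submoduleE(1) by blast

lemma submodule_zero: "submodule N R M ==> \<zero>\<^sub>M : N"
  using submoduleE(1,2,4)[of N] smult_l_null by (metis R.zero_closed equals0I subsetD)

lemma submodule_minus:
  assumes "submodule N R M" "x : N" "y : N" shows "x \<ominus>\<^sub>M y : N"
  using submoduleE[OF assms(1)] assms(2,3) by (simp add: a_minus_def)

lemma submodule_finsum:
  assumes "submodule N R M" "!!x. x : A ==> f x : N"
  shows "(\<Oplus>\<^bsub>M\<^esub>x\<in>A. f x) : N" using assms(2)
proof (induct A rule: infinite_finite_induct)
  case (insert x F)
  have "f y : carrier M" if "y : insert x F" for y using insert that submodule_carrier[OF assms(1)] by blast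
  then show ?case using insert submoduleE(5)[OF assms(1)] by (subst M.finsum_insert) auto
qed (simp_all add: submodule_zero[OF assms(1)])

text \<open>\<open>finsum\<close> folds over the carrier, so shrinking the carrier is not visibly
  harmless. The values of the sheaf and the cosheaf are exterior algebras whose carrier is replaced
  by an ideal, and their differentials have to be compared with sums in the ambient algebra.\<close>

lemma submodule_finsum_eq:
  assumes "submodule N R M" "!!x. x : A ==> f x : N"
  shows "finsum (M\<lparr>carrier := N\<rparr>) f A = finsum M f A"
proof -
  interpret N: module R "M\<lparr>carrier := N\<rparr>"
    using submodule.submodule_is_module[OF assms(1)] by (simp add: module_axioms)
  show ?thesis using assms(2)
  proof (induct A rule: infinite_finite_induct)
    case (infinite A)
    then show ?case using N.M.finsum_infinite[OF infinite(1)] M.finsum_infinite[OF infinite(1)] by simp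
  next
    case empty
    then show ?case using N.M.finsum_empty M.finsum_empty by simp
  next
    case (insert x F)
    have "f y : carrier M" if "y : insert x F" for y using insert that submodule_carrier[OF assms(1)] by blast
    then show ?case using insert N.M.finsum_insert[of F x f] by (subst M.finsum_insert) auto
  qed
qed

lemma submodule_Int: "submodule N R M ==> submodule N' R M ==> submodule (N \<inter> N') R M"
  by (intro submoduleI) (auto simp: submodule_zero submoduleE dest: submodule_carrier)

lemma submodule_singleton_zero: "submodule {\<zero>\<^sub>M} R M" by (intro submoduleI) auto

end

section \<open>Integers acting on modules\<close>

text \<open>Turns the integer incidence numbers into scalars of the ground ring, so that one matrix
  of signs acts on every coefficient module and commutes with homomorphisms by linearity.\<close>

definition rint :: "('k, 'm) ring_scheme => int => 'k" where
  "rint R k = [k] \<cdot>\<^bsub>R\<^esub> \<one>\<^sub>R"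

context cring
begin

lemma rint_closed [simp, intro]: "rint R k : carrier R" unfolding rint_def using add.int_pow_closed[of \<one> k] by simp

lemma rint_one: "rint R 1 = \<one>"
  and rint_minus_one: "rint R (-1) = \<ominus> \<one>"
  unfolding rint_def using add.int_pow_1[of \<one>] add.int_pow_neg[of \<one> 1] by auto

lemma rint_zero: "rint R 0 = \<zero>" unfolding rint_def by (simp add: add_pow_def)

lemma rint_add: "rint R (k + l) = rint R k \<oplus> rint R l"
  unfolding rint_def using add.int_pow_mult[of \<one> k l] by simp

lemma rint_mult: "rint R (k * l) = rint R k \<otimes> rint R l"
proof -
  have c: "[l] \<cdot> \<one> : carrier R" using rint_closed unfolding rint_def .
  have "rint R k \<otimes> rint R l = [k] \<cdot> ([l] \<cdot> \<one>)"
    unfolding rint_def using add_pow_ldistr_int[OF one_closed c, of k] c by simp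
  also have "\<dots> = [(l * k)] \<cdot> \<one>" using add.int_pow_pow[of \<one> k l] by simp
  finally show ?thesis by (simp add: rint_def mult.commute)
qed

end

lemma (in module) add_pow_eq_rint:
  assumes "x : carrier M" "k : {1, -1}"
  shows "[k] \<cdot>\<^bsub>M\<^esub> x = rint R k \<odot>\<^sub>M x"
  using assms M.add.int_pow_1[of x] M.add.int_pow_neg[of x 1] by (auto simp: R.rint_one R.rint_minus_one smult_l_minus)

section \<open>Direct sums and maps between them\<close>

lemma direct_sum_simps [simp]:
  "carrier (direct_sum X A) = (\<Pi>\<^sub>E I\<in>X. carrier (A I))"
  "\<zero>\<^sub>(direct_sum X A) = (\<lambda>I\<in>X. \<zero>\<^sub>(A I))"
  "f \<oplus>\<^sub>(direct_sum X A) g = (\<lambda>I\<in>X. f I \<oplus>\<^sub>(A I) g I)"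
  "a \<odot>\<^sub>(direct_sum X A) f = (\<lambda>I\<in>X. a \<odot>\<^sub>(A I) f I)" by (auto simp: direct_sum_def)

lemma direct_sum_module:
  assumes "cring R" "!!I. I : X ==> module R (A I)"
  shows "module R (direct_sum X A)"
proof -
  note ag = module.axioms(2)[OF assms(2)]
  note AE = abelian_groupE[OF ag]
  show ?thesis
  proof (rule moduleI)
    show "abelian_group (direct_sum X A)"
    proof (rule abelian_groupI)
      fix x assume x: "x : carrier (direct_sum X A)"
      let ?y = "\<lambda>I\<in>X. \<ominus>\<^sub>(A I) x I"
      have "?y : carrier (direct_sum X A)" using x abelian_group.a_inv_closed[OF ag] by (auto simp: PiE_iff)
      moreover have "?y \<oplus>\<^sub>(direct_sum X A) x = \<zero>\<^sub>(direct_sum X A)"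
        using x abelian_group.l_neg[OF ag] by (auto simp: PiE_iff fun_eq_iff)
      ultimately show "EX y:carrier (direct_sum X A). y \<oplus>\<^sub>(direct_sum X A) x = \<zero>\<^sub>(direct_sum X A)"
        by blast
    next
      fix x assume "x : carrier (direct_sum X A)"
      then show "\<zero>\<^sub>(direct_sum X A) \<oplus>\<^sub>(direct_sum X A) x = x"
        using AE(5) by (auto simp: PiE_iff fun_eq_iff extensional_def)
    next
      fix x y z assume "x : carrier (direct_sum X A)" "y : carrier (direct_sum X A)" "z : carrier (direct_sum X A)"
      then show "x \<oplus>\<^sub>(direct_sum X A) y \<oplus>\<^sub>(direct_sum X A) z = x \<oplus>\<^sub>(direct_sum X A) (y \<oplus>\<^sub>(direct_sum X A) z)"
        using AE(3) by (auto simp: PiE_iff fun_eq_iff)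
    next
      fix x y assume "x : carrier (direct_sum X A)" "y : carrier (direct_sum X A)"
      then show "x \<oplus>\<^sub>(direct_sum X A) y = y \<oplus>\<^sub>(direct_sum X A) x"
        using AE(4) by (auto simp: PiE_iff fun_eq_iff)
    qed (auto simp: PiE_iff intro!: AE(1,2))
  qed (use assms(1) in \<open>auto simp: PiE_iff fun_eq_iff extensional_def module.smult_l_distr[OF assms(2)]
      module.smult_r_distr[OF assms(2)] module.smult_assoc1[OF assms(2)] module.smult_one[OF assms(2)]
      intro!: module.smult_closed[OF assms(2)]\<close>)
qed

lemma direct_sum_submodule:
  assumes "cring R" "!!I. I : X ==> module R (A I)" "!!I. I : X ==> submodule (B I) R (A I)"
  shows "submodule (\<Pi>\<^sub>E I\<in>X. B I) R (direct_sum X A)"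
proof -
  interpret module R "direct_sum X A" using direct_sum_module[OF assms(1,2)] .
  note sub = module.submoduleE[OF assms(2) assms(3)]
  show ?thesis
  proof (rule submoduleI)
    show "(\<Pi>\<^sub>E I\<in>X. B I) \<subseteq> carrier (direct_sum X A)" using sub(1) by (auto simp: PiE_iff)
    show "\<zero>\<^sub>(direct_sum X A) : (\<Pi>\<^sub>E I\<in>X. B I)"
      using module.submodule_zero[OF assms(2) assms(3)] by auto
    show "x \<oplus>\<^sub>(direct_sum X A) y : (\<Pi>\<^sub>E I\<in>X. B I)" if "x : (\<Pi>\<^sub>E I\<in>X. B I)" "y : (\<Pi>\<^sub>E I\<in>X. B I)" for x y
      using that sub(5) by (auto simp: PiE_iff)
    show sm: "a \<odot>\<^sub>(direct_sum X A) x : (\<Pi>\<^sub>E I\<in>X. B I)" if "a : carrier R" "x : (\<Pi>\<^sub>E I\<in>X. B I)" for a x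
      using that sub(4) by (auto simp: PiE_iff)
    show "\<ominus>\<^sub>(direct_sum X A) x : (\<Pi>\<^sub>E I\<in>X. B I)" if x: "x : (\<Pi>\<^sub>E I\<in>X. B I)" for x
    proof -
      have "x : carrier (direct_sum X A)" using x sub(1) by (auto simp: PiE_iff)
      then have "\<ominus>\<^sub>(direct_sum X A) x = (\<ominus>\<^sub>R \<one>\<^sub>R) \<odot>\<^sub>(direct_sum X A) x"
        by (subst smult_l_minus) (auto simp del: direct_sum_simps)
      then show ?thesis using sm[OF _ x] by (simp del: direct_sum_simps)
    qed
  qed
qed

text \<open>\<open>N y\<close> is the support of row \<open>y\<close> of a matrix \<open>T\<close>
  of maps. All operators of the double complex have this form, so their linearity is proved once;
  the restriction to \<open>Y\<close> puts the result into the extensional direct sum.\<close>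

definition lmap :: "'y set => ('y => 'x set) => ('y => ('k,'b) module) => ('y => 'x => 'a => 'b)
    => ('x => 'a) => 'y => 'b" where
  "lmap Y N B T c = (\<lambda>y\<in>Y. \<Oplus>\<^bsub>B y\<^esub>x\<in>N y. T y x (c x))"

lemma lmap_hom:
  assumes "!!y. y : Y ==> module R (B y)" "!!y. y : Y ==> finite (N y)" "!!y. y : Y ==> N y \<subseteq> X"
    "!!y x. y : Y ==> x : N y ==> T y x : mod_hom R (A x) (B y)"
  shows "lmap Y N B T : mod_hom R (direct_sum X A) (direct_sum Y B)"
proof (rule mod_homI)
  note fs = abelian_monoid.finsum_closed[OF abelian_group.axioms(1)[OF module.axioms(2)[OF assms(1)]]]
  have cl: "T y x (f x) : carrier (B y)" if "y : Y" "x : N y" "f : carrier (direct_sum X A)" for y x f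
    using that mod_hom_closed[OF assms(4)[OF that(1,2)]] assms(3)[OF that(1)] by (auto simp: PiE_iff)
  show "lmap Y N B T f : carrier (direct_sum Y B)" if "f : carrier (direct_sum X A)" for f
    using that cl by (auto simp: lmap_def intro!: fs)
  fix f assume f: "f : carrier (direct_sum X A)"
  have fx: "f x : carrier (A x)" if "y : Y" "x : N y" for x y using that f assms(3)[of y] by (auto simp: PiE_iff)
  { fix g assume g: "g : carrier (direct_sum X A)"
    have gx: "g x : carrier (A x)" if "y : Y" "x : N y" for x y using that g assms(3)[of y] by (auto simp: PiE_iff)
    have "(\<Oplus>\<^bsub>B y\<^esub>x\<in>N y. T y x ((f \<oplus>\<^sub>(direct_sum X A) g) x)) =
        (\<Oplus>\<^bsub>B y\<^esub>x\<in>N y. T y x (f x)) \<oplus>\<^sub>(B y) (\<Oplus>\<^bsub>B y\<^esub>x\<in>N y. T y x (g x))" if y: "y : Y" for y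
    proof -
      interpret B: module R "B y" using assms(1)[OF y] .
      have "(\<Oplus>\<^bsub>B y\<^esub>x\<in>N y. T y x ((f \<oplus>\<^sub>(direct_sum X A) g) x)) =
          (\<Oplus>\<^bsub>B y\<^esub>x\<in>N y. T y x (f x) \<oplus>\<^sub>(B y) T y x (g x))"
      proof (rule B.M.finsum_cong'[OF refl])
        show "(%x. T y x (f x) \<oplus>\<^sub>(B y) T y x (g x)) : N y \<rightarrow> carrier (B y)"
          using cl[OF y _ f] cl[OF y _ g] by auto
        fix x assume x: "x : N y"
        then have "x : X" using assms(3)[OF y] by auto
        then show "T y x ((f \<oplus>\<^sub>(direct_sum X A) g) x) = T y x (f x) \<oplus>\<^sub>(B y) T y x (g x)"
          using fx[OF y x] gx[OF y x] by (simp add: mod_hom_add[OF assms(4)[OF y x]])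
      qed
      then show ?thesis using cl[OF y _ f] cl[OF y _ g] by (simp add: B.M.finsum_addf Pi_def)
    qed
    then show "lmap Y N B T (f \<oplus>\<^sub>(direct_sum X A) g) = lmap Y N B T f \<oplus>\<^sub>(direct_sum Y B) lmap Y N B T g"
      unfolding lmap_def direct_sum_simps(3)[where X = Y] by (intro restrict_ext) simp }
  { fix a assume a: "a : carrier R"
    have "(\<Oplus>\<^bsub>B y\<^esub>x\<in>N y. T y x ((a \<odot>\<^sub>(direct_sum X A) f) x)) =
        a \<odot>\<^sub>(B y) (\<Oplus>\<^bsub>B y\<^esub>x\<in>N y. T y x (f x))" if y: "y : Y" for y
    proof -
      interpret B: module R "B y" using assms(1)[OF y] .
      have "(\<Oplus>\<^bsub>B y\<^esub>x\<in>N y. T y x ((a \<odot>\<^sub>(direct_sum X A) f) x)) =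
          (\<Oplus>\<^bsub>B y\<^esub>x\<in>N y. a \<odot>\<^sub>(B y) T y x (f x))"
      proof (rule B.M.finsum_cong'[OF refl])
        show "(%x. a \<odot>\<^sub>(B y) T y x (f x)) : N y \<rightarrow> carrier (B y)" using cl[OF y _ f] a by auto
        fix x assume x: "x : N y"
        then have "x : X" using assms(3)[OF y] by auto
        then show "T y x ((a \<odot>\<^sub>(direct_sum X A) f) x) = a \<odot>\<^sub>(B y) T y x (f x)"
          using fx[OF y x] a by (simp add: mod_hom_smult[OF assms(4)[OF y x]])
      qed
      then show ?thesis using cl[OF y _ f] a assms(2)[OF y] by (simp add: B.finsum_smult_ldistr Pi_def)
    qed
    then show "lmap Y N B T (a \<odot>\<^sub>(direct_sum X A) f) = a \<odot>\<^sub>(direct_sum Y B) lmap Y N B T f"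
      unfolding lmap_def direct_sum_simps(4)[where X = Y] by (intro restrict_ext) simp }
qed

section \<open>Quotient modules\<close>

context module
begin

lemma coset_eq:
  "N +>\<^sub>M x = {b \<oplus>\<^sub>M x | b. b : N}" by (auto simp: a_r_coset_def r_coset_def)

lemma coset_eq_iff:
  assumes N: "submodule N R M" and "x : carrier M" "y : carrier M"
  shows "N +>\<^sub>M x = N +>\<^sub>M y \<longleftrightarrow> x \<ominus>\<^sub>M y : N"
proof
  note E = submoduleE[OF N]
  have Nc: "b : carrier M" if "b : N" for b using that E(1) by auto
  assume "N +>\<^sub>M x = N +>\<^sub>M y"
  moreover have "x : N +>\<^sub>M x"
    using submodule_zero[OF N] assms by (auto simp: coset_eq intro!: exI[of _ "\<zero>\<^sub>M"])
  ultimately obtain b where "b : N" "x = b \<oplus>\<^sub>M y" by (auto simp: coset_eq)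
  then show "x \<ominus>\<^sub>M y : N" using assms Nc by (simp add: a_minus_def M.a_assoc M.r_neg)
next
  note E = submoduleE[OF N]
  have Nc: "b : carrier M" if "b : N" for b using that E(1) by auto
  assume d: "x \<ominus>\<^sub>M y : N"
  have xy: "x = (x \<ominus>\<^sub>M y) \<oplus>\<^sub>M y" using assms by (simp add: a_minus_def M.a_assoc M.l_neg)
  have yx: "y = (\<ominus>\<^sub>M (x \<ominus>\<^sub>M y)) \<oplus>\<^sub>M x"
    using assms by (simp add: a_minus_def M.minus_add M.a_assoc M.l_neg M.a_comm)
      (simp add: M.a_assoc[symmetric] M.l_neg M.r_neg M.a_comm)
  show "N +>\<^sub>M x = N +>\<^sub>M y"
  proof (intro equalityI subsetI)
    fix z assume "z : N +>\<^sub>M x"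
    then obtain b where b: "b : N" "z = b \<oplus>\<^sub>M x" by (auto simp: coset_eq)
    then have "z = (b \<oplus>\<^sub>M (x \<ominus>\<^sub>M y)) \<oplus>\<^sub>M y" using assms Nc d xy by (metis M.a_assoc)
    then show "z : N +>\<^sub>M y" using E(5)[OF b(1) d] by (auto simp: coset_eq)
  next
    fix z assume "z : N +>\<^sub>M y"
    then obtain b where b: "b : N" "z = b \<oplus>\<^sub>M y" by (auto simp: coset_eq)
    then have "z = (b \<oplus>\<^sub>M (\<ominus>\<^sub>M (x \<ominus>\<^sub>M y))) \<oplus>\<^sub>M x"
      using assms Nc E(3)[OF d] yx by (metis M.a_assoc)
    then show "z : N +>\<^sub>M x" using E(5)[OF b(1) E(3)[OF d]] by (auto simp: coset_eq)
  qed
qed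

lemma minus_self: "x : carrier M ==> x \<ominus>\<^sub>M x = \<zero>\<^sub>M" by (simp add: a_minus_def M.r_neg)

lemma coset_self: "submodule N R M ==> x : carrier M ==> x : N +>\<^sub>M x"
  using submodule_zero by (auto simp: coset_eq intro!: exI[of _ "\<zero>\<^sub>M"])

lemma in_coset:
  assumes "submodule N R M" "x : carrier M" "y : N +>\<^sub>M x"
  shows "y : carrier M" "N +>\<^sub>M y = N +>\<^sub>M x"
proof -
  obtain b where b: "b : N" "y = b \<oplus>\<^sub>M x" using assms(3) by (auto simp: coset_eq)
  have bc: "b : carrier M" using submoduleE(1)[OF assms(1)] b(1) by auto
  then show y: "y : carrier M" using b assms(2) by simp
  have "y \<ominus>\<^sub>M x = b" using b bc assms(2) by (simp add: a_minus_def M.a_assoc M.r_neg)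
  then show "N +>\<^sub>M y = N +>\<^sub>M x" using coset_eq_iff[OF assms(1) y assms(2)] b(1) by simp
qed

lemma coset_add:
  assumes N: "submodule N R M" and "x : carrier M" "y : carrier M"
  shows "(N +>\<^sub>M x) <+>\<^bsub>M\<^esub> (N +>\<^sub>M y) = N +>\<^sub>M (x \<oplus>\<^sub>M y)"
proof -
  note E = submoduleE[OF N]
  have Nc: "b : carrier M" if "b : N" for b using that E(1) by auto
  show ?thesis
  proof (intro equalityI subsetI)
    fix z assume "z : (N +>\<^sub>M x) <+>\<^bsub>M\<^esub> (N +>\<^sub>M y)"
    then obtain b c where bc: "b : N" "c : N" "z = (b \<oplus>\<^sub>M x) \<oplus>\<^sub>M (c \<oplus>\<^sub>M y)"
      by (auto simp: coset_eq set_add_def set_mult_def)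
    then have "z = (b \<oplus>\<^sub>M c) \<oplus>\<^sub>M (x \<oplus>\<^sub>M y)" using assms Nc by (simp add: M.a_ac)
    then show "z : N +>\<^sub>M (x \<oplus>\<^sub>M y)" using E(5)[OF bc(1,2)] by (auto simp: coset_eq)
  next
    fix z assume "z : N +>\<^sub>M (x \<oplus>\<^sub>M y)"
    then obtain b where b: "b : N" "z = b \<oplus>\<^sub>M (x \<oplus>\<^sub>M y)" by (auto simp: coset_eq)
    then have "z = (b \<oplus>\<^sub>M x) \<oplus>\<^sub>M y" using assms Nc by (simp add: M.a_ac)
    moreover have "b \<oplus>\<^sub>M x : N +>\<^sub>M x" using b by (auto simp: coset_eq)
    ultimately show "z : (N +>\<^sub>M x) <+>\<^bsub>M\<^esub> (N +>\<^sub>M y)"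
      using coset_self[OF N assms(3)] unfolding set_add_def set_mult_def by auto
  qed
qed

lemma coset_smult:
  assumes N: "submodule N R M" and "x : carrier M" "a : carrier R"
  shows "(\<Union>z\<in>N +>\<^sub>M x. N +>\<^sub>M (a \<odot>\<^sub>M z)) = N +>\<^sub>M (a \<odot>\<^sub>M x)"
proof -
  have "N +>\<^sub>M (a \<odot>\<^sub>M z) = N +>\<^sub>M (a \<odot>\<^sub>M x)" if z: "z : N +>\<^sub>M x" for z
  proof -
    have zc: "z : carrier M" "z \<ominus>\<^sub>M x : N"
      using in_coset[OF N assms(2) z] coset_eq_iff[OF N _ assms(2)] by auto
    have "a \<odot>\<^sub>M z \<ominus>\<^sub>M a \<odot>\<^sub>M x = a \<odot>\<^sub>M (z \<ominus>\<^sub>M x)"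
      using zc assms by (simp add: a_minus_def smult_r_distr smult_r_minus)
    then show ?thesis using submoduleE(4)[OF N assms(3) zc(2)] zc assms coset_eq_iff[OF N] by simp
  qed
  then show ?thesis using coset_self[OF N assms(2)] by blast
qed

end

lemma quot_module_simps:
  "carrier (quot_module M N) = {N +>\<^sub>M x | x. x : carrier M}"
  "\<zero>\<^sub>(quot_module M N) = N"
  "X \<oplus>\<^sub>(quot_module M N) Y = X <+>\<^bsub>M\<^esub> Y"
  "a \<odot>\<^sub>(quot_module M N) X = (\<Union>x\<in>X. N +>\<^sub>M (a \<odot>\<^sub>M x))"
  by (auto simp: quot_module_def FactRing_def A_RCOSETS_def RCOSETS_def a_r_coset_def)

lemma coset_carrier_update [simp]: "N +>\<^sub>(M\<lparr>carrier := Z\<rparr>) x = N +>\<^sub>M x"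
  by (simp add: a_r_coset_def r_coset_def)

lemma set_add_carrier_update [simp]: "X <+>\<^bsub>M\<lparr>carrier := Z\<rparr>\<^esub> Y = X <+>\<^bsub>M\<^esub> Y"
  by (simp add: set_add_def set_mult_def)

text \<open>A homogeneous component of a (co)homology module is the set of classes that have a
  homogeneous representative, expressed by \<open>U\<close>. To match such components it is enough
  to move homogeneous representatives across the relation \<open>rho\<close>.\<close>

lemma quot_iso_represented:
  fixes R :: "'k ring" and M :: "('k, 'a) module" and N :: "('k, 'b) module"
  assumes M: "module R M" "submodule ZM R M" "submodule BM R M" "BM \<subseteq> ZM"
    and N: "module R N" "submodule ZN R N" "submodule BN R N" "BN \<subseteq> ZN"
    and rho: "!!x y. rho x y ==> \<phi> (BM +>\<^sub>M x) = BN +>\<^sub>N y"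
    and fwd: "!!x. x : ZM ==> U x ==> EX y:ZN. rho x y & U' y"
    and bwd: "!!y. y : ZN ==> U' y ==> EX x:ZM. rho x y & U x"
  shows "\<phi> ` {X : carrier (quot_module (M\<lparr>carrier := ZM\<rparr>) BM). EX c:X. U c} =
    {Y : carrier (quot_module (N\<lparr>carrier := ZN\<rparr>) BN). EX c:Y. U' c}"
proof -
  \<comment> \<open>The representative satisfying \<open>U\<close> is only known to lie in the
    coset. It lies in \<open>Z\<close> as well, since it differs from an element of \<open>Z\<close>
    by one of \<open>B\<close>, and \<open>B\<close> is contained in \<open>Z\<close>.\<close>
  have rep: "EX c:Z. X = B +>\<^sub>L c & U c"
    if L: "module R L" "submodule Z R L" "submodule B R L" "B \<subseteq> Z"
      and X: "X : carrier (quot_module (L\<lparr>carrier := Z\<rparr>) B)" "EX c:X. U c"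
    for L :: "('k, 'c) module" and Z B X U
  proof -
    interpret L: module R L by (rule L(1))
    obtain x where x: "x : Z" "X = B +>\<^sub>L x" using X(1) by (auto simp: quot_module_simps)
    obtain c where c: "c : X" "U c" using X(2) by blast
    have xc: "x : carrier L" using L.submodule_carrier[OF L(2) x(1)] .
    have cx: "B +>\<^sub>L c = B +>\<^sub>L x" using L.in_coset(2)[OF L(3) xc] c(1) x(2) by simp
    obtain b where b: "b : B" "c = b \<oplus>\<^sub>L x" using c(1) x(2) by (auto simp: L.coset_eq)
    have "c : Z" unfolding b(2) using b(1) L(4) x(1) by (intro L.submoduleE(5)[OF L(2)]) auto
    then show ?thesis using cx x(2) c(2) by (intro bexI[of _ c]) simp_all
  qed
  have mem: "B +>\<^sub>L c : carrier (quot_module (L\<lparr>carrier := Z\<rparr>) B) & c : B +>\<^sub>L c"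
    if L: "module R L" "submodule Z R L" "submodule B R L" and c: "c : Z" for L :: "('k, 'c) module" and Z B c
    using module.coset_self[OF L(1,3) module.submodule_carrier[OF L(1,2) c]] c by (auto simp: quot_module_simps)
  show ?thesis
  proof (intro equalityI subsetI)
    fix Y assume "Y : \<phi> ` {X : carrier (quot_module (M\<lparr>carrier := ZM\<rparr>) BM). EX c:X. U c}"
    then obtain X where X: "X : carrier (quot_module (M\<lparr>carrier := ZM\<rparr>) BM)" "EX c:X. U c" "Y = \<phi> X" by blast
    obtain c where c: "c : ZM" "X = BM +>\<^sub>M c" "U c" using rep[OF M X(1,2)] by blast
    obtain y where y: "y : ZN" "rho c y" "U' y" using fwd[OF c(1,3)] by blast
    have "Y = BN +>\<^sub>N y" using rho[OF y(2)] c(2) X(3) by simp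
    then show "Y : {Y : carrier (quot_module (N\<lparr>carrier := ZN\<rparr>) BN). EX c:Y. U' c}"
      using mem[OF N(1,2,3) y(1)] y(3) by blast
  next
    fix Y assume "Y : {Y : carrier (quot_module (N\<lparr>carrier := ZN\<rparr>) BN). EX c:Y. U' c}"
    then have Y: "Y : carrier (quot_module (N\<lparr>carrier := ZN\<rparr>) BN)" "EX c:Y. U' c" by auto
    obtain c where c: "c : ZN" "Y = BN +>\<^sub>N c" "U' c" using rep[OF N Y] by blast
    obtain x where x: "x : ZM" "rho x c" "U x" using bwd[OF c(1,3)] by blast
    have "Y = \<phi> (BM +>\<^sub>M x)" using rho[OF x(2)] c(2) by simp
    moreover have "BM +>\<^sub>M x : {X : carrier (quot_module (M\<lparr>carrier := ZM\<rparr>) BM). EX c:X. U c}"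
      using mem[OF M(1,2,3) x(1)] x(3) by blast
    ultimately show "Y : \<phi> ` {X : carrier (quot_module (M\<lparr>carrier := ZM\<rparr>) BM). EX c:X. U c}" by blast
  qed
qed

text \<open>An additive relation that is total on both sides and matches \<open>BM\<close> with
  \<open>BN\<close> is an isomorphism of quotients in disguise. The map is quantified before
  \<open>U\<close> and \<open>U'\<close>, so that a single isomorphism can be tested against all
  inner degrees.\<close>

lemma quot_iso_of_relation:
  fixes R :: "'k ring" and M :: "('k, 'a) module" and N :: "('k, 'b) module"
  assumes M: "module R M" and N: "module R N"
    and sub: "submodule ZM R M" "submodule BM R M" "submodule ZN R N" "submodule BN R N"
    and le: "BM \<subseteq> ZM" "BN \<subseteq> ZN"
    and rel: "!!x y. rho x y ==> x : ZM" "!!x y. rho x y ==> y : ZN"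
    and add: "!!x y x' y'. rho x y ==> rho x' y' ==> rho (x \<oplus>\<^sub>M x') (y \<oplus>\<^sub>N y')"
    and smult: "!!a x y. a : carrier R ==> rho x y ==> rho (a \<odot>\<^sub>M x) (a \<odot>\<^sub>N y)"
    and total: "!!x. x : ZM ==> EX y. rho x y" "!!y. y : ZN ==> EX x. rho x y"
    and null: "!!x y. rho x y ==> x : BM \<longleftrightarrow> y : BN"
  shows "EX \<phi>:mod_iso R (quot_module (M\<lparr>carrier := ZM\<rparr>) BM) (quot_module (N\<lparr>carrier := ZN\<rparr>) BN).
    ALL U U'. (ALL x:ZM. U x --> (EX y. rho x y & U' y)) --> (ALL y:ZN. U' y --> (EX x. rho x y & U x)) -->
      \<phi> ` {X : carrier (quot_module (M\<lparr>carrier := ZM\<rparr>) BM). EX c:X. U c} =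
      {Y : carrier (quot_module (N\<lparr>carrier := ZN\<rparr>) BN). EX c:Y. U' c}"
proof -
  interpret M: module R M by fact
  interpret N: module R N by fact
  let ?QM = "quot_module (M\<lparr>carrier := ZM\<rparr>) BM" and ?QN = "quot_module (N\<lparr>carrier := ZN\<rparr>) BN"
  have cM: "x : carrier M" if "x : ZM" for x using that M.submodule_carrier[OF sub(1)] by blast
  have cN: "x : carrier N" if "x : ZN" for x using that N.submodule_carrier[OF sub(3)] by blast
  have minus: "rho (x \<ominus>\<^sub>M x') (y \<ominus>\<^sub>N y')" if "rho x y" "rho x' y'" for x y x' y'
  proof -
    have "rho ((\<ominus>\<^sub>R \<one>\<^sub>R) \<odot>\<^sub>M x') ((\<ominus>\<^sub>R \<one>\<^sub>R) \<odot>\<^sub>N y')"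
      using that by (intro smult) auto
    then have "rho (\<ominus>\<^sub>M x') (\<ominus>\<^sub>N y')"
      using cM[OF rel(1)[OF that(2)]] cN[OF rel(2)[OF that(2)]] by (simp add: M.smult_l_minus N.smult_l_minus)
    then show ?thesis unfolding a_minus_def using that by (intro add)
  qed
  \<comment> \<open>Applied to differences, \<open>null\<close> yields both directions at once:
    well-definedness of the induced map and its injectivity.\<close>
  have eq: "BM +>\<^sub>M x = BM +>\<^sub>M x' \<longleftrightarrow> BN +>\<^sub>N y = BN +>\<^sub>N y'" if "rho x y" "rho x' y'" for x y x' y'
    using null[OF minus[OF that]] that rel cM cN by (simp add: M.coset_eq_iff[OF sub(2)] N.coset_eq_iff[OF sub(4)])
  \<comment> \<open>The relation is not single-valued, so a partner is chosen; \<open>eq\<close>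
    makes the resulting coset independent of the choice.\<close>
  define \<phi> where "\<phi> X = (SOME Y. EX x y. rho x y & X = BM +>\<^sub>M x & Y = BN +>\<^sub>N y)" for X
  have phi: "\<phi> (BM +>\<^sub>M x) = BN +>\<^sub>N y" if r: "rho x y" for x y
  proof -
    have "EX x' y'. rho x' y' & BM +>\<^sub>M x = BM +>\<^sub>M x' & \<phi> (BM +>\<^sub>M x) = BN +>\<^sub>N y'"
      unfolding \<phi>_def by (rule someI[of _ "BN +>\<^sub>N y"]) (use r in blast)
    then show ?thesis using eq r by metis
  qed
  have QM: "EX x y. rho x y & X = BM +>\<^sub>M x" if "X : carrier ?QM" for X
    using that total(1) by (auto simp: quot_module_simps) blast
  have QN: "EX x y. rho x y & Y = BN +>\<^sub>N y" if "Y : carrier ?QN" for Y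
    using that total(2) by (auto simp: quot_module_simps) blast
  have inM: "BM +>\<^sub>M x : carrier ?QM" if "rho x y" for x y using rel(1)[OF that] by (auto simp: quot_module_simps)
  have inN: "BN +>\<^sub>N y : carrier ?QN" if "rho x y" for x y using rel(2)[OF that] by (auto simp: quot_module_simps)
  have "\<phi> : mod_hom R ?QM ?QN"
  proof (rule mod_homI)
    show "\<phi> X : carrier ?QN" if "X : carrier ?QM" for X using QM[OF that] phi inN by metis
    fix X assume "X : carrier ?QM"
    then obtain x y where xy: "rho x y" "X = BM +>\<^sub>M x" using QM by blast
    { fix X' assume "X' : carrier ?QM"
      then obtain x' y' where xy': "rho x' y'" "X' = BM +>\<^sub>M x'" using QM by blast
      have "X \<oplus>\<^sub>?QM X' = BM +>\<^sub>M (x \<oplus>\<^sub>M x')"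
        using xy xy' rel cM by (simp add: quot_module_simps M.coset_add[OF sub(2)])
      moreover have "(BN +>\<^sub>N y) \<oplus>\<^sub>?QN (BN +>\<^sub>N y') = BN +>\<^sub>N (y \<oplus>\<^sub>N y')"
        using rel(2)[OF xy(1)] rel(2)[OF xy'(1)] cN by (simp add: quot_module_simps N.coset_add[OF sub(4)])
      ultimately show "\<phi> (X \<oplus>\<^sub>?QM X') = \<phi> X \<oplus>\<^sub>?QN \<phi> X'"
        using phi[OF add[OF xy(1) xy'(1)]] phi[OF xy(1)] phi[OF xy'(1)] xy xy' by simp }
    { fix a assume a: "a : carrier R"
      have "a \<odot>\<^sub>?QM X = BM +>\<^sub>M (a \<odot>\<^sub>M x)"
        using xy rel(1)[OF xy(1)] cM a by (simp add: quot_module_simps M.coset_smult[OF sub(2)])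
      moreover have "a \<odot>\<^sub>?QN (BN +>\<^sub>N y) = BN +>\<^sub>N (a \<odot>\<^sub>N y)"
        using rel(2)[OF xy(1)] cN a by (simp add: quot_module_simps N.coset_smult[OF sub(4)])
      ultimately show "\<phi> (a \<odot>\<^sub>?QM X) = a \<odot>\<^sub>?QN \<phi> X"
        using phi[OF smult[OF a xy(1)]] phi[OF xy(1)] xy by simp }
  qed
  moreover have "bij_betw \<phi> (carrier ?QM) (carrier ?QN)"
  proof (rule bij_betwI')
    show "\<phi> X = \<phi> X' \<longleftrightarrow> X = X'" if X: "X : carrier ?QM" "X' : carrier ?QM" for X X'
      using QM[OF X(1)] QM[OF X(2)] phi eq by metis
    show "\<phi> X : carrier ?QN" if "X : carrier ?QM" for X using QM[OF that] phi inN by metis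
    show "EX X:carrier ?QM. Y = \<phi> X" if "Y : carrier ?QN" for Y using QN[OF that] phi inM by metis
  qed
  ultimately have \<phi>: "\<phi> : mod_iso R ?QM ?QN" by (rule mod_isoI)
  show ?thesis
  proof (intro bexI[OF _ \<phi>] allI impI)
    fix U U' assume fwd: "ALL x:ZM. U x --> (EX y. rho x y & U' y)" and bwd: "ALL y:ZN. U' y --> (EX x. rho x y & U x)"
    show "\<phi> ` {X : carrier (quot_module (M\<lparr>carrier := ZM\<rparr>) BM). EX c:X. U c} =
      {Y : carrier (quot_module (N\<lparr>carrier := ZN\<rparr>) BN). EX c:Y. U' c}"
    proof (rule quot_iso_represented[OF M sub(1,2) le(1) N sub(3,4) le(2)])
      show "\<phi> (BM +>\<^sub>M x) = BN +>\<^sub>N y" if "rho x y" for x y by (rule phi[OF that])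
      show "EX y:ZN. rho x y & U' y" if "x : ZM" "U x" for x using fwd that rel(2) by blast
      show "EX x:ZM. rho x y & U x" if "y : ZN" "U' y" for y using bwd that rel(1) by blast
    qed
  qed
qed

lemma submodule_image:
  assumes "module R M" "module R N" and h: "h : mod_hom R M N" and S: "submodule S R M"
  shows "submodule (h ` S) R N"
proof -
  interpret M: module R M by fact
  interpret N: module R N by fact
  note c = M.submodule_carrier[OF S] and E = M.submoduleE[OF S]
  show ?thesis
  proof (rule N.submoduleI)
    show "h ` S \<subseteq> carrier N" using mod_hom_closed[OF h] c by auto
    show "\<zero>\<^sub>N : h ` S"
      using mod_hom_zero[OF assms(1-3)] M.submodule_zero[OF S] by (intro image_eqI[of _ h "\<zero>\<^sub>M"]) simp_all
    fix x assume "x : h ` S"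
    then obtain u where u: "x = h u" "u : S" by blast
    show "\<ominus>\<^sub>N x : h ` S"
      using mod_hom_uminus[OF assms(1-3) c[OF u(2)]] u(1) E(3)[OF u(2)] by (intro image_eqI) simp_all
    show "r \<odot>\<^sub>N x : h ` S" if "r : carrier R" for r
      using mod_hom_smult[OF h that c[OF u(2)]] u(1) E(4)[OF that u(2)] by (intro image_eqI) simp_all
    fix y assume "y : h ` S"
    then obtain v where v: "y = h v" "v : S" by blast
    show "x \<oplus>\<^sub>N y : h ` S"
      using mod_hom_add[OF h c[OF u(2)] c[OF v(2)]] u(1) v(1) E(5)[OF u(2) v(2)] by (intro image_eqI) simp_all
  qed
qed

section \<open>Homological algebra: comparing the two edges of a double complex by
  staircases\<close>

section \<open>Augmented double complexes\<close>

text \<open>The first index increases under \<open>dl\<close>, the second decreases under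
  \<open>del\<close>. A column has fixed \<open>a\<close> and is augmented by \<open>ep\<close> at
  \<open>b = 0\<close>; a row has fixed \<open>b\<close> and is augmented by \<open>g\<close> at its
  last place \<open>a = n\<close>. The two edges \<open>A\<close> and \<open>C\<close> are the
  complexes to be compared.\<close>

locale double_complex =
  fixes R :: "'k ring" and n :: nat
    and A :: "nat => ('k,'x) module" and D :: "nat => nat => ('k,'z) module" and C :: "nat => ('k,'y) module"
    and dA ep dl del g dC
  assumes mods: "!!a. module R (A a)" "!!a b. module R (D a b)" "!!b. module R (C b)"
    and homs: "!!a. dA a : mod_hom R (A a) (A (Suc a))" "!!a. ep a : mod_hom R (D a 0) (A a)"
      "!!a b. dl a b : mod_hom R (D a b) (D (Suc a) b)" "!!a b. del a b : mod_hom R (D a (Suc b)) (D a b)"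
      "!!b. g b : mod_hom R (D n b) (C b)" "!!b. dC b : mod_hom R (C (Suc b)) (C b)"
    and comm: "!!a z. z : carrier (D a 0) ==> dA a (ep a z) = ep (Suc a) (dl a 0 z)"
      "!!a b z. z : carrier (D a (Suc b)) ==> dl a b (del a b z) = del (Suc a) b (dl a (Suc b) z)"
      "!!b z. z : carrier (D n (Suc b)) ==> dC b (g (Suc b) z) = g b (del n b z)"
    and cplx: "!!a z. z : carrier (D a (Suc 0)) ==> ep a (del a 0 z) = \<zero>\<^sub>(A a)"
      "!!a b z. z : carrier (D a (Suc (Suc b))) ==> del a b (del a (Suc b) z) = \<zero>\<^sub>(D a b)"
      "!!a b z. z : carrier (D a b) ==> dl (Suc a) b (dl a b z) = \<zero>\<^sub>(D (Suc (Suc a)) b)"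
      "!!a b z. Suc a = n ==> z : carrier (D a b) ==> g b (dl a b z) = \<zero>\<^sub>(C b)"
begin

text \<open>A staircase starting at a cocycle \<open>x\<close>: lift it through \<open>ep\<close>,
  apply \<open>dl\<close>, lift through \<open>del\<close>, and so on \<open>b\<close> times. The
  sets \<open>SA\<close> and \<open>SD\<close> in which the lifts are taken are parameters, so that
  staircases of a homogeneous part can be compared with those of the whole complex.\<close>

definition zz where
  "zz SA SD a b = rec_nat (%x z. x : SA a & dA a x = \<zero>\<^sub>(A (Suc a)) & z : SD a 0 & ep a z = x)
    (%b r x z'. z' : SD (a + Suc b) (Suc b) & (EX z. r x z & dl (a + b) b z = del (a + Suc b) b z')) b"

lemma zz_0: "zz SA SD a 0 x z \<longleftrightarrow> x : SA a & dA a x = \<zero>\<^sub>(A (Suc a)) & z : SD a 0 & ep a z = x"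
  and zz_Suc: "zz SA SD a (Suc b) x z' \<longleftrightarrow> z' : SD (a + Suc b) (Suc b) &
    (EX z. zz SA SD a b x z & dl (a + b) b z = del (a + Suc b) b z')" by (simp_all add: zz_def)

lemma zz_mono:
  assumes "!!a. SA a \<subseteq> SA' a" "!!a b. SD a b \<subseteq> SD' a b" "zz SA SD a b x z"
  shows "zz SA' SD' a b x z" using assms(3)
proof (induct b arbitrary: z)
  case 0
  then show ?case using assms(1,2) unfolding zz_0 by blast
next
  case (Suc b)
  then show ?case using assms(1,2) unfolding zz_Suc by blast
qed

end

text \<open>Exactness is imposed on submodules \<open>SA\<close>, \<open>SD\<close>,
  \<open>SC\<close> of one ambient double complex. The ideals and their homogeneous parts can then
  share all operators and fall under the same theorem. Rows are exact from place 1 on, up to and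
  including the augmentation \<open>g\<close> at place \<open>n\<close>.\<close>

locale exact_double_complex = double_complex +
  fixes SA SD SC
  assumes subs: "!!a. submodule (SA a) R (A a)" "!!a b. submodule (SD a b) R (D a b)"
      "!!b. submodule (SC b) R (C b)"
    and stable: "!!a x. x : SA a ==> dA a x : SA (Suc a)" "!!a z. z : SD a 0 ==> ep a z : SA a"
      "!!a b z. z : SD a b ==> dl a b z : SD (Suc a) b" "!!a b z. z : SD a (Suc b) ==> del a b z : SD a b"
      "!!b z. z : SD n b ==> g b z : SC b" "!!b y. y : SC (Suc b) ==> dC b y : SC b"
    and col: "!!a x. a <= n ==> x : SA a ==> EX z:SD a 0. ep a z = x"
      "!!a z. a <= n ==> z : SD a 0 ==> ep a z = \<zero>\<^sub>(A a) ==> EX w:SD a (Suc 0). del a 0 w = z"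
      "!!a b z. a <= n ==> z : SD a (Suc b) ==> del a b z = \<zero>\<^sub>(D a b) ==> EX w:SD a (Suc (Suc b)). del a (Suc b) w = z"
    and row: "!!a b z. Suc a < n ==> z : SD (Suc a) b ==> dl (Suc a) b z = \<zero>\<^sub>(D (Suc (Suc a)) b) ==> EX w:SD a b. dl a b w = z"
      "!!a b z. Suc a = n ==> z : SD (Suc a) b ==> g b z = \<zero>\<^sub>(C b) ==> EX w:SD a b. dl a b w = z"
      "!!b y. y : SC b ==> EX z:SD n b. g b z = y"
    and top: "!!x. x : SA n ==> dA n x = \<zero>\<^sub>(A (Suc n))"
begin

abbreviation "Z \<equiv> zz SA SD"

sublocale A: module R "A a" for a by (rule mods)
sublocale D: module R "D a b" for a b by (rule mods)
sublocale C: module R "C b" for b by (rule mods)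

lemma SA_carrier: "x : SA a ==> x : carrier (A a)"
  and SD_carrier: "z : SD a b ==> z : carrier (D a b)"
  and SC_carrier: "y : SC b ==> y : carrier (C b)"
  using A.submodule_carrier[OF subs(1)] D.submodule_carrier[OF subs(2)] C.submodule_carrier[OF subs(3)] by blast+

lemmas SD_minus = D.submodule_minus[OF subs(2)]
lemmas dl_minus = mod_hom_minus[OF mods(2) mods(2) homs(3)]
lemmas del_minus = mod_hom_minus[OF mods(2) mods(2) homs(4)]
lemmas ep_minus = mod_hom_minus[OF mods(2) mods(1) homs(2)]
lemmas g_minus = mod_hom_minus[OF mods(2) mods(3) homs(5)]
lemmas dl_add = mod_hom_add[OF homs(3)]
lemmas del_add = mod_hom_add[OF homs(4)]
lemmas ep_add = mod_hom_add[OF homs(2)]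
lemmas g_add = mod_hom_add[OF homs(5)]

lemma D_minus_eq: "x : carrier (D a b) ==> y : carrier (D a b) ==> x = (x \<ominus>\<^sub>(D a b) y) \<oplus>\<^sub>(D a b) y"
  by (simp add: a_minus_def D.M.a_assoc D.M.l_neg)

lemma zz_in: "Z a b x z ==> x : SA a & dA a x = \<zero>\<^sub>(A (Suc a))"
  by (induct b arbitrary: z) (auto simp: zz_0 zz_Suc)

lemma zz_in': "Z a b x z ==> z : SD (a + b) b" by (cases b) (auto simp: zz_0 zz_Suc)

lemma zz_add: "Z a b x z ==> Z a b x' z' ==> Z a b (x \<oplus>\<^sub>(A a) x') (z \<oplus>\<^sub>(D (a + b) b) z')"
proof (induct b arbitrary: z z')
  case 0
  then show ?case using SA_carrier SD_carrier A.submoduleE(5)[OF subs(1)] D.submoduleE(5)[OF subs(2)]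
    by (auto simp: zz_0 ep_add mod_hom_add[OF homs(1)])
next
  case (Suc b)
  obtain w where w: "Z a b x w" "dl (a + b) b w = del (a + Suc b) b z" "z : SD (a + Suc b) (Suc b)"
    using Suc(2) by (auto simp: zz_Suc)
  obtain w' where w': "Z a b x' w'" "dl (a + b) b w' = del (a + Suc b) b z'" "z' : SD (a + Suc b) (Suc b)"
    using Suc(3) by (auto simp: zz_Suc)
  have "dl (a + b) b (w \<oplus>\<^sub>(D (a + b) b) w') = del (a + Suc b) b (z \<oplus>\<^sub>(D (a + Suc b) (Suc b)) z')"
    using w w' SD_carrier[OF zz_in'[OF w(1)]] SD_carrier[OF zz_in'[OF w'(1)]] SD_carrier by (simp add: dl_add del_add)
  then show ?case using Suc(1)[OF w(1) w'(1)] D.submoduleE(5)[OF subs(2) w(3) w'(3)] by (auto simp: zz_Suc)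
qed

lemma zz_smult: "r : carrier R ==> Z a b x z ==> Z a b (r \<odot>\<^sub>(A a) x) (r \<odot>\<^sub>(D (a + b) b) z)"
proof (induct b arbitrary: z)
  case 0
  then show ?case using SA_carrier SD_carrier A.submoduleE(4)[OF subs(1)] D.submoduleE(4)[OF subs(2)]
    by (auto simp: zz_0 mod_hom_smult[OF homs(2)] mod_hom_smult[OF homs(1)])
next
  case (Suc b)
  obtain w where w: "Z a b x w" "dl (a + b) b w = del (a + Suc b) b z" "z : SD (a + Suc b) (Suc b)"
    using Suc(3) by (auto simp: zz_Suc)
  have "dl (a + b) b (r \<odot>\<^sub>(D (a + b) b) w) = del (a + Suc b) b (r \<odot>\<^sub>(D (a + Suc b) (Suc b)) z)"
    using w SD_carrier[OF zz_in'[OF w(1)]] SD_carrier Suc(2)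
    by (simp add: mod_hom_smult[OF homs(3)] mod_hom_smult[OF homs(4)])
  then show ?case using Suc(1)[OF Suc(2) w(1)] D.submoduleE(4)[OF subs(2) Suc(2) w(3)] by (auto simp: zz_Suc)
qed

text \<open>A further step lifts \<open>dl z\<close> through \<open>del\<close>. This is possible
  because \<open>dl z\<close> is a cycle of its column: its boundary is \<open>dl\<close> of the
  element \<open>dl w\<close> found one step earlier, and \<open>dl\<close> squares to zero. At
  \<open>b = 0\<close> the cocycle condition on \<open>x\<close> takes over this part.\<close>

lemma zz_total: "x : SA a ==> dA a x = \<zero>\<^sub>(A (Suc a)) ==> a + b <= n ==> EX z. Z a b x z"
proof (induct b)
  case 0
  then show ?case using col(1)[of a x] by (auto simp: zz_0)
next
  case (Suc b)
  then obtain z where z: "Z a b x z" by auto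
  have zD: "z : SD (a + b) b" using zz_in'[OF z] .
  have "EX w:SD (a + Suc b) (Suc b). del (a + Suc b) b w = dl (a + b) b z"
  proof (cases b)
    case 0
    have "ep (Suc a) (dl a 0 z) = \<zero>\<^sub>(A (Suc a))"
      using comm(1)[of z a] SD_carrier zD z Suc(3) 0 by (simp add: zz_0)
    then show ?thesis using col(2)[of "Suc a"] stable(3)[OF zD] 0 Suc(4) by simp
  next
    case (Suc b')
    obtain w where w: "Z a b' x w" "dl (a + b') b' w = del (a + Suc b') b' z" using z Suc by (auto simp: zz_Suc)
    have "del (Suc (a + b)) b' (dl (a + b) b z) = dl (a + b) b' (dl (a + b') b' w)"
      using comm(2)[of z "a + b" b'] SD_carrier[OF zD] w(2) Suc by simp
    also have "\<dots> = \<zero>\<^sub>(D (Suc (a + b)) b')" using cplx(3)[OF SD_carrier[OF zz_in'[OF w(1)]]] Suc by simp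
    finally show ?thesis using col(3)[of "Suc (a + b)" "dl (a + b) b z" b'] stable(3)[OF zD] Suc Suc.prems(3) by simp
  qed
  then obtain w where "w : SD (a + Suc b) (Suc b)" "del (a + Suc b) b w = dl (a + b) b z" by blast
  then have "Z a (Suc b) x w" unfolding zz_Suc using z by metis
  then show ?case ..
qed

text \<open>If \<open>w\<close> lifts \<open>x'\<close>, then \<open>dl w\<close> lifts
  \<open>dA x'\<close>, and every other lift differs from it by a boundary. This decomposition is
  passed down the staircase: applying \<open>dl\<close> kills the part \<open>dl q\<close>, and
  exactness of the columns turns the remainder into the next boundary term.\<close>

lemma zz_null:
  assumes "Z (Suc a) b x z" "x : dA a ` SA a" "Suc a + b <= n"
  shows "EX p:SD (Suc a + b) (Suc b). EX q:SD (a + b) b. z = del (Suc a + b) b p \<oplus>\<^sub>(D (Suc a + b) b) dl (a + b) b q"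
  using assms(1,3)
proof (induct b arbitrary: z)
  case 0
  obtain x' where x': "x' : SA a" "x = dA a x'" using assms(2) by blast
  obtain w where w: "w : SD a 0" "ep a w = x'" using col(1)[OF _ x'(1)] 0 by auto
  have z: "z : SD (Suc a) 0" "ep (Suc a) z = x" using 0 by (auto simp: zz_0)
  have dw: "dl a 0 w : SD (Suc a) 0" using stable(3)[OF w(1)] .
  have "ep (Suc a) (dl a 0 w) = x" using comm(1)[OF SD_carrier[OF w(1)]] w x' by simp
  \<comment> \<open>\<open>z\<close> and \<open>dl w\<close> lift the same \<open>x\<close>, so
    their difference is a boundary of the column.\<close>
  then have "ep (Suc a) (z \<ominus>\<^sub>(D (Suc a) 0) dl a 0 w) = \<zero>\<^sub>(A (Suc a))"
    using z dw SD_carrier SA_carrier stable(2)[OF z(1)] by (simp add: ep_minus A.minus_self)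
  then obtain p where p: "p : SD (Suc a) (Suc 0)" "del (Suc a) 0 p = z \<ominus>\<^sub>(D (Suc a) 0) dl a 0 w"
    using col(2)[of "Suc a"] SD_minus[OF z(1) dw] 0(2) by auto
  show ?case using p w D_minus_eq[OF SD_carrier[OF z(1)] SD_carrier[OF dw]] by (metis add_0_right)
next
  case (Suc b)
  obtain w where w: "Z (Suc a) b x w" "dl (Suc a + b) b w = del (Suc a + Suc b) b z" "z : SD (Suc a + Suc b) (Suc b)"
    using Suc(2) by (auto simp: zz_Suc)
  obtain p q where pq: "p : SD (Suc a + b) (Suc b)" "q : SD (a + b) b"
    "w = del (Suc a + b) b p \<oplus>\<^sub>(D (Suc a + b) b) dl (a + b) b q" using Suc(1)[OF w(1)] Suc(3) by auto
  have dp: "dl (Suc a + b) (Suc b) p : SD (Suc a + Suc b) (Suc b)" using stable(3)[OF pq(1)] by simp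
  have "dl (Suc a + b) b w = dl (Suc a + b) b (del (Suc a + b) b p) \<oplus>\<^sub>(D (Suc (Suc a + b)) b) dl (Suc a + b) b (dl (a + b) b q)"
    unfolding pq(3) using SD_carrier stable(3)[OF pq(2)] stable(4)[OF pq(1)] by (simp add: dl_add)
  also have "\<dots> = dl (Suc a + b) b (del (Suc a + b) b p)"
    using cplx(3)[OF SD_carrier[OF pq(2)]] SD_carrier[OF stable(3)[OF stable(4)[OF pq(1)]]] by simp
  also have "\<dots> = del (Suc a + Suc b) b (dl (Suc a + b) (Suc b) p)" using comm(2)[OF SD_carrier[OF pq(1)]] by simp
  finally have "del (Suc a + Suc b) b z = del (Suc a + Suc b) b (dl (Suc a + b) (Suc b) p)" using w(2) by simp
  then have "del (Suc a + Suc b) b (z \<ominus>\<^sub>(D (Suc a + Suc b) (Suc b)) dl (Suc a + b) (Suc b) p) = \<zero>\<^sub>(D (Suc a + Suc b) b)"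
    using SD_carrier[OF dp] SD_carrier[OF w(3)] SD_carrier[OF stable(4)[OF w(3)]] by (simp add: del_minus D.minus_self)
  then obtain p' where p': "p' : SD (Suc a + Suc b) (Suc (Suc b))"
    "del (Suc a + Suc b) (Suc b) p' = z \<ominus>\<^sub>(D (Suc a + Suc b) (Suc b)) dl (Suc a + b) (Suc b) p"
    using col(3) SD_minus[OF w(3) dp] Suc(3) by meson
  have "z = del (Suc a + Suc b) (Suc b) p' \<oplus>\<^sub>(D (Suc a + Suc b) (Suc b)) dl (a + Suc b) (Suc b) p"
    using D_minus_eq[OF SD_carrier[OF w(3)] SD_carrier[OF dp]] p'(2) by simp
  then show ?case using p'(1) pq(1) by (metis add_Suc add_Suc_right)
qed

text \<open>The staircase is climbed backwards. The decomposition of \<open>z\<close> makes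
  \<open>w\<close> minus \<open>del q\<close> a cocycle of its row, and exactness of the row
  produces the decomposition of \<open>w\<close>, one step higher. At the top only
  \<open>dA (ep q)\<close> is left.\<close>

lemma zz_null':
  assumes "Z (Suc a) b x z" "p : SD (Suc a + b) (Suc b)" "q : SD (a + b) b"
    "z = del (Suc a + b) b p \<oplus>\<^sub>(D (Suc a + b) b) dl (a + b) b q" "Suc a + b <= n"
  shows "x : dA a ` SA a" using assms
proof (induct b arbitrary: z p q)
  case 0
  have "ep (Suc a) z = \<zero>\<^sub>(A (Suc a)) \<oplus>\<^sub>(A (Suc a)) dA a (ep a q)"
    using 0 SD_carrier[OF 0(2)] SD_carrier[OF 0(3)] SD_carrier[OF stable(4)[OF 0(2)]] SD_carrier[OF stable(3)[OF 0(3)]]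
      comm(1)[of q a] cplx(1)[of p "Suc a"] by (simp add: ep_add)
  also have "\<dots> = dA a (ep a q)" using SA_carrier[OF stable(1)[OF stable(2)]] 0(3) by simp
  finally have "x = dA a (ep a q)" using 0(1) by (simp add: zz_0)
  then show ?case using 0(3) stable(2)[of q a] by simp
next
  case (Suc b)
  obtain w where w: "Z (Suc a) b x w" "dl (Suc a + b) b w = del (Suc a + Suc b) b z" "z : SD (Suc a + Suc b) (Suc b)"
    using Suc(2) by (auto simp: zz_Suc)
  have q: "q : SD (Suc a + b) (Suc b)" using Suc(4) by simp
  have wD: "w : SD (Suc a + b) b" using zz_in'[OF w(1)] .
  have dq: "del (Suc a + b) b q : SD (Suc a + b) b" using stable(4)[OF q] .
  have "del (Suc a + Suc b) b z = del (Suc a + Suc b) b (del (Suc a + Suc b) (Suc b) p) \<oplus>\<^sub>(D (Suc a + Suc b) b)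
      del (Suc a + Suc b) b (dl (Suc a + b) (Suc b) q)"
    unfolding Suc(5) using SD_carrier[OF stable(4)[OF Suc(3)]] SD_carrier[OF stable(3)[OF q]] by (simp add: del_add)
  also have "\<dots> = del (Suc a + Suc b) b (dl (Suc a + b) (Suc b) q)"
    using cplx(2)[OF SD_carrier[OF Suc(3)]] SD_carrier[OF stable(4)[OF stable(3)[OF q]]] by simp
  also have "\<dots> = dl (Suc a + b) b (del (Suc a + b) b q)" using comm(2)[OF SD_carrier[OF q]] by simp
  finally have "dl (Suc a + b) b (w \<ominus>\<^sub>(D (Suc a + b) b) del (Suc a + b) b q) = \<zero>\<^sub>(D (Suc (Suc a + b)) b)"
    using w(2) SD_carrier[OF wD] SD_carrier[OF dq] SD_carrier[OF stable(3)[OF wD]] by (simp add: dl_minus D.minus_self)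
  then obtain u where u: "u : SD (a + b) b" "dl (a + b) b u = w \<ominus>\<^sub>(D (Suc a + b) b) del (Suc a + b) b q"
    using row(1)[of "a + b" "w \<ominus>\<^sub>(D (Suc a + b) b) del (Suc a + b) b q" b] SD_minus[OF wD dq] Suc(6) by auto
  have "w = dl (a + b) b u \<oplus>\<^sub>(D (Suc a + b) b) del (Suc a + b) b q"
    using D_minus_eq[OF SD_carrier[OF wD] SD_carrier[OF dq]] u(2) by simp
  then have "w = del (Suc a + b) b q \<oplus>\<^sub>(D (Suc a + b) b) dl (a + b) b u"
    using SD_carrier[OF stable(3)[OF u(1)]] SD_carrier[OF dq] by (simp add: D.M.a_comm)
  then show ?case using Suc(1)[OF w(1) q u(1)] Suc(6) by simp
qed

text \<open>The staircase is built from its lower end. If \<open>del z = dl w\<close>, then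
  \<open>dl\<close> kills \<open>del w\<close>, because it commutes with \<open>del\<close> and
  \<open>del\<close> squares to zero; exactness of the rows then supplies the element that precedes
  \<open>w\<close>.\<close>

lemma zz_surj:
  assumes "z : SD (Suc a + b) b" "Suc a + b <= n"
    "b > 0 ==> EX w:SD (a + b) (b - 1). del (Suc a + b) (b - 1) z = dl (a + b) (b - 1) w"
    "b = 0 ==> dA (Suc a) (ep (Suc a) z) = \<zero>\<^sub>(A (Suc (Suc a)))"
  shows "EX x. Z (Suc a) b x z" using assms
proof (induct b arbitrary: z)
  case 0
  then show ?case using stable(2)[of z "Suc a"] by (auto simp: zz_0)
next
  case (Suc b)
  obtain w where w: "w : SD (Suc a + b) b" "del (Suc a + Suc b) b z = dl (Suc a + b) b w" using Suc(4) by auto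
  have dlz: "dl (Suc a + b) b w : SD (Suc (Suc a + b)) b" using stable(3)[OF w(1)] .
  have "EX x. Z (Suc a) b x w"
  proof (rule Suc(1)[OF w(1)])
    show "Suc a + b <= n" using Suc(3) by simp
    \<comment> \<open>At the upper end \<open>ep w\<close> is a cocycle because
      \<open>dl w = del z\<close> and \<open>ep\<close> kills boundaries.\<close>
    show "dA (Suc a) (ep (Suc a) w) = \<zero>\<^sub>(A (Suc (Suc a)))" if "b = 0"
      using that w comm(1)[of w "Suc a"] SD_carrier cplx(1)[of z "Suc (Suc a)"] Suc(2) by simp
    show "EX v:SD (a + b) (b - 1). del (Suc a + b) (b - 1) w = dl (a + b) (b - 1) v" if pos: "b > 0"
    proof -
      obtain b' where b': "b = Suc b'" using pos by (cases b) auto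
      have w': "w : SD (Suc a + b) (Suc b')" using w(1) b' by simp
      have "dl (Suc a + b) b' (del (Suc a + b) b' w) = del (Suc (Suc a + b)) b' (del (Suc (Suc a + b)) (Suc b') z)"
        using comm(2)[OF SD_carrier[OF w']] w(2) b' by simp
      also have "\<dots> = \<zero>\<^sub>(D (Suc (Suc a + b)) b')"
        using cplx(2)[of z "Suc (Suc a + b)" b'] SD_carrier[OF Suc(2)] b' by simp
      finally obtain v where "v : SD (a + b) b'" "dl (a + b) b' v = del (Suc a + b) b' w"
        using row(1)[of "a + b" "del (Suc a + b) b' w" b'] stable(4)[OF w'] Suc(3) by auto
      then show ?thesis using b' by (intro bexI[of _ v]) simp_all
    qed
  qed
  then show ?case using w Suc(2) by (auto simp: zz_Suc)
qed

text \<open>The relation pairs a cocycle with the images under \<open>g\<close> of the ends of its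
  staircases. Totality on either side is stated separately, because a homogeneous subcomplex
  supplies through it homogeneous partners for the relation of the full complex. The case
  distinction on \<open>m\<close> reflects that no differential leaves \<open>C 0\<close>.\<close>

theorem zz_quotient_iso:
  assumes n: "Suc a + m = n" and dC0: "m = 0 ==> cyc = SC 0"
    and dCS: "!!m'. m = Suc m' ==> cyc = {y : SC m. dC m' y = \<zero>\<^sub>(C m')}"
  defines "rho \<equiv> %x y. EX z. Z (Suc a) m x z & y = g m z"
    and "cocyc \<equiv> {x : SA (Suc a). dA (Suc a) x = \<zero>\<^sub>(A (Suc (Suc a)))}"
  shows "x : cocyc ==> EX y:cyc. rho x y" "y : cyc ==> EX x:cocyc. rho x y"
    "EX \<phi>:mod_iso R (quot_module ((A (Suc a))\<lparr>carrier := cocyc\<rparr>) (dA a ` SA a))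
        (quot_module ((C m)\<lparr>carrier := cyc\<rparr>) (dC m ` SC (Suc m))).
      ALL U U'. (ALL x:cocyc. U x --> (EX y. rho x y & U' y)) --> (ALL y:cyc. U' y --> (EX x. rho x y & U x)) -->
        \<phi> ` {X : carrier (quot_module ((A (Suc a))\<lparr>carrier := cocyc\<rparr>) (dA a ` SA a)). EX c:X. U c} =
        {Y : carrier (quot_module ((C m)\<lparr>carrier := cyc\<rparr>) (dC m ` SC (Suc m))). EX c:Y. U' c}"
proof -
  have cyc_sub: "cyc \<subseteq> SC m" using dC0 dCS by (cases m) auto
  have gz: "g m z : cyc" if z: "Z (Suc a) m x z" for x z
  proof -
    have zD: "z : SD n m" using zz_in'[OF z] n by simp
    show ?thesis
    proof (cases m)
      case 0
      then show ?thesis using dC0 stable(5)[OF zD] by simp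
    next
      case (Suc m')
      obtain w where w: "Z (Suc a) m' x w" "dl (Suc a + m') m' w = del (Suc a + Suc m') m' z"
        using z Suc by (auto simp: zz_Suc)
      have "dC m' (g (Suc m') z) = g m' (dl (Suc a + m') m' w)" using comm(3)[of z m'] SD_carrier[OF zD] Suc w(2) n by simp
      also have "\<dots> = \<zero>\<^sub>(C m')" using cplx(4)[OF _ SD_carrier[OF zz_in'[OF w(1)]]] Suc n by simp
      finally show ?thesis using dCS[OF Suc] stable(5)[OF zD] Suc by simp
    qed
  qed
  show tot1: "EX y:cyc. rho x y" if "x : cocyc" for x
    using zz_total[of x "Suc a" m] that n gz unfolding cocyc_def rho_def by auto
  show tot2: "EX x:cocyc. rho x y" if y: "y : cyc" for y
  proof -
    have "y : SC m" using y cyc_sub by blast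
    then obtain z where z: "z : SD n m" "g m z = y" using row(3) by blast
    have "EX x. Z (Suc a) m x z"
    proof (rule zz_surj)
      show "z : SD (Suc a + m) m" using z n by simp
      show "Suc a + m <= n" using n by simp
      show "dA (Suc a) (ep (Suc a) z) = \<zero>\<^sub>(A (Suc (Suc a)))" if "m = 0"
        using top[of "ep (Suc a) z"] stable(2)[of z "Suc a"] z(1) that n by simp
      show "EX w:SD (a + m) (m - 1). del (Suc a + m) (m - 1) z = dl (a + m) (m - 1) w" if pos: "m > 0"
      proof -
        obtain m' where m': "m = Suc m'" using pos by (cases m) auto
        \<comment> \<open>As \<open>y\<close> is a cycle, \<open>g\<close> kills
          \<open>del z\<close>, so \<open>del z\<close> comes from place \<open>n - 1\<close> of its
          row; this is the first backward step of the staircase.\<close>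
        have "g m' (del n m' z) = \<zero>\<^sub>(C m')"
          using comm(3)[of z m'] SD_carrier[OF z(1)] z(2) y dCS[OF m'] m' by simp
        then obtain w where "w : SD (a + m) m'" "dl (a + m) m' w = del n m' z"
          using row(2)[of "a + m" "del n m' z" m'] stable(4)[of z n m'] z(1) m' n by simp blast
        then show ?thesis using m' n by (intro bexI[of _ w]) simp_all
      qed
    qed
    then obtain x where "Z (Suc a) m x z" ..
    then show ?thesis using zz_in z(2) unfolding rho_def cocyc_def by blast
  qed
  have cocyc: "submodule cocyc R (A (Suc a))"
  proof (rule A.submoduleI)
    note hom = homs(1)[of "Suc a"]
    show "cocyc \<subseteq> carrier (A (Suc a))" using SA_carrier by (auto simp: cocyc_def)
    show "\<zero>\<^sub>(A (Suc a)) : cocyc"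
      using A.submodule_zero[OF subs(1)] mod_hom_zero[OF mods(1) mods(1) hom] by (simp add: cocyc_def)
    show "\<ominus>\<^sub>(A (Suc a)) x : cocyc" if "x : cocyc" for x
      using that A.submoduleE(3)[OF subs(1)] mod_hom_uminus[OF mods(1) mods(1) hom] SA_carrier by (simp add: cocyc_def)
    show "x \<oplus>\<^sub>(A (Suc a)) y : cocyc" if "x : cocyc" "y : cocyc" for x y
      using that A.submoduleE(5)[OF subs(1)] mod_hom_add[OF hom] SA_carrier by (simp add: cocyc_def)
    show "r \<odot>\<^sub>(A (Suc a)) x : cocyc" if "r : carrier R" "x : cocyc" for r x
      using that A.submoduleE(4)[OF subs(1)] mod_hom_smult[OF hom] SA_carrier by (simp add: cocyc_def)
  qed
  have cyc: "submodule cyc R (C m)"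
  proof (cases m)
    case 0
    then show ?thesis using dC0 subs(3)[of 0] by simp
  next
    case (Suc m')
    note hom = homs(6)[of m']
    show ?thesis unfolding dCS[OF Suc] Suc
    proof (rule C.submoduleI)
      show "{y : SC (Suc m'). dC m' y = \<zero>\<^sub>(C m')} \<subseteq> carrier (C (Suc m'))" using SC_carrier by auto
    qed (use SC_carrier C.submodule_zero[OF subs(3)] mod_hom_zero[OF mods(3) mods(3) hom]
        C.submoduleE(3,4,5)[OF subs(3)] mod_hom_uminus[OF mods(3) mods(3) hom] mod_hom_add[OF hom] mod_hom_smult[OF hom] in simp_all)
  qed
  show "EX \<phi>:mod_iso R (quot_module ((A (Suc a))\<lparr>carrier := cocyc\<rparr>) (dA a ` SA a))
        (quot_module ((C m)\<lparr>carrier := cyc\<rparr>) (dC m ` SC (Suc m))).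
      ALL U U'. (ALL x:cocyc. U x --> (EX y. rho x y & U' y)) --> (ALL y:cyc. U' y --> (EX x. rho x y & U x)) -->
        \<phi> ` {X : carrier (quot_module ((A (Suc a))\<lparr>carrier := cocyc\<rparr>) (dA a ` SA a)). EX c:X. U c} =
        {Y : carrier (quot_module ((C m)\<lparr>carrier := cyc\<rparr>) (dC m ` SC (Suc m))). EX c:Y. U' c}"
  proof (rule quot_iso_of_relation[OF mods(1) mods(3) cocyc _ cyc])
    have rho_iff: "x : dA a ` SA a \<longleftrightarrow> y : dC m ` SC (Suc m)" if r: "rho x y" for x y
    proof -
      obtain z where z: "Z (Suc a) m x z" "y = g m z" using r rho_def by blast
      have zD: "z : SD n m" using zz_in'[OF z(1)] n by simp
      show ?thesis
      proof
        assume "x : dA a ` SA a"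
        then obtain p q where pq: "p : SD n (Suc m)" "q : SD (a + m) m"
          "z = del n m p \<oplus>\<^sub>(D n m) dl (a + m) m q" using zz_null[OF z(1)] n by auto
        have dlq: "dl (a + m) m q : SD n m" using stable(3)[OF pq(2)] n by simp
        have "y = g m (del n m p) \<oplus>\<^sub>(C m) g m (dl (a + m) m q)"
          unfolding z(2) pq(3) using SD_carrier[OF stable(4)[OF pq(1)]] SD_carrier[OF dlq] by (rule g_add)
        also have "\<dots> = dC m (g (Suc m) p)" using comm(3)[OF SD_carrier[OF pq(1)]] cplx(4)[OF _ SD_carrier[OF pq(2)]] n
            SC_carrier[OF stable(6)[OF stable(5)[OF pq(1)]]] by simp
        finally show "y : dC m ` SC (Suc m)" using stable(5)[OF pq(1)] by blast
      next
        assume "y : dC m ` SC (Suc m)"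
        then obtain y' where y': "y' : SC (Suc m)" "y = dC m y'" by blast
        obtain p where p: "p : SD n (Suc m)" "g (Suc m) p = y'" using row(3)[OF y'(1)] by blast
        have dp: "del n m p : SD n m" using stable(4)[OF p(1)] .
        \<comment> \<open>\<open>z\<close> and \<open>del p\<close> have the same image under
          \<open>g\<close>, hence differ by an element of the image of \<open>dl\<close>.\<close>
        have "g m (z \<ominus>\<^sub>(D n m) del n m p) = \<zero>\<^sub>(C m)"
          using comm(3)[OF SD_carrier[OF p(1)]] p(2) y'(2) z(2) SD_carrier[OF zD] SD_carrier[OF dp]
            SC_carrier[OF stable(5)[OF zD]] by (simp add: g_minus C.minus_self)
        then obtain q where q: "q : SD (a + m) m" "dl (a + m) m q = z \<ominus>\<^sub>(D n m) del n m p"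
          using row(2)[of "a + m" "z \<ominus>\<^sub>(D n m) del n m p" m] SD_minus[OF zD dp] n by auto
        have "z = dl (a + m) m q \<oplus>\<^sub>(D n m) del n m p"
          using D_minus_eq[OF SD_carrier[OF zD] SD_carrier[OF dp]] q(2) by simp
        then have "z = del n m p \<oplus>\<^sub>(D n m) dl (a + m) m q"
          using SD_carrier[OF stable(3)[OF q(1)]] SD_carrier[OF dp] n by (simp add: D.M.a_comm)
        then show "x : dA a ` SA a" using zz_null'[OF z(1), of p q] p(1) q(1) n by simp
      qed
    qed
    then show "x : dA a ` SA a \<longleftrightarrow> y : dC m ` SC (Suc m)" if "rho x y" for x y using that .
    show "submodule (dA a ` SA a) R (A (Suc a))" by (rule submodule_image[OF mods(1) mods(1) homs(1) subs(1)])
    show "submodule (dC m ` SC (Suc m)) R (C m)" by (rule submodule_image[OF mods(3) mods(3) homs(6) subs(3)])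
    show "x : cocyc" if "rho x y" for x y using that zz_in unfolding rho_def cocyc_def by blast
    show "y : cyc" if "rho x y" for x y using that gz unfolding rho_def by blast
    show "rho (x \<oplus>\<^sub>(A (Suc a)) x') (y \<oplus>\<^sub>(C m) y')" if r: "rho x y" "rho x' y'" for x y x' y'
    proof -
      obtain z z' where z: "Z (Suc a) m x z" "y = g m z" "Z (Suc a) m x' z'" "y' = g m z'" using r rho_def by blast
      have "g m (z \<oplus>\<^sub>(D (Suc a + m) m) z') = y \<oplus>\<^sub>(C m) y'"
        using z SD_carrier[OF zz_in'[OF z(1)]] SD_carrier[OF zz_in'[OF z(3)]] n by (simp add: g_add)
      then show ?thesis using zz_add[OF z(1,3)] unfolding rho_def by metis
    qed
    show "rho (r \<odot>\<^sub>(A (Suc a)) x) (r \<odot>\<^sub>(C m) y)" if r: "r : carrier R" "rho x y" for r x y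
    proof -
      obtain z where z: "Z (Suc a) m x z" "y = g m z" using r rho_def by blast
      have "g m (r \<odot>\<^sub>(D (Suc a + m) m) z) = r \<odot>\<^sub>(C m) y"
        using z SD_carrier[OF zz_in'[OF z(1)]] n r(1) by (simp add: mod_hom_smult[OF homs(5)])
      then show ?thesis using zz_smult[OF r(1) z(1)] unfolding rho_def by metis
    qed
    show "EX y. rho x y" if "x : cocyc" for x using tot1[OF that] by blast
    show "EX x. rho x y" if "y : cyc" for y using tot2[OF that] by blast
    \<comment> \<open>\<open>dA\<close> squares to zero on \<open>SA\<close>, because
      \<open>ep\<close> is onto there and carries \<open>dl\<close> to \<open>dA\<close>.\<close>
    show "dA a ` SA a \<subseteq> cocyc"
    proof
      fix x assume "x : dA a ` SA a"
      then obtain x' where x': "x' : SA a" "x = dA a x'" by blast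
      obtain w where w: "w : SD a 0" "ep a w = x'" using col(1)[OF _ x'(1)] n by auto
      have "dA (Suc a) x = ep (Suc (Suc a)) (dl (Suc a) 0 (dl a 0 w))"
        using comm(1)[OF SD_carrier[OF w(1)]] comm(1)[OF SD_carrier[OF stable(3)[OF w(1)]]] w(2) x'(2) by simp
      also have "\<dots> = \<zero>\<^sub>(A (Suc (Suc a)))"
        using cplx(3)[OF SD_carrier[OF w(1)]] mod_hom_zero[OF mods(2) mods(1) homs(2)] by simp
      finally show "x : cocyc" using stable(1)[OF x'(1)] x'(2) by (simp add: cocyc_def)
    qed
    show "dC m ` SC (Suc m) \<subseteq> cyc"
    proof
      fix y assume "y : dC m ` SC (Suc m)"
      then obtain y' where y': "y' : SC (Suc m)" "y = dC m y'" by blast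
      have yS: "y : SC m" using stable(6)[OF y'(1)] y'(2) by simp
      obtain w where w: "w : SD n (Suc m)" "g (Suc m) w = y'" using row(3)[OF y'(1)] by blast
      have y: "y = g m (del n m w)" using comm(3)[OF SD_carrier[OF w(1)]] w(2) y'(2) by simp
      show "y : cyc"
      proof (cases m)
        case 0
        then show ?thesis using dC0 yS by simp
      next
        case (Suc m')
        have "dC m' y = g m' (del n m' (del n (Suc m') w))"
          using comm(3)[of "del n m w" m'] SD_carrier[OF stable(4)[OF w(1)]] y Suc by simp
        also have "\<dots> = \<zero>\<^sub>(C m')"
          using cplx(2)[of w n m'] SD_carrier[OF w(1)] Suc mod_hom_zero[OF mods(2) mods(3) homs(5)] by simp
        finally show ?thesis using dCS[OF Suc] yS by simp
      qed
    qed
  qed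
qed

end

section \<open>Combinatorics of simplicial posets: faces of one element as sets of vertices\<close>

section \<open>Simplicial posets\<close>

lemma image_subset_iff_of_inj_on:
  assumes "inj_on f X" "A \<subseteq> X" "B \<subseteq> X"
  shows "f ` A \<subseteq> f ` B \<longleftrightarrow> A \<subseteq> B"
proof
  assume le: "f ` A \<subseteq> f ` B"
  show "A \<subseteq> B"
  proof
    fix x assume x: "x : A"
    then obtain y where "y : B" "f x = f y" using le by blast
    then show "x : B" using inj_onD[OF assms(1)] x assms(2,3) by blast
  qed
qed blast

text \<open>The ideal has \<open>2 ^ k\<close> elements, which determines \<open>k\<close> and makes
  \<open>rank\<close> well defined.\<close>

lemma boolean_ideal_unique:
  assumes "boolean_ideal S I k" "boolean_ideal S I l"
  shows "k = l"
proof -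
  have "card {J : S. J <= I} = 2 ^ k" if "boolean_ideal S I k" for k
  proof -
    obtain f where "bij_betw f {J\<in>S. J <= I} (Pow {1..k})"
      using \<open>boolean_ideal S I k\<close> unfolding boolean_ideal_def by blast
    then show ?thesis using bij_betw_same_card[of f] by (simp add: card_Pow)
  qed
  from this[OF assms(1)] this[OF assms(2)] show ?thesis by simp
qed

locale simplicial =
  fixes S :: "'p::order set"
  assumes simplicial: "simplicial_poset S"
begin

lemma finite_S [simp]: "finite S" using simplicial by (simp add: simplicial_poset_def)

lemma bot_in [simp]: "bot_of S : S"
  and bot_le: "I : S ==> bot_of S <= I"
proof -
  obtain z where z: "z : S" "ALL I:S. z <= I" using simplicial by (auto simp: simplicial_poset_def)
  have "bot_of S = z" unfolding bot_of_def using z by (intro Least_equality) auto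
  then show "bot_of S : S" "I : S ==> bot_of S <= I" using z by auto
qed

lemma rankI: "boolean_ideal S I k ==> rank S I = k" unfolding rank_def using boolean_ideal_unique by blast

lemma boolean_rank: "I : S ==> boolean_ideal S I (rank S I)" using simplicial rankI by (metis simplicial_poset_def)

abbreviation "vb \<equiv> verts_below S"

text \<open>The abstract isomorphism with the subsets of \<open>{1..k}\<close> is relabelled by
  vertices: singletons correspond to elements of rank 1, so replacing labels by atoms turns
  \<open>f I\<close> into \<open>vb I\<close>. Arguments about the faces of one element thereby
  become arguments about sets.\<close>

lemma boolean_coords:
  assumes J: "J : S"
  shows "EX f. inj_on f {I : S. I <= J} & f ` {I : S. I <= J} = Pow (vb J) &
    (ALL I:S. I <= J --> f I = vb I & card (vb I) = rank S I) &
    (ALL I:S. ALL I':S. I <= J & I' <= J --> (I <= I' \<longleftrightarrow> f I \<subseteq> f I'))"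
proof -
  obtain f where f: "bij_betw f {I\<in>S. I <= J} (Pow {1..rank S J})"
    and le: "!!I I'. I : S ==> I' : S ==> I <= J ==> I' <= J ==> I <= I' \<longleftrightarrow> f I \<subseteq> f I'"
    using boolean_rank[OF J] unfolding boolean_ideal_def by (metis (no_types, lifting) mem_Collect_eq)
  have inj: "inj_on f {I\<in>S. I <= J}" and im: "f ` {I\<in>S. I <= J} = Pow {1..rank S J}"
    using f by (auto simp: bij_betw_def)
  have ex: "EX I:S. I <= J & f I = A" if "A \<subseteq> {1..rank S J}" for A
  proof -
    have "A : f ` {I\<in>S. I <= J}" using im that by simp
    then show ?thesis by auto
  qed
  have sub: "f I \<subseteq> {1..rank S J}" if "I : S" "I <= J" for I using im that by blast
  \<comment> \<open>The ideal below \<open>I\<close> is carried onto the subsets of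
    \<open>f I\<close>; renaming \<open>f I\<close> to an initial segment of the integers exhibits
    this ideal as boolean of rank \<open>card (f I)\<close>.\<close>
  have rk: "rank S I = card (f I)" if I: "I : S" "I <= J" for I
  proof (rule rankI)
    have fin: "finite (f I)" using sub[OF I] finite_subset by blast
    obtain h where h: "bij_betw h (f I) {1..card (f I)}" using finite_same_card_bij[OF fin, of "{1..card (f I)}"] by auto
    have hI: "inj_on h (f I)" "h ` f I = {1..card (f I)}" using h by (auto simp: bij_betw_def)
    have below: "f ` {I'\<in>S. I' <= I} = Pow (f I)"
    proof
      show "f ` {I'\<in>S. I' <= I} \<subseteq> Pow (f I)" using le I by (auto dest: order_trans)
      show "Pow (f I) \<subseteq> f ` {I'\<in>S. I' <= I}"
      proof
        fix A assume A: "A : Pow (f I)"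
        then obtain I' where I': "I' : S" "I' <= J" "f I' = A" using ex sub[OF I] by blast
        then show "A : f ` {I'\<in>S. I' <= I}" using A le I by auto
      qed
    qed
    have "bij_betw (%I'. h ` f I') {I'\<in>S. I' <= I} (Pow {1..card (f I)})"
    proof -
      have "bij_betw f {I'\<in>S. I' <= I} (Pow (f I))"
        using below inj I by (auto simp: bij_betw_def intro!: inj_onI dest: order_trans elim!: inj_onD)
      moreover have "bij_betw ((`) h) (Pow (f I)) (Pow {1..card (f I)})"
        using hI by (metis bij_betw_imageI image_Pow_surj inj_on_image_Pow)
      ultimately show ?thesis using bij_betw_trans unfolding comp_def by fastforce
    qed
    moreover have "I1 <= I2 \<longleftrightarrow> h ` f I1 \<subseteq> h ` f I2" if "I1 : S" "I1 <= I" "I2 : S" "I2 <= I" for I1 I2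
    proof -
      have "f I1 \<subseteq> f I" "f I2 \<subseteq> f I" using that le I by (auto dest: order_trans)
      then have "h ` f I1 \<subseteq> h ` f I2 \<longleftrightarrow> f I1 \<subseteq> f I2" by (rule image_subset_iff_of_inj_on[OF hI(1)])
      then show ?thesis using le[of I1 I2] that I by (auto dest: order_trans)
    qed
    ultimately show "boolean_ideal S I (card (f I))" unfolding boolean_ideal_def by (intro exI[of _ "%I'. h ` f I'"]) auto
  qed
  \<comment> \<open>\<open>v x\<close> is the atom labelled \<open>x\<close>; the vertices of
    \<open>I\<close> will be the \<open>v x\<close> with \<open>x\<close> in
    \<open>f I\<close>.\<close>
  have "EX v. ALL x:{1..rank S J}. v x : S & v x <= J & f (v x) = {x}"
  proof (intro bchoice ballI)
    fix x assume "x : {1..rank S J}"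
    then show "EX y. y : S & y <= J & f y = {x}" using ex[of "{x}"] by auto
  qed
  then obtain v where v: "!!x. x : {1..rank S J} ==> v x : S & v x <= J & f (v x) = {x}" by blast
  have vbe: "vb I = v ` f I" if I: "I : S" "I <= J" for I
  proof
    show "v ` f I \<subseteq> vb I"
    proof
      fix y assume "y : v ` f I"
      then obtain x where x: "x : f I" "y = v x" by blast
      then have "x : {1..rank S J}" using sub[OF I] by blast
      then have "y : S" "y <= J" "f y = {x}" using v x by auto
      then show "y : vb I" using rk[of y] le[of y I] I x by (auto simp: verts_below_def Vert_def)
    qed
    show "vb I \<subseteq> v ` f I"
    proof
      fix y assume "y : vb I"
      then have y: "y : S" "rank S y = 1" "y <= I" by (auto simp: verts_below_def Vert_def)
      then have yJ: "y <= J" using I by (auto dest: order_trans)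
      then obtain x where x: "f y = {x}" using rk[of y] y card_1_singletonE by metis
      then have "x : f I" using le[of y I] y yJ I by auto
      moreover have "v x = y"
      proof -
        have "x : {1..rank S J}" using sub[OF I] \<open>x \<in> f I\<close> by blast
        then show ?thesis using v[of x] x y yJ inj by (auto dest: inj_onD)
      qed
      ultimately show "y : v ` f I" by blast
    qed
  qed
  have vinj: "inj_on v {1..rank S J}" using v by (intro inj_onI) (metis singleton_inject)
  let ?g = "%I. v ` f I"
  have gsub: "?g I \<subseteq> ?g I' \<longleftrightarrow> f I \<subseteq> f I'" if "I : S" "I <= J" "I' : S" "I' <= J" for I I'
    using image_subset_iff_of_inj_on[OF vinj sub sub] that by blast
  have ginj: "inj_on ?g {I : S. I <= J}"
  proof (rule inj_onI)
    fix I I' assume a: "I : {I : S. I <= J}" "I' : {I : S. I <= J}" "?g I = ?g I'"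
    then have "f I = f I'" using gsub[of I I'] gsub[of I' I] by auto
    then show "I = I'" using inj a by (auto dest: inj_onD)
  qed
  have gim: "?g ` {I : S. I <= J} = Pow (vb J)"
  proof -
    have "f J = {1..rank S J}"
    proof -
      obtain I where "I : S" "I <= J" "f I = {1..rank S J}" using ex by blast
      then show ?thesis using le[of I J] sub[of J] J by auto
    qed
    then have "vb J = v ` {1..rank S J}" using vbe[OF J] by simp
    moreover have "?g ` {I : S. I <= J} = ((`) v) ` Pow {1..rank S J}" using im by (metis image_image)
    ultimately show ?thesis by (simp add: image_Pow_surj)
  qed
  have "card (vb I) = rank S I" if "I : S" "I <= J" for I
    using vbe[OF that] rk[OF that] sub[OF that] vinj by (metis card_image inj_on_subset)
  then show ?thesis using ginj gim vbe gsub le by (intro exI[of _ ?g]) auto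
qed

text \<open>The common upper bound \<open>J\<close> is essential: in a simplicial poset distinct
  elements may have the same vertices, as two edges joining the same two points do.\<close>

lemma vb_le_iff:
  assumes "J : S" "I : S" "I' : S" "I <= J" "I' <= J"
  shows "I <= I' \<longleftrightarrow> vb I \<subseteq> vb I'"
proof -
  obtain f where f: "ALL I:S. I <= J --> f I = vb I & card (vb I) = rank S I"
    "ALL I:S. ALL I':S. I <= J & I' <= J --> (I <= I' \<longleftrightarrow> f I \<subseteq> f I')"
    using boolean_coords[OF assms(1)] by (elim exE conjE)
  show ?thesis using f(1)[rule_format, OF assms(2,4)] f(1)[rule_format, OF assms(3,5)] f(2) assms by auto
qed

lemma vb_eq_iff:
  "J : S ==> I : S ==> I' : S ==> I <= J ==> I' <= J ==> I = I' \<longleftrightarrow> vb I = vb I'"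
  using vb_le_iff by (metis order.antisym order_refl)

lemma vb_exists:
  assumes J: "J : S" "V \<subseteq> vb J"
  shows "EX I:S. I <= J & vb I = V"
proof -
  obtain f where f: "f ` {I : S. I <= J} = Pow (vb J)"
    "ALL I:S. I <= J --> f I = vb I & card (vb I) = rank S I" using boolean_coords[OF assms(1)] by (elim exE conjE)
  have "V : f ` {I : S. I <= J}" using f(1) J by blast
  then show ?thesis using f(2) by auto
qed

lemma card_vb: "I : S ==> card (vb I) = rank S I" using boolean_coords[of I] by blast

lemma finite_vb [simp]: "finite (vb I)" using finite_subset[of "vb I" S] by (auto simp: verts_below_def Vert_def)

lemma vb_mono: "I <= J ==> vb I \<subseteq> vb J" by (auto simp: verts_below_def)

lemma vbD: "v : vb I ==> v : S & v <= I & rank S v = 1" by (auto simp: verts_below_def Vert_def)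

lemma rank_mono: "I : S ==> J : S ==> I <= J ==> rank S I <= rank S J"
  using card_mono[OF finite_vb vb_mono] by (metis card_vb)

text \<open>One vertex set contains the other and both have the same finite size.\<close>

lemma eq_of_rank_eq:
  assumes "I : S" "J : S" "I <= J" "rank S I = rank S J" shows "I = J"
proof -
  have "vb I = vb J" using card_subset_eq[OF finite_vb vb_mono[OF assms(3)]] assms by (simp add: card_vb)
  then show ?thesis using vb_eq_iff[of J I J] assms by auto
qed

lemma rank_bot [simp]: "rank S (bot_of S) = 0"
proof -
  have "vb (bot_of S) = {}"
  proof (rule ccontr)
    assume "vb (bot_of S) ~= {}"
    then obtain v where v: "v : vb (bot_of S)" by blast
    then have "v = bot_of S" using bot_le vbD by (meson order.antisym)
    moreover obtain I where I: "I : S" "I <= v" "vb I = {}" using vb_exists[of v "{}"] vbD[OF v] by auto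
    ultimately show False using v bot_le[of I] by (metis emptyE order.antisym)
  qed
  then show ?thesis using card_vb[of "bot_of S"] by simp
qed

lemma rank_eq_0_iff: "I : S ==> rank S I = 0 \<longleftrightarrow> I = bot_of S"
  using eq_of_rank_eq[of "bot_of S" I] bot_le by auto

lemma vb_bot [simp]: "vb (bot_of S) = {}" using card_vb[of "bot_of S"] by simp

lemma vb_nonempty: "I : S ==> I ~= bot_of S ==> vb I ~= {}" using card_vb[of I] rank_eq_0_iff[of I] by auto

lemma le_bot: "I : S ==> I <= bot_of S ==> I = bot_of S" using bot_le by (simp add: order.antisym)

lemma covered_byD: "covered_by S I J ==> I : S & J : S & I <= J & I < J & I ~= J & rank S J = Suc (rank S I)"
  by (auto simp: covered_by_def)

lemma covered_by_iff:
  assumes "J : S" "I : S" "I' : S" "I <= J" "I' <= J"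
  shows "covered_by S I I' \<longleftrightarrow> (EX v. v ~: vb I & vb I' = insert v (vb I))"
proof
  assume c: "covered_by S I I'"
  then have sub: "vb I \<subseteq> vb I'" using covered_byD vb_mono by blast
  have "card (vb I' - vb I) = 1" using covered_byD[OF c] card_Diff_subset[OF _ sub] by (simp add: card_vb)
  then obtain v where "vb I' - vb I = {v}" using card_1_singletonE by blast
  then show "EX v. v ~: vb I & vb I' = insert v (vb I)" using sub by blast
next
  assume "EX v. v ~: vb I & vb I' = insert v (vb I)"
  then obtain v where v: "v ~: vb I" "vb I' = insert v (vb I)" by blast
  then have "I <= I'" using vb_le_iff[OF assms] by blast
  moreover have "rank S I' = Suc (rank S I)" using v card_vb[of I] card_vb[of I'] assms by simp
  ultimately show "covered_by S I I'" using assms by (auto simp: covered_by_def less_le)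
qed

text \<open>The face with given vertices is unique only relative to \<open>J\<close>, hence the
  first argument.\<close>

definition sub :: "'p => 'p set => 'p" where
  "sub J V = (THE I. I : S & I <= J & vb I = V)"

lemma sub:
  assumes "J : S" "V \<subseteq> vb J"
  shows "sub J V : S" "sub J V <= J" "vb (sub J V) = V"
proof -
  have "\<exists>!I. I : S & I <= J & vb I = V"
    using vb_exists[OF assms] vb_eq_iff[OF assms(1)] by (metis (no_types, lifting))
  then have "sub J V : S & sub J V <= J & vb (sub J V) = V" unfolding sub_def by (rule theI')
  then show "sub J V : S" "sub J V <= J" "vb (sub J V) = V" by auto
qed

lemma sub_eq: "J : S ==> I : S ==> I <= J ==> vb I = V ==> sub J V = I" using sub[of J V] vb_eq_iff[of J] vb_mono by metis

text \<open>Two vertices are added on the way from \<open>I\<close> to \<open>J\<close>; the two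
  middle elements correspond to which of them is added first.\<close>

lemma diamond:
  assumes K: "covered_by S I K" "covered_by S K J"
  shows "EX K'. K' ~= K & {L. covered_by S I L & covered_by S L J} = {K, K'}"
proof -
  have S: "I : S" "K : S" "J : S" "I <= J" "K <= J" "I <= K"
    using covered_byD[OF K(1)] covered_byD[OF K(2)] by (auto dest: order_trans)
  obtain v where v: "v ~: vb I" "vb K = insert v (vb I)" using covered_by_iff[of J I K] S K by auto
  obtain w where w: "w ~: vb K" "vb J = insert w (vb K)" using covered_by_iff[of J K J] S K by auto
  have A: "insert w (vb I) \<subseteq> vb J" using v w by auto
  let ?K' = "sub J (insert w (vb I))"
  note K' = sub[OF S(3) A]
  have "covered_by S I ?K'" using covered_by_iff[of J I ?K'] S K' v w by auto
  moreover have "covered_by S ?K' J" using covered_by_iff[of J ?K' J] S K' v w by auto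
  moreover have "?K' ~= K" using K' v w by auto
  moreover have "L = K \<or> L = ?K'" if L: "covered_by S I L" "covered_by S L J" for L
  proof -
    have SL: "L : S" "L <= J" using covered_byD[OF L(2)] by auto
    obtain x where x: "x ~: vb I" "vb L = insert x (vb I)" using covered_by_iff[of J I L] S SL L by auto
    have "x : vb J" using x vb_mono[OF SL(2)] by auto
    then have "x = v \<or> x = w" using v w x by auto
    then show ?thesis using x v K' vb_eq_iff[OF S(3) SL(1) _ SL(2)] S by metis
  qed
  ultimately show ?thesis using K by (intro exI[of _ ?K']) auto
qed

end

section \<open>Incidence complexes of boolean intervals and of flags, contracted as cones\<close>

section \<open>Incidence operators\<close>

text \<open>\<open>up\<close> lists the neighbours of a cell: those above it for boundaries, those
  below it for coboundaries, then with transposed signs. Chains are total functions here, so the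
  complex need not be cut into dimensions until an exactness statement asks for it.\<close>

definition inc :: "('k, 'a, 'm) module_scheme => ('c => 'c set) => ('c => 'c => 'k) => ('c => 'a) => 'c => 'a" where
  "inc M up e c K = (\<Oplus>\<^bsub>M\<^esub>I\<in>up K. e I K \<odot>\<^sub>M c I)"

context module
begin

lemma inc_closed:
  assumes "!!I. I : up K ==> e I K : carrier R" "!!I. I : up K ==> c I : carrier M"
  shows "inc M up e c K : carrier M" unfolding inc_def using assms by (intro M.finsum_closed) auto

lemma inc_cong:
  assumes "up K = up' K" "!!I. I : up' K ==> e I K = e' I K" "!!I. I : up' K ==> c I = c' I"
    "!!I. I : up' K ==> e' I K : carrier R" "!!I. I : up' K ==> c' I : carrier M"
  shows "inc M up e c K = inc M up' e' c' K" unfolding inc_def using assms by (intro M.finsum_cong') auto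

lemma inc_zero:
  assumes "!!I. I : up K ==> e I K : carrier R" "!!I. I : up K ==> c I = \<zero>\<^sub>M"
  shows "inc M up e c K = \<zero>\<^sub>M" unfolding inc_def using assms by (intro M.finsum_zeroI) simp

lemma inc_add:
  assumes "!!I. I : up K ==> e I K : carrier R" "!!I. I : up K ==> c I : carrier M"
    "!!I. I : up K ==> c' I : carrier M"
  shows "inc M up e (%I. c I \<oplus>\<^sub>M c' I) K = inc M up e c K \<oplus>\<^sub>M inc M up e c' K"
proof -
  have "inc M up e (%I. c I \<oplus>\<^sub>M c' I) K = (\<Oplus>\<^bsub>M\<^esub>I\<in>up K. e I K \<odot>\<^sub>M c I \<oplus>\<^sub>M e I K \<odot>\<^sub>M c' I)"
    unfolding inc_def using assms by (intro M.finsum_cong') (auto simp: smult_r_distr)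
  then show ?thesis unfolding inc_def using assms by (simp add: M.finsum_addf Pi_def)
qed

lemma inc_uminus:
  assumes "finite (up K)" "!!I. I : up K ==> e I K : carrier R" "!!I. I : up K ==> c I : carrier M"
  shows "inc M up e (%I. \<ominus>\<^sub>M c I) K = \<ominus>\<^sub>M inc M up e c K"
proof -
  have cl: "inc M up e c K : carrier M" using assms by (intro inc_closed)
  have "\<ominus>\<^sub>M inc M up e c K = (\<ominus> \<one>) \<odot>\<^sub>M inc M up e c K" using cl by (simp add: smult_l_minus)
  also have "\<dots> = (\<Oplus>\<^bsub>M\<^esub>I\<in>up K. (\<ominus> \<one>) \<odot>\<^sub>M (e I K \<odot>\<^sub>M c I))"
    unfolding inc_def using assms by (intro finsum_smult_ldistr) auto
  also have "\<dots> = inc M up e (%I. \<ominus>\<^sub>M c I) K"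
    unfolding inc_def using assms by (intro M.finsum_cong') (auto simp: smult_l_minus smult_r_minus)
  finally show ?thesis ..
qed

lemma inc_minus:
  assumes "finite (up K)" "!!I. I : up K ==> e I K : carrier R" "!!I. I : up K ==> c I : carrier M"
    "!!I. I : up K ==> c' I : carrier M"
  shows "inc M up e (%I. c I \<ominus>\<^sub>M c' I) K = inc M up e c K \<ominus>\<^sub>M inc M up e c' K"
  unfolding a_minus_def using assms inc_uminus[of up K e c'] inc_add[of up K e c "%I. \<ominus>\<^sub>M c' I"] by simp

text \<open>After the exchange of sums, each cell \<open>N\<close> two steps away from
  \<open>K\<close> is reached through exactly two intermediate cells, and hypothesis
  \<open>d\<close> makes their contributions cancel.\<close>

lemma inc_inc:
  assumes fin: "finite X" "up K \<subseteq> X" "!!I. I : up K ==> up I \<subseteq> X"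
    and e: "!!I. I : up K ==> e I K : carrier R" "!!I N. I : up K ==> N : up I ==> e N I : carrier R"
    and c: "!!I N. I : up K ==> N : up I ==> c N : carrier M"
    and d: "!!I N. I : up K ==> N : up I ==> EX I'. I' ~= I & {L : up K. N : up L} = {I, I'} &
      e N I \<otimes> e I K \<oplus> e N I' \<otimes> e I' K = \<zero>"
  shows "inc M up e (inc M up e c) K = \<zero>\<^sub>M"
proof -
  have "inc M up e (inc M up e c) K = (\<Oplus>\<^bsub>M\<^esub>I\<in>up K. \<Oplus>\<^bsub>M\<^esub>N\<in>up I. (e N I \<otimes> e I K) \<odot>\<^sub>M c N)"
    unfolding inc_def
  proof (rule M.finsum_cong'[OF refl])
    show "(%I. \<Oplus>\<^bsub>M\<^esub>N\<in>up I. (e N I \<otimes> e I K) \<odot>\<^sub>M c N) : up K \<rightarrow> carrier M"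
      using e c by (auto intro!: M.finsum_closed)
    fix I assume I: "I : up K"
    then have "finite (up I)" using fin finite_subset by blast
    then have "e I K \<odot>\<^sub>M (\<Oplus>\<^bsub>M\<^esub>N\<in>up I. e N I \<odot>\<^sub>M c N) = (\<Oplus>\<^bsub>M\<^esub>N\<in>up I. e I K \<odot>\<^sub>M (e N I \<odot>\<^sub>M c N))"
      using e c I by (intro finsum_smult_ldistr) auto
    also have "\<dots> = (\<Oplus>\<^bsub>M\<^esub>N\<in>up I. (e N I \<otimes> e I K) \<odot>\<^sub>M c N)"
      using e c I by (intro M.finsum_cong') (auto simp: smult_assoc1[symmetric] R.m_comm)
    finally show "e I K \<odot>\<^sub>M (\<Oplus>\<^bsub>M\<^esub>N\<in>up I. e N I \<odot>\<^sub>M c N) = (\<Oplus>\<^bsub>M\<^esub>N\<in>up I. (e N I \<otimes> e I K) \<odot>\<^sub>M c N)" .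
  qed
  also have "\<dots> = (\<Oplus>\<^bsub>M\<^esub>N\<in>X. \<Oplus>\<^bsub>M\<^esub>I\<in>{I : up K. N : up I}. (e N I \<otimes> e I K) \<odot>\<^sub>M c N)"
    using fin e c finite_subset[of "up K" X] by (intro M.finsum_swap_dep) auto
  also have "\<dots> = \<zero>\<^sub>M"
  proof (rule M.finsum_zeroI)
    fix N assume "N : X"
    show "(\<Oplus>\<^bsub>M\<^esub>I\<in>{I : up K. N : up I}. (e N I \<otimes> e I K) \<odot>\<^sub>M c N) = \<zero>\<^sub>M"
    proof (cases "{I : up K. N : up I} = {}")
      case True
      then show ?thesis by (simp only: M.finsum_empty)
    next
      case False
      then obtain I where I: "I : up K" "N : up I" by blast
      obtain I' where I': "I' ~= I" "{L : up K. N : up L} = {I, I'}" "e N I \<otimes> e I K \<oplus> e N I' \<otimes> e I' K = \<zero>"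
        using d[OF I] by blast
      have "I' : up K" "N : up I'" using I'(2) by auto
      then show ?thesis unfolding I'(2)
        using I I' e c by (subst M.finsum_two[of _ I I']) (auto simp: smult_l_distr[symmetric])
    qed
  qed
  finally show ?thesis .
qed

text \<open>A complex on \<open>X0 \<union> ap ` X0\<close> in which \<open>ap\<close> joins an apex to a cell is a cone, hence contractible.\<close>

lemma cone_exact:
  assumes N: "!!K. K : X0 ==> finite (N K)" "!!K. K : X0 ==> N K \<subseteq> X0"
    and ap: "inj_on ap X0" "X0 \<inter> ap ` X0 = {}"
    and up: "!!K. K : X0 ==> up K = insert (ap K) (N K)" "!!K. K : X0 ==> up (ap K) = ap ` N K"
    and e: "!!K. K : X0 ==> e (ap K) K : carrier R" "!!K. K : X0 ==> e (ap K) K \<otimes> e (ap K) K = \<one>"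
      "!!K L. K : X0 ==> L : N K ==> e L K : carrier R"
      "!!K L. K : X0 ==> L : N K ==> e (ap L) (ap K) : carrier R"
      "!!K L. K : X0 ==> L : N K ==> e (ap L) (ap K) \<otimes> e (ap K) K \<oplus> e (ap L) L \<otimes> e L K = \<zero>"
    and c: "!!K. K : X0 \<union> ap ` X0 ==> c K : carrier M"
      "!!K. K : X0 ==> inc M up e c K = \<zero>\<^sub>M"
  shows "EX h. (ALL K:X0. h K = \<zero>\<^sub>M & h (ap K) = e (ap K) K \<odot>\<^sub>M c K) &
    (ALL K:X0 \<union> ap ` X0. inc M up e h K = c K)"
proof -
  \<comment> \<open>The value at a base cell is moved to its cone, and \<open>h\<close> vanishes on
    the base. At base cells the boundary of \<open>h\<close> is \<open>c\<close> by construction; at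
    the cells \<open>ap K\<close> closedness of \<open>c\<close> has to be used.\<close>
  define h where "h I = (if I : X0 then \<zero>\<^sub>M else let K = inv_into X0 ap I in e (ap K) K \<odot>\<^sub>M c K)" for I
  have h0: "h K = \<zero>\<^sub>M" and h1: "h (ap K) = e (ap K) K \<odot>\<^sub>M c K" if "K : X0" for K
  proof -
    have "ap K ~: X0" using ap(2) that by blast
    then show "h K = \<zero>\<^sub>M" "h (ap K) = e (ap K) K \<odot>\<^sub>M c K"
      using that ap(1) by (simp_all add: h_def inv_into_f_f)
  qed
  have cc: "c K : carrier M" "c (ap K) : carrier M" if "K : X0" for K using c(1) that by auto
  have d0: "inc M up e h K = c K" if K: "K : X0" for K
  proof -
    have "inc M up e h K = e (ap K) K \<odot>\<^sub>M h (ap K)" unfolding inc_def up(1)[OF K]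
      using h0 h1 K N(1)[OF K] N(2)[OF K] e cc by (intro M.finsum_single) auto
    then show ?thesis using h1[OF K] e K cc by (simp add: smult_assoc1[symmetric])
  qed
  have d1: "inc M up e h (ap K) = c (ap K)" if K: "K : X0" for K
  proof -
    have NK: "L : X0" if "L : N K" for L using N(2)[OF K] that by blast
    have apN: "ap K ~: N K" using NK ap(2) K by blast
    \<comment> \<open>The anticommuting square is solved for the product of the two signs at
      \<open>ap L\<close>, using that the signs between a base cell and its cone square to
      one.\<close>
    have sgn: "e (ap L) (ap K) \<otimes> e (ap L) L = \<ominus> e (ap K) K \<otimes> e L K" if L: "L : N K" for L
    proof -
      define a b c' d where "a = e (ap L) (ap K)" and "b = e (ap K) K" and "c' = e (ap L) L" and "d = e L K"
      have cl: "a : carrier R" "b : carrier R" "c' : carrier R" "d : carrier R"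
        using e(1,3,4) K L NK[OF L] by (auto simp: a_def b_def c'_def d_def)
      have abcd: "a \<otimes> b \<oplus> c' \<otimes> d = \<zero>" "b \<otimes> b = \<one>" "c' \<otimes> c' = \<one>"
        using e(2)[OF K] e(2)[OF NK[OF L]] e(5)[OF K L] by (auto simp: a_def b_def c'_def d_def)
      have "a \<otimes> c' = (a \<otimes> b) \<otimes> (b \<otimes> c')"
        using cl abcd(2) by (metis R.m_assoc R.m_closed R.r_one)
      also have "a \<otimes> b = \<ominus> (c' \<otimes> d)" using abcd(1) cl by (simp add: R.sum_zero_eq_neg)
      also have "\<ominus> (c' \<otimes> d) \<otimes> (b \<otimes> c') = \<ominus> ((c' \<otimes> c') \<otimes> (b \<otimes> d))"
        using cl by algebra
      also have "\<dots> = \<ominus> b \<otimes> d" using abcd(3) cl by (simp add: R.l_minus)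
      finally show ?thesis by (simp add: a_def b_def c'_def d_def)
    qed
    have S: "(\<Oplus>\<^bsub>M\<^esub>L\<in>N K. e L K \<odot>\<^sub>M c L) : carrier M"
      using e(3)[OF K] NK cc by (intro M.finsum_closed) auto
    have "inc M up e h (ap K) = (\<Oplus>\<^bsub>M\<^esub>L\<in>N K. e (ap L) (ap K) \<odot>\<^sub>M h (ap L))"
      unfolding inc_def up(2)[OF K] using NK e h1 cc K ap(1) by (intro M.finsum_reindex) (auto intro: inj_on_subset)
    also have "\<dots> = (\<Oplus>\<^bsub>M\<^esub>L\<in>N K. (\<ominus> e (ap K) K) \<odot>\<^sub>M (e L K \<odot>\<^sub>M c L))"
    proof (rule M.finsum_cong'[OF refl])
      show "(%L. (\<ominus> e (ap K) K) \<odot>\<^sub>M (e L K \<odot>\<^sub>M c L)) : N K \<rightarrow> carrier M"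
        using e(1,3) K NK cc by auto
      fix L assume L: "L : N K"
      have "e (ap L) (ap K) \<odot>\<^sub>M h (ap L) = (e (ap L) (ap K) \<otimes> e (ap L) L) \<odot>\<^sub>M c L"
        using h1[OF NK[OF L]] e(1)[OF NK[OF L]] e(4)[OF K L] cc[OF NK[OF L]] by (simp add: smult_assoc1)
      then show "e (ap L) (ap K) \<odot>\<^sub>M h (ap L) = (\<ominus> e (ap K) K) \<odot>\<^sub>M (e L K \<odot>\<^sub>M c L)"
        unfolding sgn[OF L] using e(1)[OF K] e(3)[OF K L] cc[OF NK[OF L]] by (simp add: smult_assoc1)
    qed
    also have "\<dots> = (\<ominus> e (ap K) K) \<odot>\<^sub>M (\<Oplus>\<^bsub>M\<^esub>L\<in>N K. e L K \<odot>\<^sub>M c L)"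
      using N(1)[OF K] e(1,3) K NK cc by (intro finsum_smult_ldistr[symmetric]) auto
    \<comment> \<open>Closedness at the base cell \<open>K\<close> expresses the sum over its base
      neighbours by the value at \<open>ap K\<close>.\<close>
    also have "(\<Oplus>\<^bsub>M\<^esub>L\<in>N K. e L K \<odot>\<^sub>M c L) = \<ominus>\<^sub>M (e (ap K) K \<odot>\<^sub>M c (ap K))"
    proof -
      have "inc M up e c K = e (ap K) K \<odot>\<^sub>M c (ap K) \<oplus>\<^sub>M (\<Oplus>\<^bsub>M\<^esub>L\<in>N K. e L K \<odot>\<^sub>M c L)"
        unfolding inc_def up(1)[OF K] using N(1)[OF K] apN e(1,3) K NK cc by (intro M.finsum_insert) auto
      then show ?thesis using c(2)[OF K] S e(1)[OF K] cc[OF K]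
        by (intro M.minus_equality[symmetric]) (simp_all add: M.a_comm)
    qed
    also have "(\<ominus> e (ap K) K) \<odot>\<^sub>M (\<ominus>\<^sub>M (e (ap K) K \<odot>\<^sub>M c (ap K))) = e (ap K) K \<odot>\<^sub>M (e (ap K) K \<odot>\<^sub>M c (ap K))"
      using e(1)[OF K] cc[OF K] by (simp add: smult_l_minus smult_r_minus)
    also have "\<dots> = (e (ap K) K \<otimes> e (ap K) K) \<odot>\<^sub>M c (ap K)"
      using e(1)[OF K] cc[OF K] by (simp add: smult_assoc1)
    also have "\<dots> = c (ap K)" using e(2)[OF K] cc[OF K] by simp
    finally show ?thesis .
  qed
  show ?thesis using h0 h1 d0 d1 by (intro exI[of _ h]) auto
qed

end

section \<open>Signs and boolean intervals\<close>

locale signed_poset = simplicial S + cring R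
  for S :: "'p::order set" and R :: "'k ring" (structure) +
  fixes eps :: "'p => 'p => int"
  assumes eps: "sign_convention S eps"
begin

definition e :: "'p => 'p => 'k" where
  "e J I = rint R (eps J I)"

lemma e_closed [simp, intro]: "e J I : carrier R" by (simp add: e_def)

lemma eps_pm: "covered_by S I J ==> eps J I : {1, -1}" using eps by (simp add: sign_convention_def)

lemma e_sq: "covered_by S I J ==> e J I \<otimes> e J I = \<one>"
  using eps_pm[of I J] by (auto simp: e_def rint_mult[symmetric] rint_one)

lemma eps_smult: "module R M ==> x : carrier M ==> covered_by S I J ==> [eps J I] \<cdot>\<^bsub>M\<^esub> x = e J I \<odot>\<^sub>M x"
  using module.add_pow_eq_rint[of R M x "eps J I"] eps_pm[of I J] by (simp add: e_def)

lemma e_diamond: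
  assumes "covered_by S I K" "covered_by S K J" "covered_by S I K'" "covered_by S K' J" "K ~= K'"
  shows "e J K \<otimes> e K I \<oplus> e J K' \<otimes> e K' I = \<zero>"
proof -
  have "eps J K * eps K I + eps J K' * eps K' I = 0"
  proof -
    have "I : S" "J : S" "K : S" "K' : S" "I < J & rank S J = rank S I + 2"
      using covered_byD[OF assms(1)] covered_byD[OF assms(2)] covered_byD[OF assms(3)] by auto
    moreover have "I < K & K < J & I < K' & K' < J & K ~= K'" using assms covered_byD by blast
    ultimately show ?thesis using eps unfolding sign_convention_def by blast
  qed
  then show ?thesis by (simp add: e_def rint_mult[symmetric] rint_add[symmetric] rint_zero)
qed

lemma diamond_sign:
  assumes "covered_by S I K" "covered_by S K J"
  shows "EX K'. K' ~= K & {L. covered_by S I L & covered_by S L J} = {K, K'} &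
    e J K \<otimes> e K I \<oplus> e J K' \<otimes> e K' I = \<zero>"
proof -
  obtain K' where K': "K' ~= K" "{L. covered_by S I L & covered_by S L J} = {K, K'}" using diamond[OF assms] by blast
  then have "covered_by S I K'" "covered_by S K' J" by auto
  then show ?thesis using K' e_diamond[OF assms] by (intro exI[of _ K']) auto
qed

text \<open>A vertex \<open>v\<close> of \<open>J\<close> outside \<open>L\<close> splits the
  interval into the cells without \<open>v\<close> and their joins with \<open>v\<close>, which is a
  cone. The shape of \<open>h\<close> is recorded in the conclusion because later the value at
  \<open>K\<close> has to be located in the ideal belonging to \<open>K\<close>: it is either zero
  or comes from the cell obtained by deleting \<open>v\<close>.\<close>

lemma interval_exact:
  assumes M: "module R M" and JL: "L : S" "J : S" "L <= J" and v: "v : vb J - vb L"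
    and c: "!!K. K : S ==> L <= K ==> K <= J ==> c K : carrier M"
      "!!K. K : S ==> L <= K ==> K <= J ==> inc M (%K. {I. covered_by S K I & I <= J}) e c K = \<zero>\<^sub>M"
  shows "EX h. (ALL K:S. L <= K & K <= J --> h K = \<zero>\<^sub>M \<or>
      (EX K':S. L <= K' & K' <= J & covered_by S K' K & vb K = insert v (vb K') & h K = e K K' \<odot>\<^sub>M c K')) &
    (ALL K:S. L <= K & K <= J --> inc M (%K. {I. covered_by S K I & I <= J}) e h K = c K)"
proof -
  interpret M: module R M by fact
  let ?up = "%K. {I. covered_by S K I & I <= J}"
  define X0 where "X0 = {K : S. L <= K & K <= J & v ~: vb K}"
  define ap where "ap K = sub J (insert v (vb K))" for K
  define N where "N K = {I. covered_by S K I & I <= J & v ~: vb I}" for K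
  have X0: "K : S" "L <= K" "K <= J" "v ~: vb K" "insert v (vb K) \<subseteq> vb J" if "K : X0" for K
    using that v vb_mono[of K J] by (auto simp: X0_def)
  have ap: "ap K : S" "ap K <= J" "vb (ap K) = insert v (vb K)" "K <= ap K" "L <= ap K" "covered_by S K (ap K)"
    if K: "K : X0" for K
  proof -
    note s = sub[OF JL(2) X0(5)[OF K], folded ap_def]
    show "ap K : S" "ap K <= J" "vb (ap K) = insert v (vb K)" using s by auto
    show le: "K <= ap K" using vb_le_iff[of J K "ap K"] s X0[OF K] JL by auto
    show "L <= ap K" using order_trans[OF X0(2)[OF K] le] .
    show "covered_by S K (ap K)" using covered_by_iff[of J K "ap K"] s X0[OF K] JL by auto
  qed
  have apI: "ap K = I" if "K : X0" "I : S" "I <= J" "vb I = insert v (vb K)" for K I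
    unfolding ap_def using that JL by (intro sub_eq)
  \<comment> \<open>The inverse of \<open>ap\<close> deletes \<open>v\<close>; the result stays
    above \<open>L\<close> because \<open>v\<close> is not a vertex of \<open>L\<close>.\<close>
  have ap_surj: "EX K:X0. ap K = I & vb K = vb I - {v}" if I: "I : S" "L <= I" "I <= J" "v : vb I" for I
  proof -
    have A: "vb I - {v} \<subseteq> vb J" using vb_mono[OF I(3)] by blast
    note s = sub[OF JL(2) A]
    have "vb L \<subseteq> vb I - {v}" using vb_mono[OF I(2)] v by blast
    then have "sub J (vb I - {v}) : X0" using s vb_le_iff[of J L "sub J (vb I - {v})"] JL by (auto simp: X0_def)
    moreover have "ap (sub J (vb I - {v})) = I" using apI[OF calculation I(1,3)] s I(4) by auto
    ultimately show ?thesis using s by blast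
  qed
  have NX: "I : X0" if "K : X0" "I : N K" for K I
    using that X0[OF that(1)] covered_byD by (fastforce simp: N_def X0_def dest: order_trans)
  have up0: "?up K = insert (ap K) (N K)" if K: "K : X0" for K
  proof
    show "insert (ap K) (N K) \<subseteq> ?up K" using ap[OF K] by (auto simp: N_def)
    show "?up K \<subseteq> insert (ap K) (N K)"
    proof
      fix I assume I: "I : ?up K"
      show "I : insert (ap K) (N K)"
      proof (cases "v : vb I")
        case True
        obtain w where "w ~: vb K" "vb I = insert w (vb K)"
          using covered_by_iff[of J K I] I X0[OF K] JL covered_byD[of K I] by auto
        then have "vb I = insert v (vb K)" using True X0(4)[OF K] by auto
        then show ?thesis using apI[OF K, of I] I covered_byD[of K I] by auto
      qed (use I in \<open>auto simp: N_def\<close>)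
    qed
  qed
  have covap: "covered_by S (ap K) (ap I)" if K: "K : X0" and I: "I : N K" for K I
  proof -
    have I0: "I : X0" using NX[OF K I] .
    obtain w where w: "w ~: vb K" "vb I = insert w (vb K)"
      using covered_by_iff[of J K I] I X0[OF K] X0[OF I0] JL by (auto simp: N_def)
    then show ?thesis using covered_by_iff[of J "ap K" "ap I"] ap[OF K] ap[OF I0] JL X0[OF I0] by auto
  qed
  have up1: "?up (ap K) = ap ` N K" if K: "K : X0" for K
  proof
    show "ap ` N K \<subseteq> ?up (ap K)" using covap[OF K] ap(2) NX[OF K] by blast
    show "?up (ap K) \<subseteq> ap ` N K"
    proof
      fix I assume "I : ?up (ap K)"
      then have I: "covered_by S (ap K) I" "I <= J" by auto
      then have IS: "I : S" "ap K <= I" using covered_byD by auto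
      obtain w where w: "w ~: vb (ap K)" "vb I = insert w (vb (ap K))"
        using covered_by_iff[of J "ap K" I] I IS ap[OF K] JL by blast
      obtain K' where K': "K' : X0" "ap K' = I" "vb K' = vb I - {v}"
        using ap_surj[of I] IS I ap[OF K] w by (auto dest: order_trans)
      have "vb K' = insert w (vb K)" using K' w ap(3)[OF K] X0(4)[OF K] by auto
      then have "covered_by S K K'" using covered_by_iff[of J K K'] X0[OF K] X0[OF K'(1)] JL w ap(3)[OF K] by auto
      then have "K' : N K" using X0[OF K'(1)] by (auto simp: N_def)
      then show "I : ap ` N K" using K' by blast
    qed
  qed
  have UX: "X0 \<union> ap ` X0 = {K : S. L <= K & K <= J}"
  proof (intro equalityI subsetI)
    fix K assume "K : X0 \<union> ap ` X0"
    then show "K : {K : S. L <= K & K <= J}" using ap(1,2,5) X0(1-3) by auto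
  next
    fix K assume K: "K : {K : S. L <= K & K <= J}"
    show "K : X0 \<union> ap ` X0"
    proof (cases "v : vb K")
      case True
      then show ?thesis using ap_surj[of K] K by auto
    qed (use K in \<open>auto simp: X0_def\<close>)
  qed
  have "EX h. (ALL K:X0. h K = \<zero>\<^sub>M & h (ap K) = e (ap K) K \<odot>\<^sub>M c K) &
    (ALL K:X0 \<union> ap ` X0. inc M ?up e h K = c K)"
  proof (rule M.cone_exact[where N = N])
    show "finite (N K)" for K using finite_subset[of "N K" S] covered_byD by (auto simp: N_def)
    show "N K \<subseteq> X0" if "K : X0" for K using NX[OF that] by blast
    show "inj_on ap X0"
    proof (rule inj_onI)
      fix K K' assume a: "K : X0" "K' : X0" "ap K = ap K'"
      then have "insert v (vb K) = insert v (vb K')" using ap(3)[of K] ap(3)[of K'] by simp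
      then have "vb K = vb K'" using X0(4)[OF a(1)] X0(4)[OF a(2)] by auto
      then show "K = K'" using vb_eq_iff[of J K K'] X0[OF a(1)] X0[OF a(2)] JL by simp
    qed
    have "ap K ~: X0" if "K : X0" for K using ap(3)[OF that] X0(4)[of "ap K"] by auto
    then show "X0 \<inter> ap ` X0 = {}" by auto
    show "e (ap K) K \<otimes> e (ap K) K = \<one>" if "K : X0" for K using e_sq ap(6)[OF that] .
    show "e (ap I) (ap K) \<otimes> e (ap K) K \<oplus> e (ap I) I \<otimes> e I K = \<zero>" if K: "K : X0" and I: "I : N K" for K I
    proof (rule e_diamond[OF ap(6)[OF K] covap[OF K I] _ ap(6)[OF NX[OF K I]]])
      show "covered_by S K I" using I by (auto simp: N_def)
      show "ap K ~= I" using I ap(3)[OF K] by (auto simp: N_def)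
    qed
    show "c K : carrier M" if "K : X0 \<union> ap ` X0" for K using c(1) that UX by auto
    show "inc M ?up e c K = \<zero>\<^sub>M" if "K : X0" for K using c(2)[of K] X0[OF that] by simp
  qed (use up0 up1 in auto)
  then obtain h where h: "!!K. K : X0 ==> h K = \<zero>\<^sub>M & h (ap K) = e (ap K) K \<odot>\<^sub>M c K"
    "!!K. K : X0 \<union> ap ` X0 ==> inc M ?up e h K = c K" by blast
  have "h K = \<zero>\<^sub>M \<or>
      (EX K':S. L <= K' & K' <= J & covered_by S K' K & vb K = insert v (vb K') & h K = e K K' \<odot>\<^sub>M c K')"
    if K: "K : S" "L <= K" "K <= J" for K
  proof -
    have "K : X0 \<union> ap ` X0" using K UX by blast
    then consider "K : X0" | K' where "K' : X0" "K = ap K'" by blast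
    then show ?thesis
    proof cases
      case 2
      then show ?thesis using h(1)[OF 2(1)] X0[OF 2(1)] ap[OF 2(1)] by blast
    qed (use h(1) in blast)
  qed
  then show ?thesis using h(2) unfolding UX by (intro exI[of _ h]) simp
qed

end

section \<open>Flags\<close>

definition flags :: "'p::order set => 'p set set" where
  "flags U = {F. F \<subseteq> U & Complete_Partial_Order.chain (<=) F}"

definition flag_up :: "'p::order set => 'p set => 'p set set" where
  "flag_up U G = {F : flags U. EX x. x ~: G & F = insert x G}"

text \<open>The usual sign of a facet of an ordered simplex: the parity of the position of the added
  element.\<close>

definition flag_sign :: "'p::order set => 'p set => int" where
  "flag_sign F G = (-1) ^ card {y : G. y < the_elem (F - G)}"

lemma flagsD: "F : flags U ==> x : F ==> x : U"
  and flags_comparable: "F : flags U ==> x : F ==> y : F ==> x <= y \<or> y <= x" by (auto simp: flags_def chain_def)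

lemma flags_subset: "F : flags U ==> G \<subseteq> F ==> G : flags U" by (auto simp: flags_def chain_def)

lemma flags_finite: "finite U ==> F : flags U ==> finite F" by (auto simp: flags_def intro: finite_subset)

lemma finite_flags: "finite U ==> finite (flags U)" by (rule finite_subset[of _ "Pow U"]) (auto simp: flags_def)

lemma empty_flag [simp]: "{} : flags U" by (auto simp: flags_def chain_def)

lemma flag_sign_insert: "x ~: G ==> flag_sign (insert x G) G = (-1) ^ card {y : G. y < x}"
proof -
  assume "x ~: G"
  then have "insert x G - G = {x}" by auto
  then show ?thesis by (simp add: flag_sign_def)
qed

lemma flag_sign_pm: "flag_sign F G : {1, -1}"
proof -
  have "(-1::int) ^ k : {1, -1}" for k by (induct k) auto
  then show ?thesis unfolding flag_sign_def by blast
qed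

text \<open>Inserting the smaller \<open>x\<close> raises the position of \<open>y\<close> by one,
  while inserting \<open>y\<close> leaves the position of \<open>x\<close> alone; so the two orders
  of insertion differ by a sign.\<close>

lemma flag_sign_anti:
  assumes "finite G" "x ~: G" "y ~: G" "x < y"
  shows "flag_sign (insert y (insert x G)) (insert x G) * flag_sign (insert x G) G +
    flag_sign (insert y (insert x G)) (insert y G) * flag_sign (insert y G) G = 0"
proof -
  have ne: "x ~= y" "\<not> y < x" using assms(4) by auto
  have 1: "{z : insert x G. z < y} = insert x {z : G. z < y}" using assms by auto
  have 2: "{z : insert y G. z < x} = {z : G. z < x}" using ne by auto
  have 3: "insert y (insert x G) = insert x (insert y G)" by auto
  have "card {z : insert x G. z < y} = Suc (card {z : G. z < y})" unfolding 1 using assms by simp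
  then have a: "flag_sign (insert y (insert x G)) (insert x G) = - ((-1) ^ card {z : G. z < y})"
    using flag_sign_insert[of y "insert x G"] assms ne by simp
  have b: "flag_sign (insert y (insert x G)) (insert y G) = (-1) ^ card {z : G. z < x}"
    using flag_sign_insert[of x "insert y G"] assms ne unfolding 3 2 by simp
  show ?thesis unfolding a b flag_sign_insert[OF assms(2)] flag_sign_insert[OF assms(3)] by simp
qed

lemma flag_diamond:
  assumes U: "finite U" and G: "G : flags U" and F: "F : flag_up U G" and N: "N : flag_up U F"
  shows "EX F'. F' ~= F & {L : flag_up U G. N : flag_up U L} = {F, F'} &
    flag_sign N F * flag_sign F G + flag_sign N F' * flag_sign F' G = 0"
proof -
  obtain x where x: "x ~: G" "F = insert x G" using F by (auto simp: flag_up_def)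
  obtain y where y: "y ~: F" "N = insert y F" using N by (auto simp: flag_up_def)
  have NU: "N : flags U" using N by (auto simp: flag_up_def)
  have fin: "finite G" using flags_finite[OF U G] .
  let ?F' = "insert y G"
  have ne: "x ~= y" "y ~: G" using x y by auto
  have F': "?F' : flags U" using flags_subset[OF NU] x y by auto
  have eq: "{L : flag_up U G. N : flag_up U L} = {F, ?F'}"
  proof
    show "{L : flag_up U G. N : flag_up U L} \<subseteq> {F, ?F'}"
    proof
      fix L assume "L : {L : flag_up U G. N : flag_up U L}"
      then obtain z where z: "z ~: G" "L = insert z G" "L \<subseteq> N" by (auto simp: flag_up_def)
      then show "L : {F, ?F'}" using x y by auto
    qed
    have "?F' : flag_up U G" using F' ne by (auto simp: flag_up_def)
    moreover have "N : flag_up U ?F'" using NU x y ne unfolding flag_up_def by (auto intro!: exI[of _ x])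
    ultimately show "{F, ?F'} \<subseteq> {L : flag_up U G. N : flag_up U L}" using F N by auto
  qed
  have "x < y \<or> y < x" using flags_comparable[OF NU, of x y] x y ne by (auto simp: less_le)
  then have "flag_sign N F * flag_sign F G + flag_sign N ?F' * flag_sign ?F' G = 0"
  proof
    assume "x < y"
    then show ?thesis using flag_sign_anti[OF fin x(1) ne(2)] x y by simp
  next
    assume "y < x"
    moreover have "N = insert x (insert y G)" using x y by auto
    ultimately show ?thesis using flag_sign_anti[OF fin ne(2) x(1)] x y by (simp add: insert_commute)
  qed
  then show ?thesis using eq ne x y by (intro exI[of _ ?F']) auto
qed

context signed_poset
begin

definition fs :: "'p set => 'p set => 'k" where
  "fs F G = rint R (flag_sign F G)"

lemma fs_closed [simp, intro]: "fs F G : carrier R" by (simp add: fs_def)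

lemma flag_inc_inc:
  assumes M: "module R M" and U: "U \<subseteq> S" and G: "G : flags U" and c: "!!F. F : flags U ==> card F = Suc (Suc (card G)) ==> c F : carrier M"
  shows "inc M (flag_up U) fs (inc M (flag_up U) fs c) G = \<zero>\<^sub>M"
proof -
  interpret M: module R M by fact
  have fU: "finite U" using finite_subset[OF U] by simp
  have fl: "F : flags U" if "F : flag_up U G" for F G using that by (auto simp: flag_up_def)
  have cd: "card F = Suc (card G)" if "F : flag_up U G" for F G
    using that flags_finite[OF fU, of F] by (auto simp: flag_up_def)
  show ?thesis
  proof (rule M.inc_inc[OF finite_flags[OF fU]])
    show "EX F'. F' ~= F & {L : flag_up U G. N : flag_up U L} = {F, F'} &
      fs N F \<otimes> fs F G \<oplus> fs N F' \<otimes> fs F' G = \<zero>" if "F : flag_up U G" "N : flag_up U F" for F N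
      using flag_diamond[OF fU G that] by (auto simp: fs_def rint_mult[symmetric] rint_add[symmetric] rint_zero)
    show "c N : carrier M" if "F : flag_up U G" "N : flag_up U F" for F N
      using c[OF fl[OF that(2)]] cd[OF that(1)] cd[OF that(2)] by simp
  qed (auto simp: fl)
qed

text \<open>The two inequalities behave differently. For \<open>J < I\<close> the set contains
  \<open>I\<close> as least element, so that its flags form a cone. For \<open>I = J\<close> the
  strict inequality removes \<open>J\<close>, and the flags form the order complex on which the
  Buchsbaum condition bears.\<close>

definition above :: "'p => 'p => 'p set" where
  "above J I = {x : S. J < x & I <= x}"

abbreviation "flg J I \<equiv> flags (above J I)"
abbreviation "fup J I \<equiv> flag_up (above J I)"
abbreviation "fd M J I \<equiv> inc M (fup J I) fs"
abbreviation "cell_at J r t I F \<equiv> I : S & J <= I & rank S I = rank S J + r & F : flg J I & card F = t"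

lemma above_sub: "above J I \<subseteq> S" by (auto simp: above_def)

lemma finite_above [simp]: "finite (above J I)" using finite_subset[OF above_sub] by simp

text \<open>The least element \<open>I\<close> of \<open>above J I\<close> is the apex of a cone of
  flags. Its position sign is 1, as nothing lies below it.\<close>

lemma flag_row_exact:
  assumes M: "module R M" and I: "I : S" "J < I"
    and c: "!!F. F : flg J I ==> c F : carrier M"
      "!!G. G : flg J I ==> fd M J I c G = \<zero>\<^sub>M"
  shows "EX h. (ALL F:flg J I. h F : carrier M) &
    (ALL F:flg J I. fd M J I h F = c F)"
proof -
  interpret M: module R M by fact
  let ?U = "above J I"
  define X0 where "X0 = {F : flags ?U. I ~: F}"
  define N where "N F = {F' : flag_up ?U F. I ~: F'}" for F
  have fin: "finite F" if "F : flags ?U" for F using flags_finite[OF finite_above that] .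
  have IU: "I : ?U" using I by (auto simp: above_def)
  have ge: "I <= x" if "x : ?U" for x using that by (auto simp: above_def)
  have ins: "insert I F : flags ?U" if "F : flags ?U" for F using that IU ge by (auto simp: flags_def chain_def)
  have X0: "F : flags ?U" "I ~: F" "insert I F : flags ?U" if "F : X0" for F using that ins by (auto simp: X0_def)
  have NF: "F' : X0 & (EX x. x ~: F & x ~= I & I < x & F' = insert x F)" if F: "F : X0" and F': "F' : N F" for F F'
  proof -
    obtain x where x: "x ~: F" "F' = insert x F" "F' : flags ?U" "I ~: F'" using F' by (auto simp: N_def flag_up_def)
    then have "I <= x" "x ~= I" using flagsD[OF x(3)] ge by auto
    then show ?thesis using x by (auto simp: X0_def less_le)
  qed
  have up0: "flag_up ?U F = insert (insert I F) (N F)" if F: "F : X0" for F using X0[OF F] by (auto simp: N_def flag_up_def)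
  have up1: "flag_up ?U (insert I F) = insert I ` N F" if F: "F : X0" for F
  proof
    show "insert I ` N F \<subseteq> flag_up ?U (insert I F)"
    proof
      fix G assume "G : insert I ` N F"
      then obtain F' where F': "F' : N F" "G = insert I F'" by blast
      obtain x where x: "x ~: F" "x ~= I" "F' = insert x F" "F' : X0" using NF[OF F F'(1)] by blast
      have "G = insert x (insert I F)" using x F' by auto
      then show "G : flag_up ?U (insert I F)" using X0(3)[OF x(4)] F' x by (auto simp: flag_up_def)
    qed
    show "flag_up ?U (insert I F) \<subseteq> insert I ` N F"
    proof
      fix G assume "G : flag_up ?U (insert I F)"
      then obtain x where x: "x ~: insert I F" "G = insert x (insert I F)" "G : flags ?U" by (auto simp: flag_up_def)
      have "insert x F : flags ?U" using flags_subset[OF x(3)] x by auto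
      then have "insert x F : N F" using x X0[OF F] by (auto simp: N_def flag_up_def)
      moreover have "G = insert I (insert x F)" using x by auto
      ultimately show "G : insert I ` N F" by blast
    qed
  qed
  have sg1: "flag_sign (insert I F) F = 1" if F: "F : X0" for F
  proof -
    have "{y : F. y < I} = {}" using X0[OF F] ge flagsD by (metis (no_types, lifting) Collect_empty_eq leD)
    then show ?thesis using flag_sign_insert[OF X0(2)[OF F]] by (simp only: card.empty power_0)
  qed
  have "EX h. (ALL F:X0. h F = \<zero>\<^sub>M & h (insert I F) = fs (insert I F) F \<odot>\<^sub>M c F) &
    (ALL F:X0 \<union> insert I ` X0. inc M (flag_up ?U) fs h F = c F)"
  proof (rule M.cone_exact[where N = N])
    show "finite (N F)" for F
      using finite_subset[OF _ finite_flags[OF finite_above], of "N F" J I] by (auto simp: N_def flag_up_def)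
    show "N F \<subseteq> X0" if "F : X0" for F using NF[OF that] by blast
    show "inj_on (insert I) X0" by (intro inj_onI) (auto simp: X0_def)
    show "X0 \<inter> insert I ` X0 = {}" by (auto simp: X0_def)
    show "flag_up ?U F = insert (insert I F) (N F)" "flag_up ?U (insert I F) = insert I ` N F" if "F : X0" for F
      using up0 up1 that by auto
    show "fs (insert I F) F \<otimes> fs (insert I F) F = \<one>" if "F : X0" for F
      using sg1[OF that] by (simp add: fs_def rint_one)
    show "fs (insert I L) (insert I F) \<otimes> fs (insert I F) F \<oplus> fs (insert I L) L \<otimes> fs L F = \<zero>"
      if F: "F : X0" and L: "L : N F" for F L
    proof -
      obtain x where x: "x ~: F" "I < x" "L = insert x F" using NF[OF F L] by blast
      have "insert I L = insert x (insert I F)" using x by auto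
      then have "flag_sign (insert I L) (insert I F) * flag_sign (insert I F) F +
          flag_sign (insert I L) L * flag_sign L F = 0"
        using flag_sign_anti[OF fin[OF X0(1)[OF F]] X0(2)[OF F] x(1,2)] x(3) by simp
      then show ?thesis by (simp add: fs_def rint_mult[symmetric] rint_add[symmetric] rint_zero)
    qed
    show "c F : carrier M" if "F : X0 \<union> insert I ` X0" for F using c(1) that X0 by auto
    show "inc M (flag_up ?U) fs c F = \<zero>\<^sub>M" if "F : X0" for F using c(2) X0[OF that] by simp
  qed auto
  then obtain h where h: "!!F. F : X0 ==> h F = \<zero>\<^sub>M & h (insert I F) = fs (insert I F) F \<odot>\<^sub>M c F"
    "!!F. F : X0 \<union> insert I ` X0 ==> inc M (flag_up ?U) fs h F = c F" by (metis (no_types, lifting))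
  have UX: "F : X0 \<union> insert I ` X0" if F: "F : flags ?U" for F
  proof (cases "I : F")
    case True
    then have "F - {I} : X0" "F = insert I (F - {I})" using flags_subset[OF F] by (auto simp: X0_def)
    then show ?thesis by blast
  qed (use F in \<open>auto simp: X0_def\<close>)
  have "h F : carrier M" if "F : flags ?U" for F
  proof -
    have "F : X0 \<or> (EX G:X0. F = insert I G)" using UX[OF that] by blast
    then show ?thesis using h(1) c(1) X0 by auto
  qed
  then show ?thesis using h(2)[OF UX] by (intro exI[of _ h]) simp
qed

text \<open>The set \<open>F\<close> occurs in three roles: \<open>{}\<close> gives all covers of
  \<open>K\<close>, \<open>{J}\<close> gives the covers below a cell \<open>J\<close>, and for a
  flag only its least element counts.\<close>

definition cov :: "'p set => 'p => 'p set" where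
  "cov F K = {I. covered_by S K I & (ALL x:F. I <= x)}"

lemma cov_sub: "cov F K \<subseteq> S" using covered_byD by (auto simp: cov_def)

lemma finite_cov [simp]: "finite (cov F K)" using finite_subset[OF cov_sub] by simp

lemma cov_inc_inc:
  assumes M: "module R M" and c: "!!I. I : S ==> K <= I ==> rank S I = Suc (Suc (rank S K)) ==> ALL x:F. I <= x ==> c I : carrier M"
  shows "inc M (cov F) e (inc M (cov F) e c) K = \<zero>\<^sub>M"
proof -
  interpret M: module R M by fact
  show ?thesis
  proof (rule M.inc_inc[OF finite_S])
    fix I N assume IN: "I : cov F K" "N : cov F I"
    then have cs: "covered_by S K I" "covered_by S I N" by (auto simp: cov_def)
    obtain I' where I': "I' ~= I" "{L. covered_by S K L & covered_by S L N} = {I, I'}"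
      "e N I \<otimes> e I K \<oplus> e N I' \<otimes> e I' K = \<zero>" using diamond_sign[OF cs] by blast
    \<comment> \<open>The fourth corner of the diamond obeys the bound by \<open>F\<close>
      automatically, because it lies below \<open>N\<close>.\<close>
    have "{L : cov F K. N : cov F L} = {L. covered_by S K L & covered_by S L N}"
    proof (intro equalityI subsetI)
      fix L assume "L : {L. covered_by S K L & covered_by S L N}"
      then have L: "covered_by S K L" "covered_by S L N" by auto
      then have "L <= x" if "x : F" for x using covered_byD[OF L(2)] IN(2) that by (auto simp: cov_def dest: order_trans)
      then show "L : {L : cov F K. N : cov F L}" using L IN(2) by (auto simp: cov_def)
    qed (auto simp: cov_def)
    then show "EX I'. I' ~= I & {L : cov F K. N : cov F L} = {I, I'} &
      e N I \<otimes> e I K \<oplus> e N I' \<otimes> e I' K = \<zero>" using I' by (intro exI[of _ I']) simp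
    have "K <= N" using covered_byD[OF cs(1)] covered_byD[OF cs(2)] by (auto dest: order_trans)
    then show "c N : carrier M" using IN covered_byD[OF cs(1)] covered_byD[OF cs(2)] by (intro c) (auto simp: cov_def)
  qed (use cov_sub in auto)
qed

lemma flag_min:
  assumes "F : flg J J" "F ~= {}"
  shows "EX m:F. m : S & J < m & (ALL x:F. m <= x)"
proof -
  have "finite F" using flags_finite[OF finite_above assms(1)] .
  then obtain m where m: "m : F" "ALL x:F. x <= m --> m = x" using finite_has_minimal[OF _ assms(2)] by blast
  then have "ALL x:F. m <= x" using flags_comparable[OF assms(1)] by metis
  then show ?thesis using m flagsD[OF assms(1) m(1)] by (auto simp: above_def)
qed

text \<open>Only the least element \<open>m\<close> of the flag matters: the cells involved form the
  boolean interval from \<open>J\<close> to \<open>m\<close>, and this is a cone since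
  \<open>m\<close> has a vertex outside \<open>J\<close>.\<close>

lemma flag_column_exact:
  assumes M: "module R M" and J: "J : S" and F: "F : flg J J" "F ~= {}"
    and c: "!!K. K : S ==> J <= K ==> ALL x:F. K <= x ==> c K : carrier M"
      "!!K. K : S ==> J <= K ==> ALL x:F. K <= x ==> inc M (cov F) e c K = \<zero>\<^sub>M"
  shows "EX h. (ALL K:S. J <= K & (ALL x:F. K <= x) --> h K : carrier M) &
    (ALL K:S. J <= K & (ALL x:F. K <= x) --> inc M (cov F) e h K = c K)"
proof -
  interpret M: module R M by fact
  obtain m where m: "m : F" "m : S" "J < m" "ALL x:F. m <= x" using flag_min[OF F] by blast
  have iff: "(ALL x:F. K <= x) \<longleftrightarrow> K <= m" for K using m by (meson order_trans)
  have up: "cov F = (%K. {I. covered_by S K I & I <= m})" by (simp add: cov_def iff fun_eq_iff)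
  have "vb J \<subset> vb m" using vb_le_iff[of m m J] vb_mono[OF less_imp_le[OF m(3)]] m J by (auto simp: less_le_not_le)
  then obtain v where v: "v : vb m - vb J" by blast
  obtain h where h: "!!K. K : S ==> J <= K & K <= m ==> h K = \<zero>\<^sub>M \<or>
      (EX K':S. J <= K' & K' <= m & covered_by S K' K & vb K = insert v (vb K') & h K = e K K' \<odot>\<^sub>M c K')"
    "!!K. K : S ==> J <= K & K <= m ==> inc M (cov F) e h K = c K"
  proof -
    have c1: "c K : carrier M" if "K : S" "J <= K" "K <= m" for K using c(1)[of K] that iff by simp
    have c2: "inc M (%K. {I. covered_by S K I & I <= m}) e c K = \<zero>\<^sub>M" if "K : S" "J <= K" "K <= m" for K
      using c(2)[of K] that unfolding iff up by simp
    have "EX h. (ALL K:S. J <= K & K <= m --> h K = \<zero>\<^sub>M \<or>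
        (EX K':S. J <= K' & K' <= m & covered_by S K' K & vb K = insert v (vb K') & h K = e K K' \<odot>\<^sub>M c K')) &
      (ALL K:S. J <= K & K <= m --> inc M (%K. {I. covered_by S K I & I <= m}) e h K = c K)"
      by (rule interval_exact[OF M J m(2) less_imp_le[OF m(3)] v]) (fact c1, fact c2)
    then obtain h where h: "ALL K:S. J <= K & K <= m --> h K = \<zero>\<^sub>M \<or>
        (EX K':S. J <= K' & K' <= m & covered_by S K' K & vb K = insert v (vb K') & h K = e K K' \<odot>\<^sub>M c K')"
      "ALL K:S. J <= K & K <= m --> inc M (cov F) e h K = c K" unfolding up[symmetric] by (elim exE conjE)
    show thesis by (rule that[of h]; rule h[rule_format]; assumption)
  qed
  have "h K : carrier M" if K: "K : S" "J <= K & K <= m" for K using h(1)[OF K] c(1) unfolding iff by auto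
  then show ?thesis using h(2) unfolding iff by (intro exI[of _ h]) simp
qed

text \<open>Both composites run over the same pairs \<open>(I, F)\<close>: \<open>I\<close> covers
  \<open>K\<close>, \<open>F\<close> adds one element to \<open>G\<close>, and \<open>I\<close> lies
  below all of \<open>F\<close>. The coefficient is the product of the two signs either way, so the
  operators commute without a sign.\<close>

lemma cov_flag_commute:
  assumes M: "module R M" and K: "K : S" "J <= K" and G: "G : flg J K"
    and w: "!!I F. covered_by S K I ==> F : fup J I G ==> w I F : carrier M"
  shows "inc M (cov G) e (%I. fd M J I (w I) G) K =
    fd M J K (%F. inc M (cov F) e (%I. w I F) K) G"
proof -
  interpret M: module R M by fact
  have fu: "finite (fup J I G)" for I by (rule finite_subset[OF _ finite_flags[OF finite_above]]) (auto simp: flag_up_def)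
  have iff: "I : cov G K & F : fup J I G \<longleftrightarrow> F : fup J K G & I : cov F K" for I F
  proof
    assume a: "I : cov G K & F : fup J I G"
    then have "K <= I" using covered_byD by (auto simp: cov_def)
    then have "above J I \<subseteq> above J K" by (auto simp: above_def)
    then show "F : fup J K G & I : cov F K" using a by (auto simp: flag_up_def flags_def cov_def above_def)
  next
    assume a: "F : fup J K G & I : cov F K"
    then show "I : cov G K & F : fup J I G" by (auto simp: flag_up_def flags_def cov_def above_def)
  qed
  have w': "w I F : carrier M" if "I : cov G K" "F : fup J I G" for I F using w that by (auto simp: cov_def)
  have "inc M (cov G) e (%I. fd M J I (w I) G) K =
      (\<Oplus>\<^bsub>M\<^esub>I\<in>cov G K. \<Oplus>\<^bsub>M\<^esub>F\<in>fup J I G. (e I K \<otimes> fs F G) \<odot>\<^sub>M w I F)"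
    unfolding inc_def
  proof (rule M.finsum_cong'[OF refl])
    show "(%I. \<Oplus>\<^bsub>M\<^esub>F\<in>fup J I G. (e I K \<otimes> fs F G) \<odot>\<^sub>M w I F) : cov G K \<rightarrow> carrier M"
      using w' by (auto intro!: M.M.finsum_closed)
    fix I assume I: "I : cov G K"
    have "e I K \<odot>\<^sub>M (\<Oplus>\<^bsub>M\<^esub>F\<in>fup J I G. fs F G \<odot>\<^sub>M w I F) =
        (\<Oplus>\<^bsub>M\<^esub>F\<in>fup J I G. e I K \<odot>\<^sub>M (fs F G \<odot>\<^sub>M w I F))"
      using w'[OF I] fu by (intro M.finsum_smult_ldistr) auto
    also have "\<dots> = (\<Oplus>\<^bsub>M\<^esub>F\<in>fup J I G. (e I K \<otimes> fs F G) \<odot>\<^sub>M w I F)"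
      using w'[OF I] by (intro M.M.finsum_cong') (auto simp: M.smult_assoc1)
    finally show "e I K \<odot>\<^sub>M (\<Oplus>\<^bsub>M\<^esub>F\<in>fup J I G. fs F G \<odot>\<^sub>M w I F) =
        (\<Oplus>\<^bsub>M\<^esub>F\<in>fup J I G. (e I K \<otimes> fs F G) \<odot>\<^sub>M w I F)" .
  qed
  also have "\<dots> = (\<Oplus>\<^bsub>M\<^esub>F\<in>fup J K G. \<Oplus>\<^bsub>M\<^esub>I\<in>cov F K. (e I K \<otimes> fs F G) \<odot>\<^sub>M w I F)"
    using fu w' iff by (intro M.M.finsum_swap_rel) auto
  also have "\<dots> = fd M J K (%F. inc M (cov F) e (%I. w I F) K) G" unfolding inc_def
  proof (rule M.finsum_cong'[OF refl])
    have w'': "w I F : carrier M" if "F : fup J K G" "I : cov F K" for I F using w' iff that by blast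
    then show "(%F. fs F G \<odot>\<^sub>M (\<Oplus>\<^bsub>M\<^esub>I\<in>cov F K. e I K \<odot>\<^sub>M w I F)) : fup J K G \<rightarrow> carrier M"
      by (auto intro!: M.smult_closed M.M.finsum_closed)
    fix F assume F: "F : fup J K G"
    have "fs F G \<odot>\<^sub>M (\<Oplus>\<^bsub>M\<^esub>I\<in>cov F K. e I K \<odot>\<^sub>M w I F) =
        (\<Oplus>\<^bsub>M\<^esub>I\<in>cov F K. fs F G \<odot>\<^sub>M (e I K \<odot>\<^sub>M w I F))"
      using w''[OF F] by (intro M.finsum_smult_ldistr) auto
    also have "\<dots> = (\<Oplus>\<^bsub>M\<^esub>I\<in>cov F K. (e I K \<otimes> fs F G) \<odot>\<^sub>M w I F)"
      using w''[OF F] by (intro M.M.finsum_cong') (auto simp: M.smult_assoc1[symmetric] m_comm)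
    finally show "(\<Oplus>\<^bsub>M\<^esub>I\<in>cov F K. (e I K \<otimes> fs F G) \<odot>\<^sub>M w I F) =
      fs F G \<odot>\<^sub>M (\<Oplus>\<^bsub>M\<^esub>I\<in>cov F K. e I K \<odot>\<^sub>M w I F)" ..
  qed
  finally show ?thesis .
qed

text \<open>Reduced acyclicity of the order complex above \<open>J\<close> in low dimensions: a flag
  with \<open>t\<close> elements has dimension \<open>t - 1\<close>, and \<open>t = 0\<close> is the
  empty flag.\<close>

definition flag_acyclic :: "('k, 'a) module => 'p => nat => bool" where
  "flag_acyclic M J m \<longleftrightarrow> (ALL t<m. ALL z. (ALL F:flg J J. card F = t --> z F : carrier M) &
    (ALL G:flg J J. Suc (card G) = t --> fd M J J z G = \<zero>\<^sub>M) -->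
    (EX w. (ALL F:flg J J. card F = Suc t --> w F : carrier M) &
      (ALL F:flg J J. card F = t --> fd M J J w F = z F)))"

text \<open>
  Pairs of a cell \<open>I \<ge> J\<close> and a flag \<open>F\<close> above \<open>I\<close> form a double complex whose rows are
  contractible for \<open>I > J\<close> and whose columns are contractible for nonempty \<open>F\<close>; it compares the
  cellular complex of the star of \<open>J\<close> with the order complex of the elements above \<open>J\<close>.
\<close>

lemma flag_cell_exact:
  assumes M: "module R M" and J: "J : S" and ac: "flag_acyclic M J m"
  shows "r + t < m ==>
    (!!I F. I : S ==> J <= I ==> rank S I = rank S J + r ==> F : flg J I ==> card F = t ==> z I F : carrier M) ==>
    (!!I G. I : S ==> J <= I ==> rank S I = rank S J + r ==> G : flg J I ==> Suc (card G) = t ==>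
      fd M J I (z I) G = \<zero>\<^sub>M) ==>
    (!!K F. K : S ==> J <= K ==> Suc (rank S K) = rank S J + r ==> F : flg J K ==> card F = t ==>
      inc M (cov F) e (%I. z I F) K = \<zero>\<^sub>M) ==>
    EX w. (ALL I F. cell_at J (Suc r) (Suc t) I F --> w I F : carrier M) &
      (ALL I F. cell_at J r t I F -->
        z I F = fd M J I (%F'. inc M (cov F') e (%I'. w I' F') I) F)"
proof (induct r arbitrary: t z)
  interpret M: module R M by fact
  have aboveJ: "flg J I \<subseteq> flg J J" for I by (auto simp: flags_def above_def)
  have cd: "card F = Suc (card G)" "F : flg J I" if "F : fup J I G" for F G I
    using that flags_finite[OF finite_above, of F J I] by (auto simp: flag_up_def)
  have cv: "I : S" "J <= I" "rank S I = Suc (rank S K)" "F : flg J I"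
    if "J <= K" "F : flg J K" "I : cov F K" for I K F
    using that covered_byD[of K I] by (auto simp: cov_def flags_def above_def dest: order_trans)
  \<comment> \<open>For each nonempty flag the cells below it form a contractible column; the lifts
    for different flags are independent of each other and are collected into one
    \<open>w\<close>.\<close>
  have col: "EX w. (ALL I F. cell_at J (Suc r) (Suc t) I F --> w I F : carrier M) &
      (ALL I F. cell_at J r (Suc t) I F -->
        inc M (cov F) e (%I'. w I' F) I = u I F)"
    if u: "!!I F. I : S ==> J <= I ==> rank S I = rank S J + r ==> F : flg J I ==> card F = Suc t ==> u I F : carrier M"
      "!!K F. K : S ==> J <= K ==> Suc (rank S K) = rank S J + r ==> F : flg J K ==> card F = Suc t ==>
        inc M (cov F) e (%I. u I F) K = \<zero>\<^sub>M" for r t u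
  proof -
    have "EX h. (ALL K:S. J <= K & (ALL x:F. K <= x) --> h K : carrier M) &
      (ALL K:S. J <= K & (ALL x:F. K <= x) & rank S K = rank S J + r --> inc M (cov F) e h K = u K F)"
      if F: "F : flg J J" "card F = Suc t" for F
    proof -
      \<comment> \<open>Column exactness treats all ranks at once, so the chain is extended by zero
        to the other ranks, where its closedness is then trivial.\<close>
      let ?c = "%I. if rank S I = rank S J + r then u I F else \<zero>\<^sub>M"
      have FI: "F : flg J I" if "ALL x:F. I <= x" for I using F that by (auto simp: flags_def above_def)
      have ne: "F ~= {}" using F(2) by auto
      have "inc M (cov F) e ?c K = \<zero>\<^sub>M" if K: "K : S" "J <= K" "ALL x:F. K <= x" for K
      proof (cases "Suc (rank S K) = rank S J + r")
        case True
        then have "inc M (cov F) e ?c K = inc M (cov F) e (%I. u I F) K"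
          using cv[OF K(2) FI[OF K(3)]] u(1) F(2) by (intro M.inc_cong) auto
        then show ?thesis using u(2)[OF K(1,2) True FI[OF K(3)] F(2)] by simp
      next
        case False
        then show ?thesis using cv[OF K(2) FI[OF K(3)]] by (intro M.inc_zero) auto
      qed
      moreover have "?c K : carrier M" if K: "K : S" "J <= K" "ALL x:F. K <= x" for K
        using u(1)[OF K(1,2) _ FI[OF K(3)] F(2)] by auto
      ultimately obtain h where h: "ALL K:S. J <= K & (ALL x:F. K <= x) --> h K : carrier M"
        "ALL K:S. J <= K & (ALL x:F. K <= x) --> inc M (cov F) e h K = ?c K"
        using flag_column_exact[OF M J F(1) ne, of ?c] by auto
      then show ?thesis by (intro exI[of _ h]) auto
    qed
    then obtain h where h: "!!F K. F : flg J J ==> card F = Suc t ==> K : S ==> J <= K ==> (ALL x:F. K <= x) ==> h F K : carrier M"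
      "!!F K. F : flg J J ==> card F = Suc t ==> K : S ==> J <= K ==> (ALL x:F. K <= x) ==> rank S K = rank S J + r ==>
        inc M (cov F) e (h F) K = u K F" by metis
    have le: "ALL x:F. I <= x" if "F : flg J I" for F I using that by (auto simp: flags_def above_def)
    show ?thesis using h le aboveJ by (intro exI[of _ "%I F. h F I"]) blast
  qed
  {
    case 0
    \<comment> \<open>With \<open>r = 0\<close> the only cell is \<open>J\<close> itself. Its row of
      flags is not a cone, and this is where the acyclicity hypothesis \<open>ac\<close> is
      used.\<close>
    have "EX w. (ALL F:flg J J. card F = Suc t --> w F : carrier M) &
        (ALL F:flg J J. card F = t --> fd M J J w F = z J F)"
      using ac[unfolded flag_acyclic_def, rule_format, of t "z J"] 0 J by auto
    then obtain w0 where w0: "!!F. F : flg J J ==> card F = Suc t ==> w0 F : carrier M"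
        "!!F. F : flg J J ==> card F = t ==> fd M J J w0 F = z J F" by blast
    have IJ: "I = J" if "I : S" "J <= I" "rank S I = rank S J + 0" for I using eq_of_rank_eq[of J I] that J by simp
    have noK: False if "K : S" "J <= K" "Suc (rank S K) = rank S J + 0" for K using rank_mono[OF J that(1,2)] that(3) by simp
    have p1: "w0 F : carrier M" if "I : S" "J <= I" "rank S I = rank S J + 0" "F : flg J I" "card F = Suc t" for I F
      using w0(1) that aboveJ by auto
    have p2: "inc M (cov F) e (%I. w0 F) K = \<zero>\<^sub>M" if "K : S" "J <= K" "Suc (rank S K) = rank S J + 0"
      "F : flg J K" "card F = Suc t" for K F using noK that by blast
    have "EX w. (ALL I F. cell_at J (Suc 0) (Suc t) I F --> w I F : carrier M) &
      (ALL I F. cell_at J 0 (Suc t) I F -->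
        inc M (cov F) e (%I'. w I' F) I = w0 F)" by (rule col) (fact p1, fact p2)
    then obtain w where w1: "ALL I F. cell_at J (Suc 0) (Suc t) I F --> w I F : carrier M"
      and w2: "ALL I F. cell_at J 0 (Suc t) I F -->
        inc M (cov F) e (%I'. w I' F) I = w0 F" by (elim exE conjE)
    have w: "!!I F. I : S ==> J <= I ==> rank S I = rank S J + Suc 0 ==> F : flg J I ==> card F = Suc t ==> w I F : carrier M"
      "!!I F. I : S ==> J <= I ==> rank S I = rank S J + 0 ==> F : flg J I ==> card F = Suc t ==>
        inc M (cov F) e (%I'. w I' F) I = w0 F" using w1 w2 by simp_all
    have "z I F = fd M J I (%F'. inc M (cov F') e (%I'. w I' F') I) F"
      if I: "I : S" "J <= I" "rank S I = rank S J + 0" and F: "F : flg J I" "card F = t" for I F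
    proof -
      have "fd M J J (%F'. inc M (cov F') e (%I'. w I' F') J) F = fd M J J w0 F"
        using cd[of _ J F] w(2)[of J] J F w0(1) by (intro M.inc_cong) auto
      then show ?thesis using IJ[OF I] w0(2)[of F] F by simp
    qed
    then show ?case using w(1) by (intro exI[of _ w]) auto
  next
    case (Suc r)
    have gt: "J < I" if "I : S" "J <= I" "rank S I = rank S J + Suc r" for I using that by (auto simp: less_le)
    \<comment> \<open>For cells strictly above \<open>J\<close> the row of flags is a cone, so
      \<open>z\<close> is the flag boundary of some \<open>c'\<close>, which need not be closed in
      the cell direction.\<close>
    have "EX h. (ALL F:flg J I. h F : carrier M) &
        (ALL F:flg J I. card F = t --> fd M J I h F = z I F)"
      if I: "I : S" "J <= I" "rank S I = rank S J + Suc r" for I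
    proof -
      let ?c = "%F. if card F = t then z I F else \<zero>\<^sub>M"
      have "fd M J I ?c G = \<zero>\<^sub>M" if G: "G : flg J I" for G
      proof (cases "Suc (card G) = t")
        case True
        then have "fd M J I ?c G = fd M J I (z I) G" using cd[of _ I G] Suc.prems(2)[OF I] by (intro M.inc_cong) auto
        then show ?thesis using Suc.prems(3)[OF I G True] by simp
      next
        case False
        then show ?thesis using cd[of _ I G] by (intro M.inc_zero) auto
      qed
      moreover have "?c F : carrier M" if "F : flg J I" for F using Suc.prems(2)[OF I that] by auto
      ultimately obtain h where "ALL F:flg J I. h F : carrier M"
        "ALL F:flg J I. fd M J I h F = ?c F" using flag_row_exact[OF M I(1) gt[OF I], of ?c] by auto
      then show ?thesis by (intro exI[of _ h]) auto
    qed
    then obtain c' where c': "!!I F. I : S ==> J <= I ==> rank S I = rank S J + Suc r ==> F : flg J I ==> c' I F : carrier M"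
      "!!I F. I : S ==> J <= I ==> rank S I = rank S J + Suc r ==> F : flg J I ==> card F = t ==>
        fd M J I (c' I) F = z I F" by metis
    \<comment> \<open>\<open>z'\<close> measures the failure of \<open>c'\<close> to be closed. It
      is closed in both directions and lives one rank lower with one more flag element, so
      \<open>r + t\<close> is unchanged and the induction hypothesis applies.\<close>
    define z' where "z' K F = inc M (cov F) e (%I. c' I F) K" for K F
    have z'c: "z' K F : carrier M" if K: "K : S" "J <= K" "rank S K = rank S J + r" and F: "F : flg J K" for K F
      unfolding z'_def using cv[OF K(2) F] K(3) by (intro M.inc_closed c') auto
    have "EX w. (ALL I F. cell_at J (Suc r) (Suc (Suc t)) I F --> w I F : carrier M) &
      (ALL I F. cell_at J r (Suc t) I F -->
        z' I F = fd M J I (%F'. inc M (cov F') e (%I'. w I' F') I) F)"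
    proof (rule Suc.hyps)
      show "r + Suc t < m" using Suc.prems(1) by simp
      show "z' I F : carrier M" if "I : S" "J <= I" "rank S I = rank S J + r" "F : flg J I" "card F = Suc t" for I F
        using z'c that by simp
      show "fd M J K (z' K) G = \<zero>\<^sub>M"
        if K: "K : S" "J <= K" "rank S K = rank S J + r" and G: "G : flg J K" "Suc (card G) = Suc t" for K G
      proof -
        have "fd M J K (z' K) G = inc M (cov G) e (%I. fd M J I (c' I) G) K" unfolding z'_def
        proof (rule cov_flag_commute[OF M K(1,2) G(1), symmetric])
          fix I F assume I: "covered_by S K I" and F: "F : fup J I G"
          show "c' I F : carrier M" using covered_byD[OF I] K cd(2)[OF F] by (intro c') (auto dest: order_trans)
        qed
        also have "\<dots> = inc M (cov G) e (%I. z I G) K"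
          using cv[OF K(2) G(1)] c'(2) Suc.prems(2) K G by (intro M.inc_cong) auto
        also have "\<dots> = \<zero>\<^sub>M" using Suc.prems(4)[OF K(1,2) _ G(1)] K G by simp
        finally show ?thesis .
      qed
      show "inc M (cov F) e (%I. z' I F) K = \<zero>\<^sub>M"
        if K: "K : S" "J <= K" "Suc (rank S K) = rank S J + r" and F: "F : flg J K" "card F = Suc t" for K F
      proof -
        have "inc M (cov F) e (inc M (cov F) e (%I. c' I F)) K = \<zero>\<^sub>M"
        proof (rule cov_inc_inc[OF M])
          fix I assume I: "I : S" "K <= I" "rank S I = Suc (Suc (rank S K))" "ALL x:F. I <= x"
          then show "c' I F : carrier M" using K F by (intro c') (auto simp: flags_def above_def dest: order_trans)
        qed
        then show ?thesis unfolding z'_def by simp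
      qed
    qed
    then obtain w' where w': "!!I F. I : S ==> J <= I ==> rank S I = rank S J + Suc r ==> F : flg J I ==> card F = Suc (Suc t) ==> w' I F : carrier M"
      "!!I F. I : S ==> J <= I ==> rank S I = rank S J + r ==> F : flg J I ==> card F = Suc t ==>
        z' I F = fd M J I (%F'. inc M (cov F') e (%I'. w' I' F') I) F" by blast
    define v where "v I F = fd M J I (w' I) F" for I F
    have vc: "v I F : carrier M" if "I : S" "J <= I" "rank S I = rank S J + Suc r" "F : flg J I" "card F = Suc t" for I F
      unfolding v_def using that cd[of _ I F] by (intro M.inc_closed w') auto
    \<comment> \<open>\<open>v\<close> is a flag boundary with cell boundary \<open>z'\<close>.
      Subtracting it makes \<open>c'\<close> closed in the cell direction without changing its flag
      boundary \<open>z\<close>.\<close>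
    define u where "u I F = c' I F \<ominus>\<^sub>M v I F" for I F
    have "inc M (cov F) e (%I. u I F) K = \<zero>\<^sub>M"
      if K: "K : S" "J <= K" "Suc (rank S K) = rank S J + Suc r" and F: "F : flg J K" "card F = Suc t" for K F
    proof -
      have Kr: "rank S K = rank S J + r" using K by simp
      have "inc M (cov F) e (%I. u I F) K = inc M (cov F) e (%I. c' I F) K \<ominus>\<^sub>M inc M (cov F) e (%I. v I F) K"
        unfolding u_def using cv[OF K(2) F(1)] K F c' vc by (intro M.inc_minus) auto
      also have "inc M (cov F) e (%I. v I F) K = z' K F" unfolding v_def w'(2)[OF K(1,2) Kr F]
      proof (rule cov_flag_commute[OF M K(1,2) F(1)])
        fix I G assume I: "covered_by S K I" and G: "G : fup J I F"
        show "w' I G : carrier M" using covered_byD[OF I] K cd[OF G] F(2) by (intro w') (auto dest: order_trans)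
      qed
      also have "inc M (cov F) e (%I. c' I F) K = z' K F" by (simp add: z'_def)
      finally show ?thesis using z'c[OF K(1,2) Kr F(1)] by (simp add: M.minus_self)
    qed
    note p2 = this
    have p1: "u I F : carrier M" if "I : S" "J <= I" "rank S I = rank S J + Suc r" "F : flg J I" "card F = Suc t" for I F
      unfolding u_def using c'(1) vc that by simp
    have "EX w. (ALL I F. cell_at J (Suc (Suc r)) (Suc t) I F --> w I F : carrier M) &
      (ALL I F. cell_at J (Suc r) (Suc t) I F -->
        inc M (cov F) e (%I'. w I' F) I = u I F)" by (rule col) (fact p1, fact p2)
    then obtain w where w1: "ALL I F. cell_at J (Suc (Suc r)) (Suc t) I F --> w I F : carrier M"
      and w2: "ALL I F. cell_at J (Suc r) (Suc t) I F -->
        inc M (cov F) e (%I'. w I' F) I = u I F" by (elim exE conjE)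
    have w: "!!I F. I : S ==> J <= I ==> rank S I = rank S J + Suc (Suc r) ==> F : flg J I ==> card F = Suc t ==> w I F : carrier M"
      "!!I F. I : S ==> J <= I ==> rank S I = rank S J + Suc r ==> F : flg J I ==> card F = Suc t ==>
        inc M (cov F) e (%I'. w I' F) I = u I F" using w1 w2 by simp_all
    have "z I F = fd M J I (%F'. inc M (cov F') e (%I'. w I' F') I) F"
      if I: "I : S" "J <= I" "rank S I = rank S J + Suc r" and F: "F : flg J I" "card F = t" for I F
    proof -
      have G: "G : flg J I" "card G = Suc t" if "G : fup J I F" for G using cd[OF that] F by auto
      have "fd M J I (%F'. inc M (cov F') e (%I'. w I' F') I) F =
          fd M J I (%F'. u I F') F" using G w(2)[OF I] c'(1)[OF I] vc[OF I] by (intro M.inc_cong) (auto simp: u_def)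
      also have "\<dots> = fd M J I (c' I) F \<ominus>\<^sub>M fd M J I (v I) F"
        unfolding u_def using G c'(1)[OF I] vc[OF I] finite_subset[OF _ finite_flags[OF finite_above[of J I]]]
        by (intro M.inc_minus) (auto simp: flag_up_def)
      also have "fd M J I (v I) F = \<zero>\<^sub>M"
        unfolding v_def using w'(1)[OF I] F(2) by (intro flag_inc_inc[OF M above_sub F(1)]) auto
      also have "fd M J I (c' I) F = z I F" using c'(2)[OF I F] .
      finally show ?thesis using Suc.prems(2)[OF I F] by (simp add: a_minus_def)
    qed
    then show ?case using w(1) by (intro exI[of _ w]) blast
  }
qed

text \<open>For the empty flag, \<open>flag_cell_exact\<close> writes the cycle as a composite of
  both boundaries of some \<open>w\<close>. Exchanging the two exhibits it as the cellular boundary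
  of \<open>b\<close>, the flag boundary of \<open>w\<close>.\<close>

theorem star_exact:
  assumes M: "module R M" and J: "J : S" and ac: "flag_acyclic M J (n - rank S J)"
    and a: "a < n" and c: "!!I. I : S ==> J <= I ==> rank S I = a ==> c I : carrier M"
      "!!K. K : S ==> J <= K ==> Suc (rank S K) = a ==> inc M (cov {}) e c K = \<zero>\<^sub>M"
  shows "EX b. (ALL I:S. J <= I & rank S I = Suc a --> b I : carrier M) &
    (ALL I:S. J <= I & rank S I = a --> inc M (cov {}) e b I = c I)"
proof (cases "rank S J <= a")
  \<comment> \<open>No cell above \<open>J\<close> has rank \<open>a\<close>, so the zero chain will
    do.\<close>
  case False
  then show ?thesis using rank_mono[OF J] by (intro exI[of _ "%_. \<zero>\<^sub>M"]) (auto, (use abelian_group.axioms(1)[OF module.axioms(2)[OF M]] abelian_monoidE(2) in blast)+)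
next
  case True
  interpret M: module R M by fact
  define r where "r = a - rank S J"
  have a': "a = rank S J + r" using True by (simp add: r_def)
  have "EX w. (ALL I F. cell_at J (Suc r) (Suc 0) I F --> w I F : carrier M) &
      (ALL I F. cell_at J r 0 I F -->
        c I = fd M J I (%F'. inc M (cov F') e (%I'. w I' F') I) F)"
  proof (rule flag_cell_exact[OF M J ac])
    show "r + 0 < n - rank S J" using a a' by simp
    show "inc M (cov F) e (%I. c I) K = \<zero>\<^sub>M"
      if "K : S" "J <= K" "Suc (rank S K) = rank S J + r" "F : flg J K" "card F = 0" for K F
    proof -
      have "F = {}" using flags_finite[OF finite_above that(4)] that(5) by simp
      then show ?thesis using c(2)[of K] that a' by simp
    qed
  qed (use c a' in auto)
  then obtain w where
      w1: "ALL I F. cell_at J (Suc r) (Suc 0) I F --> w I F : carrier M"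
      and w2: "ALL I F. cell_at J r 0 I F -->
        c I = fd M J I (%F'. inc M (cov F') e (%I'. w I' F') I) F" by blast
  have w: "!!I F. I : S ==> J <= I ==> rank S I = Suc a ==> F : flg J I ==> card F = Suc 0 ==> w I F : carrier M"
      "!!I. I : S ==> J <= I ==> rank S I = a ==> c I = fd M J I (%F'. inc M (cov F') e (%I'. w I' F') I) {}"
    using w1 w2 a' by simp_all
  have cd: "card F = Suc 0" "F : flg J I" if "F : fup J I {}" for F I using that by (auto simp: flag_up_def)
  define b where "b I = fd M J I (w I) {}" for I
  have "b I : carrier M" if "I : S" "J <= I" "rank S I = Suc a" for I
    unfolding b_def using w(1)[OF that] cd by (intro M.inc_closed) auto
  moreover have "inc M (cov {}) e b I = c I" if I: "I : S" "J <= I" "rank S I = a" for I unfolding w(2)[OF I] b_def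
  proof (rule cov_flag_commute[OF M I(1,2)])
    fix I' F assume "covered_by S I I'" "F : fup J I' {}"
    then show "w I' F : carrier M" using covered_byD[of I I'] I cd[of F I'] by (intro w(1)) (auto dest: order_trans)
  qed simp
  ultimately show ?thesis by blast
qed

end

section \<open>Reduced homology of links and the Buchsbaum condition in terms of flags\<close>

section \<open>The ground ring as a module\<close>

lemma ring_as_module_simps [simp]:
  "carrier (ring_as_module R) = carrier R" "\<zero>\<^sub>(ring_as_module R) = \<zero>\<^sub>R"
  "x \<oplus>\<^sub>(ring_as_module R) y = x \<oplus>\<^sub>R y" "a \<odot>\<^sub>(ring_as_module R) x = a \<otimes>\<^sub>R x"
  by (simp_all add: ring_as_module_def)

lemma finsum_ring_as_module [simp]: "finsum (ring_as_module R) f A = finsum R f A"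
proof -
  have "add (ring_as_module R) = add R" by (simp add: ring_as_module_def)
  then show ?thesis by (simp add: finsum_def finprod_def)
qed

lemma ring_as_module_is_module:
  assumes "cring R" shows "module R (ring_as_module R)"
proof -
  interpret cring R by fact
  show ?thesis
  proof (rule moduleI)
    show "abelian_group (ring_as_module R)"
    proof (rule abelian_groupI)
      fix x assume "x : carrier (ring_as_module R)"
      then show "EX y:carrier (ring_as_module R). y \<oplus>\<^sub>(ring_as_module R) x = \<zero>\<^sub>(ring_as_module R)"
        by (intro bexI[of _ "\<ominus>\<^sub>R x"]) (auto simp: l_neg)
    qed (auto simp: a_ac)
  qed (auto simp: l_distr r_distr m_assoc intro: is_cring)
qed

lemma ring_as_module_minus:
  assumes "cring R" "x : carrier R" "y : carrier R"
  shows "x \<ominus>\<^sub>(ring_as_module R) y = x \<ominus>\<^sub>R y"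
proof -
  interpret cring R by fact
  interpret M: module R "ring_as_module R" by (rule ring_as_module_is_module[OF assms(1)])
  have "\<ominus>\<^sub>(ring_as_module R) y = \<ominus>\<^sub>R y"
    using M.M.minus_equality[of "\<ominus>\<^sub>R y" y] assms by (simp add: l_neg)
  then show ?thesis by (simp add: a_minus_def)
qed

lemma mod_hom_cong:
  assumes "module R M" "h : mod_hom R M N" "!!x. x : carrier M ==> h' x = h x"
  shows "h' : mod_hom R M N"
proof -
  interpret module R M by fact
  show ?thesis using assms(2,3) by (intro mod_homI) (auto simp: mod_hom_def)
qed

context module
begin

lemma smult_finsum:
  assumes "finite A" "!!i. i : A ==> f i : carrier R" "x : carrier M"
  shows "(\<Oplus>\<^bsub>R\<^esub>i\<in>A. f i) \<odot>\<^sub>M x = (\<Oplus>\<^bsub>M\<^esub>i\<in>A. f i \<odot>\<^sub>M x)"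
  using assms
proof (induct A)
  case (insert i A)
  then show ?case by (simp add: Pi_def smult_l_distr)
qed simp

lemma inc_swap:
  assumes "finite (up K)" "finite (up' I)"
    "!!I'. I' : up K ==> e I' K : carrier R" "!!L. L : up' I ==> e' L I : carrier R"
    "!!L I'. I' : up K ==> L : up' I ==> w L I' : carrier M"
  shows "inc M up e (%I'. inc M up' e' (%L. w L I') I) K = inc M up' e' (%L. inc M up e (w L) K) I"
proof -
  have "inc M up e (%I'. inc M up' e' (%L. w L I') I) K =
      (\<Oplus>\<^bsub>M\<^esub>I'\<in>up K. \<Oplus>\<^bsub>M\<^esub>L\<in>up' I. e I' K \<odot>\<^sub>M (e' L I \<odot>\<^sub>M w L I'))"
    unfolding inc_def using assms by (intro M.finsum_cong') (auto intro!: finsum_smult_ldistr M.finsum_closed)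
  also have "\<dots> = (\<Oplus>\<^bsub>M\<^esub>L\<in>up' I. \<Oplus>\<^bsub>M\<^esub>I'\<in>up K. e I' K \<odot>\<^sub>M (e' L I \<odot>\<^sub>M w L I'))"
    using assms by (intro M.finsum_swap) auto
  also have "\<dots> = (\<Oplus>\<^bsub>M\<^esub>L\<in>up' I. \<Oplus>\<^bsub>M\<^esub>I'\<in>up K. e' L I \<odot>\<^sub>M (e I' K \<odot>\<^sub>M w L I'))"
    using assms by (intro M.finsum_cong') (auto intro!: M.finsum_closed M.finsum_cong' simp: smult_assoc1[symmetric] R.m_comm)
  also have "\<dots> = inc M up' e' (%L. inc M up e (w L) K) I" unfolding inc_def using assms
    by (intro M.finsum_cong') (auto intro!: finsum_smult_ldistr[symmetric] M.finsum_closed smult_closed)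
  finally show ?thesis .
qed

end

section \<open>Boundary operators as homomorphisms\<close>

text \<open>The definition of \<open>bd\<close> takes integer multiples in the coefficient modules,
  whereas \<open>lmap\<close> is linear over the ring by construction. The two are compared on
  chains with values in these modules.\<close>

lemma bd_eq_lmap:
  assumes "!!I. I : K ==> module R (val A I)"
    "!!I J. covered_by K J I ==> eps I J : {1, -1}"
    "!!I J. covered_by K J I ==> mor A I J : mod_hom R (val A I) (val A J)"
    and c: "c : carrier (chain_module K A i)"
  shows "bd K eps A i c = lmap (cells K (i - 1)) (%J. {I. covered_by K J I}) (val A)
    (%J I x. rint R (eps I J) \<odot>\<^sub>(val A J) mor A I J x) c" unfolding bd_def lmap_def
proof (rule restrict_ext)
  fix J assume J: "J : cells K (i - 1)"
  then have JK: "J : K" by (simp add: cells_def)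
  interpret module R "val A J" using assms(1)[OF JK] .
  have cl: "mor A I J (c I) : carrier (val A J)" if "covered_by K J I" for I
  proof -
    have "I : cells K i" using that J by (auto simp: cells_def covered_by_def dim_of_def)
    then have "c I : carrier (val A I)" using c by (auto simp: chain_module_def)
    then show ?thesis using mod_hom_closed[OF assms(3)[OF that]] by blast
  qed
  show "(\<Oplus>\<^bsub>val A J\<^esub>I\<in>{I. covered_by K J I}. [eps I J] \<cdot>\<^bsub>val A J\<^esub> mor A I J (c I)) =
      (\<Oplus>\<^bsub>val A J\<^esub>I\<in>{I. covered_by K J I}. rint R (eps I J) \<odot>\<^sub>(val A J) mor A I J (c I))"
    using cl assms(2) by (intro M.finsum_cong') (auto simp: add_pow_eq_rint)
qed

lemma bd_hom:
  assumes R: "cring R" and "finite K" "!!I. I : K ==> module R (val A I)"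
    "!!I J. covered_by K J I ==> eps I J : {1, -1}"
    "!!I J. covered_by K J I ==> mor A I J : mod_hom R (val A I) (val A J)"
  shows "bd K eps A i : mod_hom R (chain_module K A i) (chain_module K A (i - 1))"
proof -
  have "lmap (cells K (i - 1)) (%J. {I. covered_by K J I}) (val A)
    (%J I x. rint R (eps I J) \<odot>\<^sub>(val A J) mor A I J x) : mod_hom R (chain_module K A i) (chain_module K A (i - 1))"
    unfolding chain_module_def
  proof (rule lmap_hom)
    fix J assume J: "J : cells K (i - 1)"
    then have JK: "J : K" by (simp add: cells_def)
    interpret module R "val A J" using assms(3)[OF JK] .
    show "module R (val A J)" by (rule assms(3)[OF JK])
    show "finite {I. covered_by K J I}" by (rule finite_subset[OF _ assms(2)]) (auto simp: covered_by_def)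
    show "{I. covered_by K J I} \<subseteq> cells K i" using J by (auto simp: cells_def covered_by_def dim_of_def)
    show "(%x. rint R (eps I J) \<odot>\<^sub>(val A J) mor A I J x) : mod_hom R (val A I) (val A J)"
      if "I : {I. covered_by K J I}" for I
      using that assms(5) by (intro mod_hom_comp[OF mod_hom_scale]) (auto intro: module_axioms)
  qed
  note hom = this
  have "module R (chain_module K A i)"
    unfolding chain_module_def using assms(3) R by (intro direct_sum_module) (auto simp: cells_def)
  from this hom show ?thesis by (rule mod_hom_cong) (rule bd_eq_lmap[OF assms(3,4,5)])
qed

lemma cobd_eq_lmap:
  assumes "!!I. I : K ==> module R (val A I)"
    "!!I J. covered_by K I J ==> eps J I : {1, -1}"
    "!!I J. covered_by K I J ==> mor A I J : mod_hom R (val A I) (val A J)"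
    and c: "c : carrier (cochain_module K A i)"
  shows "cobd K eps A i c = lmap (cells K (i + 1)) (%J. {I. covered_by K I J}) (val A)
    (%J I x. rint R (eps J I) \<odot>\<^sub>(val A J) mor A I J x) c" unfolding cobd_def lmap_def
proof (rule restrict_ext)
  fix J assume J: "J : cells K (i + 1)"
  then have JK: "J : K" by (simp add: cells_def)
  interpret module R "val A J" using assms(1)[OF JK] .
  have cl: "mor A I J (c I) : carrier (val A J)" if "covered_by K I J" for I
  proof -
    have "I : cells K i" using that J by (auto simp: cells_def covered_by_def dim_of_def)
    then have "c I : carrier (val A I)" using c by (auto simp: cochain_module_def)
    then show ?thesis using mod_hom_closed[OF assms(3)[OF that]] by blast
  qed
  show "(\<Oplus>\<^bsub>val A J\<^esub>I\<in>{I. covered_by K I J}. [eps J I] \<cdot>\<^bsub>val A J\<^esub> mor A I J (c I)) =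
      (\<Oplus>\<^bsub>val A J\<^esub>I\<in>{I. covered_by K I J}. rint R (eps J I) \<odot>\<^sub>(val A J) mor A I J (c I))"
    using cl assms(2) by (intro M.finsum_cong') (auto simp: add_pow_eq_rint)
qed

lemma cobd_hom:
  assumes R: "cring R" and "finite K" "!!I. I : K ==> module R (val A I)"
    "!!I J. covered_by K I J ==> eps J I : {1, -1}"
    "!!I J. covered_by K I J ==> mor A I J : mod_hom R (val A I) (val A J)"
  shows "cobd K eps A i : mod_hom R (cochain_module K A i) (cochain_module K A (i + 1))"
proof -
  have "lmap (cells K (i + 1)) (%J. {I. covered_by K I J}) (val A)
    (%J I x. rint R (eps J I) \<odot>\<^sub>(val A J) mor A I J x) : mod_hom R (cochain_module K A i) (cochain_module K A (i + 1))"
    unfolding cochain_module_def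
  proof (rule lmap_hom)
    fix J assume J: "J : cells K (i + 1)"
    then have JK: "J : K" by (simp add: cells_def)
    interpret module R "val A J" using assms(3)[OF JK] .
    show "module R (val A J)" by (rule assms(3)[OF JK])
    show "finite {I. covered_by K I J}" by (rule finite_subset[OF _ assms(2)]) (auto simp: covered_by_def)
    show "{I. covered_by K I J} \<subseteq> cells K i" using J by (auto simp: cells_def covered_by_def dim_of_def)
    show "(%x. rint R (eps J I) \<odot>\<^sub>(val A J) mor A I J x) : mod_hom R (val A I) (val A J)"
      if "I : {I. covered_by K I J}" for I
      using that assms(5) by (intro mod_hom_comp[OF mod_hom_scale]) (auto intro: module_axioms)
  qed
  note hom = this
  have "module R (cochain_module K A i)"
    unfolding cochain_module_def using assms(3) R by (intro direct_sum_module) (auto simp: cells_def)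
  from this hom show ?thesis by (rule mod_hom_cong) (rule cobd_eq_lmap[OF assms(3,4,5)])
qed

text \<open>The zero of the quotient is the set of boundaries itself, so a cycle whose coset equals
  that set belongs to it.\<close>

lemma trivial_homology_exact:
  assumes R: "cring R" and K: "finite K" and "!!I. I : K ==> module R (val A I)"
    "!!I J. covered_by K J I ==> eps I J : {1, -1}"
    "!!I J. covered_by K J I ==> mor A I J : mod_hom R (val A I) (val A J)"
    and triv: "carrier (homology K eps A i) = {\<zero>\<^sub>(homology K eps A i)}"
    and c: "c : carrier (chain_module K A i)" "bd K eps A i c = \<zero>\<^sub>(chain_module K A (i - 1))"
  shows "EX b:carrier (chain_module K A (i + 1)). bd K eps A (i + 1) b = c"
proof -
  have mod: "module R (chain_module K A j)" for j
    unfolding chain_module_def using assms(3) R by (intro direct_sum_module) (auto simp: cells_def)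
  interpret M: module R "chain_module K A i" by (rule mod)
  have hom: "bd K eps A (i + 1) : mod_hom R (chain_module K A (i + 1)) (chain_module K A i)"
    using bd_hom[OF R K assms(3-5), where i = "i + 1"] by simp
  let ?B = "bd K eps A (i + 1) ` carrier (chain_module K A (i + 1))"
  have B: "submodule ?B R (chain_module K A i)" by (rule submodule_image[OF mod mod hom module.carrier_is_submodule[OF mod]])
  have "?B +>\<^sub>(chain_module K A i) c : carrier (homology K eps A i)"
    unfolding homology_def quot_module_simps using c by auto
  also have "carrier (homology K eps A i) = {?B}" using triv by (simp add: homology_def quot_module_simps(2))
  finally have "?B +>\<^sub>(chain_module K A i) c = ?B" by simp
  then have "c : ?B" using M.coset_self[OF B c(1)] by simp
  then show ?thesis by blast
qed

section \<open>Buchsbaum posets\<close>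

context simplicial
begin

lemma rank_le_dim: "I : S ==> poset_dim S = int n - 1 ==> rank S I <= n"
proof -
  assume I: "I : S" "poset_dim S = int n - 1"
  have "dim_of S I <= poset_dim S" unfolding poset_dim_def using I by (intro Max_ge) auto
  then show ?thesis using I by (simp add: dim_of_def)
qed

lemma top_cell_exists: "poset_dim S = int n - 1 ==> EX I:S. rank S I = n"
proof -
  assume n: "poset_dim S = int n - 1"
  have "S ~= {}" using bot_in by blast
  then have "poset_dim S : dim_of S ` S" unfolding poset_dim_def by (intro Max_in) auto
  then show ?thesis using n by (auto simp: dim_of_def)
qed

text \<open>Vertices are removed from \<open>J\<close> one at a time, so that the chain meets every
  rank from 1 to that of \<open>J\<close>. Exactly this saturation identifies the link of the chain
  later.\<close>

lemma maximal_flag: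
  "J : S ==> EX C:flags (S - {bot_of S}). (ALL x:C. x <= J) & card C = rank S J & (ALL r:{1..rank S J}. EX x:C. rank S x = r)"
proof (induct "rank S J" arbitrary: J)
  case 0
  then show ?case by (intro bexI[of _ "{}"]) auto
next
  case (Suc r)
  then have "J ~= bot_of S" by auto
  then obtain v where v: "v : vb J" using vb_nonempty Suc by blast
  let ?K = "sub J (vb J - {v})"
  have K: "?K : S" "?K <= J" "vb ?K = vb J - {v}" using sub[of J "vb J - {v}"] Suc by auto
  have rK: "rank S ?K = r" using K v card_vb[of ?K] card_vb[of J] Suc by simp
  obtain C where C: "C : flags (S - {bot_of S})" "ALL x:C. x <= ?K" "card C = r" "ALL s:{1..r}. EX x:C. rank S x = s"
    using Suc(1)[of ?K] rK K by auto
  have JC: "J ~: C" using C(2) rank_mono[of J ?K] rK Suc K by auto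
  have "insert J C : flags (S - {bot_of S})"
    using C(1,2) K Suc(3) \<open>J \<noteq> bot_of S\<close> by (auto simp: flags_def chain_def dest: order_trans)
  moreover have "card (insert J C) = Suc r" using C(3) JC flags_finite[OF _ C(1)] by simp
  moreover have "ALL x:insert J C. x <= J" using C(2) K by (auto dest: order_trans)
  moreover have "ALL s:{1..Suc r}. EX x:insert J C. rank S x = s"
  proof
    fix s assume "s : {1..Suc r}"
    then have "s : {1..r} \<or> s = Suc r" by auto
    then show "EX x:insert J C. rank S x = s" using C(4) Suc(2) by auto
  qed
  ultimately show ?case using Suc(2) by (intro bexI[of _ "insert J C"]) auto
qed

text \<open>All subsets of a flag are flags, so the ideal below it is a full power set.\<close>

lemma rank_flags:
  fixes U :: "'q::order set"
  assumes F: "F : flags U" "finite U"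
  shows "rank (flags U) F = card F"
proof -
  have fin: "finite F" using flags_finite F by blast
  have eq: "{G : flags U. G <= F} = Pow F" using flags_subset[OF F(1)] by auto
  obtain h where h: "bij_betw h F {1..card F}" using finite_same_card_bij[OF fin, of "{1..card F}"] by auto
  then have hI: "inj_on h F" "h ` F = {1..card F}" by (auto simp: bij_betw_def)
  have "bij_betw ((`) h) (Pow F) (Pow {1..card F})" using hI by (metis bij_betw_imageI image_Pow_surj inj_on_image_Pow)
  moreover have "G <= G' \<longleftrightarrow> h ` G \<subseteq> h ` G'" if "G : Pow F" "G' : Pow F" for G G'
    using image_subset_iff_of_inj_on[OF hI(1), of G G'] that by auto
  ultimately have "boolean_ideal (flags U) F (card F)" unfolding boolean_ideal_def eq by (intro exI[of _ "(`) h"]) auto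
  then show ?thesis unfolding rank_def using boolean_ideal_unique by blast
qed

lemma subdivision_eq: "subdivision S = flags (S - {bot_of S})" by (simp add: subdivision_def flags_def)

text \<open>Ranks are distinct along a chain and lie in \<open>{1..n}\<close>, which bounds its
  length; a saturated chain below a top cell attains the bound.\<close>

lemma poset_dim_subdivision:
  assumes n: "poset_dim S = int n - 1"
  shows "poset_dim (subdivision S) = int n - 1"
proof -
  let ?K = "flags (S - {bot_of S})"
  have fK: "finite ?K" by (intro finite_flags) simp
  have d: "dim_of ?K F = int (card F) - 1" if "F : ?K" for F using rank_flags[OF that] by (simp add: dim_of_def)
  have le: "card F <= n" if F: "F : ?K" for F
  proof -
    have "inj_on (rank S) F"
    proof (rule inj_onI)
      fix x y assume xy: "x : F" "y : F" "rank S x = rank S y"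
      then show "x = y" using flags_comparable[OF F xy(1,2)] eq_of_rank_eq[of x y] eq_of_rank_eq[of y x] flagsD[OF F] by auto
    qed
    moreover have "rank S ` F \<subseteq> {1..n}"
    proof
      fix r assume "r : rank S ` F"
      then obtain x where x: "x : F" "r = rank S x" by blast
      then have "x : S" "x ~= bot_of S" using flagsD[OF F] by auto
      then show "r : {1..n}" using x rank_le_dim[OF _ n, of x] rank_eq_0_iff[of x] by (auto simp: Suc_le_eq)
    qed
    ultimately show ?thesis using card_inj_on_le[of "rank S" F "{1..n}"] by simp
  qed
  obtain J where "J : S" "rank S J = n" using top_cell_exists[OF n] by blast
  then obtain C where C: "C : ?K" "card C = n" using maximal_flag[of J] by auto
  have "Max (dim_of ?K ` ?K) = int n - 1"
  proof (rule Max_eqI)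
    show "int n - 1 : dim_of ?K ` ?K" using C d by (metis image_eqI)
    show "y <= int n - 1" if y: "y : dim_of ?K ` ?K" for y
    proof -
      obtain F where "F : ?K" "y = dim_of ?K F" using y by blast
      then show ?thesis using d[of F] le[of F] by simp
    qed
  qed (use fK in simp)
  then show ?thesis by (simp add: subdivision_eq poset_dim_def)
qed

end

context signed_poset
begin

text \<open>
  The order complex of the elements above \<open>J\<close> is the link in the subdivision of a maximal flag
  below \<open>J\<close>.
\<close>

lemma link_maximal_flag:
  assumes J: "J : S" "J ~= bot_of S"
    and C: "C : flags (S - {bot_of S})" "ALL x:C. x <= J" "ALL r:{1..rank S J}. EX x:C. rank S x = r"
  shows "link (subdivision S) C = flags (above J J)"
proof
  have r: "rank S J \<ge> 1" using rank_eq_0_iff[OF J(1)] J(2) by simp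
  then obtain x where x: "x : C" "rank S x = rank S J" using bspec[OF C(3), of "rank S J"] by auto
  then have JC: "J : C" using eq_of_rank_eq[of x J] C(2) J flagsD[OF C(1) x(1)] by auto
  show "link (subdivision S) C \<subseteq> flags (above J J)"
  proof
    fix F assume "F : link (subdivision S) C"
    then have F: "F : flags (S - {bot_of S})" "F \<inter> C = {}" "F \<union> C : flags (S - {bot_of S})"
      by (auto simp: link_def subdivision_eq)
    have "y : above J J" if y: "y : F" for y
    proof -
      have yS: "y : S" "y ~= bot_of S" using flagsD[OF F(1) y] by auto
      have yJ: "y ~= J" using JC F(2) y by blast
      \<comment> \<open>If \<open>y\<close> were below \<open>J\<close>, its rank would already be
        taken by an element of \<open>C\<close>. Comparable elements of equal rank coincide, so
        \<open>y\<close> would belong to \<open>C\<close>.\<close>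
      have "\<not> y <= J"
      proof
        assume le: "y <= J"
        have "rank S y : {1..rank S J}"
          using rank_mono[OF yS(1) J(1) le] rank_eq_0_iff[OF yS(1)] yS(2) by (auto simp: Suc_le_eq)
        then obtain z where z: "z : C" "rank S z = rank S y" using C(3) by blast
        have "z : S" using flagsD[OF C(1) z(1)] by simp
        then have "y = z" using flags_comparable[OF F(3), of y z] y z yS eq_of_rank_eq[of y z] eq_of_rank_eq[of z y] by auto
        then show False using z(1) y F(2) by blast
      qed
      then have "J <= y" using flags_comparable[OF F(3), of y J] y JC by auto
      then show ?thesis using yS yJ by (auto simp: above_def less_le)
    qed
    then show "F : flags (above J J)" using F(1) by (auto simp: flags_def)
  qed
  show "flags (above J J) \<subseteq> link (subdivision S) C"
  proof
    fix F assume F: "F : flags (above J J)"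
    have gt: "J < y" "y : S" if "y : F" for y using flagsD[OF F that] by (auto simp: above_def)
    have "F \<inter> C = {}"
    proof (rule ccontr)
      assume "F \<inter> C ~= {}"
      then obtain y where "y : F" "y : C" by blast
      then show False using gt(1)[of y] C(2) by (meson leD)
    qed
    moreover have nb: "y ~= bot_of S" if "y : F" for y using gt(1)[OF that] le_bot[OF J(1)] J(2) less_imp_le by blast
    moreover have "x <= y" if "x : C" "y : F" for x y using C(2) gt(1)[OF that(2)] that(1) by (meson less_imp_le order_trans)
    then have "F \<union> C : flags (S - {bot_of S})" using F C(1) gt nb unfolding flags_def chain_def by blast
    ultimately show "F : link (subdivision S) C" using F gt nb by (auto simp: link_def subdivision_eq flags_def)
  qed
qed

text \<open>Homology is defined through the covering relation of a face poset, while the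
  contractions speak of \<open>flag_up\<close>; here the two meet.\<close>

lemma flags_covered_by:
  assumes "finite U" "G : flags U"
  shows "{F. covered_by (flags U) G F} = flag_up U G"
proof (intro equalityI subsetI)
  fix F assume "F : {F. covered_by (flags U) G F}"
  then have F: "F : flags U" "G \<subset> F" "card F = Suc (card G)"
    using rank_flags[OF _ assms(1)] assms(2) by (auto simp: covered_by_def)
  have "card (F - G) = 1" using F flags_finite[OF assms] by (subst card_Diff_subset) auto
  then obtain x where "F - G = {x}" using card_1_singletonE by blast
  then show "F : flag_up U G" using F by (auto simp: flag_up_def)
next
  fix F assume "F : flag_up U G"
  then obtain x where x: "x ~: G" "F = insert x G" "F : flags U" by (auto simp: flag_up_def)
  then show "F : {F. covered_by (flags U) G F}"
    using assms rank_flags[of F U] rank_flags[of G U] flags_finite[OF assms] by (auto simp: covered_by_def)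
qed

text \<open>The Buchsbaum condition speaks of every sign convention on the link; this makes the
  position signs an admissible choice.\<close>

lemma flag_sign_convention:
  assumes U: "finite (U :: 'p set)"
  shows "sign_convention (flags U) flag_sign" unfolding sign_convention_def
proof (intro conjI allI ballI impI)
  show "flag_sign J I : {1, - 1}" for I J :: "'p set" by (rule flag_sign_pm)
  fix I J J' J'' assume S: "I : flags U" "J : flags U" "J' : flags U" "J'' : flags U"
    and r: "I < J & rank (flags U) J = rank (flags U) I + 2"
    and m: "I < J' & J' < J & I < J'' & J'' < J & J' ~= J''"
  have fin: "finite I" "finite J" "finite J'" "finite J''" using flags_finite[OF U] S by auto
  have rk: "card J = Suc (Suc (card I))" using r rank_flags[OF S(1) U] rank_flags[OF S(2) U] by simp
  have mid: "covered_by (flags U) I L & covered_by (flags U) L J" if L: "L : flags U" "I < L" "L < J" for L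
  proof -
    have fL: "finite L" using flags_finite[OF U L(1)] .
    have "card I < card L" "card L < card J" using L fin fL by (auto intro: psubset_card_mono)
    then show ?thesis using L S rk rank_flags[OF _ U] by (auto simp: covered_by_def)
  qed
  have up: "L : flag_up U I & J : flag_up U L" if "L : flags U" "I < L" "L < J" for L
    using mid[OF that] flags_covered_by[OF U] S that by blast
  have 1: "J' : flag_up U I" "J : flag_up U J'" and 2: "J'' : flag_up U I" "J : flag_up U J''" using up S m by auto
  obtain F' where F': "F' ~= J'" "{L : flag_up U I. J : flag_up U L} = {J', F'}"
    "flag_sign J J' * flag_sign J' I + flag_sign J F' * flag_sign F' I = 0" using flag_diamond[OF U S(1) 1] by blast
  have "J'' = F'" using F'(2) 2 m by blast
  then show "flag_sign J J' * flag_sign J' I + flag_sign J J'' * flag_sign J'' I = 0" using F'(3) by simp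
qed

text \<open>A saturated chain below \<open>J\<close> is a simplex of the subdivision whose link is
  the complex of flags above \<open>J\<close>, so vanishing of the reduced homology of this link is
  acyclicity of flags. The rest converts between extensional chains of the face poset and total
  functions on flags.\<close>

lemma buchsbaum_flag_acyclic:
  assumes B: "buchsbaum_poset R S" and n: "poset_dim S = int n - 1" and J: "J : S" "J ~= bot_of S"
  shows "flag_acyclic (ring_as_module R) J (n - rank S J)" unfolding flag_acyclic_def
proof (intro allI impI)
  interpret RM: module R "ring_as_module R" by (rule ring_as_module_is_module[OF is_cring])
  let ?L = "flags (above J J)"
  let ?A = "\<lparr>val = (%_. ring_as_module R), mor = (%_ _ x. x)\<rparr> :: ('p set, 'k, 'k) coeff_system"
  have fU: "finite (above J J)" by simp
  have fL: "finite ?L" by (rule finite_flags[OF fU])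
  obtain C where C: "C : flags (S - {bot_of S})" "ALL x:C. x <= J" "card C = rank S J"
    "ALL r:{1..rank S J}. EX x:C. rank S x = r" using maximal_flag[OF J(1)] by blast
  have link: "link (subdivision S) C = ?L" by (rule link_maximal_flag[OF J C(1,2,4)])
  have "C ~= {}" using C(3) rank_eq_0_iff[OF J(1)] J(2) by auto
  \<comment> \<open>The excluded dimension belongs to the link of a simplex with
    \<open>card C = rank S J\<close> vertices in a complex of dimension
    \<open>n - 1\<close>.\<close>
  then have triv: "carrier (homology ?L flag_sign ?A i) = {\<zero>\<^sub>(homology ?L flag_sign ?A i)}"
    if "i ~= int n - 1 - int (rank S J)" for i using B that C flag_sign_convention[OF fU] link poset_dim_subdivision[OF n]
    unfolding buchsbaum_poset_def buchsbaum_complex_def reduced_homology_def subdivision_eq by metis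
  fix t z
  assume t: "t < n - rank S J"
    and "(ALL F:?L. card F = t --> z F : carrier (ring_as_module R)) &
      (ALL G:?L. Suc (card G) = t --> inc (ring_as_module R) (flag_up (above J J)) fs z G = \<zero>\<^sub>(ring_as_module R))"
  then have z: "!!F. F : ?L ==> card F = t ==> z F : carrier R"
    "!!G. G : ?L ==> Suc (card G) = t ==> inc (ring_as_module R) (flag_up (above J J)) fs z G = \<zero>" by auto
  have cells: "cells ?L i = {F : ?L. int (card F) = i + 1}" for i
    using rank_flags[OF _ fU] by (auto simp: cells_def dim_of_def)
  have A: "module R (val ?A I)" "mor ?A I I' : mod_hom R (val ?A I) (val ?A I')" for I I'
    using RM.module_axioms by (auto intro: mod_homI)
  have bd: "bd ?L flag_sign ?A i c G = inc (ring_as_module R) (flag_up (above J J)) fs c G"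
    if "c : carrier (chain_module ?L ?A i)" "G : cells ?L (i - 1)" for c i G
  proof -
    have "bd ?L flag_sign ?A i c = lmap (cells ?L (i - 1)) (%J. {I. covered_by ?L J I}) (val ?A)
        (%J I x. rint R (flag_sign I J) \<odot>\<^sub>(val ?A J) mor ?A I J x) c"
      by (rule bd_eq_lmap[OF A(1) flag_sign_pm A(2) that(1)])
    then show ?thesis using that(2) flags_covered_by[OF fU, of G] by (simp add: lmap_def inc_def fs_def cells_def)
  qed
  \<comment> \<open>Elements of chain modules are extensional, hence the cut to flags with
    \<open>t\<close> elements, which have dimension \<open>t - 1\<close>.\<close>
  define c where "c = (\<lambda>F\<in>cells ?L (int t - 1). z F)"
  have c: "c : carrier (chain_module ?L ?A (int t - 1))" using z(1) by (auto simp: c_def chain_module_def cells)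
  have cd: "F : ?L" "card F = Suc (card G)" if "F : flag_up (above J J) G" for F G
    using that flags_finite[OF fU, of F] by (auto simp: flag_up_def)
  have cz: "inc (ring_as_module R) (flag_up (above J J)) fs c G = inc (ring_as_module R) (flag_up (above J J)) fs z G"
    if "Suc (card G) = t" for G using cd[of _ G] that z(1) by (intro RM.inc_cong) (auto simp: c_def cells)
  have "bd ?L flag_sign ?A (int t - 1) c = \<zero>\<^sub>(chain_module ?L ?A (int t - 1 - 1))"
  proof
    fix G
    show "bd ?L flag_sign ?A (int t - 1) c G = \<zero>\<^sub>(chain_module ?L ?A (int t - 1 - 1)) G"
    proof (cases "G : cells ?L (int t - 1 - 1)")
      case True
      then have "G : ?L" "Suc (card G) = t" by (auto simp: cells)
      then show ?thesis using bd[OF c True] cz z(2)[of G] True by (simp add: chain_module_def)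
    qed (simp add: bd_def chain_module_def)
  qed
  note closed = this
  \<comment> \<open>The bound on \<open>t\<close> keeps the dimension \<open>t - 1\<close> below the
    only one in which the link may have homology.\<close>
  have ne: "int t - 1 ~= int n - 1 - int (rank S J)" using t by simp
  obtain b where b: "b : carrier (chain_module ?L ?A (int t - 1 + 1))" "bd ?L flag_sign ?A (int t - 1 + 1) b = c"
    using trivial_homology_exact[OF is_cring fL A(1) flag_sign_pm A(2) triv[OF ne] c closed] by blast
  have "b F : carrier R" if "F : ?L" "card F = Suc t" for F
  proof -
    have "F : cells ?L (int t - 1 + 1)" using that by (simp add: cells)
    then show ?thesis using b(1) PiE_mem[of b "cells ?L (int t - 1 + 1)" "%_. carrier R" F] by (simp add: chain_module_def)
  qed
  moreover have "inc (ring_as_module R) (flag_up (above J J)) fs b F = z F" if F: "F : ?L" "card F = t" for F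
  proof -
    have Fc: "F : cells ?L (int t - 1)" using F by (simp add: cells)
    then show ?thesis using bd[OF b(1), of F] b(2) by (simp add: c_def)
  qed
  ultimately show "EX w. (ALL F:?L. card F = Suc t --> w F : carrier (ring_as_module R)) &
      (ALL F:?L. card F = t --> inc (ring_as_module R) (flag_up (above J J)) fs w F = z F)" by (intro exI[of _ b]) auto
qed

end

section \<open>The fundamental class of an orientable homology manifold\<close>

section \<open>Homology manifolds\<close>

lemma ground_ring_cring: "ground_ring R ==> cring R"
  unfolding ground_ring_def using domain.axioms(1) field.axioms(1) by blast

lemma ground_ring_one_neq_zero:
  assumes "ground_ring R" shows "\<one>\<^sub>R ~= \<zero>\<^sub>R"
proof (cases "field R")
  case True
  then show ?thesis using domain.one_not_zero field.axioms(1) by blast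
next
  case False
  then have "cring R" "R \<simeq> \<Z>" using assms by (auto simp: ground_ring_def)
  then obtain h where h: "h : ring_iso R \<Z>" by (auto simp: is_ring_iso_def)
  interpret R: cring R by fact
  have "h \<one>\<^sub>R = 1" "h \<zero>\<^sub>R = 0"
    using h ring_hom_one[of h R \<Z>] ring_hom_zero[of h R \<Z>] R.ring_axioms int.ring_axioms by (auto simp: ring_iso_def)
  then show ?thesis by auto
qed

context signed_poset
begin

abbreviation "RM \<equiv> ring_as_module R"
abbreviation "bdR \<equiv> inc RM (cov {}) e"

lemma RM_module: "module R RM" by (rule ring_as_module_is_module[OF is_cring])

text \<open>A fundamental class in coordinates, together with its characteristic property on every
  star: relative top cycles are its multiples. The empty cell is left out of the cycle condition
  because for \<open>n = 1\<close> it has codimension one, and the class need not be a cycle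
  there.\<close>

definition fundamental :: "nat => ('p => 'k) => bool" where
  "fundamental n u \<longleftrightarrow> (ALL F:S. rank S F = n --> u F : Units R) &
    (ALL K:S. K ~= bot_of S & Suc (rank S K) = n --> bdR u K = \<zero>) &
    (ALL J:S. J ~= bot_of S --> (EX F:S. J <= F & rank S F = n)) &
    (ALL J:S. J ~= bot_of S --> (ALL c. (ALL F:S. J <= F & rank S F = n --> c F : carrier R) &
      (ALL K:S. J <= K & Suc (rank S K) = n --> bdR c K = \<zero>) -->
      (EX l:carrier R. ALL F:S. J <= F & rank S F = n --> c F = l \<otimes> u F)))"

lemma fundamental_cycle:
  assumes "fundamental n u" "J : S" "J ~= bot_of S"
    "!!F. F : S ==> J <= F ==> rank S F = n ==> c F : carrier R"
    "!!K. K : S ==> J <= K ==> Suc (rank S K) = n ==> bdR c K = \<zero>"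
  shows "EX l:carrier R. ALL F:S. J <= F & rank S F = n --> c F = l \<otimes> u F" using assms by (simp add: fundamental_def)

text \<open>In top dimension a class at \<open>J\<close> is just the restriction of a relative cycle
  to the star of \<open>J\<close>. The isomorphism with the constant sheaf sends it to a scalar, and
  by naturality this scalar can be read off at any top cell \<open>F\<close> above \<open>J\<close>
  as the coefficient at \<open>F\<close> times a weight of \<open>F\<close>. So the coefficients are
  proportional to the inverses of the weights, which form the class.\<close>

lemma manifold_fundamental:
  assumes iso: "sheaf_isomorphic R S (local_homology_sheaf R S eps (poset_dim S)) (constant_system R S)"
    and n: "poset_dim S = int n - 1" and one: "\<one> ~= \<zero>"
  shows "EX u. fundamental n u"
proof -
  interpret RM: module R RM by (rule RM_module)
  let ?A = "constant_system R S" and ?b = "bot_of S"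
  let ?Z = "%J. rel_cycles R S eps (S - open_star S J) (poset_dim S)"
  let ?B = "%J. rel_boundaries R S eps (S - open_star S J) (poset_dim S)"
  let ?C = "chain_module S ?A (poset_dim S)"
  let ?X = "cells S (poset_dim S)"
  have X: "?X = {F : S. rank S F = n}" by (auto simp: cells_def dim_of_def n)
  show ?thesis
  proof (cases "n = 0")
    \<comment> \<open>Only the empty cell is present, and it merely has to carry a unit.\<close>
    case True
    have "I = ?b" if "I : S" for I using rank_le_dim[OF that n] rank_eq_0_iff[OF that] True by simp
    then show ?thesis using True by (intro exI[of _ "%_. \<one>"]) (auto simp: fundamental_def)
  next
    case False
    then have topnb: "F ~= ?b" if "F : ?X" for F using that X by auto
    have val: "val ?A I = RM" if "I ~= ?b" for I using that by (simp add: constant_system_def)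
    have mor: "mor ?A I J x = x" if "J ~= ?b" for I J x using that by (simp add: constant_system_def)
    have Cc: "c : carrier ?C \<longleftrightarrow> c : extensional ?X & (ALL F:?X. c F : carrier R)" for c
      using val topnb by (auto simp: chain_module_def PiE_iff)
    have Cadd: "(c \<oplus>\<^sub>?C d) F = c F \<oplus> d F" if "F : ?X" for c d F
      using val topnb that by (simp add: chain_module_def)
    have bd: "bd S eps ?A (poset_dim S) c K = bdR c K"
      if c: "ALL F:?X. c F : carrier R" and K: "K : S" "K ~= ?b" "Suc (rank S K) = n" for c K
    proof -
      have Kc: "K : cells S (poset_dim S - 1)" using K n by (auto simp: cells_def dim_of_def)
      have F: "F : ?X" if "covered_by S K F" for F using covered_byD[OF that] K X by simp
      have "(\<Oplus>\<^bsub>RM\<^esub>I\<in>{I. covered_by S K I}. [eps I K] \<cdot>\<^bsub>RM\<^esub> mor ?A I K (c I)) =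
          (\<Oplus>\<^bsub>RM\<^esub>I\<in>cov {} K. e I K \<odot>\<^sub>RM c I)"
      proof (rule RM.M.finsum_cong')
        show "{I. covered_by S K I} = cov {} K" by (simp add: cov_def)
        show "(%I. e I K \<odot>\<^sub>RM c I) : cov {} K \<rightarrow> carrier RM" using c F by (auto simp: cov_def)
        fix I assume "I : cov {} K"
        then have I: "covered_by S K I" by (simp add: cov_def)
        then show "[eps I K] \<cdot>\<^bsub>RM\<^esub> mor ?A I K (c I) = e I K \<odot>\<^sub>RM c I"
          using eps_smult[OF RM_module, of "c I" K I] c F[OF I] mor[OF K(2)] by simp
      qed
      then show ?thesis using Kc val[OF K(2)] by (simp add: bd_def inc_def)
    qed
    have Z: "c : ?Z J \<longleftrightarrow> c : carrier ?C & (ALL K:S. J <= K & Suc (rank S K) = n --> bdR c K = \<zero>)"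
      if J: "J : S" "J ~= ?b" for c J
    proof -
      have K: "cells S (poset_dim S - 1) - (S - open_star S J) = {K : S. J <= K & Suc (rank S K) = n}"
        by (auto simp: cells_def dim_of_def n open_star_def)
      have nb: "K ~= ?b" if "J <= K" for K using that le_bot J by auto
      show ?thesis unfolding rel_cycles_def K using bd Cc nb by fastforce
    qed
    \<comment> \<open>There are no cells above the top dimension, so relative boundaries reduce to
      chains vanishing on the star.\<close>
    have B: "t : ?B J \<longleftrightarrow> t : carrier ?C & (ALL F:?X. J <= F --> t F = \<zero>)"
      if J: "J : S" "J ~= ?b" for t J
    proof -
      have "cells S (poset_dim S + 1) = {}" using rank_le_dim[OF _ n] by (force simp: cells_def dim_of_def n)
      then have bC: "b : carrier (chain_module S ?A (poset_dim S + 1))" if "b = (%x. undefined)" for b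
        using that by (simp add: chain_module_def)
      have nocov: "{I. covered_by S K I} = {}" if "K : ?X" for K
        using that covered_byD[of K] rank_le_dim[OF _ n] X by fastforce
      have bz: "bd S eps ?A (poset_dim S + 1) b = \<zero>\<^sub>?C" for b
      proof
        fix K show "bd S eps ?A (poset_dim S + 1) b K = \<zero>\<^sub>?C K"
        proof (cases "K : ?X")
          case True
          then have K1: "K : cells S (poset_dim S + 1 - 1)" by simp
          have "bd S eps ?A (poset_dim S + 1) b K =
              (\<Oplus>\<^bsub>val ?A K\<^esub>I\<in>{}. [eps I K] \<cdot>\<^bsub>val ?A K\<^esub> mor ?A I K (b I))"
            unfolding bd_def restrict_apply'[OF K1] nocov[OF True] ..
          then show ?thesis using True topnb[OF True] val[of K] RM.M.finsum_empty by (simp add: chain_module_def)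
        qed (simp add: bd_def chain_module_def)
      qed
      have z: "\<zero>\<^sub>?C \<oplus>\<^sub>?C t = t" if "t : carrier ?C" for t
      proof
        fix F show "(\<zero>\<^sub>?C \<oplus>\<^sub>?C t) F = t F"
          using that topnb[of F] val[of F] by (cases "F : ?X") (auto simp: chain_module_def PiE_iff extensional_def)
      qed
      have X': "?X - (S - open_star S J) = {F : ?X. J <= F}" by (auto simp: open_star_def cells_def)
      show ?thesis
      proof
        assume "t : ?B J"
        then show "t : carrier ?C & (ALL F:?X. J <= F --> t F = \<zero>)" unfolding rel_boundaries_def bz X' using z by auto
      next
        assume t: "t : carrier ?C & (ALL F:?X. J <= F --> t F = \<zero>)"
        then have "t = \<zero>\<^sub>?C \<oplus>\<^sub>?C t" using z by simp
        then show "t : ?B J" unfolding rel_boundaries_def bz X' using bC[OF refl] t by blast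
      qed
    qed
    obtain h where h: "!!I. I : S ==> h I : mod_iso R (val (local_homology_sheaf R S eps (poset_dim S)) I) (val ?A I)"
      and nat: "!!I J x. I : S ==> J : S ==> I <= J ==> x : carrier (val (local_homology_sheaf R S eps (poset_dim S)) I) ==>
        h J (mor (local_homology_sheaf R S eps (poset_dim S)) I J x) = mor ?A I J (h I x)"
      using iso unfolding sheaf_isomorphic_def by (elim exE conjE) (rule that, blast+)
    let ?cl = "%J c. ?B J +>\<^sub>?C c"
    have Uval: "val (local_homology_sheaf R S eps (poset_dim S)) J = quot_module (?C\<lparr>carrier := ?Z J\<rparr>) (?B J)"
      if "J ~= ?b" for J using that by (simp add: local_homology_sheaf_def rel_homology_def)
    have carr: "carrier (quot_module (?C\<lparr>carrier := ?Z J\<rparr>) (?B J)) = ?cl J ` ?Z J" for J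
      by (auto simp: quot_module_simps)
    have hJ: "h J : mod_hom R (quot_module (?C\<lparr>carrier := ?Z J\<rparr>) (?B J)) RM"
      "bij_betw (h J) (?cl J ` ?Z J) (carrier R)" if J: "J : S" "J ~= ?b" for J
      using h[OF J(1)] unfolding Uval[OF J(2)] val[OF J(2)] mod_iso_def carr by auto
    have Cmod: "module R ?C" unfolding chain_module_def
    proof (rule direct_sum_module[OF is_cring])
      fix I assume "I : ?X"
      then show "module R (val ?A I)" using val topnb RM_module by simp
    qed
    interpret C: module R ?C by (rule Cmod)
    have Csm: "(r \<odot>\<^sub>?C c) F = r \<otimes> c F" if "F : ?X" for r c F
      using val topnb that by (simp add: chain_module_def)
    have Cz: "\<zero>\<^sub>?C F = \<zero>" if "F : ?X" for F using val topnb that by (simp add: chain_module_def)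
    have Bsub: "submodule (?B J) R ?C" if J: "J : S" "J ~= ?b" for J
    proof (rule C.submoduleI)
      show "?B J \<subseteq> carrier ?C" using B[OF J] by blast
      show "\<zero>\<^sub>?C : ?B J" using B[OF J] Cz C.M.zero_closed by blast
      show "a \<oplus>\<^sub>?C b : ?B J" if "a : ?B J" "b : ?B J" for a b using that B[OF J] Cadd C.M.a_closed by simp
      show sm: "r \<odot>\<^sub>?C a : ?B J" if "r : carrier R" "a : ?B J" for r a
        using that B[OF J] Csm C.smult_closed by simp
      show "\<ominus>\<^sub>?C a : ?B J" if "a : ?B J" for a
      proof -
        have "\<ominus>\<^sub>?C a = (\<ominus> \<one>) \<odot>\<^sub>?C a" using that B[OF J] by (simp add: C.smult_l_minus)
        then show ?thesis using sm[OF _ that] by simp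
      qed
    qed
    have ZC: "c : carrier ?C" if "c : ?Z J" "J : S" "J ~= ?b" for c J using Z that by blast
    \<comment> \<open>Consequently a class at \<open>J\<close> amounts to the coefficients on the
      top cells of the star.\<close>
    have cl_eq: "?cl J c = ?cl J d \<longleftrightarrow> (ALL F:?X. J <= F --> c F = d F)"
      if J: "J : S" "J ~= ?b" and c: "c : carrier ?C" "d : carrier ?C" for c d J
    proof -
      have Rc: "c F : carrier R" "d F : carrier R" if "F : ?X" for F using c Cc that by auto
      have neg: "(c \<ominus>\<^sub>?C d) F = c F \<ominus> d F" if "F : ?X" for F
      proof -
        have "c \<ominus>\<^sub>?C d = c \<oplus>\<^sub>?C (\<ominus> \<one>) \<odot>\<^sub>?C d"
          using c by (simp add: a_minus_def C.smult_l_minus)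
        then show ?thesis using Cadd[OF that] Csm[OF that] Rc[OF that] by (simp add: l_minus a_minus_def)
      qed
      have iff: "c F \<ominus> d F = \<zero> \<longleftrightarrow> c F = d F" if "F : ?X" for F
      proof
        assume "c F \<ominus> d F = \<zero>"
        then have "c F = \<ominus> (\<ominus> d F)" using Rc[OF that] by (intro sum_zero_eq_neg) (auto simp: a_minus_def)
        then show "c F = d F" using Rc[OF that] by simp
      qed (use Rc[OF that] in \<open>simp add: a_minus_def r_neg\<close>)
      show ?thesis using C.coset_eq_iff[OF Bsub[OF J] c] B[OF J] neg iff c by simp
    qed
    \<comment> \<open>Naturality of \<open>h\<close> and constancy of the target: a class at
      \<open>J\<close> and its restriction to a cell above \<open>J\<close> have the same
      value.\<close>
    have restr: "h F (?cl F c) = h J (?cl J c)"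
      if J: "J : S" "J ~= ?b" and F: "F : S" "J <= F" and c: "c : ?Z J" for J F c
    proof -
      have Fb: "F ~= ?b" using F le_bot J by auto
      have cC: "c : carrier ?C" using ZC[OF c J] .
      have "mor (local_homology_sheaf R S eps (poset_dim S)) J F (?cl J c) = (\<Union>x\<in>?cl J c. ?cl F x)"
        by (simp add: local_homology_sheaf_def quot_map_def)
      also have "\<dots> = ?cl F c"
      proof -
        have "?cl F x = ?cl F c" if x: "x : ?cl J c" for x
        proof -
          note x' = C.in_coset[OF Bsub[OF J] cC x]
          have "ALL G:?X. F <= G --> x G = c G" using cl_eq[OF J x'(1) cC] x'(2) F(2) by (meson order_trans)
          then show ?thesis using cl_eq[OF F(1) Fb x'(1) cC] by simp
        qed
        then show ?thesis using C.coset_self[OF Bsub[OF J] cC] by blast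
      qed
      finally have "h F (?cl F c) = mor ?A J F (h J (?cl J c))"
        using nat[OF J(1) F(1) F(2), of "?cl J c"] c unfolding Uval[OF J(2)] carr by simp
      then show ?thesis using mor[OF Fb] by simp
    qed
    have Zsm: "r \<odot>\<^sub>?C c : ?Z F" if "r : carrier R" "F : ?X" "c : carrier ?C" for r c F
    proof -
      have F: "F : S" "F ~= ?b" using that X topnb by auto
      have "\<not> (F <= K & Suc (rank S K) = n)" if "K : S" for K
        using rank_mono[OF F(1) that] X \<open>F \<in> ?X\<close> by auto
      then show ?thesis using Z[OF F] C.smult_closed that by blast
    qed
    have ZF: "c : ?Z F" if "F : ?X" "c : carrier ?C" for c F using Zsm[OF one_closed that] that by simp
    \<comment> \<open>At a top cell every chain is a relative cycle, and its class is its
      coefficient there times the class of this indicator. The value of the indicator class is the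
      weight of the cell.\<close>
    define one_at where "one_at F = (\<lambda>G\<in>?X. if G = F then \<one> else \<zero>)" for F
    have oneC: "one_at F : carrier ?C" for F using Cc by (auto simp: one_at_def)
    define wt where "wt F = h F (?cl F (one_at F))" for F
    have single: "G = F" if "F : ?X" "G : ?X" "F <= G" for F G using eq_of_rank_eq[of F G] that X by auto
    have hF: "h F (?cl F c) = c F \<otimes> wt F" and wtR: "wt F : carrier R" if F: "F : ?X" and c: "c : carrier ?C" for c F
    proof -
      have FS: "F : S" "F ~= ?b" using F X topnb by auto
      have cF: "c F : carrier R" using Cc c F by blast
      have oneZ: "one_at F : ?Z F" using ZF[OF F oneC] .
      have sC: "c F \<odot>\<^sub>?C one_at F : carrier ?C" using cF oneC by simp
      have "?cl F c = ?cl F (c F \<odot>\<^sub>?C one_at F)"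
        using cl_eq[OF FS c sC] single[OF F] Csm cF F by (auto simp: one_at_def)
      also have "\<dots> = c F \<odot>\<^sub>(quot_module (?C\<lparr>carrier := ?Z F\<rparr>) (?B F)) ?cl F (one_at F)"
        using C.coset_smult[OF Bsub[OF FS] oneC cF] by (simp add: quot_module_simps)
      finally show "h F (?cl F c) = c F \<otimes> wt F"
        using mod_hom_smult[OF hJ(1)[OF FS] cF, of "?cl F (one_at F)"] oneZ by (simp add: carr wt_def)
      show "wt F : carrier R" using mod_hom_closed[OF hJ(1)[OF FS], of "?cl F (one_at F)"] oneZ by (simp add: carr wt_def)
    qed
    \<comment> \<open>\<open>h F\<close> is onto, so some multiple of the weight is
      \<open>\<one>\<close>.\<close>
    have wtU: "wt F : Units R" if F: "F : ?X" for F
    proof -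
      have FS: "F : S" "F ~= ?b" using F X topnb by auto
      have "\<one> : h F ` ?cl F ` ?Z F" using hJ(2)[OF FS] by (auto simp: bij_betw_def)
      then obtain c where c: "c : ?Z F" "h F (?cl F c) = \<one>" by auto
      have "c F \<otimes> wt F = \<one>" using hF[OF F ZC[OF c(1) FS]] c(2) by simp
      moreover have "c F : carrier R" using Cc ZC[OF c(1) FS] F by blast
      ultimately show ?thesis using wtR[OF F oneC] m_comm unfolding Units_def by auto
    qed
    \<comment> \<open>With this normalisation, a class of value \<open>l\<close> has the coefficient
      \<open>l\<close> times \<open>u F\<close> at every top cell \<open>F\<close> of its
      star.\<close>
    define u where "u F = inv wt F" for F
    have u: "u F : Units R" "u F : carrier R" if "F : ?X" for F using wtU[OF that] by (auto simp: u_def)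
    have uw: "c F = l \<otimes> u F" if "F : ?X" "c F : carrier R" "c F \<otimes> wt F = l" for c :: "'p => 'k" and F l
      using that wtU[OF that(1)] wtR[OF that(1) oneC] by (simp add: u_def m_assoc Units_closed flip: that(3))
    have coef: "c F = h J (?cl J c) \<otimes> u F" if J: "J : S" "J ~= ?b" and c: "c : ?Z J" and F: "F : ?X" "J <= F" for J c F
      using uw[OF F(1), of c] hF[OF F(1) ZC[OF c J]] restr[OF J _ F(2) c] Cc ZC[OF c J] F X by auto
    have gen: "EX c:?Z J. (ALL F:?X. J <= F --> c F = u F) & h J (?cl J c) = \<one>" if J: "J : S" "J ~= ?b" for J
    proof -
      have "\<one> : h J ` ?cl J ` ?Z J" using hJ(2)[OF J] by (auto simp: bij_betw_def)
      then obtain c where c: "c : ?Z J" "h J (?cl J c) = \<one>" by auto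
      then show ?thesis using coef[OF J c(1)] u by auto
    qed
    have "fundamental n u" unfolding fundamental_def
    proof (intro conjI ballI impI allI)
      fix F assume "F : S" "rank S F = n"
      then show "u F : Units R" using u X by blast
    next
      fix K assume K: "K : S" "K ~= ?b & Suc (rank S K) = n"
      \<comment> \<open>The class of value \<open>\<one>\<close> at \<open>K\<close> has the
        coefficients of \<open>u\<close> on the star of \<open>K\<close>, and the boundary at
        \<open>K\<close> sees no other cells.\<close>
      then obtain c where c: "c : ?Z K" "ALL F:?X. K <= F --> c F = u F" using gen by blast
      have F: "F : ?X & K <= F" if "F : cov {} K" for F using that covered_byD[of K F] K X by (auto simp: cov_def)
      have "bdR u K = bdR c K" using F c(2) u ZC[OF c(1)] K Cc by (intro RM.inc_cong) auto
      then show "bdR u K = \<zero>" using Z[of K c] c(1) K by auto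
    next
      fix J assume J: "J : S" "J ~= ?b"
      then obtain c where c: "c : ?Z J" "h J (?cl J c) = \<one>" using gen by blast
      show "EX F:S. J <= F & rank S F = n"
      proof (rule ccontr)
        assume "\<not> ?thesis"
        \<comment> \<open>Without top cells in the star all chains have the same class, so a class
          of value \<open>\<one>\<close> would also be zero.\<close>
        then have "?cl J c = ?cl J (\<zero>\<^sub>R \<odot>\<^sub>?C c)"
          using cl_eq[OF J ZC[OF c(1) J], of "\<zero>\<^sub>R \<odot>\<^sub>?C c"] ZC[OF c(1) J] X by auto
        also have "\<dots> = \<zero> \<odot>\<^sub>(quot_module (?C\<lparr>carrier := ?Z J\<rparr>) (?B J)) ?cl J c"
          using C.coset_smult[OF Bsub[OF J] ZC[OF c(1) J] zero_closed] by (simp add: quot_module_simps)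
        finally have "h J (?cl J c) = \<zero> \<otimes> h J (?cl J c)"
          using mod_hom_smult[OF hJ(1)[OF J] zero_closed, of "?cl J c"] c(1) by (simp add: carr)
        then show False using c(2) one by simp
      qed
    next
      fix J c
      assume J: "J : S" "J ~= ?b"
        and c: "(ALL F:S. J <= F & rank S F = n --> c F : carrier R) &
          (ALL K:S. J <= K & Suc (rank S K) = n --> bdR c K = \<zero>)"
      \<comment> \<open>Extended by zero, since only the values on the star are known to lie in the
        ring; the cycle condition concerns the star alone.\<close>
      define d where "d = (\<lambda>F\<in>?X. if J <= F then c F else \<zero>)"
      have dC: "d : carrier ?C" using Cc c X by (auto simp: d_def)
      have "bdR d K = \<zero>" if K: "K : S" "J <= K" "Suc (rank S K) = n" for K
      proof -
        have F: "F : ?X & J <= F" if "F : cov {} K" for F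
          using that covered_byD[of K F] K X by (auto simp: cov_def dest: order_trans)
        have "bdR d K = bdR c K" using F c X by (intro RM.inc_cong) (auto simp: d_def)
        then show ?thesis using c K by simp
      qed
      then have dZ: "d : ?Z J" using Z[OF J] dC by blast
      have "h J (?cl J d) : carrier R" using mod_hom_closed[OF hJ(1)[OF J], of "?cl J d"] dZ by (simp add: carr)
      moreover have "c F = h J (?cl J d) \<otimes> u F" if "F : S" "J <= F" "rank S F = n" for F
        using coef[OF J dZ, of F] that X by (simp add: d_def)
      ultimately show "EX l:carrier R. ALL F:S. J <= F & rank S F = n --> c F = l \<otimes> u F" by blast
    qed
    then show ?thesis by (rule exI[of _ u])
  qed
qed

section \<open>Exactness of stars for cochains with values in an arbitrary module\<close>

section \<open>Contracting the stars\<close>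

text \<open>Coboundaries within the star of \<open>J\<close> sum over those facets that still belong
  to the star.\<close>

definition dn :: "'p => 'p => 'p set" where
  "dn J I = {L. covered_by S L I & J <= L}"

abbreviation "et \<equiv> (%L I. e I L)"
abbreviation "dnR J \<equiv> inc RM (dn J) et"

lemma dn_sub: "dn J I \<subseteq> S" using covered_byD by (auto simp: dn_def)

lemma finite_dn [simp]: "finite (dn J I)" using finite_subset[OF dn_sub] by simp

lemma dnD: "L : dn J I ==> L : S & J <= L & L <= I & J <= I & I : S & rank S I = Suc (rank S L)"
  using covered_byD[of L I] by (auto simp: dn_def dest: order_trans)

lemma dn_cov: "J <= L ==> L : dn J I \<longleftrightarrow> I : cov {} L" by (auto simp: dn_def cov_def)

lemma dn_inc_inc:
  assumes M: "module R M" and c: "!!N. N : S ==> J <= N ==> N <= I ==> rank S I = Suc (Suc (rank S N)) ==> c N : carrier M"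
  shows "inc M (dn J) et (inc M (dn J) et c) I = \<zero>\<^sub>M"
proof -
  interpret M: module R M by fact
  show ?thesis
  proof (rule M.inc_inc[OF finite_S])
    fix L N assume LN: "L : dn J I" "N : dn J L"
    then have cs: "covered_by S N L" "covered_by S L I" by (auto simp: dn_def)
    obtain L' where L': "L' ~= L" "{K. covered_by S N K & covered_by S K I} = {L, L'}"
      "e I L \<otimes> e L N \<oplus> e I L' \<otimes> e L' N = \<zero>" using diamond_sign[OF cs] by blast
    have "{K : dn J I. N : dn J K} = {K. covered_by S N K & covered_by S K I}"
    proof (intro equalityI subsetI)
      fix K assume "K : {K. covered_by S N K & covered_by S K I}"
      then have K: "covered_by S N K" "covered_by S K I" by auto
      then have "J <= K" using covered_byD[OF K(1)] dnD[OF LN(2)] by (auto dest: order_trans)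
      then show "K : {K : dn J I. N : dn J K}" using K LN(2) by (auto simp: dn_def)
    qed (auto simp: dn_def)
    then show "EX L'. L' ~= L & {K : dn J I. N : dn J K} = {L, L'} &
      e L N \<otimes> e I L \<oplus> e L' N \<otimes> e I L' = \<zero>" using L' by (intro exI[of _ L']) (simp add: m_comm)
    have "N <= I" using dnD[OF LN(1)] dnD[OF LN(2)] by (auto dest: order_trans)
    then show "c N : carrier M" using dnD[OF LN(1)] dnD[OF LN(2)] by (intro c) auto
  qed (use dn_sub in auto)
qed

definition kd :: "'p => 'p => 'k" where
  "kd I I' = (if I = I' then \<one> else \<zero>)"

lemma kd_closed [simp, intro]: "kd I I' : carrier R" by (simp add: kd_def)

text \<open>
  Exactness of the star below the top dimension gives a contraction \<open>hm\<close>, written as a matrix so that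
  its transpose contracts cochains of the star with values in an arbitrary module.
\<close>

definition contraction :: "'p => nat => ('p => 'p => 'k) => bool" where
  "contraction J a hm \<longleftrightarrow> (ALL I K. hm I K : carrier R) &
    (ALL I:S. J <= I & rank S I < a --> (ALL I':S. J <= I' & rank S I' = rank S I -->
      bdR (hm I) I' = kd I I' \<ominus> dnR J (%L. hm L I') I))"

text \<open>Read \<open>hm L\<close> as a chain \<open>h(L)\<close>. The combination in question is
  \<open>I - h(d I)\<close>, and its boundary vanishes because \<open>d h = 1 - h d\<close> holds
  one rank below and \<open>d d = 0\<close>.\<close>

lemma contraction_cycle:
  assumes J: "J : S" and hm: "contraction J (rank S I) hm" and I: "I : S" "J <= I"
    and K: "K : S" "J <= K" "Suc (rank S K) = rank S I"
  shows "bdR (%I'. kd I I' \<ominus> dnR J (%L. hm L I') I) K = \<zero>"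
proof -
  interpret RM: module R RM by (rule RM_module)
  have hc: "hm L I' : carrier R" for L I' using hm by (simp add: contraction_def)
  have ic: "dnR J (%L. hm L I') I : carrier R" for I I' using RM.inc_closed[of "dn J" I et "%L. hm L I'"] hc by simp
  have kdK: "bdR (kd I) K = (if I : cov {} K then e I K else \<zero>)" for I
  proof (cases "I : cov {} K")
    case True
    then have "bdR (kd I) K = e I K \<odot>\<^sub>RM kd I I"
      unfolding inc_def by (intro RM.M.finsum_single) (auto simp: kd_def)
    then show ?thesis using True by (simp add: kd_def)
  next
    case False
    then have "kd I I' = \<zero>" if "I' : cov {} K" for I' using that by (auto simp: kd_def)
    then have "bdR (kd I) K = \<zero>\<^sub>RM" by (intro RM.inc_zero) auto
    then show ?thesis using False by simp
  qed
  have kdI: "dnR J (%L. kd L K) I = (if I : cov {} K then e I K else \<zero>)"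
  proof (cases "I : cov {} K")
    case True
    then have "K : dn J I" using dn_cov K by simp
    then have "dnR J (%L. kd L K) I = e I K \<odot>\<^sub>RM kd K K"
      unfolding inc_def by (intro RM.M.finsum_single) (auto simp: kd_def)
    then show ?thesis using True by (simp add: kd_def)
  next
    case False
    then have "K ~: dn J I" using dn_cov K by simp
    then have "kd L K = \<zero>" if "L : dn J I" for L using that by (auto simp: kd_def)
    then have "dnR J (%L. kd L K) I = \<zero>\<^sub>RM" by (intro RM.inc_zero) auto
    then show ?thesis using False by simp
  qed
  have "bdR (%I'. kd I I' \<ominus> dnR J (%L. hm L I') I) K =
      bdR (%I'. kd I I' \<ominus>\<^sub>RM dnR J (%L. hm L I') I) K"
    using ring_as_module_minus[OF is_cring kd_closed ic] by simp
  also have "\<dots> = bdR (kd I) K \<ominus>\<^sub>RM bdR (%I'. dnR J (%L. hm L I') I) K"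
    using ic by (intro RM.inc_minus) auto
  also have "bdR (%I'. dnR J (%L. hm L I') I) K =
      dnR J (%L. bdR (hm L) K) I" using hc by (intro RM.inc_swap) auto
  also have "\<dots> = dnR J (%L. kd L K \<ominus>\<^sub>RM dnR J (%N. hm N K) L) I"
  proof (rule RM.inc_cong)
    fix L assume L: "L : dn J I"
    then have "bdR (hm L) K = kd L K \<ominus> dnR J (%N. hm N K) L" using hm[unfolded contraction_def] dnD[OF L] K by auto
    then show "bdR (hm L) K = kd L K \<ominus>\<^sub>RM dnR J (%N. hm N K) L"
      using ring_as_module_minus[OF is_cring kd_closed ic] by simp
    show "kd L K \<ominus>\<^sub>RM dnR J (%N. hm N K) L : carrier RM" using ic by (intro RM.M.minus_closed) auto
  qed auto
  also have "\<dots> = dnR J (%L. kd L K) I \<ominus>\<^sub>RM dnR J (%L. dnR J (%N. hm N K) L) I"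
    using ic by (intro RM.inc_minus) auto
  also have "dnR J (%L. dnR J (%N. hm N K) L) I = \<zero>"
    using dn_inc_inc[OF RM_module, where J=J and c="%N. hm N K" and I=I] hc by simp
  finally show ?thesis unfolding kdK kdI using ring_as_module_minus[OF is_cring] by (auto simp: a_minus_def r_neg)
qed

text \<open>Built rank by rank: \<open>I - h(d I)\<close> is a cycle, and exactness of the star
  fills it. Redefining \<open>h\<close> on rank \<open>a\<close> does not disturb
  \<open>h(d I)\<close>, which involves cells of smaller rank only.\<close>

lemma contraction_exists:
  assumes J: "J : S" and ac: "flag_acyclic RM J (n - rank S J)"
  shows "a <= n ==> EX hm. contraction J a hm"
proof (induct a)
  case 0
  show ?case by (intro exI[of _ "%_ _. \<zero>"]) (simp add: contraction_def)
next
  case (Suc a)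
  interpret RM: module R RM by (rule RM_module)
  obtain hm where hm: "contraction J a hm" using Suc by auto
  have hc: "hm L I' : carrier R" for L I' using hm by (simp add: contraction_def)
  have ic: "dnR J (%L. hm L I') I : carrier R" for I I' using RM.inc_closed[of "dn J" I et "%L. hm L I'"] hc by simp
  have "EX b. (ALL K. b K : carrier R) & (ALL I':S. J <= I' & rank S I' = a -->
      bdR b I' = kd I I' \<ominus> dnR J (%L. hm L I') I)"
    if I: "I : S" "J <= I" "rank S I = a" for I
  proof -
    let ?c = "%I'. kd I I' \<ominus> dnR J (%L. hm L I') I"
    have "EX b. (ALL K:S. J <= K & rank S K = Suc a --> b K : carrier RM) &
        (ALL I':S. J <= I' & rank S I' = a --> bdR b I' = ?c I')"
    proof (rule star_exact[OF RM_module J ac])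
      show "bdR ?c K = \<zero>\<^sub>RM" if "K : S" "J <= K" "Suc (rank S K) = a" for K
        using contraction_cycle[OF J _ I(1,2), of hm K] hm I(3) that by simp
      show "?c I' : carrier RM" for I' using ic by simp
    qed (use Suc in simp)
    then obtain b where b: "ALL K:S. J <= K & rank S K = Suc a --> b K : carrier RM"
      "ALL I':S. J <= I' & rank S I' = a --> bdR b I' = ?c I'" by blast
    \<comment> \<open>Exactness controls the filling chain only on the cells of the star of rank
      \<open>Suc a\<close>; elsewhere it is set to zero so that all entries are scalars.\<close>
    let ?b = "%K. if K : S & J <= K & rank S K = Suc a then b K else \<zero>"
    have "bdR ?b I' = ?c I'" if "I' : S" "J <= I'" "rank S I' = a" for I'
    proof -
      have K: "K : S & J <= K & rank S K = Suc a" if "K : cov {} I'" for K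
        using covered_byD[of I' K] that \<open>J \<le> I'\<close> \<open>rank S I' = a\<close> by (auto simp: cov_def dest: order_trans)
      then have "bdR ?b I' = bdR b I'" using b(1) by (intro RM.inc_cong) auto
      then show ?thesis using b(2) that by auto
    qed
    then show ?thesis using b(1) by (intro exI[of _ ?b]) auto
  qed
  then obtain b where b: "!!I. I : S & J <= I & rank S I = a ==> (ALL K. b I K : carrier R) & (ALL I':S. J <= I' & rank S I' = a -->
      bdR (b I) I' = kd I I' \<ominus> dnR J (%L. hm L I') I)" by metis
  define hm' where "hm' I = (if I : S & J <= I & rank S I = a then b I else hm I)" for I
  have "bdR (hm' I) I' = kd I I' \<ominus> dnR J (%L. hm' L I') I"
    if I: "I : S" "J <= I" "rank S I < Suc a" and I': "I' : S" "J <= I'" "rank S I' = rank S I" for I I'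
  proof -
    have "dnR J (%L. hm' L I') I = dnR J (%L. hm L I') I"
      using dnD[of _ J I] I hc by (intro RM.inc_cong) (auto simp: hm'_def)
    then show ?thesis using b[of I] hm I I' by (auto simp: hm'_def contraction_def)
  qed
  moreover have "hm' I K : carrier R" for I K using b hc by (auto simp: hm'_def)
  ultimately have "contraction J (Suc a) hm'" by (simp add: contraction_def)
  then show ?case by (intro exI)
qed

definition st :: "'p => nat => 'p set" where
  "st J a = {I : S. J <= I & rank S I = a}"

lemma finite_st [simp]: "finite (st J a)" by (simp add: st_def)

text \<open>\<open>b\<close> is the transposed contraction applied to \<open>c\<close>. Its
  coboundary at \<open>I\<close> pairs \<open>h(d I)\<close> with \<open>c\<close>, hence differs
  from \<open>c I\<close> by the pairing of the defect \<open>I - h(d I)\<close> with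
  \<open>c\<close>, which is assumed to vanish. As the entries of \<open>hm\<close> are scalars,
  \<open>b\<close> stays in the submodule \<open>N\<close>.\<close>

lemma contraction_homotopy:
  assumes M: "module R M" and hc: "!!L K. hm L K : carrier R" and N: "submodule N R M"
    and c: "!!I. I : st J a ==> c I : N"
    and defect: "!!I. I : st J a ==> (\<Oplus>\<^bsub>M\<^esub>K\<in>st J a. (kd I K \<ominus> dnR J (%L. hm L K) I) \<odot>\<^sub>M c K) = \<zero>\<^sub>M"
  shows "EX b. (ALL L. b L : N) & (ALL I:st J a. inc M (dn J) et b I = c I)"
proof -
  interpret M: module R M by fact
  interpret RM: module R RM by (rule RM_module)
  have cc: "c I : carrier M" if "I : st J a" for I using c[OF that] M.submodule_carrier[OF N] by blast
  define b where "b L = (\<Oplus>\<^bsub>M\<^esub>K\<in>st J a. hm L K \<odot>\<^sub>M c K)" for L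
  have bN: "b L : N" for L unfolding b_def using c hc M.submoduleE(4)[OF N] by (intro M.submodule_finsum[OF N]) auto
  have "inc M (dn J) et b I = c I" if I: "I : st J a" for I
  proof -
    define t where "t K = dnR J (%L. hm L K) I" for K
    have tc: "t K : carrier R" for K unfolding t_def using RM.inc_closed[of "dn J" I et "%L. hm L K"] hc by auto
    have "inc M (dn J) et b I = (\<Oplus>\<^bsub>M\<^esub>L\<in>dn J I. \<Oplus>\<^bsub>M\<^esub>K\<in>st J a. (e I L \<otimes> hm L K) \<odot>\<^sub>M c K)"
      unfolding inc_def b_def
    proof (rule M.M.finsum_cong'[OF refl])
      show "(%L. \<Oplus>\<^bsub>M\<^esub>K\<in>st J a. (e I L \<otimes> hm L K) \<odot>\<^sub>M c K) : dn J I \<rightarrow> carrier M"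
        using hc cc by (auto intro!: M.M.finsum_closed)
      fix L assume "L : dn J I"
      have "e I L \<odot>\<^sub>M (\<Oplus>\<^bsub>M\<^esub>K\<in>st J a. hm L K \<odot>\<^sub>M c K) = (\<Oplus>\<^bsub>M\<^esub>K\<in>st J a. e I L \<odot>\<^sub>M (hm L K \<odot>\<^sub>M c K))"
        using hc cc by (intro M.finsum_smult_ldistr) auto
      also have "\<dots> = (\<Oplus>\<^bsub>M\<^esub>K\<in>st J a. (e I L \<otimes> hm L K) \<odot>\<^sub>M c K)"
        using hc cc by (intro M.M.finsum_cong') (auto simp: M.smult_assoc1)
      finally show "e I L \<odot>\<^sub>M (\<Oplus>\<^bsub>M\<^esub>K\<in>st J a. hm L K \<odot>\<^sub>M c K) = (\<Oplus>\<^bsub>M\<^esub>K\<in>st J a. (e I L \<otimes> hm L K) \<odot>\<^sub>M c K)" .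
    qed
    also have "\<dots> = (\<Oplus>\<^bsub>M\<^esub>K\<in>st J a. \<Oplus>\<^bsub>M\<^esub>L\<in>dn J I. (e I L \<otimes> hm L K) \<odot>\<^sub>M c K)"
      using hc cc by (intro M.M.finsum_swap) auto
    also have "\<dots> = (\<Oplus>\<^bsub>M\<^esub>K\<in>st J a. t K \<odot>\<^sub>M c K)"
      unfolding t_def inc_def using hc cc tc[unfolded t_def inc_def] by (intro M.M.finsum_cong') (auto simp: M.smult_finsum)
    also have "\<dots> = (\<Oplus>\<^bsub>M\<^esub>K\<in>st J a. t K \<odot>\<^sub>M c K) \<oplus>\<^sub>M (\<Oplus>\<^bsub>M\<^esub>K\<in>st J a. (kd I K \<ominus> t K) \<odot>\<^sub>M c K)"
      unfolding t_def defect[OF I] using tc[unfolded t_def] cc by (intro M.M.r_zero[symmetric] M.M.finsum_closed) auto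
    also have "\<dots> = (\<Oplus>\<^bsub>M\<^esub>K\<in>st J a. t K \<odot>\<^sub>M c K \<oplus>\<^sub>M (kd I K \<ominus> t K) \<odot>\<^sub>M c K)"
      using tc cc by (intro M.M.finsum_addf[symmetric]) auto
    also have "\<dots> = (\<Oplus>\<^bsub>M\<^esub>K\<in>st J a. kd I K \<odot>\<^sub>M c K)"
      using tc cc by (intro M.M.finsum_cong')
        (auto simp: M.smult_l_distr[symmetric] a_minus_def a_assoc[symmetric] r_neg a_comm[of "t _"] a_lcomm[of "t _"] a_assoc)
    also have "\<dots> = kd I I \<odot>\<^sub>M c I" using I cc by (intro M.M.finsum_single) (auto simp: kd_def)
    finally show ?thesis using cc[OF I] by (simp add: kd_def)
  qed
  then show ?thesis using bN by blast
qed

text \<open>Below the top rank the defect of \<open>I\<close> is the boundary of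
  \<open>hm I\<close>. Pairing it with \<open>c\<close> is pairing \<open>hm I\<close> with the
  coboundary of \<open>c\<close>, which is zero.\<close>

lemma star_cochain_exact:
  assumes M: "module R M" and hm: "contraction J (Suc a) hm" and N: "submodule N R M"
    and c: "!!I. I : st J a ==> c I : N"
      "!!K. K : st J (Suc a) ==> inc M (dn J) et c K = \<zero>\<^sub>M"
  shows "EX b. (ALL L. b L : N) & (ALL I:st J a. inc M (dn J) et b I = c I)"
proof (rule contraction_homotopy[OF M _ N c(1)])
  interpret M: module R M by fact
  show hc: "hm L I' : carrier R" for L I' using hm by (simp add: contraction_def)
  have cc: "c I : carrier M" if "I : st J a" for I using c(1)[OF that] M.submodule_carrier[OF N] by blast
  fix I assume I: "I : st J a"
  have "kd I K \<ominus> dnR J (%L. hm L K) I = bdR (hm I) K" if "K : st J a" for K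
    using hm I that by (simp add: contraction_def st_def)
  then have "(\<Oplus>\<^bsub>M\<^esub>K\<in>st J a. (kd I K \<ominus> dnR J (%L. hm L K) I) \<odot>\<^sub>M c K) =
      (\<Oplus>\<^bsub>M\<^esub>K\<in>st J a. \<Oplus>\<^bsub>M\<^esub>P\<in>cov {} K. (e P K \<otimes> hm I P) \<odot>\<^sub>M c K)"
    unfolding inc_def using hc cc by (intro M.M.finsum_cong') (auto intro!: M.M.finsum_closed simp: M.smult_finsum)
  also have "\<dots> = (\<Oplus>\<^bsub>M\<^esub>P\<in>st J (Suc a). \<Oplus>\<^bsub>M\<^esub>K\<in>dn J P. (e P K \<otimes> hm I P) \<odot>\<^sub>M c K)"
  proof (rule M.M.finsum_swap_rel)
    show "K : st J a & P : cov {} K \<longleftrightarrow> P : st J (Suc a) & K : dn J P" for K P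
      using dnD[of K J P] dn_cov[of J K P] by (auto simp: st_def)
  qed (use hc cc in auto)
  also have "\<dots> = \<zero>\<^sub>M"
  proof (rule M.M.finsum_zeroI)
    fix P assume P: "P : st J (Suc a)"
    have cd: "c K : carrier M" if "K : dn J P" for K using dnD[OF that] P by (intro cc) (auto simp: st_def)
    have "(\<Oplus>\<^bsub>M\<^esub>K\<in>dn J P. (e P K \<otimes> hm I P) \<odot>\<^sub>M c K) = (\<Oplus>\<^bsub>M\<^esub>K\<in>dn J P. hm I P \<odot>\<^sub>M (e P K \<odot>\<^sub>M c K))"
      using hc cd by (intro M.M.finsum_cong') (auto simp: M.smult_assoc1[symmetric] m_comm)
    also have "\<dots> = hm I P \<odot>\<^sub>M inc M (dn J) et c P"
      unfolding inc_def using hc cd by (intro M.finsum_smult_ldistr[symmetric]) auto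
    finally show "(\<Oplus>\<^bsub>M\<^esub>K\<in>dn J P. (e P K \<otimes> hm I P) \<odot>\<^sub>M c K) = \<zero>\<^sub>M" using c(2)[OF P] hc by simp
  qed
  finally show "(\<Oplus>\<^bsub>M\<^esub>K\<in>st J a. (kd I K \<ominus> dnR J (%L. hm L K) I) \<odot>\<^sub>M c K) = \<zero>\<^sub>M" .
qed

text \<open>In top rank the defect is no longer a boundary, but it is a relative top cycle, hence a
  multiple of \<open>u\<close>; pairing \<open>u\<close> with \<open>c\<close> gives zero by
  assumption.\<close>

lemma star_cochain_exact_top:
  assumes M: "module R M" and J: "J : S" "J ~= bot_of S" and hm: "contraction J n hm" and u: "fundamental n u"
    and N: "submodule N R M" and c: "!!F. F : st J n ==> c F : N"
      "(\<Oplus>\<^bsub>M\<^esub>F\<in>st J n. u F \<odot>\<^sub>M c F) = \<zero>\<^sub>M"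
  shows "EX b. (ALL L. b L : N) & (ALL F:st J n. inc M (dn J) et b F = c F)"
proof (rule contraction_homotopy[OF M _ N c(1)])
  interpret M: module R M by fact
  interpret RM: module R RM by (rule RM_module)
  show hc: "hm L I' : carrier R" for L I' using hm by (simp add: contraction_def)
  have uR: "u F : carrier R" if "F : st J n" for F using u that Units_closed by (auto simp: fundamental_def st_def)
  have cc: "c F : carrier M" if "F : st J n" for F using c(1)[OF that] M.submodule_carrier[OF N] by blast
  fix F assume "F : st J n"
  then have F: "F : S" "J <= F" "rank S F = n" by (auto simp: st_def)
  have ic: "dnR J (%L. hm L K) F : carrier R" for K using RM.inc_closed[of "dn J" F et "%L. hm L K"] hc by auto
  have "(ALL K:S. J <= K & rank S K = n --> kd F K \<ominus> dnR J (%L. hm L K) F : carrier R) &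
    (ALL K:S. J <= K & Suc (rank S K) = n -->
      bdR (%K. kd F K \<ominus> dnR J (%L. hm L K) F) K = \<zero>)"
    using contraction_cycle[OF J(1) _ F(1,2), of hm] hm F(3) ic by simp
  then have "EX l:carrier R. ALL K:S. J <= K & rank S K = n --> kd F K \<ominus> dnR J (%L. hm L K) F = l \<otimes> u K"
    by (intro fundamental_cycle[OF u J]) auto
  \<comment> \<open>One scalar serves all cells \<open>K\<close>, so it can be taken out of the
    sum.\<close>
  then obtain l where l: "l : carrier R" "!!K. K : st J n ==> kd F K \<ominus> dnR J (%L. hm L K) F = l \<otimes> u K"
    by (auto simp: st_def)
  then have "(\<Oplus>\<^bsub>M\<^esub>K\<in>st J n. (kd F K \<ominus> dnR J (%L. hm L K) F) \<odot>\<^sub>M c K) =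
      (\<Oplus>\<^bsub>M\<^esub>K\<in>st J n. l \<odot>\<^sub>M (u K \<odot>\<^sub>M c K))"
    using uR cc by (intro M.M.finsum_cong') (auto simp: M.smult_assoc1)
  also have "\<dots> = l \<odot>\<^sub>M (\<Oplus>\<^bsub>M\<^esub>K\<in>st J n. u K \<odot>\<^sub>M c K)"
    using l(1) uR cc by (intro M.finsum_smult_ldistr[symmetric]) auto
  finally show "(\<Oplus>\<^bsub>M\<^esub>K\<in>st J n. (kd F K \<ominus> dnR J (%L. hm L K) F) \<odot>\<^sub>M c K) = \<zero>\<^sub>M"
    unfolding c(2) using l(1) by simp
qed

end

section \<open>Free algebras, exterior algebras and their functoriality\<close>

section \<open>Free algebras\<close>

lemma free_algebra_simps:
  "carrier (free_algebra R X) = {f. (ALL w. f w : carrier R) & finite {w. f w ~= \<zero>\<^sub>R} & {w. f w ~= \<zero>\<^sub>R} \<subseteq> lists X}"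
  "\<zero>\<^sub>(free_algebra R X) = (%w. \<zero>\<^sub>R)"
  "f \<oplus>\<^sub>(free_algebra R X) g = (%w. f w \<oplus>\<^sub>R g w)"
  "a \<odot>\<^sub>(free_algebra R X) f = (%w. a \<otimes>\<^sub>R f w)"
  "f \<otimes>\<^sub>(free_algebra R X) g = (%w. \<Oplus>\<^bsub>R\<^esub>j\<in>{..length w}. f (take j w) \<otimes>\<^sub>R g (drop j w))"
  "\<one>\<^sub>(free_algebra R X) = word R []" by (simp_all add: free_algebra_def word_def)

locale coefficient_ring = cring R for R :: "'k ring" (structure)
begin

abbreviation "FA X \<equiv> free_algebra R X"
abbreviation "FM M \<equiv> free_algebra R (carrier M)"

lemma FA_coeff: "f : carrier (FA X) ==> f w : carrier R" by (simp add: free_algebra_simps)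

lemma FA_I:
  assumes "!!w. f w : carrier R" "finite A" "A \<subseteq> lists X" "!!w. w ~: A ==> f w = \<zero>"
  shows "f : carrier (FA X)"
proof -
  have "{w. f w ~= \<zero>} \<subseteq> A" using assms(4) by blast
  then show ?thesis using assms finite_subset by (auto simp: free_algebra_simps)
qed

lemma FA_E:
  assumes "f : carrier (FA X)"
  shows "finite {w. f w ~= \<zero>}" "{w. f w ~= \<zero>} \<subseteq> lists X" using assms by (auto simp: free_algebra_simps)

lemma word_in [simp, intro]: "w : lists X ==> word R w : carrier (FA X)"
  by (rule FA_I[where A = "{w}"]) (auto simp: word_def)

lemma FA_module: "module R (FA X)"
proof (rule moduleI)
  show "abelian_group (FA X)"
  proof (rule abelian_groupI)
    show "f \<oplus>\<^sub>(FA X) g : carrier (FA X)" if "f : carrier (FA X)" "g : carrier (FA X)" for f g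
      using FA_E[OF that(1)] FA_E[OF that(2)] FA_coeff[OF that(1)] FA_coeff[OF that(2)]
      by (intro FA_I[where A = "{w. f w ~= \<zero>} \<union> {w. g w ~= \<zero>}"]) (auto simp: free_algebra_simps(3))
    show "\<zero>\<^sub>(FA X) : carrier (FA X)" by (simp add: free_algebra_simps)
    fix f assume f: "f : carrier (FA X)"
    show "EX g:carrier (FA X). g \<oplus>\<^sub>(FA X) f = \<zero>\<^sub>(FA X)"
    proof (rule bexI[of _ "%w. \<ominus> f w"])
      show "(%w. \<ominus> f w) : carrier (FA X)"
        using FA_E[OF f] FA_coeff[OF f] by (intro FA_I[where A = "{w. f w ~= \<zero>}"]) auto
      show "(%w. \<ominus> f w) \<oplus>\<^sub>(FA X) f = \<zero>\<^sub>(FA X)"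
        using FA_coeff[OF f] by (simp add: free_algebra_simps(2,3) l_neg)
    qed
  qed (auto simp: free_algebra_simps(2,3) FA_coeff a_ac)
  show "a \<odot>\<^sub>(FA X) f : carrier (FA X)" if "a : carrier R" "f : carrier (FA X)" for a f
    using FA_E[OF that(2)] FA_coeff[OF that(2)] that(1)
    by (intro FA_I[where A = "{w. f w ~= \<zero>}"]) (auto simp: free_algebra_simps(4))
qed (auto simp: free_algebra_simps(3,4) FA_coeff l_distr r_distr m_assoc intro: is_cring)

sublocale FA: module R "FA X" for X by (rule FA_module)

lemma FA_induct [consumes 1, case_names zero step]:
  assumes f: "f : carrier (FA X)" and zero: "P \<zero>\<^sub>(FA X)"
    and step: "!!a w f. a : carrier R ==> w : lists X ==> f : carrier (FA X) ==> P f ==>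
      P (a \<odot>\<^sub>(FA X) word R w \<oplus>\<^sub>(FA X) f)"
  shows "P f"
proof -
  have "finite A ==> A \<subseteq> lists X ==> (ALL w. f w : carrier R) ==> {w. f w ~= \<zero>} = A ==> P f" for A f
  proof (induct A arbitrary: f rule: finite_induct)
    case empty
    then have "f = \<zero>\<^sub>(FA X)" by (auto simp: free_algebra_simps)
    then show ?case using zero by simp
  next
    case (insert w A)
    let ?g = "f(w := \<zero>)"
    have gR: "ALL v. ?g v : carrier R" using insert by auto
    have gA: "{v. ?g v ~= \<zero>} = A" using insert by auto
    have "P ?g" by (rule insert(3)[OF _ gR gA]) (use insert(4) in auto)
    have "?g : carrier (FA X)" using gR gA insert by (intro FA_I[of ?g A]) auto
    have "f = f w \<odot>\<^sub>(FA X) word R w \<oplus>\<^sub>(FA X) ?g"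
      using insert by (auto simp: free_algebra_simps word_def fun_eq_iff)
    have "P (f w \<odot>\<^sub>(FA X) word R w \<oplus>\<^sub>(FA X) ?g)"
      using insert(4,5) by (intro step[OF _ _ \<open>?g \<in> carrier (FA X)\<close> \<open>P ?g\<close>]) auto
    then show ?case using \<open>f = f w \<odot>\<^bsub>FA X\<^esub> word R w \<oplus>\<^bsub>FA X\<^esub> ?g\<close> by (simp only:)
  qed
  then show ?thesis using FA_E[OF f] FA_coeff[OF f] by blast
qed

text \<open>Words span the free algebra. The algebra laws, the functoriality of
  \<open>push_words\<close> and its multiplicativity are linear in each argument and are all reduced
  to words in this way.\<close>

lemma FA_hom_ext:
  assumes "module R N" "g : mod_hom R (FA X) N" "h : mod_hom R (FA X) N"
    "!!w. w : lists X ==> g (word R w) = h (word R w)" "f : carrier (FA X)"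
  shows "g f = h f" using assms(5)
proof (induct rule: FA_induct)
  case zero
  then show ?case using mod_hom_zero[OF FA_module assms(1)] assms(2,3) by metis
next
  case (step a w f)
  then show ?case using assms(4)
    by (simp add: mod_hom_add[OF assms(2)] mod_hom_add[OF assms(3)] mod_hom_smult[OF assms(2)] mod_hom_smult[OF assms(3)])
qed

lemma FA_mult_closed:
  assumes "f : carrier (FA X)" "g : carrier (FA X)"
  shows "f \<otimes>\<^sub>(FA X) g : carrier (FA X)"
proof (rule FA_I[where A = "(%(u, v). u @ v) ` ({w. f w ~= \<zero>} \<times> {w. g w ~= \<zero>})"])
  show "(f \<otimes>\<^sub>(FA X) g) w : carrier R" for w
    using assms[THEN FA_coeff] by (auto simp: free_algebra_simps(5) intro!: finsum_closed)
  show "finite ((%(u, v). u @ v) ` ({w. f w ~= \<zero>} \<times> {w. g w ~= \<zero>}))" using assms[THEN FA_E(1)] by simp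
  show "(%(u, v). u @ v) ` ({w. f w ~= \<zero>} \<times> {w. g w ~= \<zero>}) \<subseteq> lists X"
  proof
    fix w assume "w : (%(u, v). u @ v) ` ({w. f w ~= \<zero>} \<times> {w. g w ~= \<zero>})"
    then obtain u v where "w = u @ v" "f u ~= \<zero>" "g v ~= \<zero>" by auto
    moreover from this have "u : lists X" "v : lists X" using assms[THEN FA_E(2)] by blast+
    ultimately show "w : lists X" by simp
  qed
  fix w assume w: "w ~: (%(u, v). u @ v) ` ({w. f w ~= \<zero>} \<times> {w. g w ~= \<zero>})"
  have "f (take j w) \<otimes> g (drop j w) = \<zero>" for j
  proof (rule ccontr)
    assume a: "f (take j w) \<otimes> g (drop j w) ~= \<zero>"
    then have "f (take j w) ~= \<zero>" "g (drop j w) ~= \<zero>" using assms[THEN FA_coeff] by auto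
    then have "(take j w, drop j w) : {w. f w ~= \<zero>} \<times> {w. g w ~= \<zero>}" by simp
    then have "(%(u, v). u @ v) (take j w, drop j w) : (%(u, v). u @ v) ` ({w. f w ~= \<zero>} \<times> {w. g w ~= \<zero>})"
      by (rule imageI)
    then show False using w by simp
  qed
  then show "(f \<otimes>\<^sub>(FA X) g) w = \<zero>" by (simp add: free_algebra_simps(5) finsum_zeroI)
qed

lemma FA_mult_right: "g : carrier (FA X) ==> (%f. f \<otimes>\<^sub>(FA X) g) : mod_hom R (FA X) (FA X)"
proof (rule mod_homI)
  assume g: "g : carrier (FA X)"
  note gc = FA_coeff[OF g]
  show "f \<otimes>\<^sub>(FA X) g : carrier (FA X)" if "f : carrier (FA X)" for f using FA_mult_closed that g .
  show "(f \<oplus>\<^sub>(FA X) f') \<otimes>\<^sub>(FA X) g = f \<otimes>\<^sub>(FA X) g \<oplus>\<^sub>(FA X) f' \<otimes>\<^sub>(FA X) g"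
    if "f : carrier (FA X)" "f' : carrier (FA X)" for f f' using gc that[THEN FA_coeff] unfolding free_algebra_simps(3,5)
    by (subst finsum_addf[symmetric]) (auto simp: l_distr)
  show "(a \<odot>\<^sub>(FA X) f) \<otimes>\<^sub>(FA X) g = a \<odot>\<^sub>(FA X) (f \<otimes>\<^sub>(FA X) g)"
    if "a : carrier R" "f : carrier (FA X)" for a f using gc that(1) FA_coeff[OF that(2)] unfolding free_algebra_simps(4,5)
    by (subst finsum_rdistr) (auto simp: m_assoc)
qed

lemma FA_mult_left: "f : carrier (FA X) ==> (%g. f \<otimes>\<^sub>(FA X) g) : mod_hom R (FA X) (FA X)"
proof (rule mod_homI)
  assume f: "f : carrier (FA X)"
  note fc = FA_coeff[OF f]
  show "f \<otimes>\<^sub>(FA X) g : carrier (FA X)" if "g : carrier (FA X)" for g using FA_mult_closed f that .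
  show "f \<otimes>\<^sub>(FA X) (g \<oplus>\<^sub>(FA X) g') = f \<otimes>\<^sub>(FA X) g \<oplus>\<^sub>(FA X) f \<otimes>\<^sub>(FA X) g'"
    if "g : carrier (FA X)" "g' : carrier (FA X)" for g g' using fc that[THEN FA_coeff] unfolding free_algebra_simps(3,5)
    by (subst finsum_addf[symmetric]) (auto simp: r_distr)
  show "f \<otimes>\<^sub>(FA X) (a \<odot>\<^sub>(FA X) g) = a \<odot>\<^sub>(FA X) (f \<otimes>\<^sub>(FA X) g)"
    if "a : carrier R" "g : carrier (FA X)" for a g using fc that(1) FA_coeff[OF that(2)] unfolding free_algebra_simps(4,5)
    by (subst finsum_rdistr) (auto simp: m_lcomm)
qed

lemma word_mult: "word R u \<otimes>\<^sub>(FA X) word R v = word R (u @ v)"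
proof
  fix w
  show "(word R u \<otimes>\<^sub>(FA X) word R v) w = word R (u @ v) w"
  proof (cases "w = u @ v")
    case True
    have "(\<Oplus>j\<in>{..length w}. word R u (take j w) \<otimes> word R v (drop j w)) =
        word R u (take (length u) w) \<otimes> word R v (drop (length u) w)"
    proof (rule finsum_single)
      fix j assume j: "j : {..length w}" "j ~= length u"
      then have "take j w ~= u" by (auto dest: arg_cong[where f = length])
      then show "word R u (take j w) \<otimes> word R v (drop j w) = \<zero>" by (simp add: word_def)
    qed (use True in \<open>auto simp: word_def\<close>)
    then show ?thesis using True by (simp add: free_algebra_simps(5) word_def)
  next
    case False
    have "(\<Oplus>j\<in>{..length w}. word R u (take j w) \<otimes> word R v (drop j w)) = \<zero>"
    proof (rule finsum_zeroI)
      fix j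
      have "\<not> (take j w = u & drop j w = v)" using False append_take_drop_id[of j w] by auto
      then show "word R u (take j w) \<otimes> word R v (drop j w) = \<zero>" by (auto simp: word_def)
    qed
    then show ?thesis using False by (simp add: free_algebra_simps(5) word_def)
  qed
qed

text \<open>Linearity extends the identity from words one argument at a time: first in
  \<open>f\<close>, then in \<open>g\<close>, then in \<open>h\<close>.\<close>

lemma FA_assoc:
  assumes "f : carrier (FA X)" "g : carrier (FA X)" "h : carrier (FA X)"
  shows "(f \<otimes>\<^sub>(FA X) g) \<otimes>\<^sub>(FA X) h = f \<otimes>\<^sub>(FA X) (g \<otimes>\<^sub>(FA X) h)"
proof -
  note L = FA_mult_left and Rr = FA_mult_right and C = mod_hom_comp and cl = FA_mult_closed
  have 1: "(f \<otimes>\<^sub>(FA X) word R v) \<otimes>\<^sub>(FA X) word R w = f \<otimes>\<^sub>(FA X) (word R v \<otimes>\<^sub>(FA X) word R w)"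
    if "v : lists X" "w : lists X" "f : carrier (FA X)" for f v w
    by (rule FA_hom_ext[OF FA_module C[OF Rr Rr] Rr _ that(3)]) (use that cl in \<open>auto simp: word_mult\<close>)
  have 2: "(f \<otimes>\<^sub>(FA X) g) \<otimes>\<^sub>(FA X) word R w = f \<otimes>\<^sub>(FA X) (g \<otimes>\<^sub>(FA X) word R w)"
    if "w : lists X" "f : carrier (FA X)" "g : carrier (FA X)" for f g w
    by (rule FA_hom_ext[OF FA_module C[OF Rr L] C[OF L Rr] _ that(3)]) (use that 1 in auto)
  show ?thesis by (rule FA_hom_ext[OF FA_module L C[OF L L] _ assms(3)]) (use assms 2 cl in auto)
qed

lemma FA_ring: "ring (FA X)"
proof (rule ringI)
  show "abelian_group (FA X)" by (rule module.axioms(2)[OF FA_module])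
  show "monoid (FA X)"
  proof (rule monoidI)
    show "\<one>\<^sub>(FA X) \<otimes>\<^sub>(FA X) f = f" if "f : carrier (FA X)" for f
      by (rule FA_hom_ext[OF FA_module FA_mult_left _ _ that, where h = "%f. f"])
        (auto intro: mod_homI simp: word_mult free_algebra_simps(6))
    show "f \<otimes>\<^sub>(FA X) \<one>\<^sub>(FA X) = f" if "f : carrier (FA X)" for f
      by (rule FA_hom_ext[OF FA_module FA_mult_right _ _ that, where h = "%f. f"])
        (auto intro: mod_homI simp: word_mult free_algebra_simps(6))
  qed (auto simp: FA_mult_closed FA_assoc free_algebra_simps(6))
qed (auto simp: mod_hom_add[OF FA_mult_left] mod_hom_add[OF FA_mult_right])

text \<open>The index set of \<open>push_words\<close> depends on the support of \<open>f\<close>; a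
  larger common finite set lets the sums of two functions be added.\<close>

lemma push_words_eq:
  assumes "finite A" "{u. f u ~= \<zero>} \<subseteq> A" "!!u. f u : carrier R"
  shows "push_words R h f w = (\<Oplus>u\<in>{u : A. map h u = w}. f u)" unfolding push_words_def using assms
  by (intro finsum_restrict[symmetric]) auto

lemma push_words_supp:
  assumes "f : carrier (FA X)" "push_words R h f w ~= \<zero>"
  shows "EX u. f u ~= \<zero> & map h u = w"
proof (rule ccontr)
  assume "\<not> ?thesis"
  then have "{u. f u ~= \<zero> & map h u = w} = {}" by blast
  then have "push_words R h f w = \<zero>" unfolding push_words_def by (simp only: finsum_empty)
  then show False using assms(2) by simp
qed

lemma push_words_hom:
  assumes h: "h : X \<rightarrow> Y"
  shows "push_words R h : mod_hom R (FA X) (FA Y)"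
proof (rule mod_homI)
  fix f assume f: "f : carrier (FA X)"
  note fc = FA_coeff[OF f] and fE = FA_E[OF f]
  show "push_words R h f : carrier (FA Y)"
  proof (rule FA_I[where A = "map h ` {u. f u ~= \<zero>}"])
    show "push_words R h f w : carrier R" for w unfolding push_words_def using fc by (intro finsum_closed) auto
    show "map h ` {u. f u ~= \<zero>} \<subseteq> lists Y"
    proof
      fix w assume "w : map h ` {u. f u ~= \<zero>}"
      then obtain u where "w = map h u" "f u ~= \<zero>" by blast
      moreover from this have "u : lists X" using fE(2) by blast
      ultimately show "w : lists Y" using funcset_mem[OF h] by auto
    qed
    show "push_words R h f w = \<zero>" if "w ~: map h ` {u. f u ~= \<zero>}" for w using push_words_supp[OF f] that by blast
  qed (use fE in simp)
  { fix g assume g: "g : carrier (FA X)"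
    note gc = FA_coeff[OF g] and gE = FA_E[OF g]
    let ?A = "{u. f u ~= \<zero>} \<union> {u. g u ~= \<zero>}"
    have fg: "f u \<oplus> g u = \<zero>" if "u ~: ?A" for u using that by simp
    show "push_words R h (f \<oplus>\<^sub>(FA X) g) = push_words R h f \<oplus>\<^sub>(FA Y) push_words R h g"
    proof
      fix w
      have "push_words R h (f \<oplus>\<^sub>(FA X) g) w = (\<Oplus>u\<in>{u : ?A. map h u = w}. f u \<oplus> g u)"
        unfolding free_algebra_simps(3) using fE gE fc gc fg by (intro push_words_eq) auto
      also have "\<dots> = (\<Oplus>u\<in>{u : ?A. map h u = w}. f u) \<oplus> (\<Oplus>u\<in>{u : ?A. map h u = w}. g u)"
        using fc gc by (intro finsum_addf) auto
      also have "(\<Oplus>u\<in>{u : ?A. map h u = w}. f u) = push_words R h f w"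
        using fE gE fc by (intro push_words_eq[symmetric]) auto
      also have "(\<Oplus>u\<in>{u : ?A. map h u = w}. g u) = push_words R h g w"
        using fE gE gc by (intro push_words_eq[symmetric]) auto
      finally show "push_words R h (f \<oplus>\<^sub>(FA X) g) w = (push_words R h f \<oplus>\<^sub>(FA Y) push_words R h g) w"
        by (simp add: free_algebra_simps(3))
    qed }
  { fix a assume a: "a : carrier R"
    show "push_words R h (a \<odot>\<^sub>(FA X) f) = a \<odot>\<^sub>(FA Y) push_words R h f"
    proof
      fix w
      have "push_words R h (a \<odot>\<^sub>(FA X) f) w = (\<Oplus>u\<in>{u : {u. f u ~= \<zero>}. map h u = w}. a \<otimes> f u)"
        unfolding free_algebra_simps(4) using fE fc a by (intro push_words_eq) auto
      also have "\<dots> = a \<otimes> (\<Oplus>u\<in>{u : {u. f u ~= \<zero>}. map h u = w}. f u)"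
        using fc a fE by (intro finsum_rdistr[symmetric]) auto
      also have "(\<Oplus>u\<in>{u : {u. f u ~= \<zero>}. map h u = w}. f u) = push_words R h f w"
        using fE fc by (intro push_words_eq[symmetric]) auto
      finally show "push_words R h (a \<odot>\<^sub>(FA X) f) w = (a \<odot>\<^sub>(FA Y) push_words R h f) w"
        by (simp add: free_algebra_simps(4))
    qed }
qed

lemma push_words_word: "push_words R h (word R u) = word R (map h u)"
proof
  fix w
  have "push_words R h (word R u) w = (\<Oplus>v\<in>{v : {u}. map h v = w}. word R u v)"
    by (intro push_words_eq) (auto simp: word_def)
  also have "{v : {u}. map h v = w} = (if map h u = w then {u} else {})" by auto
  finally show "push_words R h (word R u) w = word R (map h u) w" by (auto simp: word_def)
qed

lemma push_words_mult:
  assumes h: "h : X \<rightarrow> Y" and f: "f : carrier (FA X)" and g: "g : carrier (FA X)"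
  shows "push_words R h (f \<otimes>\<^sub>(FA X) g) = push_words R h f \<otimes>\<^sub>(FA Y) push_words R h g"
proof -
  note P = push_words_hom[OF h] and C = mod_hom_comp
  have mw: "word R (map h v) : carrier (FA Y)" if "ALL x:set v. x : X" for v
    using funcset_mem[OF h] that by (intro word_in) auto
  have 1: "push_words R h (f \<otimes>\<^sub>(FA X) word R v) = push_words R h f \<otimes>\<^sub>(FA Y) push_words R h (word R v)"
    if "v : lists X" "f : carrier (FA X)" for f v
    by (rule FA_hom_ext[OF FA_module C[OF P FA_mult_right] C[OF FA_mult_right P] _ that(2)])
      (use that mw in \<open>auto simp: word_mult push_words_word\<close>)
  show ?thesis by (rule FA_hom_ext[OF FA_module C[OF P FA_mult_left] C[OF FA_mult_left P] _ g])
      (use f 1 mod_hom_closed[OF P f] in auto)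
qed

section \<open>Exterior algebras\<close>

abbreviation "EI M \<equiv> exterior_ideal R M"
abbreviation "EA M \<equiv> exterior_algebra R M"
abbreviation "gen M \<equiv> exterior_gen R M"
abbreviation "cl M f \<equiv> EI M +>\<^sub>(FM M) f"

lemma exterior_relations_sub:
  assumes "module R M" shows "exterior_relations R M \<subseteq> carrier (FM M)"
proof -
  interpret M: module R M by fact
  show ?thesis unfolding exterior_relations_def Let_def
    by (auto intro!: FA.M.minus_closed FA.M.a_closed FA.smult_closed FA_mult_closed)
qed

lemma EI_ideal:
  assumes "module R M" shows "ideal (EI M) (FM M)" unfolding exterior_ideal_def
  by (rule ring.genideal_ideal[OF FA_ring exterior_relations_sub[OF assms]])

lemma EI_relation: "module R M ==> f : exterior_relations R M ==> f : EI M" unfolding exterior_ideal_def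
  using ring.genideal_self[OF FA_ring exterior_relations_sub] by blast

lemma EI_submodule:
  assumes M: "module R M" shows "submodule (EI M) R (FM M)"
proof -
  interpret ideal "EI M" "FM M" by (rule EI_ideal[OF M])
  show ?thesis
  proof (rule FA.submoduleI)
    show "EI M \<subseteq> carrier (FM M)" by (rule a_subset)
    show "a \<odot>\<^sub>(FM M) f : EI M" if "a : carrier R" "f : EI M" for a f
    proof -
      have fc: "f : carrier (FM M)" using that(2) a_subset by blast
      have one: "\<one>\<^sub>(FM M) : carrier (FM M)" by (simp add: free_algebra_simps(6))
      have "a \<odot>\<^sub>(FM M) f = (a \<odot>\<^sub>(FM M) \<one>\<^sub>(FM M)) \<otimes>\<^sub>(FM M) f"
        using mod_hom_smult[OF FA_mult_right[OF fc] that(1) one] fc monoid.l_one[OF ring.is_monoid[OF FA_ring] fc] by simp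
      then show ?thesis using I_l_closed[OF that(2)] that(1) one by simp
    qed
  qed (auto intro: a_inv_closed)
qed

lemma EA_simps:
  assumes M: "module R M"
  shows "carrier (EA M) = cl M ` carrier (FM M)"
    "\<zero>\<^sub>(EA M) = cl M \<zero>\<^sub>(FM M)" "\<one>\<^sub>(EA M) = cl M \<one>\<^sub>(FM M)"
    "f : carrier (FM M) ==> g : carrier (FM M) ==> cl M f \<oplus>\<^sub>(EA M) cl M g = cl M (f \<oplus>\<^sub>(FM M) g)"
    "f : carrier (FM M) ==> g : carrier (FM M) ==> cl M f \<otimes>\<^sub>(EA M) cl M g = cl M (f \<otimes>\<^sub>(FM M) g)"
    "f : carrier (FM M) ==> a : carrier R ==> a \<odot>\<^sub>(EA M) cl M f = cl M (a \<odot>\<^sub>(FM M) f)"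
proof -
  interpret ideal "EI M" "FM M" by (rule EI_ideal[OF M])
  note S = EI_submodule[OF M]
  show "carrier (EA M) = cl M ` carrier (FM M)" by (auto simp: exterior_algebra_def quot_module_simps)
  show "\<zero>\<^sub>(EA M) = cl M \<zero>\<^sub>(FM M)"
    using FA.M.a_coset_add_zero[OF a_subset] by (simp add: exterior_algebra_def quot_module_simps)
  show "\<one>\<^sub>(EA M) = cl M \<one>\<^sub>(FM M)" by (simp add: exterior_algebra_def quot_module_def FactRing_def)
  show "f : carrier (FM M) ==> g : carrier (FM M) ==> cl M f \<oplus>\<^sub>(EA M) cl M g = cl M (f \<oplus>\<^sub>(FM M) g)"
    using FA.coset_add[OF S] by (simp add: exterior_algebra_def quot_module_simps)
  show "f : carrier (FM M) ==> g : carrier (FM M) ==> cl M f \<otimes>\<^sub>(EA M) cl M g = cl M (f \<otimes>\<^sub>(FM M) g)"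
    using rcoset_mult_add by (simp add: exterior_algebra_def quot_module_def FactRing_def)
  show "f : carrier (FM M) ==> a : carrier R ==> a \<odot>\<^sub>(EA M) cl M f = cl M (a \<odot>\<^sub>(FM M) f)"
    using FA.coset_smult[OF S] by (simp add: exterior_algebra_def quot_module_simps)
qed

lemma EA_cases:
  assumes "module R M" "x : carrier (EA M)"
  obtains f where "f : carrier (FM M)" "x = cl M f" using assms by (auto simp: EA_simps(1))

text \<open>The exterior algebra is the quotient ring extended by a scalar multiplication, hence a
  record of another type; the ring laws are carried over field by field.\<close>

lemma EA_ring:
  assumes M: "module R M" shows "ring (EA M)"
proof -
  interpret Q: ring "FM M Quot EI M" by (rule ideal.quotient_is_ring[OF EI_ideal[OF M]])
  have eq: "carrier (EA M) = carrier (FM M Quot EI M)" "monoid.mult (EA M) = monoid.mult (FM M Quot EI M)"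
    "one (EA M) = one (FM M Quot EI M)" "zero (EA M) = zero (FM M Quot EI M)"
    "add (EA M) = add (FM M Quot EI M)" by (simp_all add: exterior_algebra_def quot_module_def)
  show ?thesis
  proof (rule ringI)
    show "abelian_group (EA M)"
    proof (rule abelian_groupI; unfold eq)
      fix x assume "x : carrier (FM M Quot EI M)"
      then show "EX y:carrier (FM M Quot EI M). y \<oplus>\<^sub>(FM M Quot EI M) x = \<zero>\<^sub>(FM M Quot EI M)"
        using Q.l_neg Q.a_inv_closed by blast
    qed (auto simp: Q.a_ac)
    show "monoid (EA M)" by (rule monoidI; unfold eq) (auto simp: Q.m_assoc)
  qed (auto simp: eq Q.l_distr Q.r_distr)
qed

lemma EA_module:
  assumes M: "module R M" shows "module R (EA M)"
proof (rule moduleI)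
  note [simp] = EA_simps(2-)[OF M]
  show "abelian_group (EA M)" by (rule ring.is_abelian_group[OF EA_ring[OF M]])
  show "a \<odot>\<^sub>(EA M) x : carrier (EA M)" if "a : carrier R" "x : carrier (EA M)" for a x
    using that by (auto simp: EA_simps(1)[OF M])
  show "(a \<oplus> b) \<odot>\<^sub>(EA M) x = a \<odot>\<^sub>(EA M) x \<oplus>\<^sub>(EA M) b \<odot>\<^sub>(EA M) x"
    if "a : carrier R" "b : carrier R" "x : carrier (EA M)" for a b x
    using that by (auto simp: EA_simps(1)[OF M] FA.smult_l_distr)
  show "a \<odot>\<^sub>(EA M) (x \<oplus>\<^sub>(EA M) y) = a \<odot>\<^sub>(EA M) x \<oplus>\<^sub>(EA M) a \<odot>\<^sub>(EA M) y"
    if "a : carrier R" "x : carrier (EA M)" "y : carrier (EA M)" for a x y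
    using that by (auto simp: EA_simps(1)[OF M] FA.smult_r_distr)
  show "(a \<otimes> b) \<odot>\<^sub>(EA M) x = a \<odot>\<^sub>(EA M) (b \<odot>\<^sub>(EA M) x)"
    if "a : carrier R" "b : carrier R" "x : carrier (EA M)" for a b x
    using that by (auto simp: EA_simps(1)[OF M] FA.smult_assoc1)
  show "\<one> \<odot>\<^sub>(EA M) x = x" if "x : carrier (EA M)" for x using that by (auto simp: EA_simps(1)[OF M])
qed (rule is_cring)

lemma EA_smult_mult:
  assumes M: "module R M" and "a : carrier R" "x : carrier (EA M)" "y : carrier (EA M)"
  shows "(a \<odot>\<^sub>(EA M) x) \<otimes>\<^sub>(EA M) y = a \<odot>\<^sub>(EA M) (x \<otimes>\<^sub>(EA M) y)"
    "x \<otimes>\<^sub>(EA M) (a \<odot>\<^sub>(EA M) y) = a \<odot>\<^sub>(EA M) (x \<otimes>\<^sub>(EA M) y)"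
proof -
  obtain f where f: "f : carrier (FM M)" "x = cl M f" using EA_cases[OF M assms(3)] .
  obtain g where g: "g : carrier (FM M)" "y = cl M g" using EA_cases[OF M assms(4)] .
  note mc = FA_mult_closed[OF f(1) g(1)]
  show "(a \<odot>\<^sub>(EA M) x) \<otimes>\<^sub>(EA M) y = a \<odot>\<^sub>(EA M) (x \<otimes>\<^sub>(EA M) y)"
    using f g mc assms(2) by (simp add: EA_simps(2-)[OF M] mod_hom_smult[OF FA_mult_right])
  show "x \<otimes>\<^sub>(EA M) (a \<odot>\<^sub>(EA M) y) = a \<odot>\<^sub>(EA M) (x \<otimes>\<^sub>(EA M) y)"
    using f g mc assms(2) by (simp add: EA_simps(2-)[OF M] mod_hom_smult[OF FA_mult_left])
qed

lemma gen_closed: "module R M ==> x : carrier M ==> gen M x : carrier (EA M)"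
  unfolding exterior_gen_def by (auto simp: EA_simps(1))

lemma cl_eqI: "module R M ==> f : carrier (FM M) ==> g : carrier (FM M) ==>
    f \<ominus>\<^sub>(FM M) g : EI M ==> cl M f = cl M g" using FA.coset_eq_iff[OF EI_submodule] by blast

lemma
  assumes M: "module R M"
  shows gen_add: "x : carrier M ==> y : carrier M ==> gen M (x \<oplus>\<^sub>M y) = gen M x \<oplus>\<^sub>(EA M) gen M y"
    and gen_smult: "a : carrier R ==> x : carrier M ==> gen M (a \<odot>\<^sub>M x) = a \<odot>\<^sub>(EA M) gen M x"
    and gen_square: "x : carrier M ==> gen M x \<otimes>\<^sub>(EA M) gen M x = \<zero>\<^sub>(EA M)"
proof -
  interpret M: module R M by fact
  note rel = EI_relation[OF M]
  show "gen M (x \<oplus>\<^sub>M y) = gen M x \<oplus>\<^sub>(EA M) gen M y" if "x : carrier M" "y : carrier M"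
  proof -
    have "word R [x \<oplus>\<^sub>M y] \<ominus>\<^sub>(FM M) (word R [x] \<oplus>\<^sub>(FM M) word R [y]) : EI M"
      using that by (intro rel) (auto simp: exterior_relations_def Let_def)
    then have "cl M (word R [x \<oplus>\<^sub>M y]) = cl M (word R [x] \<oplus>\<^sub>(FM M) word R [y])"
      using that by (intro cl_eqI[OF M]) auto
    then show ?thesis unfolding exterior_gen_def using that by (simp add: EA_simps(4)[OF M])
  qed
  show "gen M (a \<odot>\<^sub>M x) = a \<odot>\<^sub>(EA M) gen M x" if "a : carrier R" "x : carrier M"
  proof -
    have "word R [a \<odot>\<^sub>M x] \<ominus>\<^sub>(FM M) (a \<odot>\<^sub>(FM M) word R [x]) : EI M"
      using that by (intro rel) (auto simp: exterior_relations_def Let_def)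
    then have "cl M (word R [a \<odot>\<^sub>M x]) = cl M (a \<odot>\<^sub>(FM M) word R [x])"
      using that by (intro cl_eqI[OF M]) auto
    then show ?thesis unfolding exterior_gen_def using that by (simp add: EA_simps(6)[OF M])
  qed
  show "gen M x \<otimes>\<^sub>(EA M) gen M x = \<zero>\<^sub>(EA M)" if "x : carrier M"
  proof -
    have "word R [x] \<otimes>\<^sub>(FM M) word R [x] : EI M"
      using that by (intro rel) (auto simp: exterior_relations_def Let_def)
    then have "word R [x] \<otimes>\<^sub>(FM M) word R [x] \<ominus>\<^sub>(FM M) \<zero>\<^sub>(FM M) : EI M"
      by (rule FA.submodule_minus[OF EI_submodule[OF M] _ FA.submodule_zero[OF EI_submodule[OF M]]])
    then have "cl M (word R [x] \<otimes>\<^sub>(FM M) word R [x]) = cl M \<zero>\<^sub>(FM M)"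
      using that FA_mult_closed[of "word R [x]" "carrier M" "word R [x]"] by (intro cl_eqI[OF M]) auto
    then show ?thesis unfolding exterior_gen_def using that by (simp add: EA_simps(2,5)[OF M])
  qed
qed

text \<open>Polarisation of \<open>gen_square\<close> at the sum of \<open>x\<close> and
  \<open>y\<close>.\<close>

lemma gen_anticomm:
  assumes M: "module R M" and xy: "x : carrier M" "y : carrier M"
  shows "gen M x \<otimes>\<^sub>(EA M) gen M y = \<ominus>\<^sub>(EA M) (gen M y \<otimes>\<^sub>(EA M) gen M x)"
proof -
  interpret M: module R M by fact
  interpret E: ring "EA M" by (rule EA_ring[OF M])
  note c = gen_closed[OF M xy(1)] gen_closed[OF M xy(2)]
  have "\<zero>\<^sub>(EA M) = (gen M x \<oplus>\<^sub>(EA M) gen M y) \<otimes>\<^sub>(EA M) (gen M x \<oplus>\<^sub>(EA M) gen M y)"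
    using gen_square[OF M, of "x \<oplus>\<^sub>M y"] gen_add[OF M xy] xy by simp
  also have "\<dots> = gen M x \<otimes>\<^sub>(EA M) gen M y \<oplus>\<^sub>(EA M) gen M y \<otimes>\<^sub>(EA M) gen M x"
    using c gen_square[OF M] xy by (simp add: E.l_distr E.r_distr E.a_comm)
  finally show ?thesis using c by (intro E.minus_equality[symmetric]) auto
qed

text \<open>Words span the free algebra, and the class of a word is a product of generators.\<close>

lemma EA_induct [consumes 2, case_names add smult one gen]:
  assumes M: "module R M" and x: "x : carrier (EA M)"
    and add: "!!x y. x : carrier (EA M) ==> y : carrier (EA M) ==> P x ==> P y ==> P (x \<oplus>\<^sub>(EA M) y)"
    and smult: "!!a x. a : carrier R ==> x : carrier (EA M) ==> P x ==> P (a \<odot>\<^sub>(EA M) x)"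
    and one: "P \<one>\<^sub>(EA M)"
    and gen: "!!v x. v : carrier M ==> x : carrier (EA M) ==> P x ==> P (gen M v \<otimes>\<^sub>(EA M) x)"
  shows "P x"
proof -
  interpret E: ring "EA M" by (rule EA_ring[OF M])
  interpret EM: module R "EA M" by (rule EA_module[OF M])
  have w: "P (cl M (word R w)) & cl M (word R w) : carrier (EA M)" if "w : lists (carrier M)" for w using that
  proof (induct w)
    case Nil
    then show ?case using one by (simp add: EA_simps(3)[OF M] free_algebra_simps(6)) (auto simp: EA_simps(1)[OF M])
  next
    case (Cons v w)
    then have "cl M (word R (v # w)) = gen M v \<otimes>\<^sub>(EA M) cl M (word R w)"
      unfolding exterior_gen_def by (subst EA_simps(5)[OF M]) (auto simp: word_mult)
    then show ?case using gen[of v "cl M (word R w)"] Cons by (auto intro: gen_closed[OF M])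
  qed
  obtain f where f: "f : carrier (FM M)" "x = cl M f" using EA_cases[OF M x] .
  have "P (cl M f)" using f(1)
  proof (induct rule: FA_induct)
    case zero
    have "P (\<zero> \<odot>\<^sub>(EA M) \<one>\<^sub>(EA M))" using one by (intro smult) auto
    then show ?case by (simp add: EA_simps(2)[OF M, symmetric])
  next
    case (step a w f)
    have "P (a \<odot>\<^sub>(EA M) cl M (word R w) \<oplus>\<^sub>(EA M) cl M f)"
    proof (rule add)
      show "a \<odot>\<^sub>(EA M) cl M (word R w) : carrier (EA M)" using w[OF step(2)] step(1) by (intro EM.smult_closed) auto
      show "P (a \<odot>\<^sub>(EA M) cl M (word R w))" using w[OF step(2)] step(1) by (intro smult) auto
      show "cl M f : carrier (EA M)" using step(3) by (auto simp: EA_simps(1)[OF M])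
    qed (rule step)
    then show ?case using step by (simp add: EA_simps(2-)[OF M])
  qed
  then show ?thesis using f(2) by simp
qed

section \<open>Functoriality of exterior algebras\<close>

text \<open>The preimage of \<open>EI N\<close> is an ideal, and it contains the defining relations
  because each of them is sent to a relation of the same kind.\<close>

lemma push_words_EI:
  assumes M: "module R M" and N: "module R N" and h: "h : mod_hom R M N" and f: "f : EI M"
  shows "push_words R h f : EI N"
proof -
  interpret M: module R M by fact
  interpret N: module R N by fact
  have hX: "h : carrier M \<rightarrow> carrier N" using mod_hom_closed[OF h] by auto
  note P = push_words_hom[OF hX]
  interpret J: ideal "EI N" "FM N" by (rule EI_ideal[OF N])
  let ?K = "{f : carrier (FM M). push_words R h f : EI N}"
  have K: "ideal ?K (FM M)"
  proof (rule idealI[OF FA_ring])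
    show "subgroup ?K (add_monoid (FM M))"
    proof (rule FA.M.add.subgroupI)
      show "?K ~= {}" using mod_hom_zero[OF FA_module FA_module P] J.zero_closed by force
      show "\<ominus>\<^sub>(FM M) a : ?K" if "a : ?K" for a
        using that mod_hom_uminus[OF FA_module FA_module P] J.a_inv_closed by auto
      show "a \<oplus>\<^sub>(FM M) b : ?K" if "a : ?K" "b : ?K" for a b using that mod_hom_add[OF P] J.a_closed by auto
    qed auto
    show "x \<otimes>\<^sub>(FM M) a : ?K" "a \<otimes>\<^sub>(FM M) x : ?K"
      if "a : ?K" "x : carrier (FM M)" for a x
      using that push_words_mult[OF hX] mod_hom_closed[OF P] J.I_l_closed J.I_r_closed FA_mult_closed by auto
  qed
  have "exterior_relations R M \<subseteq> ?K"
  proof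
    fix r assume r: "r : exterior_relations R M"
    then have rc: "r : carrier (FM M)" using exterior_relations_sub[OF M] by blast
    have "push_words R h r : exterior_relations R N"
    proof -
      consider (a) x y where "x : carrier M" "y : carrier M"
        "r = word R [x \<oplus>\<^sub>M y] \<ominus>\<^sub>(FM M) (word R [x] \<oplus>\<^sub>(FM M) word R [y])"
        | (b) a x where "a : carrier R" "x : carrier M"
          "r = word R [a \<odot>\<^sub>M x] \<ominus>\<^sub>(FM M) (a \<odot>\<^sub>(FM M) word R [x])"
        | (c) x where "x : carrier M" "r = word R [x] \<otimes>\<^sub>(FM M) word R [x]"
        using r unfolding exterior_relations_def Let_def by blast
      then show ?thesis
      proof cases
        case a
        then have "push_words R h r = word R [h x \<oplus>\<^sub>N h y] \<ominus>\<^sub>(FM N) (word R [h x] \<oplus>\<^sub>(FM N) word R [h y])"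
          by (simp add: mod_hom_minus[OF FA_module FA_module P] mod_hom_add[OF P] push_words_word mod_hom_add[OF h])
        then show ?thesis using a mod_hom_closed[OF h] unfolding exterior_relations_def Let_def by blast
      next
        case b
        then have "push_words R h r = word R [a \<odot>\<^sub>N h x] \<ominus>\<^sub>(FM N) (a \<odot>\<^sub>(FM N) word R [h x])"
          by (simp add: mod_hom_minus[OF FA_module FA_module P] mod_hom_smult[OF P] push_words_word mod_hom_smult[OF h])
        then show ?thesis using b mod_hom_closed[OF h] unfolding exterior_relations_def Let_def by blast
      next
        case c
        then have "push_words R h r = word R [h x] \<otimes>\<^sub>(FM N) word R [h x]"
          by (simp add: push_words_mult[OF hX] push_words_word)
        then show ?thesis using c mod_hom_closed[OF h] unfolding exterior_relations_def Let_def by blast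
      qed
    qed
    then show "r : ?K" using rc EI_relation[OF N] by blast
  qed
  then have "EI M \<subseteq> ?K" unfolding exterior_ideal_def[where M = M] by (rule ring.genideal_minimal[OF FA_ring K])
  then show ?thesis using f by blast
qed

abbreviation "EM N h \<equiv> exterior_map R N h"

text \<open>\<open>quot_map\<close> is a union over a coset. All its members agree, so the induced
  map can be computed on any representative.\<close>

lemma EM_cl:
  assumes M: "module R M" and N: "module R N" and h: "h : mod_hom R M N" and f: "f : carrier (FM M)"
  shows "EM N h (cl M f) = cl N (push_words R h f)"
proof -
  have hX: "h : carrier M \<rightarrow> carrier N" using mod_hom_closed[OF h] by auto
  note P = push_words_hom[OF hX]
  have "cl N (push_words R h g) = cl N (push_words R h f)" if g: "g : cl M f" for g
  proof -
    note g' = FA.in_coset[OF EI_submodule[OF M] f g]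
    have "g \<ominus>\<^sub>(FM M) f : EI M" using FA.coset_eq_iff[OF EI_submodule[OF M] g'(1) f] g'(2) by simp
    from push_words_EI[OF M N h this] have "push_words R h g \<ominus>\<^sub>(FM N) push_words R h f : EI N"
      by (simp only: mod_hom_minus[OF FA_module FA_module P g'(1) f])
    then show ?thesis using mod_hom_closed[OF P] g' f by (intro cl_eqI[OF N]) auto
  qed
  moreover have "cl M f ~= {}" using FA.coset_self[OF EI_submodule[OF M] f] by (metis empty_iff)
  ultimately show ?thesis unfolding exterior_map_def quot_map_def by (intro SUP_eq_const)
qed

lemma
  assumes M: "module R M" and N: "module R N" and h: "h : mod_hom R M N"
  shows EM_hom: "EM N h : mod_hom R (EA M) (EA N)"
    and EM_mult: "x : carrier (EA M) ==> y : carrier (EA M) ==> EM N h (x \<otimes>\<^sub>(EA M) y) = EM N h x \<otimes>\<^sub>(EA N) EM N h y"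
    and EM_one: "EM N h \<one>\<^sub>(EA M) = \<one>\<^sub>(EA N)"
    and EM_gen: "v : carrier M ==> EM N h (gen M v) = gen N (h v)"
proof -
  have hX: "h : carrier M \<rightarrow> carrier N" using mod_hom_closed[OF h] by auto
  note P = push_words_hom[OF hX] and Pc = mod_hom_closed[OF push_words_hom[OF hX]]
  note [simp] = EM_cl[OF M N h] EA_simps(2-)[OF M] EA_simps(2-)[OF N]
  show "EM N h : mod_hom R (EA M) (EA N)"
  proof (rule mod_homI)
    show "EM N h x : carrier (EA N)" if "x : carrier (EA M)" for x
      using that Pc by (auto simp: EA_simps(1)[OF M] EA_simps(1)[OF N])
    show "EM N h (x \<oplus>\<^sub>(EA M) y) = EM N h x \<oplus>\<^sub>(EA N) EM N h y" if "x : carrier (EA M)" "y : carrier (EA M)" for x y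
      using that Pc by (auto simp: EA_simps(1)[OF M] mod_hom_add[OF P])
    show "EM N h (a \<odot>\<^sub>(EA M) x) = a \<odot>\<^sub>(EA N) EM N h x" if "a : carrier R" "x : carrier (EA M)" for a x
      using that Pc by (auto simp: EA_simps(1)[OF M] mod_hom_smult[OF P])
  qed
  show "EM N h (x \<otimes>\<^sub>(EA M) y) = EM N h x \<otimes>\<^sub>(EA N) EM N h y" if xy: "x : carrier (EA M)" "y : carrier (EA M)"
  proof -
    obtain f where f: "f : carrier (FM M)" "x = cl M f" using EA_cases[OF M xy(1)] .
    obtain g where g: "g : carrier (FM M)" "y = cl M g" using EA_cases[OF M xy(2)] .
    show ?thesis using f g Pc by (simp add: FA_mult_closed push_words_mult[OF hX])
  qed
  show "EM N h \<one>\<^sub>(EA M) = \<one>\<^sub>(EA N)" by (simp add: free_algebra_simps(6) push_words_word)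
  show "EM N h (gen M v) = gen N (h v)" if "v : carrier M"
    unfolding exterior_gen_def using that by (simp add: push_words_word)
qed

lemma push_words_comp:
  assumes "h : X \<rightarrow> Y" "k : Y \<rightarrow> Z" "l : X \<rightarrow> Z" "!!x. x : X ==> k (h x) = l x" "f : carrier (FA X)"
  shows "push_words R k (push_words R h f) = push_words R l f"
proof (rule FA_hom_ext[OF FA_module mod_hom_comp[OF push_words_hom[OF assms(2)] push_words_hom[OF assms(1)]]
      push_words_hom[OF assms(3)] _ assms(5)])
  fix w assume "w : lists X"
  then have "map k (map h w) = map l w" using assms(4) by auto
  then show "push_words R k (push_words R h (word R w)) = push_words R l (word R w)" by (simp only: push_words_word)
qed

text \<open>The composite may be any \<open>l\<close> that agrees with it on the carrier, which is
  all that the functor laws of a sheaf provide.\<close>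

lemma EM_comp:
  assumes M: "module R M" and N: "module R N" and P: "module R P" and h: "h : mod_hom R M N" and k: "k : mod_hom R N P"
    and l: "l : mod_hom R M P" "!!x. x : carrier M ==> k (h x) = l x" and x: "x : carrier (EA M)"
  shows "EM P k (EM N h x) = EM P l x"
proof -
  have hX: "h : carrier M \<rightarrow> carrier N" "k : carrier N \<rightarrow> carrier P" "l : carrier M \<rightarrow> carrier P"
    using mod_hom_closed[OF h] mod_hom_closed[OF k] mod_hom_closed[OF l(1)] by auto
  obtain f where f: "f : carrier (FM M)" "x = cl M f" using EA_cases[OF M x] .
  show ?thesis using f mod_hom_closed[OF push_words_hom[OF hX(1)] f(1)] push_words_comp[OF hX l(2) f(1)]
    by (simp add: EM_cl[OF M N h] EM_cl[OF N P k] EM_cl[OF M P l(1)])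
qed

lemma EM_id:
  assumes M: "module R M" and h: "h : mod_hom R M M" "!!x. x : carrier M ==> h x = x" and x: "x : carrier (EA M)"
  shows "EM M h x = x"
proof -
  have hX: "h : carrier M \<rightarrow> carrier M" using mod_hom_closed[OF h(1)] by auto
  obtain f where f: "f : carrier (FM M)" "x = cl M f" using EA_cases[OF M x] .
  have "push_words R h f = f"
  proof (rule FA_hom_ext[OF FA_module push_words_hom[OF hX] _ _ f(1), where h = "%f. f"])
    fix w assume "w : lists (carrier M)"
    then have "map h w = w" using h(2) by (auto intro: map_idI)
    then show "push_words R h (word R w) = word R w" by (simp only: push_words_word)
  qed (auto intro: mod_homI)
  then show ?thesis using f by (simp add: EM_cl[OF M M h(1)])
qed

lemma EM_iso:
  assumes M: "module R M" and N: "module R N" and h: "h : mod_iso R M N"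
  shows "EM N h : mod_iso R (EA M) (EA N)"
    "x : carrier (EA M) ==> EM M (inv_into (carrier M) h) (EM N h x) = x"
    "y : carrier (EA N) ==> EM N h (EM M (inv_into (carrier M) h) y) = y"
proof -
  let ?g = "inv_into (carrier M) h"
  have hh: "h : mod_hom R M N" and g: "?g : mod_hom R N M"
    using mod_iso_hom[OF h] mod_iso_hom[OF mod_iso_inv[OF M h]] by auto
  have b: "bij_betw h (carrier M) (carrier N)" using mod_iso_bij[OF h] .
  have id: "(%x. x) : mod_hom R M M" "(%x. x) : mod_hom R N N" by (auto intro: mod_homI)
  show gh: "EM M ?g (EM N h x) = x" if "x : carrier (EA M)" for x
    using EM_comp[OF M N M hh g id(1) _ that] bij_betw_inv_into_left[OF b] EM_id[OF M id(1) _ that] by simp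
  show hg: "EM N h (EM M ?g y) = y" if "y : carrier (EA N)" for y
    using EM_comp[OF N M N g hh id(2) _ that] bij_betw_inv_into_right[OF b] EM_id[OF N id(2) _ that] by simp
  have "bij_betw (EM N h) (carrier (EA M)) (carrier (EA N))"
    using gh hg mod_hom_closed[OF EM_hom[OF M N hh]] mod_hom_closed[OF EM_hom[OF N M g]]
    by (intro bij_betw_byWitness[where f' = "EM M ?g"]) auto
  then show "EM N h : mod_iso R (EA M) (EA N)" using EM_hom[OF M N hh] by (rule mod_isoI[rotated])
qed

lemma exterior_degree_iff:
  assumes M: "module R M"
  shows "x : exterior_degree R M q \<longleftrightarrow> (EX f:carrier (FM M). (ALL w. f w ~= \<zero> --> length w = q) & x = cl M f)"
proof
  assume "x : exterior_degree R M q"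
  then obtain f where f: "x : carrier (EA M)" "f : x" "ALL w. f w ~= \<zero> --> length w = q"
    by (auto simp: exterior_degree_def)
  obtain g where g: "g : carrier (FM M)" "x = cl M g" using EA_cases[OF M f(1)] .
  then show "EX f:carrier (FM M). (ALL w. f w ~= \<zero> --> length w = q) & x = cl M f"
    using FA.in_coset[OF EI_submodule[OF M] g(1), of f] f by auto
next
  assume "EX f:carrier (FM M). (ALL w. f w ~= \<zero> --> length w = q) & x = cl M f"
  then obtain f where f: "f : carrier (FM M)" "ALL w. f w ~= \<zero> --> length w = q" "x = cl M f" by blast
  then show "x : exterior_degree R M q"
    using FA.coset_self[OF EI_submodule[OF M] f(1)] by (auto simp: exterior_degree_def EA_simps(1)[OF M])
qed

lemma exterior_degree_submodule:
  assumes M: "module R M" shows "submodule (exterior_degree R M q) R (EA M)"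
proof -
  interpret E: module R "EA M" by (rule EA_module[OF M])
  note iff = exterior_degree_iff[OF M]
  have sm: "a \<odot>\<^sub>(EA M) x : exterior_degree R M q" if a: "a : carrier R" and x: "x : exterior_degree R M q" for a x
  proof -
    obtain f where f: "f : carrier (FM M)" "ALL w. f w ~= \<zero> --> length w = q" "x = cl M f" using x iff by blast
    have "ALL w. (a \<odot>\<^sub>(FM M) f) w ~= \<zero> --> length w = q" using f(2) a by (auto simp: free_algebra_simps(4)) (metis r_null)
    moreover have "a \<odot>\<^sub>(EA M) x = cl M (a \<odot>\<^sub>(FM M) f)" using f a by (simp add: EA_simps(6)[OF M])
    ultimately show ?thesis using iff f(1) a FA.smult_closed by blast
  qed
  show ?thesis
  proof (rule E.submoduleI)
    show sub: "exterior_degree R M q \<subseteq> carrier (EA M)" by (auto simp: exterior_degree_def)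
    show "\<zero>\<^sub>(EA M) : exterior_degree R M q"
      unfolding iff by (rule bexI[OF _ FA.M.zero_closed]) (auto simp: free_algebra_simps(2) EA_simps(2)[OF M])
    show "\<ominus>\<^sub>(EA M) x : exterior_degree R M q" if "x : exterior_degree R M q" for x
    proof -
      have "\<ominus>\<^sub>(EA M) x = (\<ominus> \<one>) \<odot>\<^sub>(EA M) x" using that sub by (subst E.smult_l_minus) auto
      then show ?thesis using sm[OF _ that] by simp
    qed
    show "x \<oplus>\<^sub>(EA M) y : exterior_degree R M q" if xy: "x : exterior_degree R M q" "y : exterior_degree R M q" for x y
    proof -
      obtain f where f: "f : carrier (FM M)" "ALL w. f w ~= \<zero> --> length w = q" "x = cl M f" using xy(1) unfolding iff by blast
      obtain g where g: "g : carrier (FM M)" "ALL w. g w ~= \<zero> --> length w = q" "y = cl M g" using xy(2) unfolding iff by blast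
      have "ALL w. (f \<oplus>\<^sub>(FM M) g) w ~= \<zero> --> length w = q"
        using f(2) g(2) by (auto simp: free_algebra_simps(3)) (metis l_zero zero_closed)
      moreover have "x \<oplus>\<^sub>(EA M) y = cl M (f \<oplus>\<^sub>(FM M) g)" using f g by (simp add: EA_simps(4)[OF M])
      ultimately show ?thesis using iff f(1) g(1) FA.M.a_closed by blast
    qed
  qed (rule sm)
qed

text \<open>Renaming letters preserves the length of words.\<close>

lemma EM_degree:
  assumes M: "module R M" and N: "module R N" and h: "h : mod_hom R M N" and x: "x : exterior_degree R M q"
  shows "EM N h x : exterior_degree R N q"
proof -
  have hX: "h : carrier M \<rightarrow> carrier N" using mod_hom_closed[OF h] by auto
  obtain f where f: "f : carrier (FM M)" "ALL w. f w ~= \<zero> --> length w = q" "x = cl M f"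
    using x exterior_degree_iff[OF M] by blast
  have "ALL w. push_words R h f w ~= \<zero> --> length w = q"
  proof (intro allI impI)
    fix w assume "push_words R h f w ~= \<zero>"
    then obtain u where "f u ~= \<zero>" "map h u = w" using push_words_supp[OF f(1)] by blast
    then show "length w = q" using f(2) by auto
  qed
  then show ?thesis
    unfolding exterior_degree_iff[OF N] using f mod_hom_closed[OF push_words_hom[OF hX]] EM_cl[OF M N h f(1)] by blast
qed

end

section \<open>Principal ideals of wedge products, described by commuting algebra
  endomorphisms\<close>

section \<open>Ideals generated by part of a basis\<close>

context coefficient_ring
begin

text \<open>\<open>f v x\<close> is the coordinate at \<open>om v\<close> of the component of
  \<open>x\<close> in the span, relative to a chosen complement. Over the integers independent
  vectors alone would not admit such functionals; the complement comes from the direct summand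
  condition.\<close>

lemma dual_functionals:
  fixes M :: "('k, 'v) module" and om :: "'i => 'v"
  assumes M: "module R M" and Vs: "finite Vs" and om: "!!v. v : Vs ==> om v : carrier M"
    and ind: "lin_indep R M Vs om" and ds: "direct_summand R M (lin_span R M Vs om)"
  shows "EX f. (ALL v:Vs. ALL x:carrier M. f v x : carrier R) &
    (ALL v:Vs. ALL x:carrier M. ALL y:carrier M. f v (x \<oplus>\<^sub>M y) = f v x \<oplus> f v y) &
    (ALL v:Vs. ALL a:carrier R. ALL x:carrier M. f v (a \<odot>\<^sub>M x) = a \<otimes> f v x) &
    (ALL v:Vs. ALL w:Vs. f v (om w) = (if v = w then \<one> else \<zero>))"
proof -
  interpret M: module R M by fact
  define L where "L a = (\<Oplus>\<^bsub>M\<^esub>i\<in>Vs. a i \<odot>\<^sub>M om i)" for a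
  have Lc: "L a : carrier M" if "a : Vs \<rightarrow> carrier R" for a
    unfolding L_def using that om by (auto intro!: M.M.finsum_closed)
  have Ladd: "L (%i. a i \<oplus> b i) = L a \<oplus>\<^sub>M L b" if "a : Vs \<rightarrow> carrier R" "b : Vs \<rightarrow> carrier R" for a b
  proof -
    have "L (%i. a i \<oplus> b i) = (\<Oplus>\<^bsub>M\<^esub>i\<in>Vs. a i \<odot>\<^sub>M om i \<oplus>\<^sub>M b i \<odot>\<^sub>M om i)"
      unfolding L_def using that om by (intro M.M.finsum_cong') (auto simp: M.smult_l_distr Pi_iff)
    then show ?thesis unfolding L_def using that om by (simp add: M.M.finsum_addf Pi_iff)
  qed
  have Lsm: "L (%i. c \<otimes> a i) = c \<odot>\<^sub>M L a" if "a : Vs \<rightarrow> carrier R" "c : carrier R" for a c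
  proof -
    have "c \<odot>\<^sub>M L a = (\<Oplus>\<^bsub>M\<^esub>i\<in>Vs. c \<odot>\<^sub>M (a i \<odot>\<^sub>M om i))"
      unfolding L_def using that om Vs by (intro M.finsum_smult_ldistr) (auto simp: Pi_iff)
    also have "\<dots> = L (%i. c \<otimes> a i)"
      unfolding L_def using that om by (intro M.M.finsum_cong') (auto simp: M.smult_assoc1 Pi_iff)
    finally show ?thesis ..
  qed
  have span: "lin_span R M Vs om = L ` (Vs \<rightarrow> carrier R)" by (auto simp: lin_span_def L_def)
  obtain N' where N': "submodule N' R M" "lin_span R M Vs om \<inter> N' = {\<zero>\<^sub>M}"
    "lin_span R M Vs om <+>\<^bsub>M\<^esub> N' = carrier M" using ds by (auto simp: direct_summand_def)
  note E = M.submoduleE[OF N'(1)]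
  \<comment> \<open>\<open>a\<close> lists coordinates of \<open>x\<close> modulo the complement
    \<open>N'\<close>.\<close>
  define rel where "rel x a \<longleftrightarrow> a : Vs \<rightarrow> carrier R & (EX y:N'. x = L a \<oplus>\<^sub>M y)" for x a
  have ex: "EX a. rel x a" if "x : carrier M" for x
  proof -
    have "x : lin_span R M Vs om <+>\<^bsub>M\<^esub> N'" using that N'(3) by simp
    then obtain s y where "s : lin_span R M Vs om" "y : N'" "x = s \<oplus>\<^sub>M y"
      by (auto simp: set_add_def set_mult_def)
    then show ?thesis unfolding span rel_def by auto
  qed
  \<comment> \<open>The difference of two coordinate vectors gives a combination lying both in the
    span and in \<open>N'\<close>, hence zero; independence then makes the difference itself
    vanish.\<close>
  have uniq: "a i = b i" if "rel x a" "rel x b" "i : Vs" for x a b i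
  proof -
    obtain y z where a: "a : Vs \<rightarrow> carrier R" "b : Vs \<rightarrow> carrier R" and yz: "y : N'" "z : N'"
      and eq: "L a \<oplus>\<^sub>M y = L b \<oplus>\<^sub>M z"
      using \<open>rel x a\<close> \<open>rel x b\<close> unfolding rel_def by metis
    note yc = M.submodule_carrier[OF N'(1) yz(1)] and zc = M.submodule_carrier[OF N'(1) yz(2)]
    let ?b = "%i. (\<ominus> \<one>) \<otimes> b i"
    have bR: "?b : Vs \<rightarrow> carrier R" using a by auto
    have d: "L (%i. a i \<oplus> ?b i) = L a \<ominus>\<^sub>M L b"
      using Ladd[OF a(1) bR] Lsm[OF a(2), of "\<ominus> \<one>"] Lc[OF a(2)] by (simp add: a_minus_def M.smult_l_minus)
    have "L a = (L b \<oplus>\<^sub>M z) \<ominus>\<^sub>M y"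
      unfolding eq[symmetric] using Lc[OF a(1)] yc by (simp add: a_minus_def M.M.a_assoc M.M.r_neg)
    then have "L a \<ominus>\<^sub>M L b = (L b \<oplus>\<^sub>M \<ominus>\<^sub>M L b) \<oplus>\<^sub>M (z \<ominus>\<^sub>M y)"
      using Lc[OF a(2)] yc zc by (simp add: a_minus_def M.M.a_ac)
    then have "L a \<ominus>\<^sub>M L b = z \<ominus>\<^sub>M y" using Lc[OF a(2)] yc zc by (simp add: M.M.r_neg)
    also have "\<dots> : N'" using M.submodule_minus[OF N'(1)] yz by blast
    finally have "L (%i. a i \<oplus> ?b i) : N'" using d by simp
    moreover have ab: "(%i. a i \<oplus> ?b i) : Vs \<rightarrow> carrier R" using a bR by auto
    then have "L (%i. a i \<oplus> ?b i) : lin_span R M Vs om" unfolding span by blast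
    ultimately have "L (%i. a i \<oplus> ?b i) = \<zero>\<^sub>M" using N'(2) by blast
    then have "a i \<oplus> ?b i = \<zero>" using ind ab \<open>i \<in> Vs\<close> unfolding lin_indep_def L_def by auto
    moreover have "a i : carrier R" "b i : carrier R" using a \<open>i \<in> Vs\<close> by auto
    ultimately show ?thesis using sum_zero_eq_neg[of "a i" "?b i"] by (simp add: l_minus)
  qed
  define f where "f v x = (SOME a. rel x a) v" for v x
  have frel: "rel x (%v. f v x)" if "x : carrier M" for x unfolding f_def using someI_ex[OF ex[OF that]] by simp
  have feq: "f v x = a v" if "rel x a" "x : carrier M" "v : Vs" for x a v using uniq[OF frel[OF that(2)] that(1,3)] .
  have fR: "f v x : carrier R" if "x : carrier M" "v : Vs" for v x using frel[OF that(1)] that(2) by (auto simp: rel_def)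
  have "f v (x \<oplus>\<^sub>M y) = f v x \<oplus> f v y" if x: "x : carrier M" and y: "y : carrier M" and v: "v : Vs" for x y v
  proof (rule feq[OF _ _ v])
    obtain x' y' where xy: "(%v. f v x) : Vs \<rightarrow> carrier R" "(%v. f v y) : Vs \<rightarrow> carrier R" "x' : N'" "y' : N'"
      "x = L (%v. f v x) \<oplus>\<^sub>M x'" "y = L (%v. f v y) \<oplus>\<^sub>M y'" using frel[OF x] frel[OF y] unfolding rel_def by blast
    have "x \<oplus>\<^sub>M y = (L (%v. f v x) \<oplus>\<^sub>M x') \<oplus>\<^sub>M (L (%v. f v y) \<oplus>\<^sub>M y')" using xy(5,6) by simp
    also have "\<dots> = L (%v. f v x \<oplus> f v y) \<oplus>\<^sub>M (x' \<oplus>\<^sub>M y')"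
      unfolding Ladd[OF xy(1,2)] using Lc[OF xy(1)] Lc[OF xy(2)] M.submodule_carrier[OF N'(1) xy(3)] M.submodule_carrier[OF N'(1) xy(4)]
      by (simp add: M.M.a_ac)
    finally show "rel (x \<oplus>\<^sub>M y) (%v. f v x \<oplus> f v y)"
      unfolding rel_def using xy(1,2) E(5)[OF xy(3,4)] by (auto simp: Pi_iff)
  qed (use x y in simp)
  note fadd = this
  have "f v (a \<odot>\<^sub>M x) = a \<otimes> f v x" if a: "a : carrier R" and x: "x : carrier M" and v: "v : Vs" for a x v
  proof (rule feq[OF _ _ v])
    obtain x' where x': "(%v. f v x) : Vs \<rightarrow> carrier R" "x' : N'" "x = L (%v. f v x) \<oplus>\<^sub>M x'"
      using frel[OF x] unfolding rel_def by blast
    have "a \<odot>\<^sub>M x = a \<odot>\<^sub>M (L (%v. f v x) \<oplus>\<^sub>M x')" using x'(3) by simp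
    also have "\<dots> = L (%v. a \<otimes> f v x) \<oplus>\<^sub>M a \<odot>\<^sub>M x'"
      unfolding Lsm[OF x'(1) a] using Lc[OF x'(1)] M.submodule_carrier[OF N'(1) x'(2)] a by (simp add: M.smult_r_distr)
    finally show "rel (a \<odot>\<^sub>M x) (%v. a \<otimes> f v x)"
      unfolding rel_def using x'(1) a E(4)[OF a x'(2)] by (auto simp: Pi_iff)
  qed (use a x in simp)
  note fsm = this
  have "f v (om w) = (if v = w then \<one> else \<zero>)" if v: "v : Vs" and w: "w : Vs" for v w
  proof (rule feq[OF _ _ v])
    let ?d = "%v. if v = w then \<one> else \<zero>"
    have "L ?d = ?d w \<odot>\<^sub>M om w" unfolding L_def using w Vs om by (intro M.M.finsum_single) auto
    then have "om w = L ?d \<oplus>\<^sub>M \<zero>\<^sub>M" using om[OF w] by simp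
    then show "rel (om w) ?d" unfolding rel_def using M.submodule_zero[OF N'(1)] by auto
  qed (use om w in simp)
  note fom = this
  show ?thesis using fR fadd fsm fom by (intro exI[of _ f]) simp
qed

end

locale exterior_frame = coefficient_ring R for R :: "'k ring" (structure) +
  fixes M :: "('k, 'v) module" and Vs :: "'i set" and om :: "'i => 'v" and f :: "'i => 'v => 'k"
  assumes M: "module R M" and om: "!!v. v : Vs ==> om v : carrier M"
    and f_closed: "!!v x. v : Vs ==> x : carrier M ==> f v x : carrier R"
    and f_add: "!!v x y. v : Vs ==> x : carrier M ==> y : carrier M ==> f v (x \<oplus>\<^sub>M y) = f v x \<oplus> f v y"
    and f_smult: "!!v a x. v : Vs ==> a : carrier R ==> x : carrier M ==> f v (a \<odot>\<^sub>M x) = a \<otimes> f v x"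
    and f_om: "!!v w. v : Vs ==> w : Vs ==> f v (om w) = (if v = w then \<one> else \<zero>)"
begin

sublocale M: module R M by (rule M)
sublocale E: ring "EA M" by (rule EA_ring[OF M])
sublocale EMod: module R "EA M" by (rule EA_module[OF M])

definition p where "p v x = x \<ominus>\<^sub>M f v x \<odot>\<^sub>M om v"

text \<open>The algebra endomorphism that kills \<open>g v\<close> and fixes the other
  \<open>g w\<close>. Its kernel is an ideal because it is multiplicative, and the complementary
  idempotent \<open>1 - Q v\<close> projects onto the ideal of \<open>g v\<close>.\<close>

definition Q where "Q v = EM M (p v)"

abbreviation "g v \<equiv> gen M (om v)"

lemma f_minus: "v : Vs ==> x : carrier M ==> y : carrier M ==> f v (x \<ominus>\<^sub>M y) = f v x \<ominus> f v y"
proof -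
  assume v: "v : Vs" "x : carrier M" "y : carrier M"
  have "x \<ominus>\<^sub>M y = x \<oplus>\<^sub>M (\<ominus> \<one>) \<odot>\<^sub>M y" using v by (simp add: a_minus_def M.smult_l_minus)
  then show ?thesis using v f_closed by (simp add: f_add f_smult l_minus) (simp add: a_minus_def)
qed

lemma p_hom: "v : Vs ==> p v : mod_hom R M M"
proof (rule mod_homI)
  assume v: "v : Vs"
  note [simp] = f_closed[OF v] om[OF v]
  show "p v x : carrier M" if "x : carrier M" for x using that by (simp add: p_def)
  show "p v (x \<oplus>\<^sub>M y) = p v x \<oplus>\<^sub>M p v y" if "x : carrier M" "y : carrier M" for x y
    using that by (simp add: p_def f_add[OF v] M.smult_l_distr a_minus_def M.M.minus_add M.M.a_ac)
  show "p v (a \<odot>\<^sub>M x) = a \<odot>\<^sub>M p v x" if "a : carrier R" "x : carrier M" for a x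
    using that by (simp add: p_def f_smult[OF v] M.smult_r_distr a_minus_def M.smult_r_minus M.smult_assoc1)
qed

lemma p_closed: "v : Vs ==> x : carrier M ==> p v x : carrier M" using mod_hom_closed[OF p_hom] .

lemma p_om: "v : Vs ==> w : Vs ==> p v (om w) = (if v = w then \<zero>\<^sub>M else om w)"
  using om by (auto simp: p_def f_om M.minus_self) (simp add: a_minus_def M.M.add.inv_one)

lemma p_p: "v : Vs ==> x : carrier M ==> p v (p v x) = p v x"
proof -
  assume v: "v : Vs" "x : carrier M"
  have "f v (p v x) = \<zero>" unfolding p_def
    using v om f_closed by (simp add: f_minus f_smult f_om) (simp add: a_minus_def r_neg)
  then show ?thesis using p_closed[OF v] om[OF v(1)] unfolding p_def[of v "p v x"] by (simp add: a_minus_def M.M.add.inv_one)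
qed

text \<open>For different \<open>v\<close> and \<open>w\<close> the functional \<open>f v\<close>
  does not see the correction along \<open>om w\<close>, so both orders subtract the same two
  terms.\<close>

lemma p_comm:
  assumes "v : Vs" "w : Vs" "x : carrier M"
  shows "p v (p w x) = p w (p v x)"
proof (cases "v = w")
  case False
  have "p v (p w x) = (x \<ominus>\<^sub>M f w x \<odot>\<^sub>M om w) \<ominus>\<^sub>M f v x \<odot>\<^sub>M om v" if "v : Vs" "w : Vs" "v ~= w" for v w
  proof -
    have "f v (p w x) = f v x"
      unfolding p_def using that assms(3) om f_closed by (simp add: f_minus f_smult f_om) (simp add: a_minus_def)
    then show ?thesis by (simp add: p_def)
  qed
  from this[OF assms(1,2) False] this[OF assms(2,1) False[symmetric]]
  show ?thesis using assms om f_closed by (simp add: a_minus_def M.M.a_ac)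
qed simp

lemma Q_hom: "v : Vs ==> Q v : mod_hom R (EA M) (EA M)" unfolding Q_def by (rule EM_hom[OF M M p_hom])

lemma Q_closed: "v : Vs ==> x : carrier (EA M) ==> Q v x : carrier (EA M)" using mod_hom_closed[OF Q_hom] .

lemma Q_mult: "v : Vs ==> x : carrier (EA M) ==> y : carrier (EA M) ==> Q v (x \<otimes>\<^sub>(EA M) y) = Q v x \<otimes>\<^sub>(EA M) Q v y"
  unfolding Q_def by (rule EM_mult[OF M M p_hom])

lemma Q_one: "v : Vs ==> Q v \<one>\<^sub>(EA M) = \<one>\<^sub>(EA M)" unfolding Q_def by (rule EM_one[OF M M p_hom])

lemma Q_zero: "v : Vs ==> Q v \<zero>\<^sub>(EA M) = \<zero>\<^sub>(EA M)"
  by (rule mod_hom_zero[OF EA_module[OF M] EA_module[OF M] Q_hom])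

lemma g_closed: "v : Vs ==> g v : carrier (EA M)" using gen_closed[OF M om] .

lemma gen_zero: "gen M \<zero>\<^sub>M = \<zero>\<^sub>(EA M)"
  using gen_smult[OF M zero_closed, of "\<zero>\<^sub>M"] gen_closed[OF M, of "\<zero>\<^sub>M"] by simp

lemma Q_g: "v : Vs ==> w : Vs ==> Q v (g w) = (if v = w then \<zero>\<^sub>(EA M) else g w)"
  unfolding Q_def using EM_gen[OF M M p_hom om] p_om gen_zero by simp

lemma Q_comm: "v : Vs ==> w : Vs ==> x : carrier (EA M) ==> Q v (Q w x) = Q w (Q v x)"
proof -
  assume v: "v : Vs" and w: "w : Vs" and x: "x : carrier (EA M)"
  note h = mod_hom_comp[OF p_hom[OF v] p_hom[OF w]]
  show ?thesis unfolding Q_def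
    using EM_comp[OF M M M p_hom[OF w] p_hom[OF v] h _ x] EM_comp[OF M M M p_hom[OF v] p_hom[OF w] h p_comm[OF w v] x] by simp
qed

lemma Q_Q: "v : Vs ==> x : carrier (EA M) ==> Q v (Q v x) = Q v x"
  unfolding Q_def using EM_comp[OF M M M p_hom p_hom p_hom p_p] by blast

text \<open>By induction over products of generators. A generator splits into a part fixed by
  \<open>Q v\<close> and a multiple of \<open>g v\<close>. The second part contributes a term
  divisible by \<open>g v\<close> outright, the first one after an exchange by
  anticommutation.\<close>

lemma Q_defect: "v : Vs ==> x : carrier (EA M) ==> EX z:carrier (EA M). x \<ominus>\<^sub>(EA M) Q v x = g v \<otimes>\<^sub>(EA M) z"
proof -
  assume v: "v : Vs" and x: "x : carrier (EA M)"
  note gv = g_closed[OF v] and Qc = Q_closed[OF v] and sm = EA_smult_mult[OF M]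
  show ?thesis using M x
  proof (induct rule: EA_induct)
    case (add x y)
    obtain z where z: "z : carrier (EA M)" "x \<ominus>\<^sub>(EA M) Q v x = g v \<otimes>\<^sub>(EA M) z" using add by blast
    obtain z' where z': "z' : carrier (EA M)" "y \<ominus>\<^sub>(EA M) Q v y = g v \<otimes>\<^sub>(EA M) z'" using add by blast
    have "(x \<oplus>\<^sub>(EA M) y) \<ominus>\<^sub>(EA M) Q v (x \<oplus>\<^sub>(EA M) y) = (x \<ominus>\<^sub>(EA M) Q v x) \<oplus>\<^sub>(EA M) (y \<ominus>\<^sub>(EA M) Q v y)"
      using add(1,2) Qc by (simp add: mod_hom_add[OF Q_hom[OF v]] a_minus_def E.minus_add E.a_ac)
    also have "\<dots> = g v \<otimes>\<^sub>(EA M) (z \<oplus>\<^sub>(EA M) z')" using z z' gv by (simp add: E.r_distr)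
    finally show ?case using z(1) z'(1) by blast
  next
    case (smult a x)
    obtain z where z: "z : carrier (EA M)" "x \<ominus>\<^sub>(EA M) Q v x = g v \<otimes>\<^sub>(EA M) z" using smult by blast
    have "a \<odot>\<^sub>(EA M) x \<ominus>\<^sub>(EA M) Q v (a \<odot>\<^sub>(EA M) x) = a \<odot>\<^sub>(EA M) (x \<ominus>\<^sub>(EA M) Q v x)"
      using smult(1,2) Qc by (simp add: mod_hom_smult[OF Q_hom[OF v]] a_minus_def EMod.smult_r_distr EMod.smult_r_minus)
    also have "\<dots> = g v \<otimes>\<^sub>(EA M) (a \<odot>\<^sub>(EA M) z)" using z gv smult(1) by (simp add: sm(2))
    finally show ?case using z(1) smult(1) by blast
  next
    case one
    have "\<one>\<^sub>(EA M) \<ominus>\<^sub>(EA M) Q v \<one>\<^sub>(EA M) = g v \<otimes>\<^sub>(EA M) \<zero>\<^sub>(EA M)"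
      using gv by (simp add: Q_one[OF v] a_minus_def E.r_neg)
    then show ?case by blast
  next
    case (gen u x)
    obtain z where z: "z : carrier (EA M)" "x \<ominus>\<^sub>(EA M) Q v x = g v \<otimes>\<^sub>(EA M) z" using gen by blast
    \<comment> \<open>The coefficient of \<open>om v\<close> in \<open>u\<close>; what remains is
      \<open>p v u\<close>.\<close>
    let ?c = "f v u"
    have c: "?c : carrier R" using f_closed[OF v gen(1)] .
    have gu: "gen M u : carrier (EA M)" using gen_closed[OF M gen(1)] .
    have pu: "gen M (p v u) : carrier (EA M)" using gen_closed[OF M p_closed[OF v gen(1)]] .
    have u: "gen M u = gen M (p v u) \<oplus>\<^sub>(EA M) ?c \<odot>\<^sub>(EA M) g v"
    proof -
      have "u = p v u \<oplus>\<^sub>M ?c \<odot>\<^sub>M om v"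
        using gen(1) om[OF v] c by (simp add: p_def a_minus_def M.M.a_assoc M.M.l_neg)
      then have "gen M u = gen M (p v u \<oplus>\<^sub>M ?c \<odot>\<^sub>M om v)" by simp
      then show ?thesis
        using gen_add[OF M p_closed[OF v gen(1)], of "?c \<odot>\<^sub>M om v"] gen_smult[OF M c om[OF v]] om[OF v] c by simp
    qed
    have Qx: "Q v (gen M u \<otimes>\<^sub>(EA M) x) = gen M (p v u) \<otimes>\<^sub>(EA M) Q v x"
      using Q_mult[OF v gu gen(2)] EM_gen[OF M M p_hom[OF v] gen(1)] by (simp add: Q_def)
    have xx: "x = g v \<otimes>\<^sub>(EA M) z \<oplus>\<^sub>(EA M) Q v x"
      unfolding z(2)[symmetric] using gen(2) Qc[OF gen(2)] by (simp add: a_minus_def E.a_assoc E.l_neg)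
    have anti: "gen M (p v u) \<otimes>\<^sub>(EA M) g v = \<ominus>\<^sub>(EA M) (g v \<otimes>\<^sub>(EA M) gen M (p v u))"
      by (rule gen_anticomm[OF M p_closed[OF v gen(1)] om[OF v]])
    have "gen M u \<otimes>\<^sub>(EA M) x = gen M (p v u) \<otimes>\<^sub>(EA M) x \<oplus>\<^sub>(EA M) (?c \<odot>\<^sub>(EA M) g v) \<otimes>\<^sub>(EA M) x"
      unfolding u using pu c gv gen(2) by (intro E.l_distr) auto
    also have "(?c \<odot>\<^sub>(EA M) g v) \<otimes>\<^sub>(EA M) x = g v \<otimes>\<^sub>(EA M) (?c \<odot>\<^sub>(EA M) x)"
      using sm[OF c gv gen(2)] by simp
    also have "gen M (p v u) \<otimes>\<^sub>(EA M) x = gen M (p v u) \<otimes>\<^sub>(EA M) (g v \<otimes>\<^sub>(EA M) z) \<oplus>\<^sub>(EA M) gen M (p v u) \<otimes>\<^sub>(EA M) Q v x"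
      using arg_cong[OF xx, of "%y. gen M (p v u) \<otimes>\<^sub>(EA M) y"] pu gv z(1) Qc[OF gen(2)] by (simp add: E.r_distr)
    also have "gen M (p v u) \<otimes>\<^sub>(EA M) (g v \<otimes>\<^sub>(EA M) z) = g v \<otimes>\<^sub>(EA M) (\<ominus>\<^sub>(EA M) (gen M (p v u) \<otimes>\<^sub>(EA M) z))"
    proof -
      have "gen M (p v u) \<otimes>\<^sub>(EA M) (g v \<otimes>\<^sub>(EA M) z) = (gen M (p v u) \<otimes>\<^sub>(EA M) g v) \<otimes>\<^sub>(EA M) z"
        using pu gv z(1) by (simp add: E.m_assoc)
      then show ?thesis unfolding anti using pu gv z(1) by (simp add: E.l_minus E.r_minus E.m_assoc)
    qed
    finally have eq: "gen M u \<otimes>\<^sub>(EA M) x = (g v \<otimes>\<^sub>(EA M) (\<ominus>\<^sub>(EA M) (gen M (p v u) \<otimes>\<^sub>(EA M) z)) \<oplus>\<^sub>(EA M) gen M (p v u) \<otimes>\<^sub>(EA M) Q v x)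
        \<oplus>\<^sub>(EA M) g v \<otimes>\<^sub>(EA M) (?c \<odot>\<^sub>(EA M) x)" .
    define X Y W where "X = g v \<otimes>\<^sub>(EA M) (\<ominus>\<^sub>(EA M) (gen M (p v u) \<otimes>\<^sub>(EA M) z))"
      and "Y = gen M (p v u) \<otimes>\<^sub>(EA M) Q v x" and "W = g v \<otimes>\<^sub>(EA M) (?c \<odot>\<^sub>(EA M) x)"
    have XYW: "X : carrier (EA M)" "Y : carrier (EA M)" "W : carrier (EA M)"
      using pu gv z(1) c gen(2) Qc[OF gen(2)] by (auto simp: X_def Y_def W_def)
    have "gen M u \<otimes>\<^sub>(EA M) x \<ominus>\<^sub>(EA M) Q v (gen M u \<otimes>\<^sub>(EA M) x) = ((X \<oplus>\<^sub>(EA M) Y) \<oplus>\<^sub>(EA M) W) \<ominus>\<^sub>(EA M) Y"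
      by (simp only: Qx, simp only: eq X_def Y_def W_def)
    also have "\<dots> = X \<oplus>\<^sub>(EA M) W" using XYW by (simp add: a_minus_def E.a_ac E.r_neg1 E.r_neg2 E.r_neg)
    also have "\<dots> = g v \<otimes>\<^sub>(EA M) ((\<ominus>\<^sub>(EA M) (gen M (p v u) \<otimes>\<^sub>(EA M) z)) \<oplus>\<^sub>(EA M) ?c \<odot>\<^sub>(EA M) x)"
      unfolding X_def W_def using pu gv z(1) c gen(2) by (simp add: E.r_distr)
    finally show ?case using pu gv z(1) c gen(2) by blast
  qed
qed

lemma kernel_ideal:
  assumes h: "h : mod_hom R (EA M) (EA M)"
    "!!x y. x : carrier (EA M) ==> y : carrier (EA M) ==> h (x \<otimes>\<^sub>(EA M) y) = h x \<otimes>\<^sub>(EA M) h y"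
    and I: "ideal I (EA M)"
  shows "ideal {x : carrier (EA M). h x : I} (EA M)"
proof (rule idealI[OF E.ring_axioms])
  interpret I: ideal I "EA M" by (rule I)
  let ?K = "{x : carrier (EA M). h x : I}"
  note EAm = EA_module[OF M]
  show "subgroup ?K (add_monoid (EA M))"
  proof (rule E.add.subgroupI)
    show "?K ~= {}" using mod_hom_zero[OF EAm EAm h(1)] I.zero_closed by force
    show "\<ominus>\<^sub>(EA M) a : ?K" if "a : ?K" for a using that mod_hom_uminus[OF EAm EAm h(1)] I.a_inv_closed by auto
    show "a \<oplus>\<^sub>(EA M) b : ?K" if "a : ?K" "b : ?K" for a b using that mod_hom_add[OF h(1)] I.a_closed by auto
  qed auto
  show "x \<otimes>\<^sub>(EA M) a : ?K" "a \<otimes>\<^sub>(EA M) x : ?K" if "a : ?K" "x : carrier (EA M)" for a x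
    using that h(2) mod_hom_closed[OF h(1)] I.I_l_closed I.I_r_closed by auto
qed

definition VI where "VI = Idl\<^bsub>EA M\<^esub> (g ` Vs)"

lemma VI_ideal: "ideal VI (EA M)" unfolding VI_def using g_closed by (intro E.genideal_ideal) auto

lemma g_VI: "v : Vs ==> g v : VI" unfolding VI_def using E.genideal_self[of "g ` Vs"] g_closed by auto

text \<open>The composite of all \<open>Q v\<close> is multiplicative and kills every generator of
  the ideal, hence the ideal itself; but it fixes \<open>x\<close>.\<close>

lemma VI_fixed_zero:
  assumes fin: "finite Vs" and x: "x : VI" "!!v. v : Vs ==> Q v x = x"
  shows "x = \<zero>\<^sub>(EA M)"
proof -
  have xc: "x : carrier (EA M)" using x(1) ideal.Icarr[OF VI_ideal] by blast
  \<comment> \<open>The composite is built over finite subsets \<open>A\<close>, remembering only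
    three properties: it is multiplicative, its values on the generators are known, and it fixes
    \<open>x\<close>.\<close>
  have "EX h:mod_hom R (EA M) (EA M). (ALL y:carrier (EA M). ALL z:carrier (EA M). h (y \<otimes>\<^sub>(EA M) z) = h y \<otimes>\<^sub>(EA M) h z) &
      (ALL v:Vs. h (g v) = (if v : A then \<zero>\<^sub>(EA M) else g v)) & h x = x" if "finite A" "A \<subseteq> Vs" for A
    using that
  proof (induct A)
    case empty
    show ?case by (rule bexI[of _ "%y. y"]) (auto intro: mod_homI)
  next
    case (insert w A)
    then obtain h where h: "h : mod_hom R (EA M) (EA M)"
      "ALL y:carrier (EA M). ALL z:carrier (EA M). h (y \<otimes>\<^sub>(EA M) z) = h y \<otimes>\<^sub>(EA M) h z"
      "ALL v:Vs. h (g v) = (if v : A then \<zero>\<^sub>(EA M) else g v)" "h x = x" by auto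
    have w: "w : Vs" using insert by auto
    show ?case
    proof (rule bexI[of _ "%y. Q w (h y)"], intro conjI ballI)
      show "Q w (h (y \<otimes>\<^sub>(EA M) z)) = Q w (h y) \<otimes>\<^sub>(EA M) Q w (h z)" if "y : carrier (EA M)" "z : carrier (EA M)" for y z
        using that h(2) mod_hom_closed[OF h(1)] Q_mult[OF w] by simp
      show "Q w (h (g v)) = (if v : insert w A then \<zero>\<^sub>(EA M) else g v)" if "v : Vs" for v
        using h(3) Q_g[OF w that] Q_zero[OF w] that by auto
      show "Q w (h x) = x" using h(4) x(2)[OF w] by simp
    qed (rule mod_hom_comp[OF Q_hom[OF w] h(1)])
  qed
  from this[OF fin subset_refl] obtain h where h: "h : mod_hom R (EA M) (EA M)"
    "ALL y:carrier (EA M). ALL z:carrier (EA M). h (y \<otimes>\<^sub>(EA M) z) = h y \<otimes>\<^sub>(EA M) h z"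
    "ALL v:Vs. h (g v) = (if v : Vs then \<zero>\<^sub>(EA M) else g v)" "h x = x" by blast
  have K: "ideal {x : carrier (EA M). h x : {\<zero>\<^sub>(EA M)}} (EA M)"
    using h(2) by (intro kernel_ideal[OF h(1) _ E.zeroideal]) blast
  have "g ` Vs \<subseteq> {x : carrier (EA M). h x : {\<zero>\<^sub>(EA M)}}" using g_closed h(3) by auto
  then have "VI \<subseteq> {x : carrier (EA M). h x : {\<zero>\<^sub>(EA M)}}"
    unfolding VI_def by (rule E.genideal_minimal[OF K])
  then show ?thesis using x(1) h(4) by auto
qed

definition wd where "wd vs = wedge R M (map om vs)"

lemma wd_simps: "wd [] = \<one>\<^sub>(EA M)" "wd (v # vs) = g v \<otimes>\<^sub>(EA M) wd vs"
  by (simp_all add: wd_def wedge_def)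

lemma wd_closed: "set vs \<subseteq> Vs ==> wd vs : carrier (EA M)" by (induct vs) (auto simp: wd_simps g_closed)

lemma Q_wd:
  assumes "set vs \<subseteq> Vs" "v : Vs"
  shows "Q v (wd vs) = (if v : set vs then \<zero>\<^sub>(EA M) else wd vs)" using assms(1)
proof (induct vs)
  case Nil
  then show ?case using Q_one[OF assms(2)] by (simp add: wd_simps)
next
  case (Cons w vs)
  then show ?case using Q_mult[OF assms(2), of "g w" "wd vs"] Q_g[OF assms(2), of w] wd_closed[of vs] g_closed[of w]
    by (auto simp: wd_simps)
qed

text \<open>The scalar arises as a sign, one exchange for each factor; for ideals it matters only
  that it is a scalar.\<close>

lemma wd_comm:
  assumes "set vs \<subseteq> Vs" "v : Vs"
  shows "EX c:carrier R. wd vs \<otimes>\<^sub>(EA M) g v = c \<odot>\<^sub>(EA M) (g v \<otimes>\<^sub>(EA M) wd vs)"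
  using assms(1)
proof (induct vs)
  case Nil
  then show ?case using g_closed[OF assms(2)] by (intro bexI[of _ \<one>]) (auto simp: wd_simps)
next
  case (Cons w vs)
  then obtain c where c: "c : carrier R" "wd vs \<otimes>\<^sub>(EA M) g v = c \<odot>\<^sub>(EA M) (g v \<otimes>\<^sub>(EA M) wd vs)" by auto
  have cl: "g v : carrier (EA M)" "g w : carrier (EA M)" "wd vs : carrier (EA M)"
    using g_closed wd_closed Cons assms(2) by auto
  have "wd (w # vs) \<otimes>\<^sub>(EA M) g v = g w \<otimes>\<^sub>(EA M) (c \<odot>\<^sub>(EA M) (g v \<otimes>\<^sub>(EA M) wd vs))"
    using cl c by (simp add: wd_simps E.m_assoc)
  also have "\<dots> = c \<odot>\<^sub>(EA M) ((g w \<otimes>\<^sub>(EA M) g v) \<otimes>\<^sub>(EA M) wd vs)"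
    using cl c(1) by (simp add: EA_smult_mult(2)[OF M] E.m_assoc)
  also have "g w \<otimes>\<^sub>(EA M) g v = \<ominus>\<^sub>(EA M) (g v \<otimes>\<^sub>(EA M) g w)"
    by (rule gen_anticomm[OF M om om]) (use Cons(2) assms(2) in auto)
  also have "c \<odot>\<^sub>(EA M) (\<ominus>\<^sub>(EA M) (g v \<otimes>\<^sub>(EA M) g w) \<otimes>\<^sub>(EA M) wd vs) = (\<ominus> c) \<odot>\<^sub>(EA M) (g v \<otimes>\<^sub>(EA M) wd (w # vs))"
    using cl c(1) by (simp add: wd_simps E.l_minus EMod.smult_r_minus EMod.smult_l_minus E.m_assoc)
  finally show ?case using c(1) by (intro bexI[of _ "\<ominus> c"]) auto
qed

text \<open>One factor is split off at a time. If \<open>y = wd vs * z\<close> and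
  \<open>Q v y = 0\<close>, then \<open>wd vs * Q v z = 0\<close>, so \<open>z\<close> may be
  replaced by \<open>z - Q v z\<close>, which is divisible by \<open>g v\<close>.\<close>

lemma wd_factor:
  assumes "distinct vs" "set vs \<subseteq> Vs" "y : carrier (EA M)" "!!v. v : set vs ==> Q v y = \<zero>\<^sub>(EA M)"
  shows "EX z:carrier (EA M). y = wd vs \<otimes>\<^sub>(EA M) z" using assms
proof (induct vs)
  case Nil
  then show ?case by (intro bexI[of _ y]) (auto simp: wd_simps)
next
  case (Cons v vs)
  then obtain z where z: "z : carrier (EA M)" "y = wd vs \<otimes>\<^sub>(EA M) z" by auto
  have v: "v : Vs" "v ~: set vs" "set vs \<subseteq> Vs" using Cons by auto
  have cl: "g v : carrier (EA M)" "wd vs : carrier (EA M)" using g_closed wd_closed v by auto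
  obtain z' where z': "z' : carrier (EA M)" "z \<ominus>\<^sub>(EA M) Q v z = g v \<otimes>\<^sub>(EA M) z'" using Q_defect[OF v(1) z(1)] by blast
  obtain c where c: "c : carrier R" "wd vs \<otimes>\<^sub>(EA M) g v = c \<odot>\<^sub>(EA M) (g v \<otimes>\<^sub>(EA M) wd vs)" using wd_comm[OF v(3,1)] by blast
  \<comment> \<open>\<open>Q v\<close> fixes \<open>wd vs\<close>, as \<open>v\<close> is not among
    its factors.\<close>
  have "wd vs \<otimes>\<^sub>(EA M) Q v z = Q v y"
    unfolding z(2) using Q_mult[OF v(1) cl(2) z(1)] Q_wd[OF v(3,1)] v(2) by simp
  then have 0: "wd vs \<otimes>\<^sub>(EA M) Q v z = \<zero>\<^sub>(EA M)" using Cons(5)[of v] by simp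
  have "wd vs \<otimes>\<^sub>(EA M) (z \<ominus>\<^sub>(EA M) Q v z) = wd vs \<otimes>\<^sub>(EA M) z \<ominus>\<^sub>(EA M) wd vs \<otimes>\<^sub>(EA M) Q v z"
    using cl z(1) Q_closed[OF v(1) z(1)] by (simp add: a_minus_def E.r_distr E.r_minus)
  then have "wd vs \<otimes>\<^sub>(EA M) (z \<ominus>\<^sub>(EA M) Q v z) = y"
    using 0 z(2) Cons(4) by (simp add: a_minus_def)
  then have "y = (wd vs \<otimes>\<^sub>(EA M) g v) \<otimes>\<^sub>(EA M) z'" using z' cl by (simp add: E.m_assoc)
  also have "\<dots> = wd (v # vs) \<otimes>\<^sub>(EA M) (c \<odot>\<^sub>(EA M) z')"
    unfolding c(2) using c(1) cl z'(1) by (simp add: wd_simps EA_smult_mult[OF M])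
  finally show ?case using c(1) z'(1) by blast
qed

text \<open>Membership in a principal ideal becomes a system of equations, and inclusions between
  such ideals become inclusions between sets of vertices. One inclusion holds because the kernel of
  each \<open>Q v\<close> is an ideal, the other is divisibility by
  \<open>wd_factor\<close>.\<close>

lemma wd_ideal:
  assumes vs: "distinct vs" "set vs \<subseteq> Vs"
  shows "Idl\<^bsub>EA M\<^esub> {wd vs} = {x : carrier (EA M). ALL v:set vs. Q v x = \<zero>\<^sub>(EA M)}"
proof
  have wc: "{wd vs} \<subseteq> carrier (EA M)" using wd_closed[OF vs(2)] by simp
  interpret I: ideal "Idl\<^bsub>EA M\<^esub> {wd vs}" "EA M" by (rule E.genideal_ideal[OF wc])
  have "Idl\<^bsub>EA M\<^esub> {wd vs} \<subseteq> {x : carrier (EA M). Q v x : {\<zero>\<^sub>(EA M)}}" if v: "v : set vs" for v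
  proof (rule E.genideal_minimal)
    have vV: "v : Vs" using v vs(2) by blast
    show "ideal {x : carrier (EA M). Q v x : {\<zero>\<^sub>(EA M)}} (EA M)"
      by (rule kernel_ideal[OF Q_hom[OF vV] Q_mult[OF vV] E.zeroideal])
    show "{wd vs} \<subseteq> {x : carrier (EA M). Q v x : {\<zero>\<^sub>(EA M)}}" using Q_wd[OF vs(2) vV] v wc by simp
  qed
  then show "Idl\<^bsub>EA M\<^esub> {wd vs} \<subseteq> {x : carrier (EA M). ALL v:set vs. Q v x = \<zero>\<^sub>(EA M)}"
    using I.a_subset by blast
  show "{x : carrier (EA M). ALL v:set vs. Q v x = \<zero>\<^sub>(EA M)} \<subseteq> Idl\<^bsub>EA M\<^esub> {wd vs}"
  proof
    fix x assume "x : {x : carrier (EA M). ALL v:set vs. Q v x = \<zero>\<^sub>(EA M)}"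
    then obtain z where "z : carrier (EA M)" "x = wd vs \<otimes>\<^sub>(EA M) z" using wd_factor[OF vs, of x] by blast
    then show "x : Idl\<^bsub>EA M\<^esub> {wd vs}" using I.I_r_closed E.genideal_self[OF wc] by simp
  qed
qed

lemma wd_ideal_sub_VI:
  assumes vs: "set vs \<subseteq> Vs" "vs ~= []"
  shows "Idl\<^bsub>EA M\<^esub> {wd vs} \<subseteq> VI"
proof (rule E.genideal_minimal[OF VI_ideal])
  interpret I: ideal VI "EA M" by (rule VI_ideal)
  obtain v ws where "vs = v # ws" using vs(2) by (cases vs) auto
  then show "{wd vs} \<subseteq> VI" using I.I_r_closed[OF g_VI, of v "wd ws"] wd_closed[of ws] vs(1) by (simp add: wd_simps)
qed

end

text \<open>A scalar acts as multiplication by its multiple of the unit.\<close>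

lemma ideal_submodule:
  assumes M: "module R M" and R: "cring R" and I: "ideal I (exterior_algebra R M)"
  shows "submodule I R (exterior_algebra R M)"
proof -
  interpret coefficient_ring R by (rule coefficient_ring.intro[OF R])
  interpret E: ring "EA M" by (rule EA_ring[OF M])
  interpret EMod: module R "EA M" by (rule EA_module[OF M])
  interpret I: ideal I "EA M" by (rule I)
  show ?thesis
  proof (rule EMod.submoduleI)
    show "I \<subseteq> carrier (EA M)" by (rule I.a_subset)
    show "a \<odot>\<^sub>(EA M) x : I" if a: "a : carrier R" and x: "x : I" for a x
    proof -
      have xc: "x : carrier (EA M)" using x I.a_subset by blast
      have "a \<odot>\<^sub>(EA M) x = (a \<odot>\<^sub>(EA M) \<one>\<^sub>(EA M)) \<otimes>\<^sub>(EA M) x"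
        using EA_smult_mult(1)[OF M a E.one_closed xc] xc by simp
      then show ?thesis using I.I_l_closed[OF x] a by simp
    qed
  qed (auto intro: I.a_inv_closed)
qed

section \<open>The double complex of a local system\<close>

section \<open>Local systems on a homology manifold\<close>

text \<open>The operators and their commutation relations are established for an abstract local
  system; ideals enter afterwards as submodules. Bijectivity of \<open>mr\<close> is asked away from
  the bottom only, because the exterior sheaf is zero at the bottom.\<close>

locale local_system = signed_poset S R eps
  for S :: "'p::order set" and R :: "'k ring" (structure) and eps +
  fixes n :: nat and u :: "'p => 'k" and Lam :: "'p => ('k, 'l) module" and mr :: "'p => 'p => 'l => 'l"
  assumes dim: "poset_dim S = int n - 1" and fund: "fundamental n u"
    and acyclic: "!!J. J : S ==> J ~= bot_of S ==> flag_acyclic RM J (n - rank S J)"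
    and Lam: "!!I. I : S ==> module R (Lam I)"
    and mr_hom: "!!I J. I : S ==> J : S ==> I <= J ==> mr I J : mod_hom R (Lam I) (Lam J)"
    and mr_bij: "!!I J. I : S ==> J : S ==> I <= J ==> I ~= bot_of S ==> bij_betw (mr I J) (carrier (Lam I)) (carrier (Lam J))"
    and mr_comp: "!!I J K x. I : S ==> J : S ==> K : S ==> I <= J ==> J <= K ==> x : carrier (Lam I) ==>
      mr J K (mr I J x) = mr I K x"
begin

abbreviation "cinc J \<equiv> inc (Lam J) (cov {J}) e"
abbreviation "rinc J I \<equiv> inc (Lam J) (dn I) et"

definition rk :: "nat => 'p set" where "rk a = {J : S. rank S J = a}"

text \<open>Pairs with the larger cell first. The shift in \<open>Suc b\<close> keeps
  \<open>I\<close> away from the bottom, whose place in each column is taken by the augmentation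
  \<open>ep\<close>.\<close>

definition X :: "nat => nat => ('p \<times> 'p) set" where
  "X a b = {(J, I). J : S & I : S & I <= J & rank S J = a & rank S I = Suc b}"

definition mi :: "'p => 'p => 'l => 'l" where
  "mi I J = inv_into (carrier (Lam I)) (mr I J)"

definition "A a = direct_sum (rk a) Lam"
definition "D a b = direct_sum (X a b) (%p. Lam (fst p))"
definition "C b = direct_sum (rk (Suc b)) Lam"

text \<open>Within a column all values lie in \<open>Lam J\<close>, so \<open>ep\<close> and
  \<open>del\<close> involve no transport. \<open>dA\<close> and \<open>dl\<close> transport upwards
  by \<open>mr\<close>, while \<open>g\<close> and \<open>dC\<close> bring values back to a smaller
  cell by the inverse \<open>mi\<close>. The augmentation \<open>ep\<close> is the boundary into the
  empty cell, which makes each column a reduced complex.\<close>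

definition "dA a = lmap (rk (Suc a)) (dn (bot_of S)) Lam (%J I x. e J I \<odot>\<^sub>(Lam J) mr I J x)"
definition "ep a = lmap (rk a) (%J. Pair J ` cov {J} (bot_of S)) Lam (%J p x. e (snd p) (bot_of S) \<odot>\<^sub>(Lam J) x)"
definition "del a b = lmap (X a b) (%q. Pair (fst q) ` cov {fst q} (snd q)) (%q. Lam (fst q))
  (%q p x. e (snd p) (snd q) \<odot>\<^sub>(Lam (fst q)) x)"
definition "dl a b = lmap (X (Suc a) b) (%q. (%L. (L, snd q)) ` dn (snd q) (fst q)) (%q. Lam (fst q))
  (%q p x. e (fst q) (fst p) \<odot>\<^sub>(Lam (fst q)) mr (fst p) (fst q) x)"
text \<open>Integration over the top cells of the star of \<open>I\<close> against the fundamental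
  class, after transport to \<open>Lam I\<close>.\<close>

definition "g b = lmap (rk (Suc b)) (%I. (%F. (F, I)) ` st I n) Lam (%I p x. u (fst p) \<odot>\<^sub>(Lam I) mi I (fst p) x)"
definition "dC b = lmap (rk (Suc b)) (cov {}) Lam (%K I x. e I K \<odot>\<^sub>(Lam K) mi K I x)"

lemma XD: "(J, I) : X a b ==> J : S & I : S & I <= J & rank S J = a & rank S I = Suc b & I ~= bot_of S & J ~= bot_of S"
proof -
  assume a: "(J, I) : X a b"
  then have "I ~= bot_of S" by (auto simp: X_def)
  moreover have "J ~= bot_of S" using a calculation le_bot[of I] by (auto simp: X_def)
  ultimately show ?thesis using a by (simp add: X_def)
qed

lemma rkD: "J : rk a ==> J : S & rank S J = a" by (simp add: rk_def)

lemma rk_Suc: "J : rk (Suc a) ==> J ~= bot_of S" by (auto simp: rk_def)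

lemma covJ: "I : cov {J} K \<longleftrightarrow> covered_by S K I & I <= J" by (simp add: cov_def)

lemma cov_X: "J : S ==> rank S K = b ==> I : cov {J} K ==> (J, I) : X (rank S J) b"
  using covered_byD[of K I] by (auto simp: covJ X_def)

lemma uR: "F : S ==> rank S F = n ==> u F : Units R"
  and uR': "F : S ==> rank S F = n ==> u F : carrier R" using fund by (auto simp: fundamental_def)

lemma mr_iso: "I : S ==> J : S ==> I <= J ==> I ~= bot_of S ==> mr I J : mod_iso R (Lam I) (Lam J)"
  using mr_hom mr_bij by (simp add: mod_iso_def)

lemma mi_hom: "I : S ==> J : S ==> I <= J ==> I ~= bot_of S ==> mi I J : mod_hom R (Lam J) (Lam I)"
  unfolding mi_def by (rule mod_iso_hom[OF mod_iso_inv[OF Lam mr_iso]])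

lemma mr_closed: "I : S ==> J : S ==> I <= J ==> x : carrier (Lam I) ==> mr I J x : carrier (Lam J)"
  using mod_hom_closed[OF mr_hom] .

lemma mi_closed: "I : S ==> J : S ==> I <= J ==> I ~= bot_of S ==> x : carrier (Lam J) ==> mi I J x : carrier (Lam I)"
  using mod_hom_closed[OF mi_hom] .

lemma mi_mr: "I : S ==> J : S ==> I <= J ==> I ~= bot_of S ==> x : carrier (Lam I) ==> mi I J (mr I J x) = x"
  unfolding mi_def using bij_betw_inv_into_left[OF mr_bij] .

lemma mr_mi: "I : S ==> J : S ==> I <= J ==> I ~= bot_of S ==> x : carrier (Lam J) ==> mr I J (mi I J x) = x"
  unfolding mi_def using bij_betw_inv_into_right[OF mr_bij] .

lemma mi_mr_comp:
  assumes "I : S" "L : S" "F : S" "I <= L" "L <= F" "I ~= bot_of S" "x : carrier (Lam L)"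
  shows "mi I F (mr L F x) = mi I L x"
proof -
  have "mr L F x = mr I F (mi I L x)"
    using mr_comp[OF assms(1-5) mi_closed[OF assms(1,2,4,6,7)]] mr_mi[OF assms(1,2,4,6,7)] by simp
  then show ?thesis using mi_mr[OF assms(1,3) order_trans[OF assms(4,5)] assms(6) mi_closed[OF assms(1,2,4,6,7)]] by simp
qed

lemma mi_comp:
  assumes "K : S" "I : S" "F : S" "K <= I" "I <= F" "K ~= bot_of S" "x : carrier (Lam F)"
  shows "mi K I (mi I F x) = mi K F x"
proof -
  have I: "I ~= bot_of S" using le_bot[of K] assms by auto
  have c: "mi I F x : carrier (Lam I)" by (rule mi_closed[OF assms(2,3,5) I assms(7)])
  show ?thesis using mi_mr_comp[OF assms(1-6) c] mr_mi[OF assms(2,3,5) I assms(7)] by simp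
qed

lemma A_module: "module R (A a)" unfolding A_def by (rule direct_sum_module[OF is_cring Lam]) (simp add: rk_def)

lemma D_module: "module R (D a b)" unfolding D_def by (rule direct_sum_module[OF is_cring Lam]) (auto simp: X_def)

lemma C_module: "module R (C b)" unfolding C_def by (rule direct_sum_module[OF is_cring Lam]) (simp add: rk_def)

lemma dA_hom: "dA a : mod_hom R (A a) (A (Suc a))" unfolding dA_def A_def
proof (rule lmap_hom)
  fix J assume J: "J : rk (Suc a)"
  show "module R (Lam J)" using Lam rkD[OF J] by simp
  show "dn (bot_of S) J \<subseteq> rk a" using dnD rkD[OF J] by (fastforce simp: rk_def)
  show "(%x. e J I \<odot>\<^sub>(Lam J) mr I J x) : mod_hom R (Lam I) (Lam J)" if "I : dn (bot_of S) J" for I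
    using dnD[OF that] Lam mr_hom by (intro mod_hom_comp[OF mod_hom_scale]) auto
qed simp

lemma ep_hom: "ep a : mod_hom R (D a 0) (A a)" unfolding ep_def A_def D_def
proof (rule lmap_hom)
  fix J assume J: "J : rk a"
  show "module R (Lam J)" using Lam rkD[OF J] by simp
  show "Pair J ` cov {J} (bot_of S) \<subseteq> X a 0" using cov_X[of J "bot_of S" 0] rkD[OF J] by auto
  show "(%x. e (snd p) (bot_of S) \<odot>\<^sub>(Lam J) x) : mod_hom R (Lam (fst p)) (Lam J)" if "p : Pair J ` cov {J} (bot_of S)" for p
    using that mod_hom_scale[OF Lam[of J]] rkD[OF J] by auto
qed simp

lemma del_hom: "del a b : mod_hom R (D a (Suc b)) (D a b)" unfolding del_def D_def
proof (rule lmap_hom)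
  fix q assume q: "q : X a b"
  have q': "fst q : S" "rank S (fst q) = a" "rank S (snd q) = Suc b" using q by (auto simp: X_def)
  show "module R (Lam (fst q))" using Lam q' by simp
  show "Pair (fst q) ` cov {fst q} (snd q) \<subseteq> X a (Suc b)" using cov_X[OF q'(1,3)] q'(2) by auto
  show "(%x. e (snd p) (snd q) \<odot>\<^sub>(Lam (fst q)) x) : mod_hom R (Lam (fst p)) (Lam (fst q))"
    if "p : Pair (fst q) ` cov {fst q} (snd q)" for p using that mod_hom_scale[OF Lam[OF q'(1)]] by auto
qed simp

lemma dn_X: "(J, I) : X (Suc a) b ==> L : dn I J ==> (L, I) : X a b" using dnD[of L I J] by (auto simp: X_def)

lemma dl_hom: "dl a b : mod_hom R (D a b) (D (Suc a) b)" unfolding dl_def D_def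
proof (rule lmap_hom)
  fix q assume q: "q : X (Suc a) b"
  show "module R (Lam (fst q))" using Lam q by (auto simp: X_def)
  show "(%L. (L, snd q)) ` dn (snd q) (fst q) \<subseteq> X a b" using dn_X[of "fst q" "snd q"] q by auto
  show "(%x. e (fst q) (fst p) \<odot>\<^sub>(Lam (fst q)) mr (fst p) (fst q) x) : mod_hom R (Lam (fst p)) (Lam (fst q))"
    if "p : (%L. (L, snd q)) ` dn (snd q) (fst q)" for p
    using that Lam q mr_hom dnD by (intro mod_hom_comp[OF mod_hom_scale]) (auto simp: X_def)
qed simp

lemma stD: "F : st I a ==> F : S & I <= F & rank S F = a" by (simp add: st_def)

lemma g_hom: "g b : mod_hom R (D n b) (C b)" unfolding g_def D_def C_def
proof (rule lmap_hom)
  fix I assume I: "I : rk (Suc b)"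
  show "module R (Lam I)" using Lam rkD[OF I] by simp
  show "(%F. (F, I)) ` st I n \<subseteq> X n b" using rkD[OF I] by (auto simp: X_def st_def)
  show "(%x. u (fst p) \<odot>\<^sub>(Lam I) mi I (fst p) x) : mod_hom R (Lam (fst p)) (Lam I)"
    if "p : (%F. (F, I)) ` st I n" for p
    using that Lam rkD[OF I] rk_Suc[OF I] mi_hom stD uR' by (intro mod_hom_comp[OF mod_hom_scale]) auto
qed simp

lemma dC_hom: "dC b : mod_hom R (C (Suc b)) (C b)" unfolding dC_def C_def
proof (rule lmap_hom)
  fix K assume K: "K : rk (Suc b)"
  show "module R (Lam K)" using Lam rkD[OF K] by simp
  show "cov {} K \<subseteq> rk (Suc (Suc b))" using covered_byD rkD[OF K] by (fastforce simp: rk_def cov_def)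
  show "(%x. e I K \<odot>\<^sub>(Lam K) mi K I x) : mod_hom R (Lam I) (Lam K)" if "I : cov {} K" for I
  proof -
    have I: "I : S" "K <= I" using that covered_byD[of K I] by (auto simp: cov_def)
    show ?thesis using Lam mi_hom rkD[OF K] rk_Suc[OF K] I by (intro mod_hom_comp[OF mod_hom_scale]) auto
  qed
qed simp

lemma D_val: "z : carrier (D a b) ==> (J, I) : X a b ==> z (J, I) : carrier (Lam J)" by (auto simp: D_def PiE_iff)

lemma C_val: "y : carrier (C b) ==> I : rk (Suc b) ==> y I : carrier (Lam I)" by (auto simp: C_def PiE_iff)

lemma A_ext: "x : carrier (A a) ==> y : carrier (A a) ==> (!!J. J : rk a ==> x J = y J) ==> x = y"
  unfolding A_def by (auto intro: PiE_ext)

lemma C_ext: "x : carrier (C b) ==> y : carrier (C b) ==> (!!J. J : rk (Suc b) ==> x J = y J) ==> x = y"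
  unfolding C_def by (auto intro: PiE_ext)

lemma D_ext: "x : carrier (D a b) ==> y : carrier (D a b) ==> (!!J I. (J, I) : X a b ==> x (J, I) = y (J, I)) ==> x = y"
  unfolding D_def by (auto intro: PiE_ext)

lemma A_zero: "J : rk a ==> \<zero>\<^sub>(A a) J = \<zero>\<^sub>(Lam J)"
  and C_zero: "J : rk (Suc a) ==> \<zero>\<^sub>(C a) J = \<zero>\<^sub>(Lam J)"
  and D_zero: "(J, I) : X a b ==> \<zero>\<^sub>(D a b) (J, I) = \<zero>\<^sub>(Lam J)" by (simp_all add: A_def C_def D_def)

lemma ep_apply:
  assumes z: "z : carrier (D a 0)" and J: "J : rk a"
  shows "ep a z J = cinc J (%I. z (J, I)) (bot_of S)"
proof -
  interpret L: module R "Lam J" using Lam rkD[OF J] by simp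
  show ?thesis unfolding ep_def lmap_def inc_def using J D_val[OF z] cov_X[of J "bot_of S" 0] rkD[OF J]
    by (simp, subst L.M.finsum_reindex) (auto intro!: inj_onI L.smult_closed)
qed

lemma del_apply:
  assumes z: "z : carrier (D a (Suc b))" and JK: "(J, K) : X a b"
  shows "del a b z (J, K) = cinc J (%I. z (J, I)) K"
proof -
  interpret L: module R "Lam J" using Lam XD[OF JK] by simp
  show ?thesis unfolding del_def lmap_def inc_def using JK D_val[OF z] cov_X[of J K "Suc b"] XD[OF JK]
    by (simp, subst L.M.finsum_reindex) (auto intro!: inj_onI L.smult_closed)
qed

lemma dl_apply:
  assumes z: "z : carrier (D a b)" and JI: "(J, I) : X (Suc a) b"
  shows "dl a b z (J, I) = rinc J I (%L. mr L J (z (L, I))) J"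
proof -
  interpret L: module R "Lam J" using Lam XD[OF JI] by simp
  have c: "mr L J (z (L, I)) : carrier (Lam J)" if "L : dn I J" for L
    using D_val[OF z dn_X[OF JI that]] dnD[OF that] by (intro mr_closed) auto
  show ?thesis unfolding dl_def lmap_def inc_def using JI c
    by (simp, subst L.M.finsum_reindex) (auto intro!: inj_onI L.smult_closed)
qed

lemma g_apply:
  assumes z: "z : carrier (D n b)" and I: "I : rk (Suc b)"
  shows "g b z I = (\<Oplus>\<^bsub>Lam I\<^esub>F\<in>st I n. u F \<odot>\<^sub>(Lam I) mi I F (z (F, I)))"
proof -
  interpret L: module R "Lam I" using Lam rkD[OF I] by simp
  have c: "mi I F (z (F, I)) : carrier (Lam I)" if "F : st I n" for F
    using D_val[OF z, of F I] stD[OF that] rkD[OF I] rk_Suc[OF I] by (intro mi_closed) (auto simp: X_def)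
  show ?thesis unfolding g_def lmap_def using I c uR' stD
    by (simp, subst L.M.finsum_reindex) (auto intro!: inj_onI L.smult_closed)
qed

lemma dA_apply: "J : rk (Suc a) ==> dA a x J = inc (Lam J) (dn (bot_of S)) et (%L. mr L J (x L)) J"
  by (simp add: dA_def lmap_def inc_def)

lemma dC_apply: "K : rk (Suc b) ==> dC b y K = inc (Lam K) (cov {}) e (%I. mi K I (y I)) K"
  by (simp add: dC_def lmap_def inc_def)

lemma mr_inc:
  assumes "I : S" "J : S" "I <= J" "!!L. L : up K ==> s L K : carrier R" "!!L. L : up K ==> c L : carrier (Lam I)"
  shows "mr I J (inc (Lam I) up s c K) = inc (Lam J) up s (%L. mr I J (c L)) K"
proof -
  interpret I: module R "Lam I" by (rule Lam[OF assms(1)])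
  interpret J: module R "Lam J" by (rule Lam[OF assms(2)])
  note h = mr_hom[OF assms(1-3)]
  have "mr I J (inc (Lam I) up s c K) = (\<Oplus>\<^bsub>Lam J\<^esub>L\<in>up K. mr I J (s L K \<odot>\<^sub>(Lam I) c L))"
    unfolding inc_def using assms(4,5) by (intro mod_hom_finsum[OF Lam Lam h]) (auto simp: assms)
  also have "\<dots> = inc (Lam J) up s (%L. mr I J (c L)) K"
    unfolding inc_def using assms(4,5) mod_hom_closed[OF h] by (intro J.M.finsum_cong') (auto simp: mod_hom_smult[OF h])
  finally show ?thesis .
qed

lemma mi_inc:
  assumes "I : S" "J : S" "I <= J" "I ~= bot_of S" "!!L. L : up K ==> s L K : carrier R" "!!L. L : up K ==> c L : carrier (Lam J)"
  shows "mi I J (inc (Lam J) up s c K) = inc (Lam I) up s (%L. mi I J (c L)) K"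
proof -
  interpret I: module R "Lam I" by (rule Lam[OF assms(1)])
  interpret J: module R "Lam J" by (rule Lam[OF assms(2)])
  note h = mi_hom[OF assms(1-4)]
  have "mi I J (inc (Lam J) up s c K) = (\<Oplus>\<^bsub>Lam I\<^esub>L\<in>up K. mi I J (s L K \<odot>\<^sub>(Lam J) c L))"
    unfolding inc_def using assms(5,6) by (intro mod_hom_finsum[OF Lam Lam h]) (auto simp: assms)
  also have "\<dots> = inc (Lam I) up s (%L. mi I J (c L)) K"
    unfolding inc_def using assms(5,6) mod_hom_closed[OF h] by (intro I.M.finsum_cong') (auto simp: mod_hom_smult[OF h])
  finally show ?thesis .
qed

text \<open>Both orders sum over the pairs \<open>(L, I)\<close> in which \<open>I\<close> covers
  \<open>K\<close>, \<open>L\<close> is covered by \<open>J\<close> and \<open>I\<close> lies below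
  \<open>L\<close>; the coefficient is the same product of two signs. With \<open>K\<close> the
  bottom this gives \<open>dA_ep\<close>, otherwise \<open>dl_del\<close>.\<close>

lemma dl_inc_commute:
  assumes J: "J : S" and K: "K : S" "K <= J"
    and z: "!!L I. L : dn K J ==> I : cov {L} K ==> z (L, I) : carrier (Lam L)"
  shows "rinc J K (%L. mr L J (cinc L (%I. z (L, I)) K)) J =
    cinc J (%I. rinc J I (%L. mr L J (z (L, I))) J) K"
proof -
  interpret M: module R "Lam J" by (rule Lam[OF J])
  have iff: "L : dn K J & I : cov {L} K \<longleftrightarrow> I : cov {J} K & L : dn I J" for L I
    using covered_byD[of K I] covered_byD[of L J] by (auto simp: covJ dn_def dest: order_trans)
  have c: "mr L J (z (L, I)) : carrier (Lam J)" if "L : dn K J" "I : cov {L} K" for L I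
    using z[OF that] dnD[OF that(1)] by (intro mr_closed) auto
  have "rinc J K (%L. mr L J (cinc L (%I. z (L, I)) K)) J =
      (\<Oplus>\<^bsub>Lam J\<^esub>L\<in>dn K J. \<Oplus>\<^bsub>Lam J\<^esub>I\<in>cov {L} K. (e J L \<otimes> e I K) \<odot>\<^sub>(Lam J) mr L J (z (L, I)))"
    unfolding inc_def[of "Lam J" "dn K"]
  proof (rule M.M.finsum_cong'[OF refl])
    show "(%L. \<Oplus>\<^bsub>Lam J\<^esub>I\<in>cov {L} K. (e J L \<otimes> e I K) \<odot>\<^sub>(Lam J) mr L J (z (L, I))) : dn K J \<rightarrow> carrier (Lam J)"
      using c by (auto intro!: M.M.finsum_closed)
    fix L assume L: "L : dn K J"
    have "mr L J (cinc L (%I. z (L, I)) K) = inc (Lam J) (cov {L}) e (%I. mr L J (z (L, I))) K"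
      using dnD[OF L] z[OF L] by (intro mr_inc) auto
    then have "e J L \<odot>\<^sub>(Lam J) mr L J (cinc L (%I. z (L, I)) K) =
        (\<Oplus>\<^bsub>Lam J\<^esub>I\<in>cov {L} K. e J L \<odot>\<^sub>(Lam J) (e I K \<odot>\<^sub>(Lam J) mr L J (z (L, I))))"
      unfolding inc_def using c[OF L] by (simp add: M.finsum_smult_ldistr Pi_iff)
    also have "\<dots> = (\<Oplus>\<^bsub>Lam J\<^esub>I\<in>cov {L} K. (e J L \<otimes> e I K) \<odot>\<^sub>(Lam J) mr L J (z (L, I)))"
      using c[OF L] by (intro M.M.finsum_cong') (auto simp: M.smult_assoc1)
    finally show "e J L \<odot>\<^sub>(Lam J) mr L J (cinc L (%I. z (L, I)) K) =
        (\<Oplus>\<^bsub>Lam J\<^esub>I\<in>cov {L} K. (e J L \<otimes> e I K) \<odot>\<^sub>(Lam J) mr L J (z (L, I)))" .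
  qed
  also have "\<dots> = (\<Oplus>\<^bsub>Lam J\<^esub>I\<in>cov {J} K. \<Oplus>\<^bsub>Lam J\<^esub>L\<in>dn I J. (e J L \<otimes> e I K) \<odot>\<^sub>(Lam J) mr L J (z (L, I)))"
    using c iff by (intro M.M.finsum_swap_rel) auto
  also have "\<dots> = cinc J (%I. rinc J I (%L. mr L J (z (L, I))) J) K" unfolding inc_def
  proof (rule M.M.finsum_cong'[OF refl])
    have c': "mr L J (z (L, I)) : carrier (Lam J)" if "I : cov {J} K" "L : dn I J" for L I using c iff that by blast
    then show "(%I. e I K \<odot>\<^sub>(Lam J) (\<Oplus>\<^bsub>Lam J\<^esub>L\<in>dn I J. e J L \<odot>\<^sub>(Lam J) mr L J (z (L, I)))) : cov {J} K \<rightarrow> carrier (Lam J)"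
      by (auto intro!: M.smult_closed M.M.finsum_closed)
    fix I assume I: "I : cov {J} K"
    have "e I K \<odot>\<^sub>(Lam J) (\<Oplus>\<^bsub>Lam J\<^esub>L\<in>dn I J. e J L \<odot>\<^sub>(Lam J) mr L J (z (L, I))) =
        (\<Oplus>\<^bsub>Lam J\<^esub>L\<in>dn I J. e I K \<odot>\<^sub>(Lam J) (e J L \<odot>\<^sub>(Lam J) mr L J (z (L, I))))"
      using c'[OF I] by (intro M.finsum_smult_ldistr) auto
    also have "\<dots> = (\<Oplus>\<^bsub>Lam J\<^esub>L\<in>dn I J. (e J L \<otimes> e I K) \<odot>\<^sub>(Lam J) mr L J (z (L, I)))"
      using c'[OF I] by (intro M.M.finsum_cong') (auto simp: M.smult_assoc1[symmetric] m_comm)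
    finally show "(\<Oplus>\<^bsub>Lam J\<^esub>L\<in>dn I J. (e J L \<otimes> e I K) \<odot>\<^sub>(Lam J) mr L J (z (L, I))) =
        e I K \<odot>\<^sub>(Lam J) (\<Oplus>\<^bsub>Lam J\<^esub>L\<in>dn I J. e J L \<odot>\<^sub>(Lam J) mr L J (z (L, I)))" ..
  qed
  finally show ?thesis .
qed

lemma dA_ep:
  assumes z: "z : carrier (D a 0)"
  shows "dA a (ep a z) = ep (Suc a) (dl a 0 z)"
proof (rule A_ext)
  have dz: "dl a 0 z : carrier (D (Suc a) 0)" using mod_hom_closed[OF dl_hom z] .
  show "dA a (ep a z) : carrier (A (Suc a))" using mod_hom_closed[OF dA_hom mod_hom_closed[OF ep_hom z]] .
  show "ep (Suc a) (dl a 0 z) : carrier (A (Suc a))" using mod_hom_closed[OF ep_hom dz] .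
  fix J assume J: "J : rk (Suc a)"
  interpret M: module R "Lam J" using Lam rkD[OF J] by simp
  have Lr: "L : rk a" if "L : dn (bot_of S) J" for L using dnD[OF that] rkD[OF J] by (simp add: rk_def)
  have zc: "z (L, I) : carrier (Lam L)" if "L : dn (bot_of S) J" "I : cov {L} (bot_of S)" for L I
    using cov_X[OF _ rank_bot that(2)] rkD[OF Lr[OF that(1)]] by (intro D_val[OF z]) auto
  have "dA a (ep a z) J = inc (Lam J) (dn (bot_of S)) et (%L. mr L J (cinc L (%I. z (L, I)) (bot_of S))) J"
    unfolding dA_apply[OF J]
  proof (rule M.inc_cong)
    fix L assume L: "L : dn (bot_of S) J"
    show "mr L J (ep a z L) = mr L J (cinc L (%I. z (L, I)) (bot_of S))" using ep_apply[OF z Lr[OF L]] by simp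
    have "cinc L (%I. z (L, I)) (bot_of S) : carrier (Lam L)"
      using zc[OF L] by (intro module.inc_closed[OF Lam]) (auto simp: dnD[OF L])
    then show "mr L J (cinc L (%I. z (L, I)) (bot_of S)) : carrier (Lam J)" using dnD[OF L] by (intro mr_closed) auto
  qed auto
  also have "\<dots> = cinc J (%I. rinc J I (%L. mr L J (z (L, I))) J) (bot_of S)"
    using rkD[OF J] bot_le zc by (intro dl_inc_commute) auto
  also have "\<dots> = cinc J (%I. dl a 0 z (J, I)) (bot_of S)"
  proof (rule M.inc_cong)
    fix I assume I: "I : cov {J} (bot_of S)"
    have JI: "(J, I) : X (Suc a) 0" using cov_X[OF _ rank_bot I] rkD[OF J] by simp
    show "rinc J I (%L. mr L J (z (L, I))) J = dl a 0 z (J, I)" using dl_apply[OF z JI] by simp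
    show "dl a 0 z (J, I) : carrier (Lam J)" by (rule D_val[OF dz JI])
  qed auto
  also have "\<dots> = ep (Suc a) (dl a 0 z) J" using ep_apply[OF dz J] by simp
  finally show "dA a (ep a z) J = ep (Suc a) (dl a 0 z) J" .
qed

lemma dl_del:
  assumes z: "z : carrier (D a (Suc b))"
  shows "dl a b (del a b z) = del (Suc a) b (dl a (Suc b) z)"
proof (rule D_ext)
  have dz: "dl a (Suc b) z : carrier (D (Suc a) (Suc b))" using mod_hom_closed[OF dl_hom z] .
  have ez: "del a b z : carrier (D a b)" using mod_hom_closed[OF del_hom z] .
  show "dl a b (del a b z) : carrier (D (Suc a) b)" using mod_hom_closed[OF dl_hom ez] .
  show "del (Suc a) b (dl a (Suc b) z) : carrier (D (Suc a) b)" using mod_hom_closed[OF del_hom dz] .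
  fix J K assume JK: "(J, K) : X (Suc a) b"
  interpret M: module R "Lam J" using Lam XD[OF JK] by simp
  have LK: "(L, K) : X a b" if "L : dn K J" for L by (rule dn_X[OF JK that])
  have zc: "z (L, I) : carrier (Lam L)" if "L : dn K J" "I : cov {L} K" for L I
    using cov_X[of L K "Suc b" I] that XD[OF LK[OF that(1)]] by (intro D_val[OF z]) auto
  have "dl a b (del a b z) (J, K) = rinc J K (%L. mr L J (cinc L (%I. z (L, I)) K)) J" unfolding dl_apply[OF ez JK]
  proof (rule M.inc_cong)
    fix L assume L: "L : dn K J"
    show "mr L J (del a b z (L, K)) = mr L J (cinc L (%I. z (L, I)) K)" using del_apply[OF z LK[OF L]] by simp
    have "cinc L (%I. z (L, I)) K : carrier (Lam L)"
      using zc[OF L] by (intro module.inc_closed[OF Lam]) (auto simp: dnD[OF L])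
    then show "mr L J (cinc L (%I. z (L, I)) K) : carrier (Lam J)" using dnD[OF L] by (intro mr_closed) auto
  qed auto
  also have "\<dots> = cinc J (%I. rinc J I (%L. mr L J (z (L, I))) J) K" using XD[OF JK] zc by (intro dl_inc_commute) auto
  also have "\<dots> = cinc J (%I. dl a (Suc b) z (J, I)) K"
  proof (rule M.inc_cong)
    fix I assume I: "I : cov {J} K"
    have JI: "(J, I) : X (Suc a) (Suc b)" using cov_X[of J K "Suc b" I] I XD[OF JK] by simp
    show "rinc J I (%L. mr L J (z (L, I))) J = dl a (Suc b) z (J, I)" using dl_apply[OF z JI] by simp
    show "dl a (Suc b) z (J, I) : carrier (Lam J)" by (rule D_val[OF dz JI])
  qed auto
  also have "\<dots> = del (Suc a) b (dl a (Suc b) z) (J, K)" using del_apply[OF dz JK] by simp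
  finally show "dl a b (del a b z) (J, K) = del (Suc a) b (dl a (Suc b) z) (J, K)" .
qed

text \<open>Choosing a cover \<open>I\<close> of \<open>K\<close> and a top cell \<open>F\<close>
  above it is the same as choosing \<open>F\<close> above \<open>K\<close> and then \<open>I\<close>
  between them. The transports compose by \<open>mi_comp\<close>, so boundary and integration can be
  exchanged.\<close>

lemma dC_g:
  assumes z: "z : carrier (D n (Suc b))"
  shows "dC b (g (Suc b) z) = g b (del n b z)"
proof (rule C_ext)
  have ez: "del n b z : carrier (D n b)" using mod_hom_closed[OF del_hom z] .
  show "dC b (g (Suc b) z) : carrier (C b)" using mod_hom_closed[OF dC_hom mod_hom_closed[OF g_hom z]] .
  show "g b (del n b z) : carrier (C b)" using mod_hom_closed[OF g_hom ez] .
  fix K assume K: "K : rk (Suc b)"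
  have KS: "K : S" "K ~= bot_of S" "rank S K = Suc b" using rkD[OF K] rk_Suc[OF K] by auto
  interpret M: module R "Lam K" by (rule Lam[OF KS(1)])
  have I: "I : S" "K <= I" "I : rk (Suc (Suc b))" if "I : cov {} K" for I
    using that covered_byD[of K I] KS by (auto simp: cov_def rk_def)
  have FI: "(F, I) : X n (Suc b)" if "I : cov {} K" "F : st I n" for F I
    using I[OF that(1)] stD[OF that(2)] by (auto simp: X_def rk_def)
  have zc: "z (F, I) : carrier (Lam F)" if "I : cov {} K" "F : st I n" for F I by (rule D_val[OF z FI[OF that]])
  have iff: "I : cov {} K & F : st I n \<longleftrightarrow> F : st K n & I : cov {F} K" for I F
    using covered_byD[of K I] by (auto simp: cov_def st_def dest: order_trans)
  have kz: "mi K F (z (F, I)) : carrier (Lam K)" if "I : cov {} K" "F : st I n" for F I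
    using zc[OF that] I[OF that(1)] stD[OF that(2)] KS by (intro mi_closed) (auto dest: order_trans)
  have "dC b (g (Suc b) z) K = (\<Oplus>\<^bsub>Lam K\<^esub>I\<in>cov {} K. \<Oplus>\<^bsub>Lam K\<^esub>F\<in>st I n. (e I K \<otimes> u F) \<odot>\<^sub>(Lam K) mi K F (z (F, I)))"
    unfolding dC_apply[OF K] inc_def
  proof (rule M.M.finsum_cong'[OF refl])
    show "(%I. \<Oplus>\<^bsub>Lam K\<^esub>F\<in>st I n. (e I K \<otimes> u F) \<odot>\<^sub>(Lam K) mi K F (z (F, I))) : cov {} K \<rightarrow> carrier (Lam K)"
      using kz uR' stD by (auto intro!: M.M.finsum_closed M.smult_closed)
    fix I assume IK: "I : cov {} K"
    note I' = I[OF IK]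
    have Ib: "I ~= bot_of S" using rk_Suc[OF I'(3)] .
    note h = mi_hom[OF KS(1) I'(1,2) KS(2)]
    have iz: "mi I F (z (F, I)) : carrier (Lam I)" if "F : st I n" for F
      using zc[OF IK that] I' stD[OF that] Ib by (intro mi_closed) auto
    have "mi K I (g (Suc b) z I) = (\<Oplus>\<^bsub>Lam K\<^esub>F\<in>st I n. mi K I (u F \<odot>\<^sub>(Lam I) mi I F (z (F, I))))"
      unfolding g_apply[OF z I'(3)] using iz uR' stD
      by (intro mod_hom_finsum[OF Lam[OF I'(1)] Lam[OF KS(1)] h]) (auto intro!: module.smult_closed[OF Lam[OF I'(1)]])
    also have "\<dots> = (\<Oplus>\<^bsub>Lam K\<^esub>F\<in>st I n. u F \<odot>\<^sub>(Lam K) mi K F (z (F, I)))"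
    proof (rule M.M.finsum_cong'[OF refl])
      show "(%F. u F \<odot>\<^sub>(Lam K) mi K F (z (F, I))) : st I n \<rightarrow> carrier (Lam K)"
        using kz[OF IK] uR' stD by (auto intro!: M.smult_closed)
      fix F assume F: "F : st I n"
      show "mi K I (u F \<odot>\<^sub>(Lam I) mi I F (z (F, I))) = u F \<odot>\<^sub>(Lam K) mi K F (z (F, I))"
        using mod_hom_smult[OF h _ iz[OF F]] uR' stD[OF F] mi_comp[OF KS(1) I'(1) _ I'(2) _ KS(2) zc[OF IK F]] by simp
    qed
    finally have "e I K \<odot>\<^sub>(Lam K) mi K I (g (Suc b) z I) = (\<Oplus>\<^bsub>Lam K\<^esub>F\<in>st I n. e I K \<odot>\<^sub>(Lam K) (u F \<odot>\<^sub>(Lam K) mi K F (z (F, I))))"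
      using kz[OF IK] uR' stD by (simp add: M.finsum_smult_ldistr Pi_iff)
    also have "\<dots> = (\<Oplus>\<^bsub>Lam K\<^esub>F\<in>st I n. (e I K \<otimes> u F) \<odot>\<^sub>(Lam K) mi K F (z (F, I)))"
      using kz[OF IK] uR' stD by (intro M.M.finsum_cong') (auto simp: M.smult_assoc1)
    finally show "e I K \<odot>\<^sub>(Lam K) mi K I (g (Suc b) z I) = (\<Oplus>\<^bsub>Lam K\<^esub>F\<in>st I n. (e I K \<otimes> u F) \<odot>\<^sub>(Lam K) mi K F (z (F, I)))" .
  qed
  also have "\<dots> = (\<Oplus>\<^bsub>Lam K\<^esub>F\<in>st K n. \<Oplus>\<^bsub>Lam K\<^esub>I\<in>cov {F} K. (e I K \<otimes> u F) \<odot>\<^sub>(Lam K) mi K F (z (F, I)))"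
    using kz uR' stD iff by (intro M.M.finsum_swap_rel) auto
  also have "\<dots> = g b (del n b z) K" unfolding g_apply[OF ez K]
  proof (rule M.M.finsum_cong'[OF refl])
    have FK: "(F, K) : X n b" if "F : st K n" for F using KS stD[OF that] by (simp add: X_def)
    show "(%F. u F \<odot>\<^sub>(Lam K) mi K F (del n b z (F, K))) : st K n \<rightarrow> carrier (Lam K)"
      using D_val[OF ez FK] stD uR' KS by (auto intro!: M.smult_closed mi_closed)
    fix F assume F: "F : st K n"
    note F' = stD[OF F]
    have zc': "z (F, I) : carrier (Lam F)" "mi K F (z (F, I)) : carrier (Lam K)" if "I : cov {F} K" for I
      using zc kz iff F that by blast+
    have "mi K F (del n b z (F, K)) = inc (Lam K) (cov {F}) e (%I. mi K F (z (F, I))) K"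
      unfolding del_apply[OF z FK[OF F]] using KS F' zc' by (intro mi_inc) auto
    then have "u F \<odot>\<^sub>(Lam K) mi K F (del n b z (F, K)) = (\<Oplus>\<^bsub>Lam K\<^esub>I\<in>cov {F} K. u F \<odot>\<^sub>(Lam K) (e I K \<odot>\<^sub>(Lam K) mi K F (z (F, I))))"
      unfolding inc_def using zc' uR' F' by (simp add: M.finsum_smult_ldistr Pi_iff)
    also have "\<dots> = (\<Oplus>\<^bsub>Lam K\<^esub>I\<in>cov {F} K. (e I K \<otimes> u F) \<odot>\<^sub>(Lam K) mi K F (z (F, I)))"
      using zc' uR' F' by (intro M.M.finsum_cong') (auto simp: M.smult_assoc1[symmetric] m_comm)
    finally show "(\<Oplus>\<^bsub>Lam K\<^esub>I\<in>cov {F} K. (e I K \<otimes> u F) \<odot>\<^sub>(Lam K) mi K F (z (F, I))) = u F \<odot>\<^sub>(Lam K) mi K F (del n b z (F, K))" ..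
  qed
  finally show "dC b (g (Suc b) z) K = g b (del n b z) K" .
qed

lemma ep_del:
  assumes z: "z : carrier (D a (Suc 0))"
  shows "ep a (del a 0 z) = \<zero>\<^sub>(A a)"
proof (rule A_ext)
  have ez: "del a 0 z : carrier (D a 0)" using mod_hom_closed[OF del_hom z] .
  show "ep a (del a 0 z) : carrier (A a)" using mod_hom_closed[OF ep_hom ez] .
  show "\<zero>\<^sub>(A a) : carrier (A a)" using A_module module.axioms(2) abelian_groupE(2) by blast
  fix J assume J: "J : rk a"
  note JS = rkD[OF J]
  interpret M: module R "Lam J" using Lam JS by simp
  have "ep a (del a 0 z) J = cinc J (cinc J (%I. z (J, I))) (bot_of S)" unfolding ep_apply[OF ez J]
  proof (rule M.inc_cong)
    fix K assume K: "K : cov {J} (bot_of S)"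
    have JK: "(J, K) : X a 0" using cov_X[OF _ rank_bot K] JS by simp
    show "del a 0 z (J, K) = cinc J (%I. z (J, I)) K" by (rule del_apply[OF z JK])
    then show "cinc J (%I. z (J, I)) K : carrier (Lam J)" using D_val[OF ez JK] by simp
  qed auto
  also have "\<dots> = \<zero>\<^sub>(Lam J)" using JS by (intro cov_inc_inc Lam D_val[OF z]) (auto simp: X_def)
  finally show "ep a (del a 0 z) J = \<zero>\<^sub>(A a) J" using A_zero[OF J] by simp
qed

lemma del_del:
  assumes z: "z : carrier (D a (Suc (Suc b)))"
  shows "del a b (del a (Suc b) z) = \<zero>\<^sub>(D a b)"
proof (rule D_ext)
  have ez: "del a (Suc b) z : carrier (D a (Suc b))" using mod_hom_closed[OF del_hom z] .
  show "del a b (del a (Suc b) z) : carrier (D a b)" using mod_hom_closed[OF del_hom ez] .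
  show "\<zero>\<^sub>(D a b) : carrier (D a b)" using D_module module.axioms(2) abelian_groupE(2) by blast
  fix J P assume JP: "(J, P) : X a b"
  note JS = XD[OF JP]
  interpret M: module R "Lam J" using Lam JS by simp
  have "del a b (del a (Suc b) z) (J, P) = cinc J (cinc J (%I. z (J, I))) P" unfolding del_apply[OF ez JP]
  proof (rule M.inc_cong)
    fix K assume K: "K : cov {J} P"
    have JK: "(J, K) : X a (Suc b)" using cov_X[of J P "Suc b" K] K JS by simp
    show "del a (Suc b) z (J, K) = cinc J (%I. z (J, I)) K" by (rule del_apply[OF z JK])
    then show "cinc J (%I. z (J, I)) K : carrier (Lam J)" using D_val[OF ez JK] by simp
  qed auto
  also have "\<dots> = \<zero>\<^sub>(Lam J)" using JS by (intro cov_inc_inc Lam D_val[OF z]) (auto simp: X_def)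
  finally show "del a b (del a (Suc b) z) (J, P) = \<zero>\<^sub>(D a b) (J, P)" using D_zero[OF JP] by simp
qed

lemma dl_dl:
  assumes z: "z : carrier (D a b)"
  shows "dl (Suc a) b (dl a b z) = \<zero>\<^sub>(D (Suc (Suc a)) b)"
proof (rule D_ext)
  have ez: "dl a b z : carrier (D (Suc a) b)" using mod_hom_closed[OF dl_hom z] .
  show "dl (Suc a) b (dl a b z) : carrier (D (Suc (Suc a)) b)" using mod_hom_closed[OF dl_hom ez] .
  show "\<zero>\<^sub>(D (Suc (Suc a)) b) : carrier (D (Suc (Suc a)) b)" using D_module module.axioms(2) abelian_groupE(2) by blast
  fix J I assume JI: "(J, I) : X (Suc (Suc a)) b"
  note JS = XD[OF JI]
  interpret M: module R "Lam J" using Lam JS by simp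
  have zc: "mr N J (z (N, I)) : carrier (Lam J)" if "N : S" "I <= N" "N <= J" "rank S J = Suc (Suc (rank S N))" for N
    using that JS by (intro mr_closed D_val[OF z]) (auto simp: X_def)
  have "dl (Suc a) b (dl a b z) (J, I) = rinc J I (rinc J I (%N. mr N J (z (N, I)))) J" unfolding dl_apply[OF ez JI]
  proof (rule M.inc_cong)
    fix L assume L: "L : dn I J"
    note L' = dnD[OF L]
    have LI: "(L, I) : X (Suc a) b" by (rule dn_X[OF JI L])
    have zN: "mr N L (z (N, I)) : carrier (Lam L)" "z (N, I) : carrier (Lam N)" "mr N J (z (N, I)) : carrier (Lam J)" if "N : dn I L" for N
      using D_val[OF z dn_X[OF LI that]] dnD[OF that] L' by (auto intro!: mr_closed dest: order_trans)
    have "mr L J (dl a b z (L, I)) = rinc J I (%N. mr L J (mr N L (z (N, I)))) L"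
      unfolding dl_apply[OF z LI] using L' zN by (intro mr_inc) auto
    also have "\<dots> = rinc J I (%N. mr N J (z (N, I))) L"
    proof (rule M.inc_cong)
      fix N assume N: "N : dn I L"
      show "mr L J (mr N L (z (N, I))) = mr N J (z (N, I))" using dnD[OF N] L' zN[OF N] by (intro mr_comp) auto
    qed (use zN in auto)
    finally show "mr L J (dl a b z (L, I)) = rinc J I (%N. mr N J (z (N, I))) L" .
    show "rinc J I (%N. mr N J (z (N, I))) L : carrier (Lam J)" using zN by (intro M.inc_closed) auto
  qed auto
  also have "\<dots> = \<zero>\<^sub>(Lam J)" using JS zc by (intro dn_inc_inc Lam) auto
  finally show "dl (Suc a) b (dl a b z) (J, I) = \<zero>\<^sub>(D (Suc (Suc a)) b) (J, I)" using D_zero[OF JI] by simp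
qed

text \<open>Once all values are transported back to \<open>Lam I\<close>, the row of
  \<open>I\<close> becomes the cochain complex of the star of \<open>I\<close> with constant
  coefficients, to which the contraction of the star applies.\<close>

lemma mi_dl:
  assumes z: "z : carrier (D a b)" and FI: "(F, I) : X (Suc a) b"
  shows "mi I F (dl a b z (F, I)) = rinc I I (%L. mi I L (z (L, I))) F"
proof -
  note I' = XD[OF FI]
  interpret M: module R "Lam I" using Lam I' by simp
  have zL: "z (L, I) : carrier (Lam L)" "mr L F (z (L, I)) : carrier (Lam F)" "mi I L (z (L, I)) : carrier (Lam I)"
    if "L : dn I F" for L using D_val[OF z dn_X[OF FI that]] dnD[OF that] I' by (auto intro!: mi_closed mr_closed)
  have "mi I F (dl a b z (F, I)) = rinc I I (%L. mi I F (mr L F (z (L, I)))) F"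
    unfolding dl_apply[OF z FI] using I' zL by (intro mi_inc) auto
  also have "\<dots> = rinc I I (%L. mi I L (z (L, I))) F"
  proof (rule M.inc_cong)
    fix L assume L: "L : dn I F"
    show "mi I F (mr L F (z (L, I))) = mi I L (z (L, I))" using dnD[OF L] I' zL(1)[OF L] by (intro mi_mr_comp) auto
  qed (use zL in auto)
  finally show ?thesis .
qed

text \<open>After the exchange of sums the coefficient of a cell \<open>L\<close> of codimension one
  is the boundary of \<open>u\<close> at \<open>L\<close>. It vanishes, as \<open>L\<close> lies
  above \<open>I\<close> and is therefore not the bottom.\<close>

lemma g_dl:
  assumes n: "Suc a = n" and z: "z : carrier (D a b)"
  shows "g b (dl a b z) = \<zero>\<^sub>(C b)"
proof (rule C_ext)
  have ez: "dl a b z : carrier (D n b)" using mod_hom_closed[OF dl_hom z] n by simp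
  show "g b (dl a b z) : carrier (C b)" using mod_hom_closed[OF g_hom ez] .
  show "\<zero>\<^sub>(C b) : carrier (C b)" using C_module module.axioms(2) abelian_groupE(2) by blast
  fix I assume I: "I : rk (Suc b)"
  have IS: "I : S" "I ~= bot_of S" "rank S I = Suc b" using rkD[OF I] rk_Suc[OF I] by auto
  interpret M: module R "Lam I" by (rule Lam[OF IS(1)])
  have zL: "z (L, I) : carrier (Lam L)" "mi I L (z (L, I)) : carrier (Lam I)" if "L : st I a" for L
    using stD[OF that] IS by (auto intro!: mi_closed D_val[OF z] simp: X_def)
  have dst: "L : st I a" if "F : st I n" "L : dn I F" for F L using dnD[OF that(2)] stD[OF that(1)] n by (simp add: st_def)
  have "g b (dl a b z) I = (\<Oplus>\<^bsub>Lam I\<^esub>F\<in>st I n. \<Oplus>\<^bsub>Lam I\<^esub>L\<in>dn I F. (e F L \<otimes> u F) \<odot>\<^sub>(Lam I) mi I L (z (L, I)))"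
    unfolding g_apply[OF ez I]
  proof (rule M.M.finsum_cong'[OF refl])
    show "(%F. \<Oplus>\<^bsub>Lam I\<^esub>L\<in>dn I F. (e F L \<otimes> u F) \<odot>\<^sub>(Lam I) mi I L (z (L, I))) : st I n \<rightarrow> carrier (Lam I)"
      using zL(2)[OF dst] uR' stD by (auto intro!: M.M.finsum_closed M.smult_closed)
    fix F assume F: "F : st I n"
    note F' = stD[OF F]
    have FI: "(F, I) : X (Suc a) b" using F' IS n by (simp add: X_def)
    have "u F \<odot>\<^sub>(Lam I) mi I F (dl a b z (F, I)) = (\<Oplus>\<^bsub>Lam I\<^esub>L\<in>dn I F. u F \<odot>\<^sub>(Lam I) (e F L \<odot>\<^sub>(Lam I) mi I L (z (L, I))))"
      unfolding mi_dl[OF z FI] inc_def using zL(2)[OF dst[OF F]] uR' F' by (simp add: M.finsum_smult_ldistr Pi_iff)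
    also have "\<dots> = (\<Oplus>\<^bsub>Lam I\<^esub>L\<in>dn I F. (e F L \<otimes> u F) \<odot>\<^sub>(Lam I) mi I L (z (L, I)))"
      using zL(2)[OF dst[OF F]] uR' F' by (intro M.M.finsum_cong') (auto simp: M.smult_assoc1[symmetric] m_comm)
    finally show "u F \<odot>\<^sub>(Lam I) mi I F (dl a b z (F, I)) = (\<Oplus>\<^bsub>Lam I\<^esub>L\<in>dn I F. (e F L \<otimes> u F) \<odot>\<^sub>(Lam I) mi I L (z (L, I)))" .
  qed
  also have "\<dots> = (\<Oplus>\<^bsub>Lam I\<^esub>L\<in>st I a. \<Oplus>\<^bsub>Lam I\<^esub>F\<in>cov {} L. (e F L \<otimes> u F) \<odot>\<^sub>(Lam I) mi I L (z (L, I)))"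
  proof (rule M.M.finsum_swap_rel)
    show "F : st I n & L : dn I F \<longleftrightarrow> L : st I a & F : cov {} L" for F L
      using dnD[of L I F] dn_cov[of I L F] n by (auto simp: st_def)
    show "(e F L \<otimes> u F) \<odot>\<^sub>(Lam I) mi I L (z (L, I)) : carrier (Lam I)" if "F : st I n" "L : dn I F" for F L
      using zL(2)[OF dst[OF that]] uR' stD[OF that(1)] by (intro M.smult_closed) auto
  qed auto
  also have "\<dots> = \<zero>\<^sub>(Lam I)"
  proof (rule M.M.finsum_zeroI)
    fix L assume L: "L : st I a"
    note L' = stD[OF L]
    have Lb: "L ~= bot_of S" using L' le_bot[of I] IS by auto
    have Fn: "F : S & rank S F = n" if "F : cov {} L" for F using that covered_byD[of L F] L' n by (auto simp: cov_def)
    have "(\<Oplus>\<^bsub>Lam I\<^esub>F\<in>cov {} L. (e F L \<otimes> u F) \<odot>\<^sub>(Lam I) mi I L (z (L, I))) = inc RM (cov {}) e u L \<odot>\<^sub>(Lam I) mi I L (z (L, I))"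
      unfolding inc_def using Fn uR' zL(2)[OF L] by (subst M.smult_finsum[symmetric]) auto
    also have "inc RM (cov {}) e u L = \<zero>" using fund L' Lb n by (simp add: fundamental_def)
    finally show "(\<Oplus>\<^bsub>Lam I\<^esub>F\<in>cov {} L. (e F L \<otimes> u F) \<odot>\<^sub>(Lam I) mi I L (z (L, I))) = \<zero>\<^sub>(Lam I)"
      using zL(2)[OF L] by simp
  qed
  finally show "g b (dl a b z) I = \<zero>\<^sub>(C b) I" using C_zero[OF I] by simp
qed

sublocale double_complex R n A D C dA ep dl del g dC
  by (rule double_complex.intro; (rule A_module D_module C_module dA_hom ep_hom dl_hom del_hom g_hom dC_hom)?;
    (rule dA_ep dl_del dC_g ep_del del_del dl_dl g_dl)?; assumption?)

end

section \<open>Exactness of columns and rows for a system of ideals\<close>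

lemma (in module) inc_submodule:
  assumes "submodule N R M" "!!I. I : up K ==> e I K : carrier R" "!!I. I : up K ==> c I : N"
  shows "inc M up e c K : N"
  unfolding inc_def using assms by (intro submodule_finsum[OF assms(1)] submoduleE(4)[OF assms(1)]) auto

text \<open>The properties of the ideals on which the exactness proofs rest, in a form shared by the
  ideals and their homogeneous parts. \<open>Ds J (bot_of S)\<close> stands for the value of the
  ideal sheaf at \<open>J\<close>, \<open>Ds J I\<close> for the ideal of \<open>pi_I\<close> in the
  exterior algebra at \<open>J\<close>, and \<open>Ds J J\<close> for the value of the cosheaf. At
  the bottom \<open>Ds_mr_bot\<close> asks for an inclusion instead of an equality, since larger
  cells have more generators.\<close>

locale coefficient_ideals = local_system +
  fixes Ds :: "'a => 'a => 'c set" and P :: "'a => 'a => 'c => 'c"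
  assumes Ds_sub: "!!J I. J : S ==> I : S ==> I <= J ==> submodule (Ds J I) R (Lam J)"
    and Ds_anti: "!!J I K. J : S ==> I : S ==> K : S ==> K <= I ==> I <= J ==> I ~= bot_of S ==> Ds J I \<subseteq> Ds J K"
    and Ds_mr: "!!I J J'. I : S ==> J : S ==> J' : S ==> I <= J ==> J <= J' ==> I ~= bot_of S ==> mr J J' ` Ds J I = Ds J' I"
    and Ds_mr_bot: "!!J J' x. J : S ==> J' : S ==> J <= J' ==> x : Ds J (bot_of S) ==> mr J J' x : Ds J' (bot_of S)"
    and P_hom: "!!J v. J : S ==> v : vb J ==> P J v : mod_hom R (Lam J) (Lam J)"
    and P_insert: "!!J v K I x. J : S ==> v : vb J ==> K : S ==> I : S ==> K <= I ==> I <= J ==> vb I = insert v (vb K) ==>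
      x : Ds J K ==> P J v x : Ds J I"
    and P_zero: "!!J x. J : S ==> x : Ds J (bot_of S) ==> (!!v. v : vb J ==> P J v x = \<zero>\<^sub>(Lam J)) ==> x = \<zero>\<^sub>(Lam J)"
    and P_idem: "!!J v x. J : S ==> v : vb J ==> x : carrier (Lam J) ==> P J v (P J v x) = P J v x"
    and P_comm: "!!J v w x. J : S ==> v : vb J ==> w : vb J ==> x : carrier (Lam J) ==> P J v (P J w x) = P J w (P J v x)"
begin

lemma Ds_carrier: "J : S ==> I : S ==> I <= J ==> x : Ds J I ==> x : carrier (Lam J)"
  using module.submodule_carrier[OF Lam Ds_sub] .

text \<open>\<open>P J v\<close> moves the ideal of \<open>K\<close> into that of \<open>K\<close>
  joined with \<open>v\<close>. Hence the cone contraction with apex \<open>v\<close>, applied after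
  \<open>P J v\<close>, stays within the ideals. The price is that it inverts the boundary only up
  to \<open>P J v\<close>.\<close>

lemma column_step:
  assumes J: "J : S" and v: "v : vb J"
    and c: "!!I. I : S ==> I <= J ==> c I : Ds J I"
      "!!K. K : S ==> K <= J ==> cinc J c K = \<zero>\<^sub>(Lam J)"
  shows "EX h. (ALL I:S. I <= J --> h I : Ds J I) & (ALL K:S. K <= J --> cinc J h K = P J v (c K))"
proof -
  interpret M: module R "Lam J" by (rule Lam[OF J])
  note Ph = P_hom[OF J v]
  have cc: "c I : carrier (Lam J)" if "I : S" "I <= J" for I using Ds_carrier[OF J that c(1)[OF that]] .
  have cv: "(%K. {I. covered_by S K I & I <= J}) = cov {J}" by (simp add: cov_def fun_eq_iff)
  have "cinc J (%I. P J v (c I)) K = \<zero>\<^sub>(Lam J)" if K: "K : S" "K <= J" for K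
  proof -
    have cI: "I : S" "I <= J" "c I : carrier (Lam J)" if "I : cov {J} K" for I
      using that covered_byD[of K I] cc by (auto simp: covJ)
    have "cinc J (%I. P J v (c I)) K = (\<Oplus>\<^bsub>Lam J\<^esub>I\<in>cov {J} K. P J v (e I K \<odot>\<^sub>(Lam J) c I))"
      unfolding inc_def using cI mod_hom_smult[OF Ph] mod_hom_closed[OF Ph] by (intro M.M.finsum_cong') auto
    also have "\<dots> = P J v (cinc J c K)"
      unfolding inc_def using cI by (intro mod_hom_finsum[OF Lam[OF J] Lam[OF J] Ph, symmetric]) auto
    finally show ?thesis using c(2)[OF K] mod_hom_zero[OF Lam[OF J] Lam[OF J] Ph] by simp
  qed
  then have "EX h. (ALL K:S. bot_of S <= K & K <= J --> h K = \<zero>\<^sub>(Lam J) \<or>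
      (EX K':S. bot_of S <= K' & K' <= J & covered_by S K' K & vb K = insert v (vb K') & h K = e K K' \<odot>\<^sub>(Lam J) P J v (c K'))) &
    (ALL K:S. bot_of S <= K & K <= J --> inc (Lam J) (%K. {I. covered_by S K I & I <= J}) e h K = P J v (c K))"
    using J v cc mod_hom_closed[OF Ph] bot_in bot_le
    by (intro interval_exact[OF Lam[OF J], where c="%K. P J v (c K)" and L="bot_of S"]) (auto simp: cv)
  then obtain h where h0: "ALL K:S. bot_of S <= K & K <= J --> h K = \<zero>\<^sub>(Lam J) \<or>
      (EX K':S. bot_of S <= K' & K' <= J & covered_by S K' K & vb K = insert v (vb K') & h K = e K K' \<odot>\<^sub>(Lam J) P J v (c K'))"
    and h1: "ALL K:S. bot_of S <= K & K <= J --> cinc J h K = P J v (c K)" unfolding cv by (elim exE conjE)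
  have "h K : Ds J K" if K: "K : S" "K <= J" for K
  proof (cases "h K = \<zero>\<^sub>(Lam J)")
    case True
    then show ?thesis using M.submodule_zero[OF Ds_sub[OF J K]] by simp
  next
    case False
    then obtain K' where K': "K' : S" "K' <= J" "covered_by S K' K" "vb K = insert v (vb K')" "h K = e K K' \<odot>\<^sub>(Lam J) P J v (c K')"
      using h0 K bot_le by blast
    show ?thesis unfolding K'(5) using covered_byD[OF K'(3)] K
      by (intro M.submoduleE(4)[OF Ds_sub[OF J K]] P_insert[OF J v K'(1) K(1) _ K(2) K'(4) c(1)[OF K'(1,2)]]) auto
  qed
  then show ?thesis using h1 bot_le by (intro exI[of _ h]) simp
qed

text \<open>Boundaries stay in the system because the ideal of a cell is contained in those of its
  faces.\<close>

lemma inc_Ds: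
  assumes J: "J : S" and K: "K : S" "K <= J" and h: "!!I. I : S ==> I <= J ==> I ~= bot_of S ==> h I : Ds J I"
  shows "cinc J h K : Ds J K"
proof (rule module.inc_submodule[OF Lam[OF J] Ds_sub[OF J K]])
  fix I assume "I : cov {J} K"
  then have I: "I : S" "I <= J" "K <= I" "rank S I = Suc (rank S K)" using covered_byD[of K I] by (auto simp: covJ)
  then have "I ~= bot_of S" by (auto simp: rank_bot)
  then show "h I : Ds J K" using h[OF I(1,2)] Ds_anti[OF J I(1) K(1) I(3,2)] by blast
qed auto

text \<open>The partial contractions are combined one vertex at a time. Correcting by the
  contraction for \<open>v\<close> turns the defect \<open>c'\<close> into \<open>c'\<close> minus
  \<open>P J v c'\<close>. This is killed by \<open>P J v\<close>, by idempotence, and still by the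
  idempotents treated before, by commutativity. A defect killed by all of them is zero.\<close>

lemma column_exact:
  assumes J: "J : S" and c: "!!I. I : S ==> I <= J ==> c I : Ds J I"
      "!!K. K : S ==> K <= J ==> cinc J c K = \<zero>\<^sub>(Lam J)"
  shows "EX h. (ALL I:S. I <= J --> h I : Ds J I) & (ALL K:S. K <= J --> cinc J h K = c K)"
proof -
  interpret M: module R "Lam J" by (rule Lam[OF J])
  have cc: "c I : carrier (Lam J)" if "I : S" "I <= J" for I using Ds_carrier[OF J that c(1)[OF that]] .
  have covI: "I : S & I <= J" if "I : cov {J} K" for I K using that covered_byD[of K I] by (auto simp: covJ)
  have "EX h. (ALL I:S. I <= J --> h I : Ds J I) &
      (ALL w:B. ALL K:S. K <= J --> P J w (c K \<ominus>\<^sub>(Lam J) cinc J h K) = \<zero>\<^sub>(Lam J))" if "finite B" "B \<subseteq> vb J" for B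
    using that
  proof (induct B)
    case empty
    then show ?case by (intro exI[of _ "%_. \<zero>\<^sub>(Lam J)"]) (simp add: M.submodule_zero[OF Ds_sub[OF J]])
  next
    case (insert v B)
    then have v: "v : vb J" and B: "B \<subseteq> vb J" by auto
    obtain h where h: "ALL I:S. I <= J --> h I : Ds J I"
      and hP: "ALL w:B. ALL K:S. K <= J --> P J w (c K \<ominus>\<^sub>(Lam J) cinc J h K) = \<zero>\<^sub>(Lam J)"
      using insert(3)[OF B] by (elim exE conjE)
    have hc: "h I : carrier (Lam J)" if "I : S" "I <= J" for I using Ds_carrier[OF J that] h that by simp
    have ih: "cinc J h K : carrier (Lam J)" for K using hc covI by (intro M.inc_closed) auto
    define c' where "c' K = c K \<ominus>\<^sub>(Lam J) cinc J h K" for K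
    have c'D: "c' K : Ds J K" if K: "K : S" "K <= J" for K
      unfolding c'_def using c(1) h inc_Ds[OF J K] K by (intro M.submodule_minus[OF Ds_sub[OF J K]]) auto
    have c'c: "c' K : carrier (Lam J)" if K: "K : S" "K <= J" for K using Ds_carrier[OF J K c'D[OF K]] .
    have "cinc J c' K = \<zero>\<^sub>(Lam J)" if K: "K : S" "K <= J" for K
    proof -
      have "cinc J c' K = cinc J c K \<ominus>\<^sub>(Lam J) cinc J (cinc J h) K"
        unfolding c'_def using cc ih covI by (intro M.inc_minus) auto
      also have "cinc J (cinc J h) K = \<zero>\<^sub>(Lam J)" using hc by (intro cov_inc_inc[OF Lam[OF J]]) auto
      finally show ?thesis using c(2)[OF K] by (simp add: M.minus_self)
    qed
    then have "EX h'. (ALL I:S. I <= J --> h' I : Ds J I) & (ALL K:S. K <= J --> cinc J h' K = P J v (c' K))"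
      using c'D by (intro column_step[OF J v]) auto
    then obtain h' where h': "ALL I:S. I <= J --> h' I : Ds J I" "ALL K:S. K <= J --> cinc J h' K = P J v (c' K)"
      by (elim exE conjE)
    have h'c: "h' I : carrier (Lam J)" if "I : S" "I <= J" for I using Ds_carrier[OF J that] h'(1) that by simp
    have "P J w (c K \<ominus>\<^sub>(Lam J) cinc J (%I. h I \<oplus>\<^sub>(Lam J) h' I) K) = \<zero>\<^sub>(Lam J)"
      if w: "w : insert v B" and K: "K : S" "K <= J" for w K
    proof -
      have wJ: "w : vb J" using w v B by auto
      note Pv = P_hom[OF J v] and Pw = P_hom[OF J wJ]
      have pv: "P J v (c' K) : carrier (Lam J)" using mod_hom_closed[OF Pv c'c[OF K]] .
      have "cinc J (%I. h I \<oplus>\<^sub>(Lam J) h' I) K = cinc J h K \<oplus>\<^sub>(Lam J) P J v (c' K)"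
        using hc h'c covI h'(2) K by (subst M.inc_add) auto
      then have "c K \<ominus>\<^sub>(Lam J) cinc J (%I. h I \<oplus>\<^sub>(Lam J) h' I) K = c' K \<ominus>\<^sub>(Lam J) P J v (c' K)"
        using cc[OF K] ih[of K] pv unfolding c'_def by (simp add: a_minus_def M.minus_add M.a_assoc)
      then have "P J w (c K \<ominus>\<^sub>(Lam J) cinc J (%I. h I \<oplus>\<^sub>(Lam J) h' I) K) = P J w (c' K) \<ominus>\<^sub>(Lam J) P J w (P J v (c' K))"
        using mod_hom_minus[OF Lam[OF J] Lam[OF J] Pw c'c[OF K] pv] by simp
      also have "\<dots> = \<zero>\<^sub>(Lam J)"
      proof (cases "w = v")
        case True
        then show ?thesis using P_idem[OF J v c'c[OF K]] pv by (simp add: M.minus_self)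
      next
        case False
        then have "P J w (c' K) = \<zero>\<^sub>(Lam J)" using hP w K by (simp add: c'_def)
        then show ?thesis using P_comm[OF J wJ v c'c[OF K]] mod_hom_zero[OF Lam[OF J] Lam[OF J] Pv] by (simp add: M.minus_self)
      qed
      finally show ?thesis .
    qed
    moreover have "h I \<oplus>\<^sub>(Lam J) h' I : Ds J I" if I: "I : S" "I <= J" for I
      using h h'(1) I by (intro M.submoduleE(5)[OF Ds_sub[OF J I]]) auto
    ultimately show ?case by (intro exI[of _ "%I. h I \<oplus>\<^sub>(Lam J) h' I"]) blast
  qed
  then have "EX h. (ALL I:S. I <= J --> h I : Ds J I) &
      (ALL w:vb J. ALL K:S. K <= J --> P J w (c K \<ominus>\<^sub>(Lam J) cinc J h K) = \<zero>\<^sub>(Lam J))" by simp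
  then obtain h where h: "ALL I:S. I <= J --> h I : Ds J I"
    and hP: "ALL w:vb J. ALL K:S. K <= J --> P J w (c K \<ominus>\<^sub>(Lam J) cinc J h K) = \<zero>\<^sub>(Lam J)" by (elim exE conjE)
  have "cinc J h K = c K" if K: "K : S" "K <= J" for K
  proof -
    have iD: "cinc J h K : Ds J K" using inc_Ds[OF J K] h by simp
    then have "c K \<ominus>\<^sub>(Lam J) cinc J h K : Ds J K"
      using c(1)[OF K] by (intro M.submodule_minus[OF Ds_sub[OF J K]])
    \<comment> \<open>All ideals of \<open>J\<close> are contained in the one attached to the
      bottom, and there \<open>P_zero\<close> applies.\<close>
    then have "c K \<ominus>\<^sub>(Lam J) cinc J h K : Ds J (bot_of S)"
      using Ds_anti[OF J K(1) bot_in bot_le[OF K(1)] K(2)] by (cases "K = bot_of S") auto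
    then have "c K \<ominus>\<^sub>(Lam J) cinc J h K = \<zero>\<^sub>(Lam J)" by (rule P_zero[OF J]) (use hP K in simp)
    then have "\<ominus>\<^sub>(Lam J) (\<ominus>\<^sub>(Lam J) cinc J h K) = c K"
      using cc[OF K] Ds_carrier[OF J K iD] by (intro M.minus_equality) (simp_all add: a_minus_def)
    then show ?thesis using Ds_carrier[OF J K iD] by simp
  qed
  then show ?thesis using h by blast
qed

definition "SA a = (\<Pi>\<^sub>E J\<in>rk a. Ds J (bot_of S))"
definition "SD a b = (\<Pi>\<^sub>E p\<in>X a b. Ds (fst p) (snd p))"
definition "SC b = (\<Pi>\<^sub>E I\<in>rk (Suc b). Ds I I)"

lemma SA_sub: "submodule (SA a) R (A a)"
  and SD_sub: "submodule (SD a b) R (D a b)"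
  and SC_sub: "submodule (SC b) R (C b)" unfolding SA_def SD_def SC_def A_def D_def C_def
  by (rule direct_sum_submodule[OF is_cring]; auto dest!: rkD XD intro!: Lam Ds_sub bot_in bot_le)+

lemma SA_car: "x : SA a ==> x : carrier (A a)"
  and SD_car: "z : SD a b ==> z : carrier (D a b)"
  and SC_car: "y : SC b ==> y : carrier (C b)"
  using module.submodule_carrier[OF A_module SA_sub] module.submodule_carrier[OF D_module SD_sub]
    module.submodule_carrier[OF C_module SC_sub] by blast+

lemma SAI: "x : carrier (A a) ==> (!!J. J : rk a ==> x J : Ds J (bot_of S)) ==> x : SA a"
  and SDI: "z : carrier (D a b) ==> (!!J I. (J, I) : X a b ==> z (J, I) : Ds J I) ==> z : SD a b"
  and SCI: "y : carrier (C b) ==> (!!I. I : rk (Suc b) ==> y I : Ds I I) ==> y : SC b"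
  by (auto simp: SA_def SD_def SC_def A_def D_def C_def PiE_iff)

lemma SA_val: "x : SA a ==> J : rk a ==> x J : Ds J (bot_of S)"
  and SD_val: "z : SD a b ==> (J, I) : X a b ==> z (J, I) : Ds J I"
  and SC_val: "y : SC b ==> I : rk (Suc b) ==> y I : Ds I I" by (auto simp: SA_def SD_def SC_def PiE_iff)

lemma SD_restrict:
  assumes "!!J I. (J, I) : X a b ==> z (J, I) : Ds J I"
  shows "restrict z (X a b) : SD a b" using assms by (auto simp: SD_def PiE_iff)

lemma mi_Ds:
  assumes "(J, I) : X a b" "x : Ds J I"
  shows "mi I J x : Ds I I"
proof -
  note I = XD[OF assms(1)]
  have "x : mr I J ` Ds I I" using Ds_mr[of I I J] I assms(2) by simp
  then obtain y where "y : Ds I I" "x = mr I J y" by blast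
  then show ?thesis using mi_mr[of I J y] Ds_carrier[of I I y] I by simp
qed

lemma mr_Ds: "I : S ==> J : S ==> J' : S ==> I <= J ==> J <= J' ==> I ~= bot_of S ==> x : Ds J I ==> mr J J' x : Ds J' I"
  using Ds_mr[of I J J'] by blast

lemma SA_stable: "x : SA a ==> dA a x : SA (Suc a)"
proof (rule SAI)
  assume x: "x : SA a"
  show "dA a x : carrier (A (Suc a))" using mod_hom_closed[OF dA_hom SA_car[OF x]] .
  fix J assume J: "J : rk (Suc a)"
  note JS = rkD[OF J]
  show "dA a x J : Ds J (bot_of S)" unfolding dA_apply[OF J]
  proof (rule module.inc_submodule[OF Lam Ds_sub])
    fix L assume L: "L : dn (bot_of S) J"
    then have "L : rk a" using dnD[OF L] JS by (simp add: rk_def)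
    then show "mr L J (x L) : Ds J (bot_of S)" using dnD[OF L] SA_val[OF x] JS by (intro Ds_mr_bot) auto
  qed (use JS bot_in bot_le in auto)
qed

lemma ep_stable: "z : SD a 0 ==> ep a z : SA a"
proof (rule SAI)
  assume z: "z : SD a 0"
  show "ep a z : carrier (A a)" using mod_hom_closed[OF ep_hom SD_car[OF z]] .
  fix J assume J: "J : rk a"
  note JS = rkD[OF J]
  show "ep a z J : Ds J (bot_of S)" unfolding ep_apply[OF SD_car[OF z] J]
  proof (rule module.inc_submodule[OF Lam Ds_sub])
    fix I assume I: "I : cov {J} (bot_of S)"
    have JI: "(J, I) : X a 0" using cov_X[OF _ rank_bot I] JS by simp
    show "z (J, I) : Ds J (bot_of S)" using SD_val[OF z JI] Ds_anti[of J I "bot_of S"] XD[OF JI] bot_in bot_le by blast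
  qed (use JS bot_in bot_le in auto)
qed

lemma dl_stable: "z : SD a b ==> dl a b z : SD (Suc a) b"
proof (rule SDI)
  assume z: "z : SD a b"
  show "dl a b z : carrier (D (Suc a) b)" using mod_hom_closed[OF dl_hom SD_car[OF z]] .
  fix J I assume JI: "(J, I) : X (Suc a) b"
  note JS = XD[OF JI]
  show "dl a b z (J, I) : Ds J I" unfolding dl_apply[OF SD_car[OF z] JI]
  proof (rule module.inc_submodule[OF Lam Ds_sub])
    fix L assume L: "L : dn I J"
    show "mr L J (z (L, I)) : Ds J I" using dnD[OF L] SD_val[OF z dn_X[OF JI L]] JS by (intro mr_Ds[of I L J]) auto
  qed (use JS in auto)
qed

lemma del_stable: "z : SD a (Suc b) ==> del a b z : SD a b"
proof (rule SDI)
  assume z: "z : SD a (Suc b)"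
  show "del a b z : carrier (D a b)" using mod_hom_closed[OF del_hom SD_car[OF z]] .
  fix J K assume JK: "(J, K) : X a b"
  note JS = XD[OF JK]
  show "del a b z (J, K) : Ds J K" unfolding del_apply[OF SD_car[OF z] JK]
  proof (rule module.inc_submodule[OF Lam Ds_sub])
    fix I assume I: "I : cov {J} K"
    have JI: "(J, I) : X a (Suc b)" using cov_X[of J K "Suc b" I] I JS by simp
    show "z (J, I) : Ds J K" using SD_val[OF z JI] Ds_anti[of J I K] XD[OF JI] JS I covered_byD[of K I] by (auto simp: covJ)
  qed (use JS in auto)
qed

lemma g_stable: "z : SD n b ==> g b z : SC b"
proof (rule SCI)
  assume z: "z : SD n b"
  show "g b z : carrier (C b)" using mod_hom_closed[OF g_hom SD_car[OF z]] .
  fix I assume I: "I : rk (Suc b)"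
  note IS = rkD[OF I]
  interpret M: module R "Lam I" using Lam IS by simp
  have D: "submodule (Ds I I) R (Lam I)" using IS by (intro Ds_sub) auto
  show "g b z I : Ds I I" unfolding g_apply[OF SD_car[OF z] I]
  proof (rule M.submodule_finsum[OF D])
    fix F assume F: "F : st I n"
    have FI: "(F, I) : X n b" using stD[OF F] IS by (simp add: X_def)
    show "u F \<odot>\<^sub>(Lam I) mi I F (z (F, I)) : Ds I I"
      using uR' stD[OF F] mi_Ds[OF FI SD_val[OF z FI]] by (intro M.submoduleE(4)[OF D]) auto
  qed
qed

lemma dC_stable: "y : SC (Suc b) ==> dC b y : SC b"
proof (rule SCI)
  assume y: "y : SC (Suc b)"
  show "dC b y : carrier (C b)" using mod_hom_closed[OF dC_hom SC_car[OF y]] .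
  fix K assume K: "K : rk (Suc b)"
  note KS = rkD[OF K]
  show "dC b y K : Ds K K" unfolding dC_apply[OF K]
  proof (rule module.inc_submodule[OF Lam Ds_sub])
    fix I assume "I : cov {} K"
    then have I: "covered_by S K I" by (simp add: cov_def)
    have IK: "I : rk (Suc (Suc b))" "(I, K) : X (Suc (Suc b)) b" using covered_byD[OF I] KS by (auto simp: rk_def X_def)
    have "y I : Ds I K" using SC_val[OF y IK(1)] Ds_anti[of I I K] XD[OF IK(2)] by auto
    then show "mi K I (y I) : Ds K K" by (rule mi_Ds[OF IK(2)])
  qed (use KS in auto)
qed

text \<open>\<open>column_exact\<close> concerns one cell \<open>J\<close> and all ranks together;
  here all \<open>J\<close> of rank \<open>a\<close> are treated in the single rank
  \<open>b\<close>, the other ranks being filled with zero.\<close>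

lemma column_lift:
  assumes c: "!!J K. J : rk a ==> K : S ==> K <= J ==> rank S K = b ==> c J K : Ds J K"
    and cyc: "!!J K. J : rk a ==> K : S ==> K <= J ==> Suc (rank S K) = b ==> cinc J (c J) K = \<zero>\<^sub>(Lam J)"
  shows "EX w:SD a b. ALL J:rk a. ALL K:S. K <= J & rank S K = b --> cinc J (%I. w (J, I)) K = c J K"
proof -
  have "EX h. (ALL I:S. I <= J --> h I : Ds J I) & (ALL K:S. K <= J & rank S K = b --> cinc J h K = c J K)"
    if J: "J : rk a" for J
  proof -
    have JS: "J : S" using rkD[OF J] by simp
    interpret M: module R "Lam J" by (rule Lam[OF JS])
    define c' where "c' K = (if rank S K = b then c J K else \<zero>\<^sub>(Lam J))" for K
    have c'D: "c' K : Ds J K" if "K : S" "K <= J" for K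
      using c[OF J that] M.submodule_zero[OF Ds_sub[OF JS that]] by (simp add: c'_def)
    have "cinc J c' K = \<zero>\<^sub>(Lam J)" if K: "K : S" "K <= J" for K
    proof (cases "Suc (rank S K) = b")
      case True
      have "cinc J c' K = cinc J (c J) K"
      proof (rule M.inc_cong)
        fix I assume "I : cov {J} K"
        then have I: "I : S" "I <= J" "rank S I = b" using covered_byD[of K I] True by (auto simp: covJ)
        show "c' I = c J I" using I by (simp add: c'_def)
        show "c J I : carrier (Lam J)" using Ds_carrier[OF JS I(1,2) c[OF J I]] .
      qed auto
      then show ?thesis using cyc[OF J K True] by simp
    next
      case False
      then show ?thesis using covered_byD[of K] by (intro M.inc_zero) (auto simp: c'_def covJ)
    qed
    then have "EX h. (ALL I:S. I <= J --> h I : Ds J I) & (ALL K:S. K <= J --> cinc J h K = c' K)"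
      using c'D by (intro column_exact[OF JS]) auto
    then obtain h where "ALL I:S. I <= J --> h I : Ds J I" "ALL K:S. K <= J --> cinc J h K = c' K" by (elim exE conjE)
    then show ?thesis by (intro exI[of _ h]) (auto simp: c'_def)
  qed
  then have "ALL J:rk a. EX h. (ALL I:S. I <= J --> h I : Ds J I) & (ALL K:S. K <= J & rank S K = b --> cinc J h K = c J K)"
    by blast
  then obtain h where h: "ALL J:rk a. (ALL I:S. I <= J --> h J I : Ds J I) & (ALL K:S. K <= J & rank S K = b --> cinc J (h J) K = c J K)"
    by (elim bchoice[elim_format] exE)
  define w where "w = restrict (%p. h (fst p) (snd p)) (X a b)"
  have rkX: "J : rk a" if "(J, I) : X a b" for J I using XD[OF that] by (simp add: rk_def)
  have "w : SD a b" unfolding w_def using h rkX XD by (intro SD_restrict) auto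
  moreover have "cinc J (%I. w (J, I)) K = c J K" if J: "J : rk a" and K: "K : S" "K <= J" "rank S K = b" for J K
  proof -
    have "cinc J (%I. w (J, I)) K = cinc J (h J) K"
    proof (rule module.inc_cong[OF Lam])
      fix I assume I: "I : cov {J} K"
      have JI: "(J, I) : X a b" using cov_X[OF _ K(3) I] rkD[OF J] by simp
      show "w (J, I) = h J I" using JI by (simp add: w_def)
      show "h J I : carrier (Lam J)" using Ds_carrier[of J I] h J XD[OF JI] by simp
    qed (use rkD[OF J] in auto)
    then show ?thesis using h J K by simp
  qed
  ultimately show ?thesis by blast
qed

lemma column_0: "x : SA a ==> EX z:SD a 0. ep a z = x"
proof -
  assume x: "x : SA a"
  \<comment> \<open>In rank \<open>0\<close> only the bottom occurs, where the prescribed value is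
    \<open>x J\<close>, and the cycle condition is empty.\<close>
  have "EX w:SD a 0. ALL J:rk a. ALL K:S. K <= J & rank S K = 0 --> cinc J (%I. w (J, I)) K = x J"
    using SA_val[OF x] rank_eq_0_iff by (intro column_lift[where c="%J K. x J"]) auto
  then obtain w where w: "w : SD a 0" "ALL J:rk a. ALL K:S. K <= J & rank S K = 0 --> cinc J (%I. w (J, I)) K = x J"
    by (elim bexE)
  have "ep a w = x" using w ep_apply[OF SD_car[OF w(1)]] bot_in bot_le rkD
    by (intro A_ext[OF mod_hom_closed[OF ep_hom SD_car] SA_car[OF x]]) (auto simp: rank_bot)
  then show ?thesis using w(1) by blast
qed

lemma column_del:
  assumes z: "z : SD a b"
    and cyc: "!!J K. J : rk a ==> K : S ==> K <= J ==> rank S K = b ==> cinc J (%I. z (J, I)) K = \<zero>\<^sub>(Lam J)"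
  shows "EX w:SD a (Suc b). del a b w = z"
proof -
  have X: "(J, K) : X a b" if "J : rk a" "K : S" "K <= J" "rank S K = Suc b" for J K using that by (simp add: X_def rk_def)
  have "EX w:SD a (Suc b). ALL J:rk a. ALL K:S. K <= J & rank S K = Suc b --> cinc J (%I. w (J, I)) K = z (J, K)"
    using SD_val[OF z] X cyc by (intro column_lift[where c="%J K. z (J, K)"]) auto
  then obtain w where w: "w : SD a (Suc b)" "ALL J:rk a. ALL K:S. K <= J & rank S K = Suc b --> cinc J (%I. w (J, I)) K = z (J, K)"
    by (elim bexE)
  have "del a b w = z"
  proof (rule D_ext[OF mod_hom_closed[OF del_hom SD_car[OF w(1)]] SD_car[OF z]])
    fix J K assume JK: "(J, K) : X a b"
    then have "J : rk a" using XD[OF JK] by (simp add: rk_def)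
    then show "del a b w (J, K) = z (J, K)" using del_apply[OF SD_car[OF w(1)] JK] w(2) XD[OF JK] by simp
  qed
  then show ?thesis using w(1) by blast
qed

text \<open>A row splits into the stars of its cells \<open>I\<close>. There the problem is solved
  with values in the fixed ideal \<open>Ds I I\<close>, and \<open>mr\<close> carries the solution
  to the ideals \<open>Ds J I\<close>.\<close>

lemma row_lift:
  assumes z: "z : SD (Suc a) b"
    and ex: "!!I. I : rk (Suc b) ==> EX y. (ALL L. y L : Ds I I) & (ALL J:st I (Suc a). rinc I I y J = mi I J (z (J, I)))"
  shows "EX w:SD a b. dl a b w = z"
proof -
  have "ALL I:rk (Suc b). EX y. (ALL L. y L : Ds I I) & (ALL J:st I (Suc a). rinc I I y J = mi I J (z (J, I)))"
    using ex by blast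
  then obtain y where y: "ALL I:rk (Suc b). (ALL L. y I L : Ds I I) & (ALL J:st I (Suc a). rinc I I (y I) J = mi I J (z (J, I)))"
    by (elim bchoice[elim_format] exE)
  define w where "w = restrict (%p. mr (snd p) (fst p) (y (snd p) (fst p))) (X a b)"
  have rkX: "I : rk (Suc b)" if "(J, I) : X a' b" for J I a' using XD[OF that] by (simp add: rk_def)
  have w: "w : SD a b" unfolding w_def
  proof (rule SD_restrict)
    fix J I assume JI: "(J, I) : X a b"
    show "mr (snd (J, I)) (fst (J, I)) (y (snd (J, I)) (fst (J, I))) : Ds J I"
      using XD[OF JI] y rkX[OF JI] by (auto intro!: mr_Ds[of I I J])
  qed
  have "dl a b w = z"
  proof (rule D_ext[OF mod_hom_closed[OF dl_hom SD_car[OF w]] SD_car[OF z]])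
    fix J I assume JI: "(J, I) : X (Suc a) b"
    note JS = XD[OF JI]
    have yc: "y I L : carrier (Lam I)" for L using Ds_carrier[of I I] y rkX[OF JI] JS by auto
    \<comment> \<open>Both sides are compared after transport to \<open>Lam I\<close>; this loses
      nothing, since \<open>mr\<close> inverts \<open>mi\<close>.\<close>
    have "mi I J (dl a b w (J, I)) = rinc I I (%L. mi I L (w (L, I))) J" by (rule mi_dl[OF SD_car[OF w] JI])
    also have "\<dots> = rinc I I (y I) J"
    proof (rule module.inc_cong[OF Lam])
      fix L assume L: "L : dn I J"
      show "mi I L (w (L, I)) = y I L" using dn_X[OF JI L] dnD[OF L] JS yc by (simp add: w_def mi_mr)
    qed (use JS yc in auto)
    also have "\<dots> = mi I J (z (J, I))" using y rkX[OF JI] JS by (simp add: st_def)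
    finally have "mr I J (mi I J (dl a b w (J, I))) = mr I J (mi I J (z (J, I)))" by simp
    then show "dl a b w (J, I) = z (J, I)"
      using mr_mi[of I J] JS D_val[OF mod_hom_closed[OF dl_hom SD_car[OF w]] JI] D_val[OF SD_car[OF z] JI] by simp
  qed
  then show ?thesis using w by blast
qed

lemma mi_SD:
  assumes "z : SD a b" "I : rk (Suc b)" "L : st I a"
  shows "mi I L (z (L, I)) : Ds I I"
proof -
  have LI: "(L, I) : X a b" using stD[OF assms(3)] rkD[OF assms(2)] by (simp add: X_def)
  show ?thesis by (rule mi_Ds[OF LI SD_val[OF assms(1) LI]])
qed

lemma row_exact:
  assumes a: "Suc a < n" and z: "z : SD (Suc a) b" and dz: "dl (Suc a) b z = \<zero>\<^sub>(D (Suc (Suc a)) b)"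
  shows "EX w:SD a b. dl a b w = z"
proof (rule row_lift[OF z])
  fix I assume I: "I : rk (Suc b)"
  note IS = rkD[OF I] and Ib = rk_Suc[OF I]
  \<comment> \<open>Exactness in rank \<open>Suc a\<close> uses the contraction up to and including
    that rank, available because \<open>Suc (Suc a) \<le> n\<close>.\<close>
  have "EX hm. contraction I (Suc (Suc a)) hm" using contraction_exists[of I n, OF _ acyclic] IS Ib a by simp
  then obtain hm where hm: "contraction I (Suc (Suc a)) hm" ..
  show "EX y. (ALL L. y L : Ds I I) & (ALL J:st I (Suc a). rinc I I y J = mi I J (z (J, I)))"
  proof (rule star_cochain_exact[OF Lam hm, where c="%J. mi I J (z (J, I))"])
    fix K assume K: "K : st I (Suc (Suc a))"
    have KI: "(K, I) : X (Suc (Suc a)) b" using stD[OF K] IS by (simp add: X_def)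
    have "rinc I I (%J. mi I J (z (J, I))) K = mi I K (dl (Suc a) b z (K, I))" using mi_dl[OF SD_car[OF z] KI] by simp
    also have "\<dots> = \<zero>\<^sub>(Lam I)" unfolding dz
      using D_zero[OF KI] mod_hom_zero[OF Lam Lam mi_hom] XD[OF KI] by simp
    finally show "rinc I I (%J. mi I J (z (J, I))) K = \<zero>\<^sub>(Lam I)" .
  qed (use IS Ds_sub mi_SD[OF z I] in auto)
qed

lemma row_exact_top:
  assumes a: "Suc a = n" and z: "z : SD (Suc a) b" and gz: "g b z = \<zero>\<^sub>(C b)"
  shows "EX w:SD a b. dl a b w = z"
proof (rule row_lift[OF z])
  fix I assume I: "I : rk (Suc b)"
  note IS = rkD[OF I] and Ib = rk_Suc[OF I]
  have "EX hm. contraction I n hm" using contraction_exists[of I n, OF _ acyclic] IS Ib by simp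
  then obtain hm where hm: "contraction I n hm" ..
  show "EX y. (ALL L. y L : Ds I I) & (ALL J:st I (Suc a). rinc I I y J = mi I J (z (J, I)))" unfolding a
  proof (rule star_cochain_exact_top[OF Lam _ Ib hm fund, where c="%J. mi I J (z (J, I))"])
    show "(\<Oplus>\<^bsub>Lam I\<^esub>F\<in>st I n. u F \<odot>\<^sub>(Lam I) mi I F (z (F, I))) = \<zero>\<^sub>(Lam I)"
      using g_apply[OF SD_car, of z b I] z a gz I C_zero[OF I] by simp
  qed (use IS Ds_sub mi_SD[OF z I] a in auto)
qed

text \<open>For each \<open>I\<close> the whole value is placed on one chosen top cell
  \<open>F0 I\<close> above it and divided by the unit \<open>u (F0 I)\<close>.\<close>

lemma g_surj:
  assumes y: "y : SC b"
  shows "EX z:SD n b. g b z = y"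
proof -
  have "ALL I:rk (Suc b). EX F. F : st I n" using fund rkD rk_Suc by (fastforce simp: fundamental_def st_def)
  then obtain F0 where F0: "ALL I:rk (Suc b). F0 I : st I n" by (elim bchoice[elim_format] exE)
  define z where "z = restrict (%p. if fst p = F0 (snd p) then mr (snd p) (fst p) (inv (u (fst p)) \<odot>\<^sub>(Lam (snd p)) y (snd p)) else \<zero>\<^sub>(Lam (fst p))) (X n b)"
  have rkX: "I : rk (Suc b)" if "(F, I) : X n b" for F I using XD[OF that] by (simp add: rk_def)
  have z: "z : SD n b" unfolding z_def
  proof (rule SD_restrict)
    fix F I assume FI: "(F, I) : X n b"
    note FS = XD[OF FI]
    have "submodule (Ds I I) R (Lam I)" "submodule (Ds F I) R (Lam F)" using FS Ds_sub by auto
    moreover have "mr I F (inv (u F) \<odot>\<^sub>(Lam I) y I) : Ds F I" using uR FS SC_val[OF y rkX[OF FI]] Ds_sub[of I I]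
      by (intro mr_Ds[of I I F] module.submoduleE(4)[OF Lam]) auto
    ultimately show "(if fst (F, I) = F0 (snd (F, I)) then mr (snd (F, I)) (fst (F, I)) (inv (u (fst (F, I))) \<odot>\<^sub>(Lam (snd (F, I))) y (snd (F, I))) else \<zero>\<^sub>(Lam (fst (F, I)))) : Ds F I"
      using module.submodule_zero[OF Lam, of F "Ds F I"] FS by auto
  qed
  have "g b z = y"
  proof (rule C_ext[OF mod_hom_closed[OF g_hom SD_car[OF z]] SC_car[OF y]])
    fix I assume I: "I : rk (Suc b)"
    note IS = rkD[OF I] and Ib = rk_Suc[OF I]
    interpret M: module R "Lam I" using Lam IS by simp
    have F: "F0 I : S" "I <= F0 I" "rank S (F0 I) = n" using F0 I stD by auto
    have yI: "y I : carrier (Lam I)" using C_val[OF SC_car[OF y] I] .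
    have uI: "u (F0 I) : carrier R" "inv (u (F0 I)) : carrier R" "u (F0 I) \<otimes> inv (u (F0 I)) = \<one>" using uR[OF F(1,3)] by auto
    have X: "(F, I) : X n b" if "F : st I n" for F using stD[OF that] IS by (simp add: X_def)
    have "g b z I = (\<Oplus>\<^bsub>Lam I\<^esub>F\<in>st I n. u F \<odot>\<^sub>(Lam I) mi I F (z (F, I)))" by (rule g_apply[OF SD_car[OF z] I])
    also have "\<dots> = (\<Oplus>\<^bsub>Lam I\<^esub>F\<in>st I n. if F = F0 I then y I else \<zero>\<^sub>(Lam I))"
    proof (rule M.M.finsum_cong'[OF refl])
      fix F assume F': "F : st I n"
      have "mi I F (z (F, I)) = (if F = F0 I then inv (u F) \<odot>\<^sub>(Lam I) y I else \<zero>\<^sub>(Lam I))"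
        using X[OF F'] stD[OF F'] IS Ib yI uI mod_hom_zero[OF Lam Lam mi_hom, of F I] by (auto simp: z_def mi_mr)
      then show "u F \<odot>\<^sub>(Lam I) mi I F (z (F, I)) = (if F = F0 I then y I else \<zero>\<^sub>(Lam I))"
        using uR'[of F] stD[OF F'] yI uI by (auto simp: M.smult_assoc1[symmetric])
    qed (use yI in auto)
    also have "\<dots> = y I" using F0 I yI by (subst M.M.finsum_single[where a="F0 I"]) auto
    finally show "g b z I = y I" .
  qed
  then show ?thesis using z by blast
qed

sublocale exact_double_complex R n A D C dA ep dl del g dC SA SD SC
proof (intro exact_double_complex.intro exact_double_complex_axioms.intro)
  show "double_complex R n A D C dA ep dl del g dC" by (rule double_complex_axioms)
  show "EX w:SD a (Suc 0). del a 0 w = z" if z: "z : SD a 0" "ep a z = \<zero>\<^sub>(A a)" for a z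
  proof (rule column_del[OF z(1)])
    fix J K assume J: "J : rk a" and K: "K : S" "rank S K = 0"
    then have "K = bot_of S" by (simp add: rank_eq_0_iff)
    then show "cinc J (%I. z (J, I)) K = \<zero>\<^sub>(Lam J)"
      using ep_apply[OF SD_car[OF z(1)] J] z(2) A_zero[OF J] by simp
  qed
  show "EX w:SD a (Suc (Suc b)). del a (Suc b) w = z" if z: "z : SD a (Suc b)" "del a b z = \<zero>\<^sub>(D a b)" for a b z
  proof (rule column_del[OF z(1)])
    fix J K assume "J : rk a" and "K : S" "K <= J" "rank S K = Suc b"
    then have JK: "(J, K) : X a b" by (simp add: X_def rk_def)
    then show "cinc J (%I. z (J, I)) K = \<zero>\<^sub>(Lam J)"
      using del_apply[OF SD_car[OF z(1)] JK] z(2) D_zero[OF JK] by simp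
  qed
  \<comment> \<open>There are no cells of rank \<open>n + 1\<close>.\<close>
  show "dA n x = \<zero>\<^sub>(A (Suc n))" if x: "x : SA n" for x
  proof (rule A_ext)
    show "dA n x : carrier (A (Suc n))" using mod_hom_closed[OF dA_hom SA_car[OF x]] .
    show "\<zero>\<^sub>(A (Suc n)) : carrier (A (Suc n))" using A_module module.axioms(2) abelian_groupE(2) by blast
    fix J assume "J : rk (Suc n)"
    then show "dA n x J = \<zero>\<^sub>(A (Suc n)) J" using rkD[of J "Suc n"] rank_le_dim[OF _ dim, of J] by simp
  qed
  show "EX w:SD a b. dl a b w = z" if "Suc a = n" "z : SD (Suc a) b" "g b z = \<zero>\<^sub>(C b)" for a b z
    using that by (rule row_exact_top)
  show "EX z:SD n b. g b z = y" if "y : SC b" for b y using that by (rule g_surj)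
  show "submodule (SA a) R (A a)" "submodule (SC b) R (C b)" for a b by (rule SA_sub SC_sub)+
  show "submodule (SD a b) R (D a b)" for a b by (rule SD_sub)
qed (rule SA_stable ep_stable dl_stable del_stable g_stable dC_stable column_0 row_exact, assumption+)+

end

section \<open>The ideals of a characteristic function as a system of coefficients\<close>

section \<open>The ideals of a characteristic function\<close>

context coefficient_ring
begin

lemma EM_ring_hom:
  assumes M: "module R M" and N: "module R N" and h: "h : mod_hom R M N"
  shows "ring_hom_ring (EA M) (EA N) (EM N h)"
  using mod_hom_closed[OF EM_hom[OF M N h]] mod_hom_add[OF EM_hom[OF M N h]] EM_mult[OF M N h] EM_one[OF M N h]
  by (intro ring_hom_ringI2 EA_ring M N ring_hom_memI) auto

text \<open>The preimage of an ideal under a ring homomorphism is an ideal, so it is enough to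
  follow the generators.\<close>

lemma EM_genideal_sub:
  assumes M: "module R M" and N: "module R N" and h: "h : mod_hom R M N"
    and B: "B \<subseteq> carrier (EA M)" and B': "B' \<subseteq> carrier (EA N)" "EM N h ` B \<subseteq> B'" and x: "x : Idl\<^bsub>EA M\<^esub> B"
  shows "EM N h x : Idl\<^bsub>EA N\<^esub> B'"
proof -
  interpret E: ring "EA M" by (rule EA_ring[OF M])
  interpret E': ring "EA N" by (rule EA_ring[OF N])
  have "ideal {r : carrier (EA M). EM N h r : Idl\<^bsub>EA N\<^esub> B'} (EA M)"
    by (rule ring_hom_ring.ideal_vimage[OF EM_ring_hom[OF M N h] E'.genideal_ideal[OF B'(1)]])
  then have "Idl\<^bsub>EA M\<^esub> B \<subseteq> {r : carrier (EA M). EM N h r : Idl\<^bsub>EA N\<^esub> B'}"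
    using B B'(2) E'.genideal_self[OF B'(1)] by (intro E.genideal_minimal) auto
  then show ?thesis using x by blast
qed

lemma EM_wedge:
  assumes M: "module R M" and N: "module R N" and h: "h : mod_hom R M N" and xs: "set xs \<subseteq> carrier M"
  shows "wedge R M xs : carrier (EA M)" "EM N h (wedge R M xs) = wedge R N (map h xs)"
proof -
  interpret E: ring "EA M" by (rule EA_ring[OF M])
  have "wedge R M xs : carrier (EA M) & EM N h (wedge R M xs) = wedge R N (map h xs)"
    using xs by (induct xs) (simp_all add: wedge_def EM_one[OF M N h] EM_mult[OF M N h] EM_gen[OF M N h] gen_closed[OF M])
  then show "wedge R M xs : carrier (EA M)" "EM N h (wedge R M xs) = wedge R N (map h xs)" by auto
qed

end

lemma zero_module_module:
  assumes "module R M" shows "module R (zero_module M)"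
proof -
  interpret module R M by fact
  show ?thesis unfolding zero_module_def
    using submodule.submodule_is_module[OF submodule_singleton_zero] module_axioms by simp
qed

lemma zero_module_simps:
  "carrier (zero_module M) = {\<zero>\<^sub>M}" "\<zero>\<^sub>(zero_module M) = \<zero>\<^sub>M" "x \<oplus>\<^sub>(zero_module M) y = x \<oplus>\<^sub>M y"
  "a \<odot>\<^sub>(zero_module M) x = a \<odot>\<^sub>M x" by (simp_all add: zero_module_def)

locale characteristic_data = signed_poset S R eps
  for S :: "'p::order set" and R :: "'k ring" (structure) and eps +
  fixes V :: "('k, 'w) module" and VV :: "('p, 'k, 'v) coeff_system" and om :: "'p => 'v"
  assumes loc: "locally_constant_sheaf R S V VV" and char: "characteristic_function R S VV om"
begin

sublocale coefficient_ring R ..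

abbreviation "VI I \<equiv> val VV I"
abbreviation "Lam \<equiv> val (exterior_sheaf R S VV)"
abbreviation "mr \<equiv> mor (exterior_sheaf R S VV)"

definition "w I i = mor VV i I (om i)"

lemma VM: "I : S ==> module R (VI I)"
  and vhom: "I : S ==> J : S ==> I <= J ==> mor VV I J : mod_hom R (VI I) (VI J)"
  and vid: "I : S ==> x : carrier (VI I) ==> mor VV I I x = x"
  and vcomp: "I : S ==> J : S ==> K : S ==> I <= J ==> J <= K ==> x : carrier (VI I) ==>
    mor VV J K (mor VV I J x) = mor VV I K x" using loc unfolding locally_constant_sheaf_def is_sheaf_def by auto

lemma viso: "I : S ==> J : S ==> I ~= bot_of S ==> I <= J ==> mor VV I J : mod_iso R (VI I) (VI J)"
  using loc unfolding locally_constant_sheaf_def by auto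

lemma vbD: "v : vb J ==> v : S & v <= J & v : Vert S" by (auto simp: verts_below_def Vert_def)

lemma vb_not_bot: "v : vb J ==> J : S ==> J ~= bot_of S" by auto

lemma Lam_simps: "I ~= bot_of S ==> Lam I = EA (VI I)" "Lam (bot_of S) = zero_module (EA (VI (bot_of S)))"
  by (simp_all add: exterior_sheaf_def)

lemma mr_eq: "mr I J = EM (VI J) (mor VV I J)" by (simp add: exterior_sheaf_def)

lemma Lam_zero: "\<zero>\<^sub>(Lam J) = \<zero>\<^sub>(EA (VI J))"
  and Lam_add: "x \<oplus>\<^sub>(Lam J) y = x \<oplus>\<^sub>(EA (VI J)) y"
  and Lam_smult: "a \<odot>\<^sub>(Lam J) x = a \<odot>\<^sub>(EA (VI J)) x"
  by (simp_all add: exterior_sheaf_def zero_module_simps)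

lemma Lam_module: "I : S ==> module R (Lam I)"
  using EA_module[OF VM] zero_module_module[OF EA_module[OF VM]] by (simp add: exterior_sheaf_def)

lemma Lam_carrier: "I : S ==> x : carrier (Lam I) ==> x : carrier (EA (VI I))"
  using module.submodule_zero[OF EA_module[OF VM] module.submodule_singleton_zero[OF EA_module[OF VM]]]
    abelian_groupE(2)[OF module.axioms(2)[OF EA_module[OF VM]]]
  by (auto simp: exterior_sheaf_def zero_module_simps split: if_splits)

lemma mr_hom: "I : S ==> J : S ==> I <= J ==> mr I J : mod_hom R (Lam I) (Lam J)"
proof -
  assume I: "I : S" and J: "J : S" and le: "I <= J"
  have h: "mr I J : mod_hom R (EA (VI I)) (EA (VI J))" unfolding mr_eq by (rule EM_hom[OF VM[OF I] VM[OF J] vhom[OF I J le]])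
  have z: "mr I J \<zero>\<^sub>(EA (VI I)) = \<zero>\<^sub>(EA (VI J))" by (rule mod_hom_zero[OF EA_module EA_module h]) (rule VM I J)+
  have J0: "I = bot_of S" if "J = bot_of S" using le_bot[OF I] le that by simp
  show ?thesis
  proof (rule mod_homI)
    fix x assume x: "x : carrier (Lam I)"
    show "mr I J x : carrier (Lam J)"
      using x z J0 mod_hom_closed[OF h Lam_carrier[OF I x]] by (auto simp: exterior_sheaf_def zero_module_simps split: if_splits)
  next
    fix x y assume x: "x : carrier (Lam I)" "y : carrier (Lam I)"
    show "mr I J (x \<oplus>\<^sub>(Lam I) y) = mr I J x \<oplus>\<^sub>(Lam J) mr I J y"
      using mod_hom_add[OF h x[THEN Lam_carrier[OF I]]] unfolding Lam_add .
  next
    fix a x assume x: "a : carrier R" "x : carrier (Lam I)"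
    show "mr I J (a \<odot>\<^sub>(Lam I) x) = a \<odot>\<^sub>(Lam J) mr I J x"
      using mod_hom_smult[OF h x(1) Lam_carrier[OF I x(2)]] unfolding Lam_smult .
  qed
qed

lemma w_closed: "J : S ==> v : vb J ==> w J v : carrier (VI J)"
  using char mod_hom_closed[OF vhom] vbD[of v J] by (simp add: w_def characteristic_function_def)

lemma mor_w: "J : S ==> J' : S ==> J <= J' ==> v : vb J ==> mor VV J J' (w J v) = w J' v"
  using char vcomp[of v J J' "om v"] vbD[of v J] by (simp add: w_def characteristic_function_def)

text \<open>Dual functionals are chosen at each cell separately. They contract the column of that
  cell only, so the choices at different cells need not match.\<close>

definition "fn J = (SOME f. exterior_frame R (VI J) (vb J) (w J) f)"

lemma frame: "J : S ==> J ~= bot_of S ==> exterior_frame R (VI J) (vb J) (w J) (fn J)"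
proof -
  assume J: "J : S" "J ~= bot_of S"
  have "lin_indep R (VI J) (vb J) (w J)" "direct_summand R (VI J) (lin_span R (VI J) (vb J) (w J))"
    using char J unfolding characteristic_function_def w_def by auto
  then have "EX f. (ALL v:vb J. ALL x:carrier (VI J). f v x : carrier R) &
    (ALL v:vb J. ALL x:carrier (VI J). ALL y:carrier (VI J). f v (x \<oplus>\<^sub>(VI J) y) = f v x \<oplus> f v y) &
    (ALL v:vb J. ALL a:carrier R. ALL x:carrier (VI J). f v (a \<odot>\<^sub>(VI J) x) = a \<otimes> f v x) &
    (ALL v:vb J. ALL u:vb J. f v (w J u) = (if v = u then \<one> else \<zero>))"
    by (intro dual_functionals VM J w_closed finite_vb)
  then obtain f where "ALL v:vb J. ALL x:carrier (VI J). f v x : carrier R"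
    "ALL v:vb J. ALL x:carrier (VI J). ALL y:carrier (VI J). f v (x \<oplus>\<^sub>(VI J) y) = f v x \<oplus> f v y"
    "ALL v:vb J. ALL a:carrier R. ALL x:carrier (VI J). f v (a \<odot>\<^sub>(VI J) x) = a \<otimes> f v x"
    "ALL v:vb J. ALL u:vb J. f v (w J u) = (if v = u then \<one> else \<zero>)" by (elim exE conjE)
  then have "exterior_frame R (VI J) (vb J) (w J) f"
    using VM J w_closed by (intro exterior_frame.intro exterior_frame_axioms.intro coefficient_ring_axioms) auto
  then show ?thesis unfolding fn_def by (rule someI[of "exterior_frame R (VI J) (vb J) (w J)"])
qed

definition "Q J = exterior_frame.Q R (VI J) (w J) (fn J)"
text \<open>The idempotent onto the ideal generated by the vector of \<open>v\<close>, complementary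
  to \<open>Q J v\<close>.\<close>

definition "P J v x = x \<ominus>\<^sub>(EA (VI J)) Q J v x"
text \<open>The same choice term as in \<open>pi_elem\<close>, so that the generators of
  \<open>Ds\<close> and of \<open>pi_cosheaf\<close> coincide literally.\<close>

definition "vs I = (SOME vs. distinct vs & set vs = vb I)"

lemma vs: "distinct (vs I)" "set (vs I) = vb I"
proof -
  have "EX xs. distinct xs & set xs = vb I" using finite_distinct_list[OF finite_vb] by blast
  then have "distinct (vs I) & set (vs I) = vb I" unfolding vs_def by (rule someI_ex)
  then show "distinct (vs I)" "set (vs I) = vb I" by auto
qed

text \<open>At \<open>I\<close> the bottom the full ideal of \<open>J\<close> appears instead of the
  principal ideal of an empty product, because this is the target of the augmentation
  \<open>ep\<close>. Over \<open>J\<close> the bottom everything is zero, as the sheaves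
  are.\<close>

definition "Ds J I = (if J = bot_of S then {\<zero>\<^sub>(Lam J)}
  else if I = bot_of S then Idl\<^bsub>EA (VI J)\<^esub> ((%v. gen (VI J) (w J v)) ` vb J)
  else Idl\<^bsub>EA (VI J)\<^esub> {wedge R (VI J) (map (w J) (vs I))})"

lemma gens_closed: "J : S ==> (%v. gen (VI J) (w J v)) ` vb J \<subseteq> carrier (EA (VI J))"
  using gen_closed[OF VM w_closed] by auto

lemma vb_sub: "I : S ==> J : S ==> I <= J ==> vb I \<subseteq> vb J" by (auto simp: verts_below_def)

lemma wd_closed: "I : S ==> J : S ==> I <= J ==> {wedge R (VI J) (map (w J) (vs I))} \<subseteq> carrier (EA (VI J))"
proof -
  assume J: "I : S" "J : S" "I <= J"
  have "set (map (w J) (vs I)) \<subseteq> carrier (VI J)" using w_closed[OF J(2)] vb_sub[OF J] by (auto simp: vs)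
  then show ?thesis using EM_wedge(1)[OF VM VM vhom[of J J]] J(2) by simp
qed

lemma Ds_iff:
  assumes J: "J : S" "I : S" "I <= J" "I ~= bot_of S"
  shows "x : Ds J I \<longleftrightarrow> x : carrier (EA (VI J)) & (ALL v:vb I. Q J v x = \<zero>\<^sub>(EA (VI J)))"
proof -
  have Jb: "J ~= bot_of S" using le_bot[OF J(2)] J by auto
  interpret F: exterior_frame R "VI J" "vb J" "w J" "fn J" by (rule frame[OF J(1) Jb])
  show ?thesis using F.wd_ideal[of "vs I"] J Jb vb_sub[OF J(2,1,3)] by (simp add: Ds_def Q_def vs F.wd_def)
qed

lemma Ds_bot: "J : S ==> J ~= bot_of S ==> Ds J (bot_of S) = exterior_frame.VI R (VI J) (vb J) (w J)"
  by (simp add: Ds_def exterior_frame.VI_def[OF frame])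

lemma Ds_submodule:
  assumes J: "J : S" "I : S" "I <= J"
  shows "submodule (Ds J I) R (EA (VI J))"
proof (cases "J = bot_of S")
  case True
  then show ?thesis using module.submodule_singleton_zero[OF EA_module[OF VM[OF J(1)]]] by (simp add: Ds_def Lam_zero)
next
  case False
  interpret E: ring "EA (VI J)" by (rule EA_ring[OF VM[OF J(1)]])
  have "ideal (Ds J I) (EA (VI J))" using False J gens_closed wd_closed by (simp add: Ds_def E.genideal_ideal)
  then show ?thesis by (rule ideal_submodule[OF VM[OF J(1)] is_cring])
qed

lemma Ds_submodule_Lam: "J : S ==> I : S ==> I <= J ==> submodule (Ds J I) R (Lam J)"
  using Ds_submodule[of J I] module.submodule_singleton_zero[OF Lam_module, of J]
  by (cases "J = bot_of S") (auto simp: Ds_def Lam_simps)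

lemma Q_props:
  assumes J: "J : S" and v: "v : vb J"
  shows "Q J v : mod_hom R (EA (VI J)) (EA (VI J))" "EX h:mod_hom R (VI J) (VI J). Q J v = EM (VI J) h"
    "x : carrier (EA (VI J)) ==> Q J v (Q J v x) = Q J v x"
    "u : vb J ==> x : carrier (EA (VI J)) ==> Q J v (Q J u x) = Q J u (Q J v x)"
proof -
  interpret F: exterior_frame R "VI J" "vb J" "w J" "fn J" using vb_not_bot[OF v J] by (rule frame[OF J])
  show "Q J v : mod_hom R (EA (VI J)) (EA (VI J))" using F.Q_hom[OF v] by (simp add: Q_def)
  show "EX h:mod_hom R (VI J) (VI J). Q J v = EM (VI J) h" using F.p_hom[OF v] by (auto simp: Q_def F.Q_def)
  show "x : carrier (EA (VI J)) ==> Q J v (Q J v x) = Q J v x" using F.Q_Q[OF v] by (simp add: Q_def)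
  show "u : vb J ==> x : carrier (EA (VI J)) ==> Q J v (Q J u x) = Q J u (Q J v x)" using F.Q_comm[OF v] by (simp add: Q_def)
qed

text \<open>For \<open>K\<close> not the bottom, fewer vertices mean fewer equations. For
  \<open>K\<close> the bottom, a nonempty wedge product lies in the ideal generated by its
  factors.\<close>

lemma Ds_antimono:
  assumes J: "J : S" and I: "I : S" and K: "K : S" and le: "K <= I" "I <= J" and b: "I ~= bot_of S"
  shows "Ds J I \<subseteq> Ds J K"
proof (cases "K = bot_of S")
  case True
  have Jb: "J ~= bot_of S" using le_bot[OF I] le b by auto
  interpret F: exterior_frame R "VI J" "vb J" "w J" "fn J" by (rule frame[OF J Jb])
  have "vs I ~= []" using vs(2)[of I] vb_nonempty[OF I b] by auto
  then show ?thesis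
    using F.wd_ideal_sub_VI[of "vs I"] vb_sub[OF I J le(2)] b Jb Ds_bot[OF J Jb] True by (simp add: Ds_def vs F.wd_def)
next
  case False
  then show ?thesis using Ds_iff[OF J I le(2) b] Ds_iff[OF J K order_trans[OF le] False] vb_sub[OF K I le(1)] by blast
qed

lemma wd_map:
  assumes J: "I : S" "J : S" "J' : S" "I <= J" "J <= J'"
  shows "EM (VI J') (mor VV J J') (wedge R (VI J) (map (w J) (vs I))) = wedge R (VI J') (map (w J') (vs I))"
proof -
  have m: "map (mor VV J J') (map (w J) (vs I)) = map (w J') (vs I)"
    using mor_w[OF J(2,3,5)] vb_sub[OF J(1,2,4)] by (auto simp: vs)
  have s: "set (map (w J) (vs I)) \<subseteq> carrier (VI J)" using w_closed[OF J(2)] vb_sub[OF J(1,2,4)] by (auto simp: vs)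
  show ?thesis using EM_wedge(2)[OF VM[OF J(2)] VM[OF J(3)] vhom[OF J(2,3,5)] s] unfolding m .
qed

text \<open>Generators go to generators: the vertices of \<open>J\<close> are among those of
  \<open>J'\<close>, and the wedge product for \<open>I\<close> at \<open>J\<close> is mapped to the
  one at \<open>J'\<close>.\<close>

lemma mr_Ds_sub:
  assumes J: "I : S" "J : S" "J' : S" "I <= J" "J <= J'" and x: "x : Ds J I"
  shows "mr J J' x : Ds J' I"
proof (cases "J = bot_of S")
  case True
  then have "x = \<zero>\<^sub>(Lam J)" using x by (simp add: Ds_def)
  then have "mr J J' x = \<zero>\<^sub>(Lam J')" using mod_hom_zero[OF Lam_module Lam_module mr_hom] J by simp
  then show ?thesis using module.submodule_zero[OF Lam_module Ds_submodule_Lam] J by (metis order_trans)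
next
  case False
  have J'b: "J' ~= bot_of S" using le_bot[OF J(2)] J False by auto
  note M = VM[OF J(2)] VM[OF J(3)] vhom[OF J(2,3,5)]
  show ?thesis
  proof (cases "I = bot_of S")
    case True
    have "EM (VI J') (mor VV J J') ` (%v. gen (VI J) (w J v)) ` vb J \<subseteq> (%v. gen (VI J') (w J' v)) ` vb J'"
      using EM_gen[OF M w_closed[OF J(2)]] mor_w[OF J(2,3,5)] vb_sub[OF J(2,3,5)] by auto
    then show ?thesis
      using EM_genideal_sub[OF M gens_closed[OF J(2)] gens_closed[OF J(3)]] x True False J'b by (simp add: Ds_def mr_eq)
  next
    case I: False
    have "EM (VI J') (mor VV J J') ` {wedge R (VI J) (map (w J) (vs I))} \<subseteq> {wedge R (VI J') (map (w J') (vs I))}"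
      using wd_map[OF J] by simp
    then show ?thesis
      using EM_genideal_sub[OF M wd_closed[OF J(1,2,4)] wd_closed[OF J(1,3) order_trans[OF J(4,5)]]] x I False J'b by (simp add: Ds_def mr_eq)
  qed
qed

text \<open>Since \<open>I\<close> already lies below \<open>J\<close>, the generator of the ideal
  at \<open>J'\<close> is the image of the one at \<open>J\<close>, so the inverse of the
  restriction map takes one principal ideal into the other. For the full ideals this would fail,
  hence the condition that \<open>I\<close> is not the bottom.\<close>

lemma inv_mr_Ds:
  assumes J: "I : S" "J : S" "J' : S" "I <= J" "J <= J'" "I ~= bot_of S" and x: "x : Ds J' I"
  defines "y \<equiv> EM (VI J) (inv_into (carrier (VI J)) (mor VV J J')) x"
  shows "y : Ds J I" "mr J J' y = x"
proof -
  have b: "J ~= bot_of S" "J' ~= bot_of S" using le_bot[OF J(1)] le_bot[OF J(2)] J by auto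
  note M = VM[OF J(2)] VM[OF J(3)]
  note iso = viso[OF J(2,3) b(1) J(5)]
  let ?h = "inv_into (carrier (VI J)) (mor VV J J')"
  have h: "?h : mod_hom R (VI J') (VI J)" by (rule mod_iso_hom[OF mod_iso_inv[OF M(1) iso]])
  have le: "I <= J'" using order_trans[OF J(4,5)] .
  have wJ: "wedge R (VI J) (map (w J) (vs I)) : carrier (EA (VI J))" using wd_closed[OF J(1,2,4)] by simp
  have "EM (VI J) ?h (wedge R (VI J') (map (w J') (vs I))) = wedge R (VI J) (map (w J) (vs I))"
    using EM_iso(2)[OF M iso wJ] wd_map[OF J(1-5)] by simp
  then have "EM (VI J) ?h ` {wedge R (VI J') (map (w J') (vs I))} \<subseteq> {wedge R (VI J) (map (w J) (vs I))}" by simp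
  then show "y : Ds J I"
    using EM_genideal_sub[OF M(2,1) h wd_closed[OF J(1,3) le] wd_closed[OF J(1,2,4)]] x J(6) b by (simp add: Ds_def y_def)
  have "x : carrier (EA (VI J'))" using Ds_iff[OF J(3,1) le J(6)] x by simp
  then show "mr J J' y = x" unfolding y_def mr_eq by (rule EM_iso(3)[OF M iso])
qed

text \<open>Stability under all induced maps \<open>EM\<close> is demanded because restriction maps,
  their inverses and the endomorphisms \<open>Q\<close> are all of this form. The two instances are
  the whole algebra and a fixed exterior degree.\<close>

definition homogeneous :: "('p => ('v list => 'k) set set) => bool" where
  "homogeneous W \<longleftrightarrow> (ALL J:S. ALL N. submodule N R (EA (VI J)) --> submodule (N \<inter> W J) R (EA (VI J))) &
    (ALL J:S. ALL J':S. ALL h:mod_hom R (VI J) (VI J'). ALL x:carrier (EA (VI J)) \<inter> W J. EM (VI J') h x : W J')"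

lemma homogeneous_UNIV: "homogeneous (%_. UNIV)" by (simp add: homogeneous_def)

lemma homogeneous_degree: "homogeneous (%J. exterior_degree R (VI J) q)" unfolding homogeneous_def
  using module.submodule_Int[OF EA_module[OF VM] _ exterior_degree_submodule[OF VM]] EM_degree[OF VM VM] by auto

lemma P_closed: "J : S ==> v : vb J ==> x : carrier (EA (VI J)) ==> P J v x : carrier (EA (VI J))"
proof -
  assume J: "J : S" and v: "v : vb J" and x: "x : carrier (EA (VI J))"
  interpret E: module R "EA (VI J)" by (rule EA_module[OF VM[OF J]])
  show ?thesis unfolding P_def using x mod_hom_closed[OF Q_props(1)[OF J v] x] by (rule E.minus_closed)
qed

lemma Q_P:
  assumes J: "J : S" and v: "v : vb J" "u : vb J" and x: "x : carrier (EA (VI J))"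
  shows "Q J u (P J v x) = Q J u x \<ominus>\<^sub>(EA (VI J)) Q J v (Q J u x)"
  unfolding P_def using mod_hom_minus[OF EA_module EA_module Q_props(1)[OF J v(2)] x mod_hom_closed[OF Q_props(1)[OF J v(1)] x]]
    VM[OF J] Q_props(4)[OF J v(2) v(1) x] by simp

end

locale characteristic_manifold = characteristic_data S R eps V VV om
  for S :: "'p::order set" and R :: "'k ring" (structure) and eps and V :: "('k, 'w) module"
    and VV :: "('p, 'k, 'v) coeff_system" and om :: "'p => 'v" +
  fixes n :: nat and u :: "'p => 'k"
  assumes dim: "poset_dim S = int n - 1" and fund: "fundamental n u"
    and acyclic: "!!J. J : S ==> J ~= bot_of S ==> flag_acyclic RM J (n - rank S J)"
begin

sublocale L: local_system S R eps n u Lam mr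
proof (intro local_system.intro local_system_axioms.intro)
  show "signed_poset S R eps" by (rule signed_poset_axioms)
  show "poset_dim S = int n - 1" by (rule dim)
  show "fundamental n u" by (rule fund)
  show "flag_acyclic RM J (n - rank S J)" if "J : S" "J ~= bot_of S" for J by (rule acyclic[OF that])
  show "module R (Lam I)" if "I : S" for I by (rule Lam_module[OF that])
  show "mr I J : mod_hom R (Lam I) (Lam J)" if "I : S" "J : S" "I <= J" for I J by (rule mr_hom[OF that])
  show "bij_betw (mr I J) (carrier (Lam I)) (carrier (Lam J))" if IJ: "I : S" "J : S" "I <= J" "I ~= bot_of S" for I J
  proof -
    have "J ~= bot_of S" using le_bot[OF IJ(1)] IJ by auto
    then show ?thesis using mod_iso_bij[OF EM_iso(1)[OF VM VM viso]] IJ by (simp add: Lam_simps mr_eq)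
  qed
  show "mr J K (mr I J x) = mr I K x" if "I : S" "J : S" "K : S" "I <= J" "J <= K" "x : carrier (Lam I)" for I J K x
    unfolding mr_eq using that vhom order_trans[OF that(4,5)] vcomp Lam_carrier VM by (intro EM_comp) auto
qed

text \<open>Intersecting with \<open>W\<close> preserves every axiom, since each map involved is
  induced by a linear map or is the difference of the identity and such a map. The full ideals and
  their components of a given degree are thus handled in one proof.\<close>

theorem coefficient_ideals_homogeneous:
  assumes W: "homogeneous W"
  shows "coefficient_ideals S R eps n u Lam mr (%J I. Ds J I \<inter> W J) P"
proof (intro coefficient_ideals.intro coefficient_ideals_axioms.intro)
  show "local_system S R eps n u Lam mr" by (rule L.local_system_axioms)
  have sub: "submodule (N \<inter> W J) R (EA (VI J))" if "J : S" "submodule N R (EA (VI J))" for J N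
    using W that unfolding homogeneous_def by blast
  have WEM: "EM (VI J') h x : W J'" if "J : S" "J' : S" "h : mod_hom R (VI J) (VI J')" "x : carrier (EA (VI J))" "x : W J" for J J' h x
    using W that unfolding homogeneous_def by blast
  have WD: "submodule (Ds J I \<inter> W J) R (EA (VI J))" if "J : S" "I : S" "I <= J" for J I
    using sub[OF that(1) Ds_submodule[OF that]] .
  have car: "x : carrier (EA (VI J))" if "J : S" "I : S" "I <= J" "x : Ds J I" for J I x
    using module.submodule_carrier[OF EA_module[OF VM[OF that(1)]] Ds_submodule[OF that(1-3)] that(4)] .
  show "submodule (Ds J I \<inter> W J) R (Lam J)" if J: "J : S" "I : S" "I <= J" for J I
  proof (cases "J = bot_of S")
    case True
    have "\<zero>\<^sub>(EA (VI J)) : Ds J I \<inter> W J" using module.submodule_zero[OF EA_module[OF VM[OF J(1)]] WD[OF J]] .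
    then have "Ds J I \<inter> W J = {\<zero>\<^sub>(Lam J)}" using True by (auto simp: Ds_def Lam_zero)
    then show ?thesis using module.submodule_singleton_zero[OF Lam_module[OF J(1)]] by simp
  next
    case False
    then show ?thesis using WD[OF J] by (simp add: Lam_simps)
  qed
  show "Ds J I \<inter> W J \<subseteq> Ds J K \<inter> W J" if "J : S" "I : S" "K : S" "K <= I" "I <= J" "I ~= bot_of S" for J I K
    using Ds_antimono[OF that] by blast
  have mrW: "mr J J' x : Ds J' I \<inter> W J'" if J: "I : S" "J : S" "J' : S" "I <= J" "J <= J'" and x: "x : Ds J I \<inter> W J" for I J J' x
    using mr_Ds_sub[OF J, of x] WEM[OF J(2,3) vhom[OF J(2,3,5)] car[OF J(2,1,4)]] x by (simp add: mr_eq)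
  show "mr J J' ` (Ds J I \<inter> W J) = Ds J' I \<inter> W J'" if J: "I : S" "J : S" "J' : S" "I <= J" "J <= J'" "I ~= bot_of S" for I J J'
  proof (intro equalityI subsetI)
    fix y assume "y : mr J J' ` (Ds J I \<inter> W J)"
    then show "y : Ds J' I \<inter> W J'" using mrW[OF J(1-5)] by blast
  next
    fix x assume x: "x : Ds J' I \<inter> W J'"
    have Jb: "J ~= bot_of S" using le_bot[OF J(1)] J by auto
    have h: "inv_into (carrier (VI J)) (mor VV J J') : mod_hom R (VI J') (VI J)"
      by (rule mod_iso_hom[OF mod_iso_inv[OF VM[OF J(2)] viso[OF J(2,3) Jb J(5)]]])
    have "EM (VI J) (inv_into (carrier (VI J)) (mor VV J J')) x : Ds J I \<inter> W J"
      using inv_mr_Ds(1)[OF J, of x] WEM[OF J(3,2) h car[OF J(3,1) order_trans[OF J(4,5)]]] x by simp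
    then show "x : mr J J' ` (Ds J I \<inter> W J)" using inv_mr_Ds(2)[OF J, of x] x by (metis IntD1 imageI)
  qed
  show "mr J J' x : Ds J' (bot_of S) \<inter> W J'" if "J : S" "J' : S" "J <= J'" "x : Ds J (bot_of S) \<inter> W J" for J J' x
    using mrW[OF bot_in that(1,2) bot_le[OF that(1)] that(3,4)] .
  show "P J v : mod_hom R (Lam J) (Lam J)" if J: "J : S" "v : vb J" for J v
  proof -
    interpret E: module R "EA (VI J)" by (rule EA_module[OF VM[OF J(1)]])
    note Qh = Q_props(1)[OF J]
    have "P J v : mod_hom R (EA (VI J)) (EA (VI J))"
    proof (rule mod_homI)
      fix a x assume "a : carrier R" "x : carrier (EA (VI J))"
      then show "P J v (a \<odot>\<^sub>(EA (VI J)) x) = a \<odot>\<^sub>(EA (VI J)) P J v x"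
        using mod_hom_smult[OF Qh] mod_hom_closed[OF Qh] by (simp add: P_def a_minus_def E.smult_r_distr E.smult_r_minus)
    next
      fix x y assume "x : carrier (EA (VI J))" "y : carrier (EA (VI J))"
      then show "P J v (x \<oplus>\<^sub>(EA (VI J)) y) = P J v x \<oplus>\<^sub>(EA (VI J)) P J v y"
        using mod_hom_add[OF Qh] mod_hom_closed[OF Qh] by (simp add: P_def a_minus_def E.minus_add E.M.a_ac)
    qed (rule P_closed[OF J])
    then show ?thesis using Lam_simps(1)[OF vb_not_bot[OF J(2,1)]] by simp
  qed
  show "P J v x : Ds J I \<inter> W J" if J: "J : S" "v : vb J" "K : S" "I : S" "K <= I" "I <= J" "vb I = insert v (vb K)"
    and x: "x : Ds J K \<inter> W J" for J v K I x
  proof -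
    interpret E: module R "EA (VI J)" by (rule EA_module[OF VM[OF J(1)]])
    have Ib: "I ~= bot_of S" using J(7) by auto
    have le: "K <= J" by (rule order_trans[OF J(5,6)])
    have xc: "x : carrier (EA (VI J))" using car[OF J(1,3) le] x by simp
    obtain h where h: "h : mod_hom R (VI J) (VI J)" "Q J v = EM (VI J) h" using Q_props(2)[OF J(1,2)] by blast
    have "Q J v x : carrier (EA (VI J)) \<inter> W J"
      using WEM[OF J(1,1) h(1) xc] x mod_hom_closed[OF Q_props(1)[OF J(1,2)] xc] h(2) by simp
    then have "P J v x : carrier (EA (VI J)) \<inter> W J" unfolding P_def
      using x xc sub[OF J(1) E.carrier_is_submodule] by (intro E.submodule_minus) auto
    \<comment> \<open>\<open>Q J v\<close> kills \<open>P J v x\<close> by idempotence. For a vertex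
      \<open>y\<close> of \<open>K\<close>, \<open>Q J y\<close> commutes with \<open>Q J v\<close>
      and already kills \<open>x\<close>.\<close>
    moreover have "Q J y (P J v x) = \<zero>\<^sub>(EA (VI J))" if y: "y : vb I" for y
    proof -
      have yJ: "y : vb J" using vb_sub[OF J(4,1,6)] y by blast
      note Qy = mod_hom_closed[OF Q_props(1)[OF J(1) yJ] xc]
      show ?thesis
      proof (cases "y = v")
        case True
        then show ?thesis using Q_P[OF J(1,2) yJ xc] Q_props(3)[OF J(1) yJ xc] Qy by (simp add: E.minus_self)
      next
        case False
        then have "y : vb K" using y J(7) by simp
        moreover from this have "K ~= bot_of S" by auto
        ultimately have "Q J y x = \<zero>\<^sub>(EA (VI J))" using Ds_iff[OF J(1,3) le] x by simp
        then show ?thesis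
          using Q_P[OF J(1,2) yJ xc] mod_hom_zero[OF E.module_axioms E.module_axioms Q_props(1)[OF J(1,2)]] by (simp add: E.minus_self)
      qed
    qed
    ultimately show ?thesis using Ds_iff[OF J(1,4,6) Ib] by simp
  qed
  show "x = \<zero>\<^sub>(Lam J)" if J: "J : S" and x: "x : Ds J (bot_of S) \<inter> W J" and Px: "!!v. v : vb J ==> P J v x = \<zero>\<^sub>(Lam J)" for J x
  proof (cases "J = bot_of S")
    case True
    then show ?thesis using x by (simp add: Ds_def)
  next
    case False
    interpret E: module R "EA (VI J)" by (rule EA_module[OF VM[OF J]])
    interpret F: exterior_frame R "VI J" "vb J" "w J" "fn J" by (rule frame[OF J False])
    have xc: "x : carrier (EA (VI J))" using car[OF J bot_in bot_le[OF J]] x by simp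
    \<comment> \<open>Vanishing of \<open>P J v x\<close> means that \<open>Q J v\<close> fixes
      \<open>x\<close>; an element of the ideal fixed by all of them is zero by
      \<open>VI_fixed_zero\<close>.\<close>
    have "Q J v x = x" if v: "v : vb J" for v
    proof -
      note Qx = mod_hom_closed[OF Q_props(1)[OF J v] xc]
      have "\<ominus>\<^sub>(EA (VI J)) (\<ominus>\<^sub>(EA (VI J)) Q J v x) = x"
        using Px[OF v] xc Qx by (intro E.minus_equality) (simp_all add: P_def a_minus_def Lam_zero)
      then show ?thesis using Qx by simp
    qed
    then show ?thesis using F.VI_fixed_zero[of x] x Ds_bot[OF J False] by (simp add: Q_def Lam_zero)
  qed
  show "P J v (P J v x) = P J v x" if J: "J : S" "v : vb J" and x: "x : carrier (Lam J)" for J v x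
  proof -
    interpret E: module R "EA (VI J)" by (rule EA_module[OF VM[OF J(1)]])
    have xc: "x : carrier (EA (VI J))" by (rule Lam_carrier[OF J(1) x])
    have "Q J v (P J v x) = \<zero>\<^sub>(EA (VI J))"
      using Q_P[OF J(1,2,2) xc] Q_props(3)[OF J xc] mod_hom_closed[OF Q_props(1)[OF J] xc] by (simp add: E.minus_self)
    then show ?thesis using P_closed[OF J xc] unfolding P_def[of J v "P J v x"] by (simp add: a_minus_def)
  qed
  show "P J v (P J y x) = P J y (P J v x)" if J: "J : S" and v: "v : vb J" "y : vb J" and x: "x : carrier (Lam J)" for J v y x
  proof -
    interpret E: module R "EA (VI J)" by (rule EA_module[OF VM[OF J]])
    have xc: "x : carrier (EA (VI J))" by (rule Lam_carrier[OF J x])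
    note c = mod_hom_closed[OF Q_props(1)[OF J v(1)]] mod_hom_closed[OF Q_props(1)[OF J v(2)]]
    show ?thesis unfolding P_def[of J v "P J y x"] P_def[of J y "P J v x"] Q_P[OF J v(2,1) xc] Q_P[OF J v(1,2) xc]
      using c xc Q_props(4)[OF J v(1,2) xc] by (simp add: P_def a_minus_def E.minus_add E.M.a_ac)
  qed
qed

end

section \<open>The duality isomorphism and the inner grading\<close>

section \<open>Duality\<close>

lemma mod_hom_restrict:
  assumes "h : mod_hom R M N" "A \<subseteq> carrier M" "!!x. x : A ==> h x : B"
  shows "h : mod_hom R (M\<lparr>carrier := A\<rparr>) (N\<lparr>carrier := B\<rparr>)"
proof -
  have "x : carrier M" if "x : A" for x using assms(2) that by blast
  then show ?thesis using assms(3) mod_hom_add[OF assms(1)] mod_hom_smult[OF assms(1)] by (intro mod_homI) auto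
qed

text \<open>Makes a chain module with coefficients in ideals equal, as a record, to the ambient
  direct sum with a smaller carrier, which is the form in which the double complex produces its
  quotients.\<close>

lemma direct_sum_carrier_update:
  assumes "!!I. I : X ==> B I = (A I)\<lparr>carrier := N I\<rparr>"
  shows "direct_sum X B = (direct_sum X A)\<lparr>carrier := \<Pi>\<^sub>E I\<in>X. N I\<rparr>"
  using assms by (simp add: direct_sum_def restrict_def fun_eq_iff cong: PiE_cong)

lemma direct_sum_zero_unique:
  assumes "!!I. I : X ==> carrier (A I) = {\<zero>\<^sub>(A I)}" and x: "x : carrier (direct_sum X A)"
  shows "x = \<zero>\<^sub>(direct_sum X A)"
proof
  fix I
  show "x I = \<zero>\<^sub>(direct_sum X A) I"
    using PiE_mem[OF x[unfolded direct_sum_simps], of I] PiE_arb[OF x[unfolded direct_sum_simps], of I] assms(1)[of I]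
    by (cases "I : X") simp_all
qed

context characteristic_manifold
begin

abbreviation "IS \<equiv> ideal_sheaf R S VV om"
abbreviation "PC \<equiv> pi_cosheaf R S VV om"

lemma plain_ideals: "coefficient_ideals S R eps n u Lam mr Ds P"
  using coefficient_ideals_homogeneous[OF homogeneous_UNIV] by simp

sublocale plain: coefficient_ideals S R eps n u Lam mr Ds P by (rule plain_ideals)

text \<open>The double complex keeps one ambient module per cell and varies its submodules; the
  values of the sheaf are put into this form.\<close>

lemma val_IS: "val IS I = (Lam I)\<lparr>carrier := Ds I (bot_of S)\<rparr>"
  by (simp add: ideal_sheaf_def Ds_def exterior_sheaf_def zero_module_def w_def)

lemma val_PC: "val PC I = (Lam I)\<lparr>carrier := Ds I I\<rparr>"
  by (simp add: pi_cosheaf_def exterior_cosheaf_def Ds_def exterior_sheaf_def zero_module_def pi_elem_def vs_def w_def[abs_def])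

lemma val_bot:
  "carrier (val IS (bot_of S)) = {\<zero>\<^sub>(val IS (bot_of S))}" "carrier (val PC (bot_of S)) = {\<zero>\<^sub>(val PC (bot_of S))}"
  by (simp_all add: val_IS val_PC Ds_def)

lemma mor_IS: "mor IS = mr" by (simp add: ideal_sheaf_def)

lemma mor_PC: "mor PC J I = (if I = bot_of S then (%_. \<zero>\<^sub>(Lam I)) else L.mi I J)"
  by (simp add: pi_cosheaf_def exterior_cosheaf_def L.mi_def)

lemma val_module: "I : S ==> module R (val IS I)" "I : S ==> module R (val PC I)" unfolding val_IS val_PC
  using submodule.submodule_is_module[OF Ds_submodule_Lam Lam_module] bot_in bot_le by auto

lemma eps_pm1: "covered_by S I J ==> eps J I : {1, -1}" using eps unfolding sign_convention_def by blast

lemma mor_IS_hom: "covered_by S I J ==> mor IS I J : mod_hom R (val IS I) (val IS J)"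
proof -
  assume "covered_by S I J"
  then have IJ: "I : S" "J : S" "I <= J" using covered_byD[of I J] by auto
  show ?thesis unfolding val_IS mor_IS
    using mr_Ds_sub[OF bot_in IJ(1,2) bot_le[OF IJ(1)] IJ(3)] plain.Ds_carrier[OF IJ(1) bot_in bot_le[OF IJ(1)]]
    by (intro mod_hom_restrict[OF mr_hom[OF IJ]]) auto
qed

lemma mor_PC_hom: "covered_by S J I ==> mor PC I J : mod_hom R (val PC I) (val PC J)"
proof -
  assume "covered_by S J I"
  then have IJ: "J : S" "I : S" "J <= I" "rank S I = Suc (rank S J)" using covered_byD[of J I] by auto
  interpret N: module R "val PC J" by (rule val_module(2)[OF IJ(1)])
  have Ib: "I ~= bot_of S" using IJ(4) by (auto simp: rank_bot)
  show ?thesis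
  proof (cases "J = bot_of S")
    case True
    have z: "\<zero>\<^sub>(Lam J) = \<zero>\<^sub>(val PC J)" by (simp add: val_PC)
    have m: "mor PC I J = (%_. \<zero>\<^sub>(val PC J))" unfolding mor_PC z[symmetric] using True by simp
    show ?thesis unfolding m by (rule mod_homI) simp_all
  next
    case False
    \<comment> \<open>\<open>L.X\<close> records the second cell by its rank less one, hence the
      subtraction; it is exact because \<open>J\<close> is not the bottom.\<close>
    have X: "(I, J) : L.X (rank S I) (rank S J - 1)" using IJ False rank_eq_0_iff[OF IJ(1)] by (simp add: L.X_def)
    show ?thesis unfolding val_PC mor_PC
      using False plain.mi_Ds[OF X] Ds_antimono[OF IJ(2,2,1,3) order_refl Ib] plain.Ds_carrier[OF IJ(2,2) order_refl]
      by (simp, intro mod_hom_restrict[OF L.mi_hom[OF IJ(1-3) False]]) auto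
  qed
qed

text \<open>Dimension is rank minus one. Cohomology in degree \<open>k\<close> therefore sits at
  \<open>L.A (Suc k)\<close>, while homology in degree \<open>m\<close> sits at
  \<open>L.C m\<close>, whose index is already shifted.\<close>

lemma cells_rk: "cells S (int a - 1) = L.rk a" by (auto simp: cells_def dim_of_def L.rk_def)

lemma cochains: "cochain_module S IS (int a - 1) = (L.A a)\<lparr>carrier := plain.SA a\<rparr>"
  unfolding cochain_module_def cells_rk L.A_def plain.SA_def by (rule direct_sum_carrier_update) (rule val_IS)

lemma chains: "chain_module S PC (int m) = (L.C m)\<lparr>carrier := plain.SC m\<rparr>"
  unfolding chain_module_def L.C_def plain.SC_def cells_rk[of "Suc m", simplified]
  by (rule direct_sum_carrier_update) (rule val_PC)

text \<open>Two discrepancies are bridged: integer multiples against scalars, and sums taken in the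
  ideal against sums in the exterior algebra.\<close>

lemma cobd_dA:
  assumes c: "c : plain.SA a"
  shows "cobd S eps IS (int a - 1) c = L.dA a c"
proof -
  have cC: "c : carrier (cochain_module S IS (int a - 1))" using c by (simp add: cochains)
  have dn: "{I. covered_by S I J} = dn (bot_of S) J" for J using covered_byD[of _ J] bot_le by (auto simp: dn_def)
  have "cobd S eps IS (int a - 1) c = lmap (L.rk (Suc a)) (%J. {I. covered_by S I J}) (val IS)
      (%J I x. e J I \<odot>\<^sub>(val IS J) mor IS I J x) c"
    using cobd_eq_lmap[where eps=eps and A=IS and K=S, OF val_module(1) eps_pm1 mor_IS_hom cC] cells_rk[of "Suc a"] by (simp add: e_def)
  also have "\<dots> = L.dA a c" unfolding L.dA_def lmap_def
  proof (rule restrict_ext)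
    fix J assume J: "J : L.rk (Suc a)"
    note JS = L.rkD[OF J]
    have D: "submodule (Ds J (bot_of S)) R (Lam J)" using JS bot_in bot_le by (intro Ds_submodule_Lam) auto
    \<comment> \<open>All summands lie in the ideal, which allows the sum there to be replaced by
      the ambient one.\<close>
    have mem: "e J I \<odot>\<^sub>(Lam J) mr I J (c I) : Ds J (bot_of S)" if "I : dn (bot_of S) J" for I
    proof -
      have I: "I : S" "I <= J" "I : L.rk a" using dnD[OF that] JS by (auto simp: L.rk_def)
      have "mr I J (c I) : Ds J (bot_of S)"
        using mr_Ds_sub[OF bot_in I(1) _ bot_le[OF I(1)] I(2) plain.SA_val[OF c I(3)]] JS by simp
      then show ?thesis by (intro module.submoduleE(4)[OF Lam_module D]) (use JS in auto)
    qed
    show "(\<Oplus>\<^bsub>val IS J\<^esub>I\<in>{I. covered_by S I J}. e J I \<odot>\<^sub>(val IS J) mor IS I J (c I)) =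
        (\<Oplus>\<^bsub>Lam J\<^esub>I\<in>dn (bot_of S) J. e J I \<odot>\<^sub>(Lam J) mr I J (c I))"
      unfolding dn val_IS mor_IS using module.submodule_finsum_eq[OF Lam_module D mem] JS by simp
  qed
  finally show ?thesis .
qed

lemma bd_dC:
  assumes c: "c : plain.SC (Suc m)"
  shows "bd S eps PC (int (Suc m)) c = L.dC m c"
proof -
  have cC: "c : carrier (chain_module S PC (int (Suc m)))" unfolding chains using c by simp
  have cv: "{I. covered_by S J I} = cov {} J" for J by (simp add: cov_def)
  have "bd S eps PC (int (Suc m)) c = lmap (L.rk (Suc m)) (%J. {I. covered_by S J I}) (val PC)
      (%J I x. e I J \<odot>\<^sub>(val PC J) mor PC I J x) c"
    using bd_eq_lmap[where eps=eps and A=PC and K=S, OF val_module(2) eps_pm1 mor_PC_hom cC] cells_rk[of "Suc m"] by (simp add: e_def)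
  also have "\<dots> = L.dC m c" unfolding L.dC_def lmap_def
  proof (rule restrict_ext)
    fix J assume J: "J : L.rk (Suc m)"
    note JS = L.rkD[OF J] and Jb = L.rk_Suc[OF J]
    have D: "submodule (Ds J J) R (Lam J)" using JS by (intro Ds_submodule_Lam) auto
    have mem: "e I J \<odot>\<^sub>(Lam J) L.mi J I (c I) : Ds J J" if "I : cov {} J" for I
    proof -
      have "covered_by S J I" using that by (simp add: cov_def)
      then have I: "I : S" "J <= I" "I : L.rk (Suc (Suc m))" "(I, J) : L.X (Suc (Suc m)) m"
        using covered_byD[of J I] JS by (auto simp: L.rk_def L.X_def)
      \<comment> \<open>The value is first regarded in the larger ideal belonging to the face
        \<open>J\<close>, still in the exterior algebra at \<open>I\<close>, and then transported to
        \<open>J\<close>.\<close>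
      have "c I : Ds I J" using plain.SC_val[OF c I(3)] Ds_antimono[of I I J] I(1,2) JS L.rk_Suc[OF I(3)] by blast
      then have "L.mi J I (c I) : Ds J J" by (rule plain.mi_Ds[OF I(4)])
      then show ?thesis by (intro module.submoduleE(4)[OF Lam_module D]) (use JS in auto)
    qed
    show "(\<Oplus>\<^bsub>val PC J\<^esub>I\<in>{I. covered_by S J I}. e I J \<odot>\<^sub>(val PC J) mor PC I J (c I)) =
        (\<Oplus>\<^bsub>Lam J\<^esub>I\<in>cov {} J. e I J \<odot>\<^sub>(Lam J) L.mi J I (c I))"
      unfolding cv val_PC mor_PC using module.submodule_finsum_eq[OF Lam_module D mem] JS Jb by simp
  qed
  finally show ?thesis .
qed

text \<open>Only the bottom has dimension \<open>-1\<close>, and the cosheaf is zero there.\<close>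

lemma bd_0: "c : carrier (chain_module S PC 0) ==> bd S eps PC 0 c = \<zero>\<^sub>(chain_module S PC (- 1))"
proof -
  assume c: "c : carrier (chain_module S PC 0)"
  have "bd S eps PC 0 : mod_hom R (chain_module S PC 0) (chain_module S PC (0 - 1))"
    using finite_S by (intro bd_hom[OF is_cring _ val_module(2) eps_pm1 mor_PC_hom])
  then have "bd S eps PC 0 c : carrier (chain_module S PC (- 1))" using mod_hom_closed c by fastforce
  moreover have "I = bot_of S" if "I : cells S (- 1)" for I
    using that rank_eq_0_iff[of I] by (simp add: cells_def dim_of_def)
  then have "carrier (val PC I) = {\<zero>\<^sub>(val PC I)}" if "I : cells S (- 1)" for I using val_bot(2) that by simp
  ultimately show ?thesis unfolding chain_module_def by (intro direct_sum_zero_unique)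
qed

text \<open>The cells compared have ranks \<open>a + 1\<close> and \<open>m + 1\<close>, and
  \<open>Suc a + m = n\<close> is the relation between the two degrees. The isomorphism is taken
  from the full complex before an inner degree is fixed. For each degree the homogeneous complex is
  exact as well, and its staircases supply homogeneous partners in both directions.\<close>

theorem duality_middle:
  assumes n: "Suc a + m = n"
  shows "EX \<phi>:mod_iso R (cohomology S eps IS (int a)) (homology S eps PC (int m)).
    ALL q. \<phi> ` represented_in S (%I. exterior_degree R (VI I) q) (int a) (cohomology S eps IS (int a)) =
      represented_in S (%I. exterior_degree R (VI I) q) (int m) (homology S eps PC (int m))"
proof -
  define Z where "Z = {x : plain.SA (Suc a). L.dA (Suc a) x = \<zero>\<^sub>(L.A (Suc (Suc a)))}"
  define B where "B = L.dA a ` plain.SA a"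
  \<comment> \<open>The quantified \<open>m'\<close> makes the condition empty for
    \<open>m = 0\<close>, where every chain is a cycle.\<close>
  define ZC where "ZC = {y : plain.SC m. ALL m'. m = Suc m' --> L.dC m' y = \<zero>\<^sub>(L.C m')}"
  define BC where "BC = L.dC m ` plain.SC (Suc m)"
  have k: "int a = int (Suc a) - 1" "int a - 1 + 1 = int (Suc a) - 1" "int a + 1 = int (Suc (Suc a)) - 1" by auto
  have H1: "cohomology S eps IS (int a) = quot_module ((L.A (Suc a))\<lparr>carrier := Z\<rparr>) B"
  proof -
    have "{c : carrier (cochain_module S IS (int a)). cobd S eps IS (int a) c = \<zero>\<^sub>(cochain_module S IS (int a + 1))} = Z"
      unfolding Z_def k(3) unfolding k(1) cochains using cobd_dA[of _ "Suc a"] by auto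
    moreover have "cobd S eps IS (int a - 1) ` carrier (cochain_module S IS (int a - 1)) = B"
      unfolding B_def cochains using cobd_dA[of _ a] by (simp cong: image_cong)
    ultimately show ?thesis unfolding cohomology_def
      unfolding k(1)[THEN arg_cong[of _ _ "cochain_module S IS"]] cochains by simp
  qed
  have H2: "homology S eps PC (int m) = quot_module ((L.C m)\<lparr>carrier := ZC\<rparr>) BC"
  proof -
    have "{c : carrier (chain_module S PC (int m)). bd S eps PC (int m) c = \<zero>\<^sub>(chain_module S PC (int m - 1))} = ZC"
    proof (cases m)
      case 0
      then show ?thesis unfolding ZC_def using bd_0 chains[of 0] by auto
    next
      case (Suc m')
      have "int m - 1 = int m'" using Suc by simp
      then show ?thesis unfolding ZC_def using bd_dC[of _ m'] chains[of m] chains[of m'] Suc by auto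
    qed
    moreover have "bd S eps PC (int m + 1) ` carrier (chain_module S PC (int m + 1)) = BC"
      unfolding BC_def using bd_dC[of _ m] chains[of "Suc m"] by (simp add: add.commute cong: image_cong)
    ultimately show ?thesis unfolding homology_def chains by simp
  qed
  have cyc: "m = 0 ==> ZC = plain.SC 0" "!!m'. m = Suc m' ==> ZC = {y : plain.SC m. L.dC m' y = \<zero>\<^sub>(L.C m')}"
    by (auto simp: ZC_def)
  have "EX \<phi>:mod_iso R (quot_module ((L.A (Suc a))\<lparr>carrier := Z\<rparr>) B) (quot_module ((L.C m)\<lparr>carrier := ZC\<rparr>) BC).
      ALL U U'. (ALL x:Z. U x --> (EX y. (EX z. plain.Z (Suc a) m x z & y = L.g m z) & U' y)) --> (ALL y:ZC. U' y --> (EX x. (EX z. plain.Z (Suc a) m x z & y = L.g m z) & U x)) -->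
      \<phi> ` {X : carrier (quot_module ((L.A (Suc a))\<lparr>carrier := Z\<rparr>) B). EX c:X. U c} = {Y : carrier (quot_module ((L.C m)\<lparr>carrier := ZC\<rparr>) BC). EX c:Y. U' c}"
    unfolding Z_def B_def BC_def by (rule plain.zz_quotient_iso(3)[OF n cyc])
  then obtain \<phi> where \<phi>: "\<phi> : mod_iso R (quot_module ((L.A (Suc a))\<lparr>carrier := Z\<rparr>) B) (quot_module ((L.C m)\<lparr>carrier := ZC\<rparr>) BC)"
    and graded: "ALL U U'. (ALL x:Z. U x --> (EX y. (EX z. plain.Z (Suc a) m x z & y = L.g m z) & U' y)) --> (ALL y:ZC. U' y --> (EX x. (EX z. plain.Z (Suc a) m x z & y = L.g m z) & U x)) -->
      \<phi> ` {X : carrier (quot_module ((L.A (Suc a))\<lparr>carrier := Z\<rparr>) B). EX c:X. U c} = {Y : carrier (quot_module ((L.C m)\<lparr>carrier := ZC\<rparr>) BC). EX c:Y. U' c}" by (elim bexE)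
  show ?thesis
  proof (intro bexI[of _ \<phi>] allI)
    show "\<phi> : mod_iso R (cohomology S eps IS (int a)) (homology S eps PC (int m))" unfolding H1 H2 by (rule \<phi>)
    fix q
    let ?W = "%J. exterior_degree R (VI J) q"
    interpret W: coefficient_ideals S R eps n u Lam mr "%J I. Ds J I \<inter> ?W J" P
      by (rule coefficient_ideals_homogeneous[OF homogeneous_degree])
    let ?ZW = "{x : W.SA (Suc a). L.dA (Suc a) x = \<zero>\<^sub>(L.A (Suc (Suc a)))}"
      and ?CW = "{y : W.SC m. ALL m'. m = Suc m' --> L.dC m' y = \<zero>\<^sub>(L.C m')}"
    have cycW: "m = 0 ==> ?CW = W.SC 0" "!!m'. m = Suc m' ==> ?CW = {y : W.SC m. L.dC m' y = \<zero>\<^sub>(L.C m')}" by auto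
    have SAW: "x : W.SA b \<longleftrightarrow> x : plain.SA b & (ALL J:L.rk b. x J : ?W J)" for x b
      by (auto simp: W.SA_def plain.SA_def PiE_iff)
    have SCW: "x : W.SC b \<longleftrightarrow> x : plain.SC b & (ALL J:L.rk (Suc b). x J : ?W J)" for x b
      by (auto simp: W.SC_def plain.SC_def PiE_iff)
    have sub: "W.SA b \<subseteq> plain.SA b" "W.SD b c \<subseteq> plain.SD b c" for b c
      by (auto simp: W.SA_def plain.SA_def W.SD_def plain.SD_def PiE_iff)
    \<comment> \<open>Both complexes have the same operators, so a homogeneous staircase is in
      particular one for the relation that defines \<open>\<phi>\<close>.\<close>
    have mono: "plain.Z (Suc a) m x z" if "W.Z (Suc a) m x z" for x z by (rule L.zz_mono[OF sub that])
    have "\<phi> ` {X : carrier (quot_module ((L.A (Suc a))\<lparr>carrier := Z\<rparr>) B). EX c:X. ALL I:L.rk (Suc a). c I : ?W I} =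
      {Y : carrier (quot_module ((L.C m)\<lparr>carrier := ZC\<rparr>) BC). EX c:Y. ALL I:L.rk (Suc m). c I : ?W I}"
    proof (rule graded[rule_format])
      fix x assume x: "x : Z" "ALL I:L.rk (Suc a). x I : ?W I"
      then have xW: "x : ?ZW" by (simp add: SAW Z_def)
      have "EX y:?CW. EX z. W.Z (Suc a) m x z & y = L.g m z" by (rule W.zz_quotient_iso(1)[OF n cycW xW])
      then obtain y z where "y : ?CW" "W.Z (Suc a) m x z" "y = L.g m z" by (elim bexE exE conjE)
      then show "EX y. (EX z. plain.Z (Suc a) m x z & y = L.g m z) & (ALL I:L.rk (Suc m). y I : ?W I)"
        using mono by (intro exI[of _ y]) (auto simp: ZC_def SCW)
    next
      fix y assume y: "y : ZC" "ALL I:L.rk (Suc m). y I : ?W I"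
      then have yW: "y : ?CW" by (simp add: SCW ZC_def)
      have "EX x:?ZW. EX z. W.Z (Suc a) m x z & y = L.g m z" by (rule W.zz_quotient_iso(2)[OF n cycW yW])
      then obtain x z where "x : ?ZW" "W.Z (Suc a) m x z" "y = L.g m z" by (elim bexE exE conjE)
      then show "EX x. (EX z. plain.Z (Suc a) m x z & y = L.g m z) & (ALL I:L.rk (Suc a). x I : ?W I)"
        using mono by (intro exI[of _ x]) (auto simp: Z_def SAW)
    qed
    then show "\<phi> ` represented_in S ?W (int a) (cohomology S eps IS (int a)) = represented_in S ?W (int m) (homology S eps PC (int m))"
      unfolding represented_in_def H1 H2 using cells_rk[of "Suc a"] cells_rk[of "Suc m"] by simp
  qed
qed

text \<open>In these degrees, and in the complementary ones, a cell can only be the empty one, where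
  both coefficient systems vanish. Both sides are zero modules, related by the pair of
  zeros.\<close>

lemma duality_trivial:
  assumes k: "k < 0 \<or> int n <= k"
  shows "EX \<phi>:mod_iso R (cohomology S eps IS k) (homology S eps PC (int n - 1 - k)).
    ALL q. \<phi> ` represented_in S (%I. exterior_degree R (VI I) q) k (cohomology S eps IS k) =
      represented_in S (%I. exterior_degree R (VI I) q) (int n - 1 - k) (homology S eps PC (int n - 1 - k))"
proof -
  let ?l = "int n - 1 - k" and ?M = "cochain_module S IS k" and ?N = "chain_module S PC (int n - 1 - k)"
  have cells: "cells S i \<subseteq> {bot_of S}" if "i < 0 \<or> int n <= i" for i
    using that rank_le_dim[OF _ dim] rank_eq_0_iff by (fastforce simp: cells_def dim_of_def)
  have ck: "I = bot_of S" if "I : cells S k \<or> I : cells S ?l" for I using cells[of k] cells[of ?l] k that by auto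
  have mods: "module R ?M" "module R ?N" "module R (cochain_module S IS i)" "module R (chain_module S PC i)" for i
    unfolding cochain_module_def chain_module_def
    by (rule direct_sum_module[OF is_cring val_module(1)] direct_sum_module[OF is_cring val_module(2)]; simp add: cells_def)+
  have M0: "x = \<zero>\<^sub>?M" if "x : carrier ?M" for x
    using that ck val_bot(1) unfolding cochain_module_def by (intro direct_sum_zero_unique) auto
  have N0: "x = \<zero>\<^sub>?N" if "x : carrier ?N" for x
    using that ck val_bot(2) unfolding chain_module_def by (intro direct_sum_zero_unique) auto
  have zin: "\<zero>\<^sub>L : carrier L" if "module R L" for L :: "('k, 'p => ('v list => 'k) set) module"
    using that module.axioms(2) abelian_groupE(2) by blast
  have MN: "carrier ?M = {\<zero>\<^sub>?M}" "carrier ?N = {\<zero>\<^sub>?N}" using M0 N0 zin[OF mods(1)] zin[OF mods(2)] by blast+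
  have ch: "cobd S eps IS i : mod_hom R (cochain_module S IS i) (cochain_module S IS (i + 1))" for i
    using finite_S by (intro cobd_hom[OF is_cring _ val_module(1) eps_pm1 mor_IS_hom])
  have bh: "bd S eps PC i : mod_hom R (chain_module S PC i) (chain_module S PC (i - 1))" for i
    using finite_S by (intro bd_hom[OF is_cring _ val_module(2) eps_pm1 mor_PC_hom])
  have Z: "{c : carrier ?M. cobd S eps IS k c = \<zero>\<^sub>(cochain_module S IS (k + 1))} = {\<zero>\<^sub>?M}"
    using MN(1) mod_hom_zero[OF mods(3) mods(3) ch] by auto
  have ZC: "{c : carrier ?N. bd S eps PC ?l c = \<zero>\<^sub>(chain_module S PC (?l - 1))} = {\<zero>\<^sub>?N}"
    using MN(2) mod_hom_zero[OF mods(4) mods(4) bh] by auto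
  have img: "f ` carrier L = {\<zero>\<^sub>N}" if f: "f : mod_hom R L N" "module R L" "module R N" and N: "carrier N = {\<zero>\<^sub>N}"
    for f and L N :: "('k, 'p => ('v list => 'k) set) module"
  proof (intro equalityI subsetI)
    fix y assume "y : f ` carrier L"
    then obtain x where "x : carrier L" "y = f x" by (elim imageE)
    then show "y : {\<zero>\<^sub>N}" using mod_hom_closed[OF f(1)] N by simp
  next
    fix y assume "y : {\<zero>\<^sub>N}"
    then have "y = f \<zero>\<^sub>L" using mod_hom_zero[OF f(2,3,1)] by simp
    then show "y : f ` carrier L" using zin[OF f(2)] by (rule image_eqI)
  qed
  have B: "cobd S eps IS (k - 1) ` carrier (cochain_module S IS (k - 1)) = {\<zero>\<^sub>?M}"
    using ch[of "k - 1"] by (intro img mods MN) simp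
  have BC: "bd S eps PC (?l + 1) ` carrier (chain_module S PC (?l + 1)) = {\<zero>\<^sub>?N}"
    using bh[of "?l + 1"] unfolding add_diff_cancel_right' by (intro img mods MN)
  interpret M: module R ?M by (rule mods)
  interpret N: module R ?N by (rule mods)
  have "EX \<phi>:mod_iso R (quot_module (?M\<lparr>carrier := {\<zero>\<^sub>?M}\<rparr>) {\<zero>\<^sub>?M}) (quot_module (?N\<lparr>carrier := {\<zero>\<^sub>?N}\<rparr>) {\<zero>\<^sub>?N}). ALL U U'. (ALL x:{\<zero>\<^sub>?M}. U x --> (EX y. (x = \<zero>\<^sub>?M & y = \<zero>\<^sub>?N) & U' y)) --> (ALL y:{\<zero>\<^sub>?N}. U' y --> (EX x. (x = \<zero>\<^sub>?M & y = \<zero>\<^sub>?N) & U x)) -->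
      \<phi> ` {X : carrier (quot_module (?M\<lparr>carrier := {\<zero>\<^sub>?M}\<rparr>) {\<zero>\<^sub>?M}). EX c:X. U c} = {Y : carrier (quot_module (?N\<lparr>carrier := {\<zero>\<^sub>?N}\<rparr>) {\<zero>\<^sub>?N}). EX c:Y. U' c}"
    by (rule quot_iso_of_relation[OF mods(1,2)])
      (auto intro: M.submodule_singleton_zero N.submodule_singleton_zero)
  then obtain \<phi> where \<phi>: "\<phi> : mod_iso R (quot_module (?M\<lparr>carrier := {\<zero>\<^sub>?M}\<rparr>) {\<zero>\<^sub>?M}) (quot_module (?N\<lparr>carrier := {\<zero>\<^sub>?N}\<rparr>) {\<zero>\<^sub>?N})" and graded: "ALL U U'. (ALL x:{\<zero>\<^sub>?M}. U x --> (EX y. (x = \<zero>\<^sub>?M & y = \<zero>\<^sub>?N) & U' y)) --> (ALL y:{\<zero>\<^sub>?N}. U' y --> (EX x. (x = \<zero>\<^sub>?M & y = \<zero>\<^sub>?N) & U x)) -->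
      \<phi> ` {X : carrier (quot_module (?M\<lparr>carrier := {\<zero>\<^sub>?M}\<rparr>) {\<zero>\<^sub>?M}). EX c:X. U c} = {Y : carrier (quot_module (?N\<lparr>carrier := {\<zero>\<^sub>?N}\<rparr>) {\<zero>\<^sub>?N}). EX c:Y. U' c}" by (elim bexE)
  \<comment> \<open>The zero chain represents the zero class in every inner degree.\<close>
  have deg: "\<zero>\<^sub>(Lam I) : exterior_degree R (VI I) q" if "I : S" for I q
    unfolding Lam_zero using that EA_module VM exterior_degree_submodule by (intro module.submodule_zero) auto
  show ?thesis
  proof (intro bexI[of _ \<phi>] allI)
    show "\<phi> : mod_iso R (cohomology S eps IS k) (homology S eps PC ?l)"
      unfolding cohomology_def homology_def Z ZC B BC by (rule \<phi>)
    show "\<phi> ` represented_in S (%I. exterior_degree R (VI I) q) k (cohomology S eps IS k) =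
      represented_in S (%I. exterior_degree R (VI I) q) ?l (homology S eps PC ?l)" for q
      unfolding represented_in_def cohomology_def homology_def Z ZC B BC
      by (rule graded[rule_format]; use deg in \<open>auto simp: chain_module_def cochain_module_def val_PC val_IS cells_def\<close>)
  qed
qed

theorem duality:
  "EX \<phi>:mod_iso R (cohomology S eps IS k) (homology S eps PC (int n - 1 - k)).
    ALL q. \<phi> ` represented_in S (%I. exterior_degree R (VI I) q) k (cohomology S eps IS k) =
      represented_in S (%I. exterior_degree R (VI I) q) (int n - 1 - k) (homology S eps PC (int n - 1 - k))"
proof (cases "k < 0 \<or> int n <= k")
  case True
  then show ?thesis by (rule duality_trivial)
next
  case False
  then have k: "Suc (nat k) + nat (int n - 1 - k) = n" "int (nat k) = k" "int (nat (int n - 1 - k)) = int n - 1 - k" by auto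
  show ?thesis using duality_middle[OF k(1)] unfolding k(2,3) .
qed

end

theorem corollary3p6:
  fixes R :: "'k ring"
    and S :: "'p::order set"
    and eps :: "'p \<Rightarrow> 'p \<Rightarrow> int"
    and n :: nat
    and V :: "('k, 'w) module"
    and VV :: "('p, 'k, 'v) coeff_system"
    and om :: "'p \<Rightarrow> 'v"
    and k :: int
  assumes "ground_ring R"
    and "simplicial_poset S" and "pure S" and "poset_dim S = int n - 1"
    and "sign_convention S eps"
    and "homology_manifold R S eps"
    and "free_of_finite_rank R V"
    and "locally_constant_sheaf R S V VV"
    and "characteristic_function R S VV om"
  defines "Hco \<equiv> cohomology S eps (ideal_sheaf R S VV om) k"
    and "Hho \<equiv> homology S eps (pi_cosheaf R S VV om) (int n - 1 - k)"
  shows "\<exists>\<phi> \<in> mod_iso R Hco Hho. \<forall>q.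
           \<phi> ` represented_in S (\<lambda>I. exterior_degree R (val VV I) q) k Hco
             = represented_in S (\<lambda>I. exterior_degree R (val VV I) q) (int n - 1 - k) Hho"
proof -
  note man = assms(6)[unfolded homology_manifold_def]
  interpret cring R by (rule ground_ring_cring[OF assms(1)])
  interpret signed_poset S R eps using assms(2,5) by unfold_locales
  \<comment> \<open>Orientability enters through the fundamental class, the Buchsbaum condition
    through the acyclicity of the flags above each cell.\<close>
  have "EX u. fundamental n u"
    by (rule manifold_fundamental[OF conjunct2[OF man] assms(4) ground_ring_one_neq_zero[OF assms(1)]])
  then obtain u where u: "fundamental n u" ..
  interpret characteristic_manifold S R eps V VV om n u
    using assms(4,8,9) u buchsbaum_flag_acyclic[OF conjunct1[OF man] assms(4)] by unfold_locales
  show ?thesis unfolding Hco_def Hho_def by (rule duality)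
qed

end
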